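(* Let $N\ge 1$, $\mu_1,\mu_2>0$, $2<p_1,p_2<2+\frac4N$, $r_1,r_2>1$, $2+\frac4N<r_1+r_2<2^*$, and let $a_1,a_2>0$ be given. Then there exist $\beta_0=\beta_0(a_1,a_2)>0$ and $\rho_0=\rho_0(a_1,a_2)>0$ such that, for any $0<\beta\le\beta_0$: (i) Every minimizing sequence of the problem $$m(a_1,a_2)=\inf\{J(u_1,u_2):(u_1,u_2)\in S(a_1,a_2)\cap\mathcal B(\rho_0)\}$$ is compact, up to translation, in $H^1(\mathbb R^N)\times H^1(\mathbb R^N)$. In particular there exists $(\lambda_1^v,\lambda_2^v,v_1,v_2)\in\mathbb R^2\times H^1(\mathbb R^N)\times H^1(\mathbb R^N)$ solving $$\begin{cases}-\Delta v_1=\lambda_1^v v_1+\mu_1|v_1|^{p_1-2}v_1+\beta r_1|v_1|^{r_1-2}v_1|v_2|^{r_2},\\-\Delta v_2=\lambda_2^v v_2+\mu_2|v_2|^{p_2-2}v_2+\beta r_2|v_1|^{r_1}|v_2|^{r_2-2}v_2,\end{cases}\qquad \int_{\mathbb R^N}|v_1|^2\,dx=a_1,\ \int_{\mathbb R^N}|v_2|^2\,dx=a_2,$$ with $(v_1,v_2)\in\mathcal B(\rho_0)$, both components $v_1,v_2$ positive, and $J(v_1,v_2)<0$. (ii) If $2\le N\le4$, or if $N\ge5$ and either $p_i\le r_1+r_2-\frac2N$ for $i=1,2$ or $|p_1-p_2|\le\frac2N$, then there exists a second solution $(\lambda_1^u,\lambda_2^u,u_1,u_2)\in\mathbb R^2\times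 H^1(\mathbb R^N)\times H^1(\mathbb R^N)$ of the same system with the same mass constraints $\int_{\mathbb R^N}|u_i|^2\,dx=a_i$, $i=1,2$, with both components $u_1,u_2$ positive and $J(u_1,u_2)>0$. Moreover, if $N\le4$, then $\lambda_1^v,\lambda_2^v<0$ and (for the solution in (ii)) $\lambda_1^u,\lambda_2^u<0$.
   Context: $2^*=\frac{2N}{N-2}$ if $N\ge3$ and $2^*=\infty$ if $N=1,2$. For $\beta>0$, $$J(u_1,u_2)=\frac12\int_{\mathbb R^N}|\nabla u_1|^2+|\nabla u_2|^2\,dx-\sum_{i=1}^2\frac{\mu_i}{p_i}\int_{\mathbb R^N}|u_i|^{p_i}\,dx-\beta\int_{\mathbb R^N}|u_1|^{r_1}|u_2|^{r_2}\,dx$$ on $H^1(\mathbb R^N)\times H^1(\mathbb R^N)$ (so $J$ and $m(a_1,a_2)$ depend on $\beta$). $S(a)=\{u\in H^1(\mathbb R^N):\int_{\mathbb R^N}|u|^2\,dx=a\}$, $S(a_1,a_2)=S(a_1)\times S(a_2)$, and for $\rho>0$, $\mathcal B(\rho)=\{(u_1,u_2)\in H^1(\mathbb R^N)\times H^1(\mathbb R^N):\int_{\mathbb R^N}|\nabla u_1|^2+|\nabla u_2|^2\,dx<\rho\}$. A minimizing sequence is a sequence in $S(a_1,a_2)\cap\mathcal B(\rho_0)$ along which $J$ tends to $m(a_1,a_2)$; it is compact up to translation if there are $y_n\in\mathbb R^N$ such that the sequence of functions translated by $y_n$ (the same translation for both components) has a strongly convergent subsequence. Solutions of the system are understood in the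 weak sense. *)

theory Defs
  imports "HOL-Analysis.Analysis"
begin

text \<open>
  Elements of \<open>L\<^sup>2\<close> and \<open>H\<^sup>1\<close> are represented by real-valued, Lebesgue measurable functions on
  \<open>real ^ 'n\<close> (with \<open>N = CARD('n)\<close>), without passing to the quotient by almost everywhere equality.
\<close>

definition critical_exponent :: "nat \<Rightarrow> ereal" where
  "critical_exponent N = (if N \<ge> 3 then ereal (2 * real N / (real N - 2)) else \<infinity>)"

definition partial_derivative :: "'n :: finite \<Rightarrow> (real ^ 'n \<Rightarrow> real) \<Rightarrow> real ^ 'n \<Rightarrow> real" where
  "partial_derivative i f x = frechet_derivative f (at x) (axis i 1)"

primrec C_k :: "nat \<Rightarrow> (real ^ 'n \<Rightarrow> real) \<Rightarrow> bool" where
  "C_k 0 f \<longleftrightarrow> continuous_on UNIV f"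
| "C_k (Suc k) f \<longleftrightarrow> (\<forall>x. f differentiable (at x)) \<and> (\<forall>i. C_k k (partial_derivative i f))"

definition test_functions :: "(real ^ 'n \<Rightarrow> real) set" where
  "test_functions = {\<phi>. (\<forall>k. C_k k \<phi>) \<and> compact (closure {x. \<phi> x \<noteq> 0})}"

definition locally_integrable ::
  "(real ^ 'n \<Rightarrow> 'b :: {banach, second_countable_topology}) \<Rightarrow> bool" where
  "locally_integrable f \<longleftrightarrow> (\<forall>K. compact K \<longrightarrow> set_integrable lebesgue K f)"

definition is_weak_gradient :: "(real ^ 'n \<Rightarrow> real) \<Rightarrow> (real ^ 'n \<Rightarrow> real ^ 'n) \<Rightarrow> bool" where
  "is_weak_gradient u G \<longleftrightarrow> locally_integrable u \<and> locally_integrable G \<and>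
     (\<forall>\<phi>\<in>test_functions. \<forall>i.
        (LINT x|lebesgue. u x * partial_derivative i \<phi> x) = - (LINT x|lebesgue. G x $ i * \<phi> x))"

text \<open>A weak gradient is unique up to a null set; one representative is chosen.\<close>

definition grad :: "(real ^ 'n \<Rightarrow> real) \<Rightarrow> real ^ 'n \<Rightarrow> real ^ 'n" where
  "grad u = (SOME G. is_weak_gradient u G)"

definition L2 :: "(real ^ 'n \<Rightarrow> 'b :: real_normed_vector) set" where
  "L2 = {f. f \<in> borel_measurable lebesgue \<and> integrable lebesgue (\<lambda>x. (norm (f x))\<^sup>2)}"

definition H1 :: "(real ^ 'n \<Rightarrow> real) set" where
  "H1 = {u. u \<in> L2 \<and> (\<exists>G. is_weak_gradient u G \<and> G \<in> L2)}"

definition H1_norm :: "(real ^ 'n \<Rightarrow> real) \<Rightarrow> real" where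
  "H1_norm u = sqrt ((LINT x|lebesgue. \<bar>u x\<bar>\<^sup>2) + (LINT x|lebesgue. (norm (grad u x))\<^sup>2))"

definition energy ::
  "real \<Rightarrow> real \<Rightarrow> real \<Rightarrow> real \<Rightarrow> real \<Rightarrow> real \<Rightarrow> real \<Rightarrow>
   (real ^ 'n \<Rightarrow> real) \<Rightarrow> (real ^ 'n \<Rightarrow> real) \<Rightarrow> real" where
  "energy \<mu>\<^sub>1 \<mu>\<^sub>2 p\<^sub>1 p\<^sub>2 r\<^sub>1 r\<^sub>2 \<beta> u\<^sub>1 u\<^sub>2 =
     1 / 2 * (LINT x|lebesgue. (norm (grad u\<^sub>1 x))\<^sup>2 + (norm (grad u\<^sub>2 x))\<^sup>2)
     - (\<mu>\<^sub>1 / p\<^sub>1 * (LINT x|lebesgue. \<bar>u\<^sub>1 x\<bar> powr p\<^sub>1)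
        + \<mu>\<^sub>2 / p\<^sub>2 * (LINT x|lebesgue. \<bar>u\<^sub>2 x\<bar> powr p\<^sub>2))
     - \<beta> * (LINT x|lebesgue. \<bar>u\<^sub>1 x\<bar> powr r\<^sub>1 * \<bar>u\<^sub>2 x\<bar> powr r\<^sub>2)"

definition mass_sphere :: "real \<Rightarrow> (real ^ 'n \<Rightarrow> real) set" where
  "mass_sphere a = {u \<in> H1. (LINT x|lebesgue. \<bar>u x\<bar>\<^sup>2) = a}"

definition grad_ball :: "real \<Rightarrow> ((real ^ 'n \<Rightarrow> real) \<times> (real ^ 'n \<Rightarrow> real)) set" where
  "grad_ball \<rho> = {(u\<^sub>1, u\<^sub>2). u\<^sub>1 \<in> H1 \<and> u\<^sub>2 \<in> H1 \<and>
     (LINT x|lebesgue. (norm (grad u\<^sub>1 x))\<^sup>2 + (norm (grad u\<^sub>2 x))\<^sup>2) < \<rho>}"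

definition admissible ::
  "real \<Rightarrow> real \<Rightarrow> real \<Rightarrow> ((real ^ 'n \<Rightarrow> real) \<times> (real ^ 'n \<Rightarrow> real)) set" where
  "admissible a\<^sub>1 a\<^sub>2 \<rho> = (mass_sphere a\<^sub>1 \<times> mass_sphere a\<^sub>2) \<inter> grad_ball \<rho>"

text \<open>
  The infimum is taken in the reals: for positive masses and radius and subcritical exponents,
  the admissible set is nonempty by scaling, and the energy is bounded below on it by the
  Gagliardo--Nirenberg inequality.

  The domain \<open>real ^ 'n\<close> is not determined by the remaining arguments and is passed as a type.
\<close>

definition inf_energy ::
  "'n :: finite itself \<Rightarrow> real \<Rightarrow> real \<Rightarrow> real \<Rightarrow> real \<Rightarrow> real \<Rightarrow> real \<Rightarrow> real \<Rightarrow>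
   real \<Rightarrow> real \<Rightarrow> real \<Rightarrow> real" where
  "inf_energy _ \<mu>\<^sub>1 \<mu>\<^sub>2 p\<^sub>1 p\<^sub>2 r\<^sub>1 r\<^sub>2 \<beta> a\<^sub>1 a\<^sub>2 \<rho> =
     (INF (u\<^sub>1, u\<^sub>2) \<in> (admissible a\<^sub>1 a\<^sub>2 \<rho> :: ((real ^ 'n \<Rightarrow> real) \<times> (real ^ 'n \<Rightarrow> real)) set).
        energy \<mu>\<^sub>1 \<mu>\<^sub>2 p\<^sub>1 p\<^sub>2 r\<^sub>1 r\<^sub>2 \<beta> u\<^sub>1 u\<^sub>2)"

definition minimizing_sequence ::
  "real \<Rightarrow> real \<Rightarrow> real \<Rightarrow> real \<Rightarrow> real \<Rightarrow> real \<Rightarrow> real \<Rightarrow> real \<Rightarrow> real \<Rightarrow> real \<Rightarrow>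
   (nat \<Rightarrow> real ^ 'n \<Rightarrow> real) \<Rightarrow> (nat \<Rightarrow> real ^ 'n \<Rightarrow> real) \<Rightarrow> bool" where
  "minimizing_sequence \<mu>\<^sub>1 \<mu>\<^sub>2 p\<^sub>1 p\<^sub>2 r\<^sub>1 r\<^sub>2 \<beta> a\<^sub>1 a\<^sub>2 \<rho> U\<^sub>1 U\<^sub>2 \<longleftrightarrow>
     (\<forall>n. (U\<^sub>1 n, U\<^sub>2 n) \<in> admissible a\<^sub>1 a\<^sub>2 \<rho>) \<and>
     (\<lambda>n. energy \<mu>\<^sub>1 \<mu>\<^sub>2 p\<^sub>1 p\<^sub>2 r\<^sub>1 r\<^sub>2 \<beta> (U\<^sub>1 n) (U\<^sub>2 n))
       \<longlonglongrightarrow> inf_energy TYPE('n) \<mu>\<^sub>1 \<mu>\<^sub>2 p\<^sub>1 p\<^sub>2 r\<^sub>1 r\<^sub>2 \<beta> a\<^sub>1 a\<^sub>2 \<rho>"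

definition compact_up_to_translation ::
  "(nat \<Rightarrow> real ^ 'n \<Rightarrow> real) \<Rightarrow> (nat \<Rightarrow> real ^ 'n \<Rightarrow> real) \<Rightarrow> bool" where
  "compact_up_to_translation U\<^sub>1 U\<^sub>2 \<longleftrightarrow>
     (\<exists>(y :: nat \<Rightarrow> real ^ 'n) (\<sigma> :: nat \<Rightarrow> nat). strict_mono \<sigma> \<and>
       (\<exists>w\<^sub>1\<in>H1. \<exists>w\<^sub>2\<in>H1.
          (\<lambda>n. H1_norm (\<lambda>x. U\<^sub>1 (\<sigma> n) (x - y (\<sigma> n)) - w\<^sub>1 x)) \<longlonglongrightarrow> 0 \<and>
          (\<lambda>n. H1_norm (\<lambda>x. U\<^sub>2 (\<sigma> n) (x - y (\<sigma> n)) - w\<^sub>2 x)) \<longlonglongrightarrow> 0))"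

definition weak_solution ::
  "real \<Rightarrow> real \<Rightarrow> real \<Rightarrow> real \<Rightarrow> real \<Rightarrow> real \<Rightarrow> real \<Rightarrow> real \<Rightarrow> real \<Rightarrow>
   (real ^ 'n \<Rightarrow> real) \<Rightarrow> (real ^ 'n \<Rightarrow> real) \<Rightarrow> bool" where
  "weak_solution \<mu>\<^sub>1 \<mu>\<^sub>2 p\<^sub>1 p\<^sub>2 r\<^sub>1 r\<^sub>2 \<beta> lam\<^sub>1 lam\<^sub>2 u\<^sub>1 u\<^sub>2 \<longleftrightarrow> u\<^sub>1 \<in> H1 \<and> u\<^sub>2 \<in> H1 \<and>
     (\<forall>\<phi>\<in>H1.
        (LINT x|lebesgue. grad u\<^sub>1 x \<bullet> grad \<phi> x) =
          lam\<^sub>1 * (LINT x|lebesgue. u\<^sub>1 x * \<phi> x)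
          + \<mu>\<^sub>1 * (LINT x|lebesgue. \<bar>u\<^sub>1 x\<bar> powr (p\<^sub>1 - 2) * u\<^sub>1 x * \<phi> x)
          + \<beta> * r\<^sub>1 * (LINT x|lebesgue.
              \<bar>u\<^sub>1 x\<bar> powr (r\<^sub>1 - 2) * u\<^sub>1 x * \<bar>u\<^sub>2 x\<bar> powr r\<^sub>2 * \<phi> x)) \<and>
     (\<forall>\<phi>\<in>H1.
        (LINT x|lebesgue. grad u\<^sub>2 x \<bullet> grad \<phi> x) =
          lam\<^sub>2 * (LINT x|lebesgue. u\<^sub>2 x * \<phi> x)
          + \<mu>\<^sub>2 * (LINT x|lebesgue. \<bar>u\<^sub>2 x\<bar> powr (p\<^sub>2 - 2) * u\<^sub>2 x * \<phi> x)
          + \<beta> * r\<^sub>2 * (LINT x|lebesgue.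
              \<bar>u\<^sub>1 x\<bar> powr r\<^sub>1 * \<bar>u\<^sub>2 x\<bar> powr (r\<^sub>2 - 2) * u\<^sub>2 x * \<phi> x))"

definition positive_function :: "(real ^ 'n \<Rightarrow> real) \<Rightarrow> bool" where
  "positive_function u \<longleftrightarrow> (AE x in lebesgue. u x > 0)"

end

theory Submission
  imports Defs "HOL-Complex_Analysis.Great_Picard"
begin

text \<open>
  Both solutions are obtained variationally with elementary means, without symmetrisation. Replacing
  two profiles \<open>u, v\<close> by \<open>sqrt (u^2 + v^2)\<close> adds their masses, does not increase the sum of the
  Dirichlet integrals and is superadditive, strictly on overlapping profiles, for all nonlinear terms.
  Hence splitting of a bounded non-vanishing sequence strictly lowers the functional, and a missing
  mass can be filled with a widely spread function of negative energy. The first solution minimises the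
  energy in the ball, the second one minimises \<open>max\<^sub>t J (t^(N/2) u (t x))\<close> over pairs of mass at most
  \<open>a\<^sub>1, a\<^sub>2\<close>; the maximum is attained at a single \<open>t\<close>, so the minimiser is critical. Positivity comes
  from testing with \<open>(\<phi> - k v)\<^sup>+\<close>, which makes the zero set of \<open>v\<close> translation invariant, and the
  signs of the multipliers from testing with rescaled bumps.
\<close>

text \<open>The \<open>H1\<close> theory rests on one criterion: a square integrable
  \<open>u\<close> lies in \<open>H1\<close> with \<open>dirp i u <= c i\<close> as soon as
  \<open>mass (u (x + h e_i) - u x) <= h^2 c i\<close> for all \<open>h\<close> and
  \<open>i\<close>, and conversely. Contractions, scalings and almost everywhere limits act directly
  on this inequality. Averages over small cubes, being pairings with a fixed indicator, are the
  common source of the Sobolev bounds, of compactness and of the notion of vanishing.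

  Two circularities shape the minimisations. Strict inequalities are lost in limits, so the gain
  from merging is measured on the two limit profiles, a fixed number set against errors tending to
  zero. And a filling that must have negative energy at the peak of the filled pair influences that
  peak; hence peaks are confined beforehand to a compact range depending only on an upper bound for
  the Dirichlet integral and a lower one for the coupling. The hypotheses
  \<open>p1, p2 < 2 + 4/N < r1 + r2\<close> enter as exponents below and above two in the dilation
  parameter, which yields both the well and the barrier.\<close>

abbreviation lmeas :: "('a :: euclidean_space => 'b :: topological_space) set" where
 "lmeas == borel_measurable lebesgue"

abbreviation almost_all :: "('a :: euclidean_space => bool) => bool" (binder "ae " 10) where
 "almost_all P == AE x in lebesgue. P x"

abbreviation seq_tendsto :: "(nat => 'a :: topological_space) => 'a => bool" ("(_/ ----> _)" [60, 60] 60) where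
 "f ----> l == LIMSEQ f l"

subsection \<open>Square integrable functions\<close>

lemma L2_iff: "f \<in> L2 \<longleftrightarrow> f \<in> lmeas & integrable lebesgue (%x. (f x)^2)"
 for f :: "real ^ 'n => real"
 by (simp add: L2_def)

lemma L2_measurable [dest]: "f \<in> L2 ==> f \<in> lmeas"
 for f :: "real ^ 'n => real"
 by (simp add: L2_def)

lemma L2_square_integrable: "f \<in> L2 ==> integrable lebesgue (%x. (f x)^2)"
 for f :: "real ^ 'n => real"
 by (simp add: L2_def)

definition mass :: "(real ^ 'n => real) => real" where
 "mass f = (LINT x|lebesgue. (f x)^2)"

definition ip :: "(real ^ 'n => real) => (real ^ 'n => real) => real" where
 "ip f g = (LINT x|lebesgue. f x * g x)"

lemma mass_nonneg [simp]: "0 <= mass f"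
 unfolding mass_def by (rule integral_nonneg_AE) auto

lemma ip_self: "ip f f = mass f"
 by (simp add: ip_def mass_def power2_eq_square)

lemma ip_commute: "ip f g = ip g f"
 by (simp add: ip_def mult.commute)

lemma L2_mult_integrable:
 fixes f g :: "real ^ 'n => real"
 assumes "f \<in> L2" "g \<in> L2"
 shows "integrable lebesgue (%x. f x * g x)"
proof (rule Bochner_Integration.integrable_bound)
 show "integrable lebesgue (%x. (f x)^2 + (g x)^2)"
  using assms by (simp add: L2_iff)
 show "(%x. f x * g x) \<in> lmeas"
  using assms by (auto simp: L2_iff)
 have "\<bar>a * b\<bar> <= a^2 + b^2" for a b :: real
  using sum_squares_bound[of "\<bar>a\<bar>" "\<bar>b\<bar>"] mult_nonneg_nonneg[of "\<bar>a\<bar>" "\<bar>b\<bar>"]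
  unfolding abs_mult power2_abs by linarith
 then show "ae x. norm (f x * g x) <= norm ((f x)^2 + (g x)^2)"
  by (intro AE_I2) (auto intro: order_trans[OF _ abs_ge_self])
qed

lemma L2_dominated:
 fixes f g :: "real ^ 'n => real"
 assumes "g \<in> L2" "f \<in> lmeas" "ae x. \<bar>f x\<bar> <= \<bar>g x\<bar>"
 shows "f \<in> L2" "mass f <= mass g"
proof -
 have *: "ae x. (f x)^2 <= (g x)^2"
  using assms(3) by eventually_elim (simp add: abs_le_square_iff)
 have i: "integrable lebesgue (%x. (f x)^2)"
  by (rule Bochner_Integration.integrable_bound[of _ "%x. (g x)^2"])
   (use assms * in \<open>auto simp: L2_iff\<close>)
 then show "f \<in> L2" using assms by (simp add: L2_iff)
 show "mass f <= mass g"
  unfolding mass_def using i assms * by (intro integral_mono_AE) (auto simp: L2_iff)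
qed

lemma L2_add [intro]:
 fixes f g :: "real ^ 'n => real"
 assumes "f \<in> L2" "g \<in> L2" shows "(%x. f x + g x) \<in> L2"
 using assms L2_mult_integrable[OF assms] by (auto simp: L2_iff power2_sum mult.assoc)

lemma L2_cmult [intro]:
 fixes f :: "real ^ 'n => real"
 assumes "f \<in> L2" shows "(%x. c * f x) \<in> L2"
 using assms by (auto simp: L2_iff power_mult_distrib)

lemma L2_diff [intro]:
 fixes f g :: "real ^ 'n => real"
 assumes "f \<in> L2" "g \<in> L2" shows "(%x. f x - g x) \<in> L2"
 using L2_add[OF assms(1) L2_cmult[OF assms(2), of "-1"]] by simp

lemma L2_uminus [intro]:
 fixes f :: "real ^ 'n => real"
 assumes "f \<in> L2" shows "(%x. - f x) \<in> L2"
 using L2_cmult[OF assms, of "-1"] by simp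

lemma L2_abs [intro]:
 fixes f :: "real ^ 'n => real"
 assumes "f \<in> L2" shows "(%x. \<bar>f x\<bar>) \<in> L2"
 using assms by (auto simp: L2_iff)

lemma L2_zero [simp]: "(%x. 0 :: real) \<in> L2"
 by (simp add: L2_def)

lemma mass_cmult: "mass (%x. c * f x) = c^2 * mass f"
 by (simp add: mass_def power_mult_distrib)

lemma mass_abs [simp]: "mass (%x. \<bar>f x\<bar>) = mass f"
 by (simp add: mass_def)

lemma mass_uminus [simp]: "mass (%x. - f x) = mass f"
 by (simp add: mass_def)

lemma mass_zero [simp]: "mass (%x. 0) = 0"
 by (simp add: mass_def)

lemma ip_cmult_left: "ip (%x. c * f x) g = c * ip f g"
 by (simp add: ip_def mult.assoc)

lemma ip_cmult_right: "ip f (%x. c * g x) = c * ip f g"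
 by (simp add: ip_def mult.left_commute)

lemma ip_add_left: "f \<in> L2 ==> g \<in> L2 ==> h \<in> L2 ==> ip (%x. f x + g x) h = ip f h + ip g h"
 by (simp add: ip_def distrib_right L2_mult_integrable)

lemma ip_diff_left: "f \<in> L2 ==> g \<in> L2 ==> h \<in> L2 ==> ip (%x. f x - g x) h = ip f h - ip g h"
 by (simp add: ip_def left_diff_distrib L2_mult_integrable)

lemma ip_add_right: "f \<in> L2 ==> g \<in> L2 ==> h \<in> L2 ==> ip h (%x. f x + g x) = ip h f + ip h g"
 by (simp add: ip_def distrib_left L2_mult_integrable)

lemma ip_diff_right: "f \<in> L2 ==> g \<in> L2 ==> h \<in> L2 ==> ip h (%x. f x - g x) = ip h f - ip h g"
 by (simp add: ip_def right_diff_distrib L2_mult_integrable)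

lemma mass_add:
 assumes "f \<in> L2" "g \<in> L2"
 shows "mass (%x. f x + g x) = mass f + 2 * ip f g + mass g"
proof -
 note fg = assms L2_add[OF assms]
 have "ip (%x. f x + g x) (%x. f x + g x) = (ip f f + ip f g) + (ip g f + ip g g)"
  using fg by (subst ip_add_left; (subst ip_add_right)?; simp add: ip_add_right)
 then show ?thesis unfolding ip_self ip_commute[of g f] by simp
qed

lemma mass_diff:
 assumes "f \<in> L2" "g \<in> L2"
 shows "mass (%x. f x - g x) = mass f - 2 * ip f g + mass g"
 using mass_add[OF assms(1) L2_cmult[OF assms(2), of "-1"]]
 unfolding mass_cmult ip_cmult_right by simp

lemma mass_cong_AE:
 assumes "ae x. f x = g x" "f \<in> lmeas" "g \<in> lmeas"
 shows "mass f = mass g"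
 unfolding mass_def using assms by (intro integral_cong_AE) auto

lemma L2_cong_AE:
 fixes f g :: "real ^ 'n => real"
 assumes "ae x. f x = g x" "g \<in> lmeas" "f \<in> L2"
 shows "g \<in> L2"
 by (rule L2_dominated(1)[OF assms(3,2)]) (use assms(1) in eventually_elim, simp)

lemma ip_cong_AE:
 assumes "ae x. f x = f' x" "ae x. g x = g' x"
  "f \<in> L2" "f' \<in> L2" "g \<in> L2" "g' \<in> L2"
 shows "ip f g = ip f' g'"
 unfolding ip_def
 by (rule integral_cong_AE) (use assms in \<open>auto dest!: L2_measurable\<close>)

lemma mass_eq_0_iff:
 fixes f :: "real ^ 'n => real"
 assumes "f \<in> L2"
 shows "mass f = 0 \<longleftrightarrow> (ae x. f x = 0)"
 unfolding mass_def using assms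
 by (subst integral_nonneg_eq_0_iff_AE) (auto simp: L2_iff)

text \<open>The masses of \<open>e f - g\<close> and \<open>e f + g\<close> are nonnegative. The
  free weight \<open>e\<close> serves twice: \<open>e = 1\<close> gives the factor two in
  \<open>mass_add_le\<close>, the balancing \<open>e\<close> gives Cauchy-Schwarz.\<close>

lemma ip_le_mass:
 fixes f g :: "real ^ 'n => real"
 assumes "f \<in> L2" "g \<in> L2" "e > 0"
 shows "2 * \<bar>ip f g\<bar> <= e * mass f + mass g / e"
proof -
 have "0 <= mass (%x. e * f x - g x)" "0 <= mass (%x. e * f x + g x)" by auto
 then have "2 * e * \<bar>ip f g\<bar> <= e^2 * mass f + mass g"
  using assms by (auto simp: mass_diff mass_add L2_cmult ip_cmult_left mass_cmult abs_if)
 then show ?thesis using assms(3) by (simp add: field_simps power2_eq_square)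
qed

lemma ip_Cauchy_Schwarz:
 fixes f g :: "real ^ 'n => real"
 assumes "f \<in> L2" "g \<in> L2"
 shows "\<bar>ip f g\<bar> <= sqrt (mass f) * sqrt (mass g)"
proof -
 have z: "ip f g = 0" if "f \<in> L2" "g \<in> L2" "mass f = 0" for f g :: "real ^ 'n => real"
 proof -
  have "ae x. f x = 0" using that mass_eq_0_iff by blast
  then have "ae x. f x * g x = 0" by eventually_elim simp
  then show ?thesis unfolding ip_def by (rule integral_eq_zero_AE)
 qed
 consider "mass f = 0" | "mass g = 0" | "mass f > 0" "mass g > 0"
  using mass_nonneg[of f] mass_nonneg[of g] by linarith
 then show ?thesis
 proof cases
  case 3
  let ?e = "sqrt (mass g) / sqrt (mass f)"
  have "2 * \<bar>ip f g\<bar> <= ?e * mass f + mass g / ?e"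
   using 3 assms by (intro ip_le_mass) auto
  also have "?e * mass f = sqrt (mass f) * sqrt (mass g)"
   using 3 by (simp add: field_simps)
  also have "mass g / ?e = sqrt (mass f) * sqrt (mass g)"
   using 3 by (simp add: field_simps)
  finally show ?thesis by simp
 qed (use z[OF assms] z[OF assms(2,1)] in \<open>auto simp: ip_commute\<close>)
qed

lemma sqrt_mass_add:
 fixes f g :: "real ^ 'n => real"
 assumes "f \<in> L2" "g \<in> L2"
 shows "sqrt (mass (%x. f x + g x)) <= sqrt (mass f) + sqrt (mass g)"
proof (rule real_le_lsqrt)
 show "mass (%x. f x + g x) <= (sqrt (mass f) + sqrt (mass g))^2"
  using assms ip_Cauchy_Schwarz[OF assms] by (simp add: mass_add power2_sum)
qed auto

lemma sqrt_mass_diff: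
 fixes f g :: "real ^ 'n => real"
 assumes "f \<in> L2" "g \<in> L2"
 shows "sqrt (mass (%x. f x - g x)) <= sqrt (mass f) + sqrt (mass g)"
 using sqrt_mass_add[OF assms(1) L2_uminus[OF assms(2)]] by simp

lemma mass_add_le:
 fixes f g :: "real ^ 'n => real"
 assumes "f \<in> L2" "g \<in> L2"
 shows "mass (%x. f x + g x) <= 2 * mass f + 2 * mass g"
 using ip_le_mass[OF assms, of 1] by (simp add: mass_add[OF assms])

lemma mass_diff_le:
 fixes f g :: "real ^ 'n => real"
 assumes "f \<in> L2" "g \<in> L2"
 shows "mass (%x. f x - g x) <= 2 * mass f + 2 * mass g"
 using ip_le_mass[OF assms, of 1] by (simp add: mass_diff[OF assms])

text \<open>Fatou's lemma in a form that also yields integrability of the limit; the bound is asked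
  for only eventually, so that it applies to sequences whose integrals merely converge.\<close>

lemma Fatou_integrable:
 fixes f :: "nat => 'a => real"
 assumes f: "!!n. integrable M (f n)" and nn: "!!n. AE x in M. 0 <= f n x"
  and g: "g \<in> borel_measurable M" and lim: "AE x in M. (%n. f n x) ----> g x"
  and le: "eventually (%n. integral\<^sup>L M (f n) <= c) sequentially"
 shows "integrable M g" "integral\<^sup>L M g <= c"
proof -
 have nn': "AE x in M. \<forall>n. 0 <= f n x" using nn by (simp add: AE_all_countable)
 have gnn: "AE x in M. 0 <= g x"
  using lim nn' by eventually_elim (metis LIMSEQ_le_const)
 have "0 <= integral\<^sup>L M (f n)" for n using nn by (rule integral_nonneg_AE)
 moreover obtain m where "integral\<^sup>L M (f m) <= c" using le eventually_happens'[OF _ le] by auto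
 ultimately have c0: "0 <= c" by (meson order_trans)
 have "(\<integral>\<^sup>+x. ennreal (g x) \<partial>M) = (\<integral>\<^sup>+x. liminf (%n. ennreal (f n x)) \<partial>M)"
 proof (rule nn_integral_cong_AE, use lim in eventually_elim)
  fix x assume "(%n. f n x) ----> g x"
  then have "(%n. ennreal (f n x)) ----> ennreal (g x)" by (rule tendsto_ennrealI)
  then show "ennreal (g x) = liminf (%n. ennreal (f n x))"
   by (simp add: lim_imp_Liminf)
 qed
 also have "... <= liminf (%n. \<integral>\<^sup>+x. ennreal (f n x) \<partial>M)"
  using f by (intro nn_integral_liminf) auto
 also have "(%n. \<integral>\<^sup>+x. ennreal (f n x) \<partial>M) = (%n. ennreal (integral\<^sup>L M (f n)))"
  using f nn by (intro ext nn_integral_eq_integral)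
 also have "liminf (%n. ennreal (integral\<^sup>L M (f n))) <= liminf (%n. ennreal c)"
  by (rule Liminf_mono) (use le in eventually_elim, auto intro: ennreal_leI)
 also have "... = ennreal c" by (simp add: Liminf_const)
 finally have *: "(\<integral>\<^sup>+x. ennreal (g x) \<partial>M) <= ennreal c" .
 show i: "integrable M g"
  using g gnn * by (intro integrableI_nonneg) (auto simp: top_unique intro: le_less_trans)
 show "integral\<^sup>L M g <= c"
  using * nn_integral_eq_integral[OF i gnn] c0 by simp
qed

lemma Fatou_L2:
 fixes f :: "nat => real ^ 'n => real"
 assumes "!!n. f n \<in> L2" "g \<in> lmeas"
  "ae x. (%n. f n x) ----> g x" "eventually (%n. mass (f n) <= c) sequentially"
 shows "g \<in> L2" "mass g <= c"
proof -
 have *: "ae x. (%n. (f n x)^2) ----> (g x)^2"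
  using assms(3) by eventually_elim (intro tendsto_power)
 note F = Fatou_integrable[where M = lebesgue and f = "%n x. (f n x)^2" and g = "%x. (g x)^2" and c = c]
 show "g \<in> L2" using F(1) * assms by (auto simp: L2_iff mass_def)
 show "mass g <= c" unfolding mass_def by (rule F(2)) (use * assms in \<open>auto simp: L2_iff mass_def\<close>)
qed

lemma sigma_finite_lebesgue: "sigma_finite_measure (lebesgue :: 'a :: euclidean_space measure)"
 proof -
 have "\<exists>A :: 'a set set. countable A & A \<subseteq> sets lborel & \<Union>A = space lborel & (\<forall>a\<in>A. emeasure lborel a ~= \<infinity>)"
  by (rule lborel.sigma_finite_countable)
 then obtain A :: "'a set set" where A: "countable A & A \<subseteq> sets lborel & \<Union>A = space lborel & (\<forall>a\<in>A. emeasure lborel a ~= \<infinity>)" ..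
 show ?thesis
  by (rule sigma_finite_measure.intro, rule exI[of _ A]) (use A in auto)
qed

text \<open>Multiplication by \<open>s\<close> sends \<open>L2\<close> to \<open>L1\<close> without
  destroying pointwise information, since it can be divided out again; the bound
  \<open>s x <= 1\<close> keeps masses from growing.\<close>

lemma positive_L2_weight:
 obtains s :: "real ^ 'n => real" where "s \<in> L2" "!!x. 0 < s x" "!!x. s x <= 1"
proof -
 interpret sigma_finite_measure "lebesgue :: (real ^ 'n) measure" by (rule sigma_finite_lebesgue)
 obtain \<omega> :: "real ^ 'n => real" where \<omega>: "\<omega> \<in> lmeas" "!!x. \<omega> x > 0" "!!x. \<omega> x <= 1" "integrable lebesgue \<omega>"
  using obtain_positive_integrable_function by blast
 show ?thesis
  by (rule that[of "%x. sqrt (\<omega> x)"]) (use \<omega> \<omega>(2)[THEN less_imp_le] in \<open>auto simp: L2_iff\<close>)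
qed

text \<open>After multiplication by the weight \<open>s\<close> the sequence is Cauchy in
  \<open>L1\<close>, so a subsequence converges almost everywhere. Fatou applied to
  \<open>f n - f (sg j)\<close> as \<open>j\<close> grows turns this into convergence of the whole
  sequence in mass.\<close>

lemma L2_complete:
 fixes f :: "nat => real ^ 'n => real"
 assumes f: "!!n. f n \<in> L2"
  and C: "!!e. e > 0 ==> \<exists>N. \<forall>m\<ge>N. \<forall>n\<ge>N. mass (%x. f m x - f n x) <= e"
 obtains g sg where "g \<in> L2" "strict_mono (sg :: nat => nat)" "ae x. (%n. f (sg n) x) ----> g x"
  "(%n. mass (%x. f n x - g x)) ----> 0"
proof -
 obtain s :: "real ^ 'n => real" where s: "s \<in> L2" "!!x. 0 < s x" by (rule positive_L2_weight) blast
 have "\<exists>N. \<forall>i\<ge>N. \<forall>j\<ge>N. (LINT x|lebesgue. norm (f i x * s x - f j x * s x)) < e" if e: "e > 0" for e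
 proof -
  \<comment> \<open>The denominator \<open>S + 1\<close> keeps \<open>e / (S + 1)\<close> meaningful
    in every case and makes the final estimate strict.\<close>
  define S where "S = sqrt (mass s)"
  have S: "S >= 0" by (simp add: S_def)
  obtain N where N: "!!i j. i >= N ==> j >= N ==> mass (%x. f i x - f j x) <= (e / (S + 1))^2"
   using C[of "(e / (S + 1))^2"] e S by auto
  have "(LINT x|lebesgue. norm (f i x * s x - f j x * s x)) < e" if "i >= N" "j >= N" for i j
  proof -
   have d: "(%x. f i x - f j x) \<in> L2" using f by auto
   have "(LINT x|lebesgue. norm (f i x * s x - f j x * s x)) = ip (%x. \<bar>f i x - f j x\<bar>) s"
    unfolding ip_def using s(2)[THEN less_imp_le] by (simp add: left_diff_distrib[symmetric] abs_mult)
   also have "... <= sqrt (mass (%x. f i x - f j x)) * S"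
    using ip_Cauchy_Schwarz[OF L2_abs[OF d] s(1)] by (simp add: S_def)
   also have "... <= e / (S + 1) * S"
    using N[OF that] e S by (intro mult_right_mono real_le_lsqrt) auto
   also have "... < e" using e S by (simp add: field_simps)
   finally show ?thesis .
  qed
  then show ?thesis by blast
 qed
 from cauchy_L1_AE_cauchy_subseq[OF L2_mult_integrable[OF f s(1)] this]
 obtain sg where sm: "strict_mono sg" and cau: "ae x. Cauchy (%n. f (sg n) x * s x)" by blast
 define g where "g x = lim (%n. f (sg n) x)" for x
 have gm: "g \<in> lmeas"
  unfolding g_def using f by (intro borel_measurable_lim_metric) auto
 from cau have lim: "ae x. (%n. f (sg n) x) ----> g x"
 proof eventually_elim
  case (elim x)
  then obtain l where "(%n. f (sg n) x * s x) ----> l" using Cauchy_convergent by (auto simp: convergent_def)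
  from tendsto_divide[OF this tendsto_const[of "s x"]] s(2)[of x] have "(%n. f (sg n) x) ----> l / s x" by simp
  then show ?case by (auto simp: g_def convergent_LIMSEQ_iff[symmetric] convergent_def)
 qed
 have key: "\<exists>N. \<forall>n\<ge>N. (%x. f n x - g x) \<in> L2 & mass (%x. f n x - g x) <= e" if e: "e > 0" for e
 proof -
  obtain N where N: "!!i j. i >= N ==> j >= N ==> mass (%x. f i x - f j x) <= e" using C[OF e] by blast
  have "(%x. f n x - g x) \<in> L2 & mass (%x. f n x - g x) <= e" if n: "n >= N" for n
  proof -
   have l: "ae x. (%j. f n x - f (sg j) x) ----> f n x - g x"
    using lim by eventually_elim (intro tendsto_intros)
   have "\<forall>\<^sub>F j in sequentially. mass (%x. f n x - f (sg j) x) <= e"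
    using seq_suble[OF sm] n by (intro eventually_sequentiallyI[of N] N) (auto intro: le_trans)
   moreover have "(%x. f n x - f (sg j) x) \<in> L2" for j using f by auto
   moreover have "(%x. f n x - g x) \<in> lmeas"
    using f[of n] gm by (intro borel_measurable_diff) auto
   ultimately show ?thesis using Fatou_L2[of "%j x. f n x - f (sg j) x" "%x. f n x - g x" e] l by blast
  qed
  then show ?thesis by blast
 qed
 obtain n where "(%x. f n x - g x) \<in> L2" using key[of 1] by auto
 from L2_diff[OF f this, of n] have gL: "g \<in> L2" by simp
 have "(%n. mass (%x. f n x - g x)) ----> 0"
 proof (rule LIMSEQ_I)
  fix r :: real assume "r > 0"
  then obtain N where "!!n. n >= N ==> mass (%x. f n x - g x) <= r / 2" using key[of "r / 2"] by auto
  with \<open>r > 0\<close> have "norm (mass (%x. f n x - g x) - 0) < r" if "n >= N" for n using that by fastforce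
  then show "\<exists>n0. \<forall>n\<ge>n0. norm (mass (%x. f n x - g x) - 0) < r" by blast
 qed
 with gL sm lim show ?thesis using that by blast
qed

text \<open>Midpoints are all that the parallelogram identity asks for, and both a bound on the mass
  and closeness of a pairing to its limit are stable under them, so they pass to the hull by
  induction.\<close>

inductive_set midpoint_hull :: "(nat => 'a => real) => nat => ('a => real) set"
 for f n where
  base: "k >= n ==> f k \<in> midpoint_hull f n"
 | mid: "u \<in> midpoint_hull f n ==> v \<in> midpoint_hull f n ==> (%x. (u x + v x) / 2) \<in> midpoint_hull f n"

lemma midpoint_hull_antimono: "u \<in> midpoint_hull f m ==> n <= m ==> u \<in> midpoint_hull f n"
 by (induction rule: midpoint_hull.induct) (auto intro: midpoint_hull.intros)

text \<open>Near-minimal elements of the midpoint hulls of the tails form a Cauchy sequence by the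
 parallelogram identity; its limit represents every limit of pairings with the sequence.\<close>

lemma L2_bounded_weak_limit:
 fixes f :: "nat => real ^ 'n => real"
 assumes f: "!!n. f n \<in> L2" and b: "!!n. mass (f n) <= c"
 obtains g where "g \<in> L2" "mass g <= c"
  "!!phi l. phi \<in> L2 ==> (%n. ip (f n) phi) ----> l ==> ip g phi = l"
proof -
 let ?H = "midpoint_hull f"
 have HL: "u \<in> L2 & mass u <= c" if "u \<in> ?H n" for u n
  using that
 proof induction
  case (mid u v)
  have "mass (%x. u x + v x) <= 2 * mass u + 2 * mass v" using mid by (intro mass_add_le) auto
  then have "mass (%x. (u x + v x) / 2) <= c"
   using mid mass_cmult[of "1/2" "%x. u x + v x"] by (simp add: power2_eq_square)
  with mid show ?case using L2_cmult[OF L2_add, of u v "1/2"] by simp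
 qed (use f b in auto)
 \<comment> \<open>The minimal masses of the tails increase and are bounded by \<open>c\<close>; the
   gap \<open>D - d k\<close> then bounds the distance of near-minimal elements, because their
   midpoint again lies in the hull.\<close>
 define d where "d n = (INF u\<in>?H n. mass u)" for n
 have bb: "bdd_below (mass ` ?H n)" for n by (rule bdd_belowI[of _ 0]) auto
 have ne: "?H n ~= {}" for n using midpoint_hull.base[of n n f] by auto
 have dle: "d n <= mass u" if "u \<in> ?H n" for u n
  unfolding d_def using bb that by (rule cINF_lower)
 have dmono: "d n <= d m" if "n <= m" for m n
  unfolding d_def using ne bb that by (intro cINF_superset_mono) (auto intro: midpoint_hull_antimono)
 have "\<exists>u\<in>?H n. mass u < d n + 1 / (real n + 1)" for n
  using cINF_less_iff[OF ne bb, of n "d n + 1 / (real n + 1)"] unfolding d_def by auto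
 then obtain g where gH: "!!n. g n \<in> ?H n" and gm: "!!n. mass (g n) < d n + 1 / (real n + 1)" by metis
 have gL: "g n \<in> L2" for n using HL gH by blast
 have dc: "d n <= c" for n using dle[OF gH[of n]] HL[OF gH[of n]] by simp
 have d0: "d 0 <= d n" for n using dmono by simp
 have "norm (d n) <= \<bar>c\<bar> + \<bar>d 0\<bar>" for n using dc[of n] d0[of n] by auto
 then have "convergent d" using dmono by (intro Bseq_mono_convergent BseqI'[of _ "\<bar>c\<bar> + \<bar>d 0\<bar>"]) auto
 then obtain D where D: "d ----> D" by (auto simp: convergent_def)
 have dD: "d n <= D" for n using D dmono by (intro incseq_le) (auto simp: incseq_def)
 have par: "mass (%x. g m x - g n x) <= 4 * (D - d k) + 4 / (real k + 1)" if "m >= k" "n >= k" for k m n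
 proof -
  have "(%x. (g m x + g n x) / 2) \<in> ?H k"
   using that gH by (intro midpoint_hull.mid) (auto intro: midpoint_hull_antimono)
  from dle[OF this] have "d k <= mass (%x. g m x + g n x) / 4"
   using mass_cmult[of "1/2" "%x. g m x + g n x"] by (simp add: power2_eq_square)
  moreover have "mass (g m) <= D + 1 / (real k + 1)" "mass (g n) <= D + 1 / (real k + 1)"
   using gm[of m] gm[of n] dD[of m] dD[of n] that
    frac_le[of 1 1 "real k + 1" "real m + 1"] frac_le[of 1 1 "real k + 1" "real n + 1"] by auto
  ultimately show ?thesis using gL by (auto simp: mass_diff mass_add)
 qed
 have "(%k. 4 * (D - d k) + 4 * inverse (real (Suc k))) ----> 4 * (D - D) + 4 * 0"
  by (intro tendsto_intros D LIMSEQ_inverse_real_of_nat)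
 then have par0: "(%k. 4 * (D - d k) + 4 / (real k + 1)) ----> 0"
  by (simp add: inverse_eq_divide add.commute)
 have "\<exists>N. \<forall>m\<ge>N. \<forall>n\<ge>N. mass (%x. g m x - g n x) <= e" if "e > 0" for e
 proof -
  from par0 that have "eventually (%k. 4 * (D - d k) + 4 / (real k + 1) < e) sequentially"
   by (rule order_tendstoD)
  then obtain k where "4 * (D - d k) + 4 / (real k + 1) < e"
   by (auto simp: eventually_sequentially)
  then show ?thesis using par by (intro exI[of _ k]) (meson less_imp_le order_trans)
 qed
 from L2_complete[OF gL this] obtain h sg where h: "h \<in> L2" "strict_mono sg"
   "ae x. (%n. g (sg n) x) ----> h x" "(%n. mass (%x. g n x - h x)) ----> 0"
  by blast
 show ?thesis
 proof (rule that[of h])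
  show "h \<in> L2" by fact
  show "mass h <= c"
   by (rule Fatou_L2(2)[where f = "%n. g (sg n)"]) (use h gL gH HL in \<open>auto simp: L2_iff intro!: always_eventually\<close>)
  fix phi :: "real ^ 'n => real" and l assume phi: "phi \<in> L2" and l: "(%n. ip (f n) phi) ----> l"
  have A: "(%n. ip (g n) phi) ----> ip h phi"
  proof (rule LIM_zero_cancel)
   show "(%n. ip (g n) phi - ip h phi) ----> 0"
   proof (rule Lim_null_comparison)
    show "eventually (%n. norm (ip (g n) phi - ip h phi) <= sqrt (mass (%x. g n x - h x)) * sqrt (mass phi)) sequentially"
     using ip_Cauchy_Schwarz[OF L2_diff[OF gL h(1)] phi] gL h(1) phi
     by (intro always_eventually) (simp add: ip_diff_left)
    have "(%n. sqrt (mass (%x. g n x - h x)) * sqrt (mass phi)) ----> sqrt 0 * sqrt (mass phi)"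
     by (intro tendsto_intros h(4))
    then show "(%n. sqrt (mass (%x. g n x - h x)) * sqrt (mass phi)) ----> 0" by simp
   qed
  qed
  have B: "(%n. ip (g n) phi) ----> l"
  proof (rule LIMSEQ_I)
   fix r :: real assume "r > 0"
   then obtain N where N: "!!n. n >= N ==> norm (ip (f n) phi - l) < r"
    using LIMSEQ_D[OF l] by blast
   \<comment> \<open>A neighbourhood of \<open>l\<close> is convex, so the pairing stays in it under
     midpoints; this transfers the limit from \<open>f\<close> to the near-minimal elements
     \<open>g n\<close>.\<close>
   have H: "\<bar>ip u phi - l\<bar> < r" if "u \<in> ?H N" for u
    using that
   proof induction
    case (base k) then show ?case using N by auto
   next
    case (mid u v)
    have "ip (%x. (u x + v x) / 2) phi = (ip u phi + ip v phi) / 2"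
     using ip_cmult_left[of "1/2" "%x. u x + v x" phi] ip_add_left[of u v phi] mid.hyps HL phi by simp
    with mid.IH show ?case by (simp add: abs_if split: if_splits)
   qed
   show "\<exists>n0. \<forall>n\<ge>n0. norm (ip (g n) phi - l) < r"
    using H midpoint_hull_antimono[OF gH] by (intro exI[of _ N]) auto
  qed
  show "ip h phi = l" using A B LIMSEQ_unique by blast
 qed
qed

subsection \<open>Affine substitutions\<close>

lemma affine_measurable_lebesgue:
 fixes a :: "'a :: euclidean_space"
 assumes "c ~= 0"
 shows "(%x. c *\<^sub>R x + a) \<in> lebesgue \<rightarrow>\<^sub>M lebesgue"
proof -
 have "(%x. a + (\<Sum>j\<in>Basis. (c * (x \<bullet> j)) *\<^sub>R j)) = (%x. c *\<^sub>R x + a)"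
  unfolding scaleR_scaleR[symmetric] scaleR_sum_right[symmetric] by (simp add: euclidean_representation ac_simps)
 then show ?thesis using lebesgue_affine_measurable[of "%_. c" a] assms by simp
qed

text \<open>The single source of the substitution rules: integrability, integrals and null sets
  under translation and dilation are all read off from the image measure.\<close>

lemma distr_affine_lebesgue:
 fixes a :: "'a :: euclidean_space"
 assumes c: "c ~= 0"
 shows "distr lebesgue lebesgue (%x. c *\<^sub>R x + a) = density lebesgue (%_. ennreal (1 / \<bar>c\<bar> ^ DIM('a)))"
proof (rule measure_eqI)
 fix A assume A: "A \<in> sets (distr lebesgue lebesgue (%x. c *\<^sub>R x + a))"
 have "(%x. c *\<^sub>R x + a) -` A = (%x. (1/c) *\<^sub>R x + (- (1/c) *\<^sub>R a)) ` A" (is "?L = ?R")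
 proof
  show "?R \<subseteq> ?L" using c by (auto simp: scaleR_add_right scaleR_diff_right)
  show "?L \<subseteq> ?R"
  proof
   fix x assume "x \<in> ?L"
   then have "c *\<^sub>R x + a \<in> A" by simp
   moreover have "x = (1/c) *\<^sub>R (c *\<^sub>R x + a) + (- (1/c) *\<^sub>R a)" using c by (simp add: scaleR_add_right)
   ultimately show "x \<in> ?R" by blast
  qed
 qed
 then have "emeasure lebesgue ((%x. c *\<^sub>R x + a) -` A) = ennreal (\<bar>1/c\<bar> ^ DIM('a)) * emeasure lebesgue A"
  using emeasure_lebesgue_affine[of "1/c" "- (1/c) *\<^sub>R a" A] by (simp add: ennreal_power)
 then show "emeasure (distr lebesgue lebesgue (%x. c *\<^sub>R x + a)) A =
   emeasure (density lebesgue (%_. ennreal (1 / \<bar>c\<bar> ^ DIM('a)))) A"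
  using A affine_measurable_lebesgue[OF c, of a]
  by (simp add: emeasure_distr emeasure_density nn_integral_cmult power_one_over)
qed simp

lemma measurable_affine:
 fixes a :: "'a :: euclidean_space" and f :: "'a => 'b :: topological_space"
 assumes "f \<in> lmeas" "c ~= 0"
 shows "(%x. f (c *\<^sub>R x + a)) \<in> lmeas"
 using measurable_compose[OF affine_measurable_lebesgue[OF assms(2)] assms(1)] .

lemma integrable_affine:
 fixes a :: "'a :: euclidean_space" and f :: "'a => real"
 assumes c: "c ~= 0" and f: "integrable lebesgue f"
 shows "integrable lebesgue (%x. f (c *\<^sub>R x + a))"
proof -
 have "integrable (density lebesgue (%_. ennreal (1 / \<bar>c\<bar> ^ DIM('a)))) f"
  using f by (subst integrable_real_density) auto
 then show ?thesis
  unfolding distr_affine_lebesgue[OF c, of a, symmetric]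
  using integrable_distr[OF affine_measurable_lebesgue[OF c]] by blast
qed

lemma integral_affine:
 fixes a :: "'a :: euclidean_space" and f :: "'a => real"
 assumes c: "c ~= 0" and f: "f \<in> lmeas"
 shows "(LINT x|lebesgue. f (c *\<^sub>R x + a)) = (LINT x|lebesgue. f x) / \<bar>c\<bar> ^ DIM('a)"
proof -
 have "(LINT x|lebesgue. f (c *\<^sub>R x + a)) = integral\<^sup>L (distr lebesgue lebesgue (%x. c *\<^sub>R x + a)) f"
  using affine_measurable_lebesgue[OF c] f by (subst integral_distr) auto
 also have "... = (LINT x|lebesgue. f x) / \<bar>c\<bar> ^ DIM('a)"
  unfolding distr_affine_lebesgue[OF c] using f by (subst integral_real_density) auto
 finally show ?thesis .
qed

lemma AE_affine:
 fixes a :: "'a :: euclidean_space"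
 assumes c: "c ~= 0" and P: "ae x. P x"
 shows "ae x. P (c *\<^sub>R x + a)"
proof -
 obtain N where N: "!!x. x \<in> space lebesgue - N ==> P x" "N \<in> null_sets lebesgue"
  using AE_E3[OF P] by blast
 let ?T = "%x. c *\<^sub>R x + a"
 have "emeasure (distr lebesgue lebesgue ?T) N = 0"
  unfolding distr_affine_lebesgue[OF c] using N(2) by (simp add: emeasure_density nn_integral_null_set null_setsD2)
 then have "?T -` N \<in> null_sets lebesgue"
  using N measurable_sets[OF affine_measurable_lebesgue[OF c], of N a] affine_measurable_lebesgue[OF c, of a]
  by (auto simp: emeasure_distr null_sets_def)
 then show ?thesis by (rule AE_I') (use N in auto)
qed

lemma measurable_translate:
 fixes a :: "'a :: euclidean_space" and f :: "'a => 'b :: topological_space"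
 shows "f \<in> lmeas ==> (%x. f (x + a)) \<in> lmeas"
 using measurable_affine[of f 1 a] by simp

lemma integrable_translate:
 fixes a :: "'a :: euclidean_space" and f :: "'a => real"
 shows "integrable lebesgue f ==> integrable lebesgue (%x. f (x + a))"
 using integrable_affine[of 1 f a] by simp

lemma integral_translate:
 fixes a :: "'a :: euclidean_space" and f :: "'a => real"
 shows "f \<in> lmeas ==> (LINT x|lebesgue. f (x + a)) = (LINT x|lebesgue. f x)"
 using integral_affine[of 1 f a] by simp

lemma AE_translate:
 fixes a :: "'a :: euclidean_space"
 shows "ae x. P x ==> ae x. P (x + a)"
 using AE_affine[of 1 P a] by simp

lemma L2_translate [intro]:
 fixes f :: "real ^ 'n => real"
 shows "f \<in> L2 ==> (%x. f (x + a)) \<in> L2"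
 by (auto simp: L2_iff intro: measurable_translate integrable_translate[of "%x. (f x)^2"])

lemma mass_translate:
 fixes f :: "real ^ 'n => real"
 shows "f \<in> lmeas ==> mass (%x. f (x + a)) = mass f"
 unfolding mass_def by (rule integral_translate) simp

lemma ip_translate:
 fixes f g :: "real ^ 'n => real"
 assumes "f \<in> L2" "g \<in> L2"
 shows "ip (%x. f (x + a)) g = ip f (%x. g (x - a))"
proof -
 have "(%x. f x * g (x - a)) \<in> lmeas"
  using assms measurable_translate[of g "-a"] by (auto simp: L2_iff)
 from integral_translate[OF this, of a] show ?thesis by (simp add: ip_def)
qed

text \<open>Joint measurability of \<open>f (x + h)\<close>, as Tonelli requires, and induction over
  Borel functions are both available for a Borel function, so arguments of this kind first change
  \<open>f\<close> on a null set.\<close>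

lemma borel_representative:
 fixes f :: "real ^ 'n => real"
 assumes "f \<in> lmeas"
 obtains g where "g \<in> borel_measurable borel" "ae x. f x = g x" "g \<in> lmeas"
proof -
 obtain g where g: "g \<in> borel_measurable lborel" "AE x in lborel. f x = g x"
  using completion_ex_borel_measurable_real[OF assms] by blast
 show ?thesis
  by (rule that[of g]) (use g AE_completion[OF g(2)] measurable_completion[OF g(1)] in simp_all)
qed

text \<open>Almost everywhere convergence and boundedness in \<open>L^2\<close> give weak convergence: split
 according to whether \<open>\<bar>phi\<bar> <= \<eta> \<bar>v n\<bar>\<close>.\<close>

lemma ip_tendsto_0_AE:
 fixes v :: "nat => real ^ 'n => real"
 assumes v: "!!n. v n \<in> L2" and b: "!!n. mass (v n) <= c" and phi: "phi \<in> L2"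
  and ae: "ae x. (%n. v n x) ----> 0"
 shows "(%n. LINT x|lebesgue. \<bar>v n x * phi x\<bar>) ----> 0" "(%n. ip (v n) phi) ----> 0"
proof -
 have c0: "c >= 0" using b[of 0] mass_nonneg[of "v 0"] by linarith
 have [measurable]: "v n \<in> lmeas" "phi \<in> lmeas" for n
  using v phi by auto
 show A: "(%n. LINT x|lebesgue. \<bar>v n x * phi x\<bar>) ----> 0"
 proof (rule LIMSEQ_I)
  fix r :: real assume r: "r > 0"
  \<comment> \<open>Chosen so that the region \<open>|phi| <= \<eta> |v n|\<close> contributes at
    most \<open>\<eta> c < r/2\<close>, uniformly in \<open>n\<close>. On its complement the product
    is at most \<open>phi^2 / \<eta>\<close>, an integrable majorant independent of
    \<open>n\<close>.\<close>
  define \<eta> where "\<eta> = r / (2 * (c + 1))"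
  have \<eta>: "\<eta> > 0" "\<eta> * c < r / 2" using r c0 by (auto simp: \<eta>_def field_simps)
  define w where "w n x = (if \<bar>phi x\<bar> > \<eta> * \<bar>v n x\<bar> then \<bar>v n x * phi x\<bar> else 0)" for n x
  have [measurable]: "w n \<in> lmeas" for n unfolding w_def by measurable
  have wb: "norm (w n x) <= (1/\<eta>) * (phi x)^2" for n x
  proof -
   have "\<bar>v n x\<bar> * \<bar>phi x\<bar> <= (\<bar>phi x\<bar> / \<eta>) * \<bar>phi x\<bar>" if "\<bar>phi x\<bar> > \<eta> * \<bar>v n x\<bar>"
    using that \<eta> by (intro mult_right_mono) (auto simp: field_simps)
   then show ?thesis using \<eta> by (auto simp: w_def abs_mult power2_eq_square)
  qed
  have "(%n. LINT x|lebesgue. w n x) ----> (LINT x|(lebesgue :: (real^'n) measure). 0)"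
  proof (rule integral_dominated_convergence[where w = "%x. (1/\<eta>) * (phi x)^2"])
   show "integrable lebesgue (%x. (1/\<eta>) * (phi x)^2)" using phi by (simp add: L2_iff)
   show "ae x. (%n. w n x) ----> 0"
    using ae
   proof eventually_elim
    case (elim x)
    have "(%n. \<bar>v n x * phi x\<bar>) ----> \<bar>0 * phi x\<bar>" by (intro tendsto_intros elim)
    then have "(%n. \<bar>v n x * phi x\<bar>) ----> 0" by simp
    then show ?case by (rule Lim_null_comparison[rotated]) (auto simp: w_def)
   qed
  qed (use wb in auto)
  then have "eventually (%n. (LINT x|lebesgue. w n x) < r / 2) sequentially"
   using r by (intro order_tendstoD(2)) auto
  then obtain n0 where n0: "!!n. n >= n0 ==> (LINT x|lebesgue. w n x) < r / 2"
   by (auto simp: eventually_sequentially)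
  have "norm ((LINT x|lebesgue. \<bar>v n x * phi x\<bar>) - 0) < r" if "n >= n0" for n
  proof -
   have wi: "integrable lebesgue (w n)"
    by (rule Bochner_Integration.integrable_bound[of _ "%x. (1/\<eta>) * (phi x)^2"])
     (use phi wb \<eta> in \<open>auto simp: L2_iff\<close>)
   have pw: "\<bar>v n x * phi x\<bar> <= \<eta> * (v n x)^2 + w n x" for x
   proof (cases "\<bar>phi x\<bar> > \<eta> * \<bar>v n x\<bar>")
    case False
    then have "\<bar>v n x\<bar> * \<bar>phi x\<bar> <= \<bar>v n x\<bar> * (\<eta> * \<bar>v n x\<bar>)" by (intro mult_left_mono) auto
    also have "... = \<eta> * (v n x)^2" by (simp add: power2_eq_square mult.left_commute[of "\<bar>v n x\<bar>" \<eta>])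
    finally show ?thesis using False by (simp add: w_def abs_mult)
   qed (use \<eta> in \<open>simp add: w_def\<close>)
   have "(LINT x|lebesgue. \<bar>v n x * phi x\<bar>) <= (LINT x|lebesgue. \<eta> * (v n x)^2 + w n x)"
    using pw wi v[of n] L2_mult_integrable[OF v[of n] phi]
    by (intro integral_mono) (auto simp: L2_iff)
   also have "... = \<eta> * mass (v n) + (LINT x|lebesgue. w n x)"
    using wi v[of n] by (simp add: L2_iff mass_def)
   also have "... <= \<eta> * c + (LINT x|lebesgue. w n x)" using \<eta> b by (intro add_right_mono mult_left_mono) auto
   also have "... < r" using n0[OF that] \<eta> by simp
   finally have "(LINT x|lebesgue. \<bar>v n x * phi x\<bar>) < r" .
   moreover have "0 <= (LINT x|lebesgue. \<bar>v n x * phi x\<bar>)" by simp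
   ultimately show ?thesis by simp
  qed
  then show "\<exists>n0. \<forall>n\<ge>n0. norm ((LINT x|lebesgue. \<bar>v n x * phi x\<bar>) - 0) < r" by blast
 qed
 show "(%n. ip (v n) phi) ----> 0"
  by (rule Lim_null_comparison[OF _ A]) (auto simp: ip_def intro!: always_eventually integral_abs_bound)
qed

text \<open>Tonelli: the integral over \<open>h\<close> of the measure of the overlap is the product
  of the two measures, hence nonzero. It is applied to Borel subsets of \<open>X\<close> and
  \<open>Y\<close> that still have positive measure.\<close>

lemma overlap_translate:
 fixes X Y :: "(real ^ 'n) set"
 assumes X: "X \<in> sets lebesgue" "emeasure lebesgue X ~= 0"
  and Y: "Y \<in> sets lebesgue" "emeasure lebesgue Y ~= 0"
 obtains h where "emeasure lebesgue {x \<in> X. x + h \<in> Y} ~= 0"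
proof -
 have borel_sub: "\<exists>S \<in> sets borel. S \<subseteq> X & emeasure lborel S ~= 0"
  if "X \<in> sets lebesgue" "emeasure lebesgue X ~= 0" for X :: "(real ^ 'n) set"
 proof -
  from that(1) obtain S N N' where S: "X = S \<union> N" "N \<subseteq> N'" "N' \<in> null_sets lborel" "S \<in> sets lborel"
   by (rule sets_completionE)
  have "N \<in> null_sets lebesgue" using S(2,3) null_sets_completionI null_sets_completion_subset by blast
  then have "emeasure lebesgue X = emeasure lebesgue S"
   using S by (simp add: emeasure_Un_null_set)
  then show ?thesis using S that by auto
 qed
 obtain S T where S: "S \<in> sets borel" "S \<subseteq> X" "emeasure lborel S ~= 0"
  and T: "T \<in> sets borel" "T \<subseteq> Y" "emeasure lborel T ~= 0"
  using borel_sub X Y by metis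
 note [measurable] = S(1) T(1)
 have shift: "(\<integral>\<^sup>+h. indicator T (x + h) \<partial>lborel) = emeasure lborel T" for x
 proof -
  have "emeasure lborel T = (\<integral>\<^sup>+h. indicator T h \<partial>distr lborel borel ((+) x))"
   by (simp add: lborel_distr_plus)
  also have "... = (\<integral>\<^sup>+h. indicator T (x + h) \<partial>lborel)"
   by (subst nn_integral_distr) auto
  finally show ?thesis by simp
 qed
 have "\<exists>h. emeasure lborel {x \<in> S. x + h \<in> T} ~= 0"
 proof (rule ccontr)
  assume "~ ?thesis"
  then have "0 = (\<integral>\<^sup>+h. emeasure lborel {x \<in> S. x + h \<in> T} \<partial>lborel)" by simp
  also have "... = (\<integral>\<^sup>+h. (\<integral>\<^sup>+x. indicator S x * indicator T (x + h) \<partial>lborel) \<partial>lborel)"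
  proof (rule nn_integral_cong)
   fix h :: "real ^ 'n"
   have "{x \<in> S. x + h \<in> T} \<in> sets lborel" by measurable
   moreover have "(indicator S x * indicator T (x + h) :: ennreal) = indicator {x \<in> S. x + h \<in> T} x" for x
    by (simp add: indicator_def flip: of_bool_conj)
   ultimately show "emeasure lborel {x \<in> S. x + h \<in> T} = (\<integral>\<^sup>+x. indicator S x * indicator T (x + h) \<partial>lborel)"
    by simp
  qed
  also have "... = (\<integral>\<^sup>+x. (\<integral>\<^sup>+h. indicator S x * indicator T (x + h) \<partial>lborel) \<partial>lborel)"
   by (rule lborel_pair.Fubini') measurable
  also have "... = (\<integral>\<^sup>+x. indicator S x * emeasure lborel T \<partial>lborel)"
   by (subst nn_integral_cmult) (auto simp: shift)
  also have "... = emeasure lborel S * emeasure lborel T"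
   by (subst nn_integral_multc) auto
  finally show False using S T by auto
 qed
 then obtain h where h: "emeasure lborel {x \<in> S. x + h \<in> T} ~= 0" by blast
 have "(%x. x + h) -` Y \<inter> space lebesgue \<in> sets lebesgue"
  using affine_measurable_lebesgue[of 1 h] Y(1) by (intro measurable_sets) auto
 then have "X \<inter> ((%x. x + h) -` Y) \<in> sets lebesgue" using X by auto
 also have "X \<inter> ((%x. x + h) -` Y) = {x \<in> X. x + h \<in> Y}" by auto
 finally have m: "{x \<in> X. x + h \<in> Y} \<in> sets lebesgue" .
 have "{x \<in> S. x + h \<in> T} \<in> sets lborel" by measurable
 then have "emeasure lborel {x \<in> S. x + h \<in> T} = emeasure lebesgue {x \<in> S. x + h \<in> T}" by simp
 also have "... <= emeasure lebesgue {x \<in> X. x + h \<in> Y}"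
  using S T by (intro emeasure_mono m) auto
 finally have "emeasure lebesgue {x \<in> X. x + h \<in> Y} ~= 0" using h by auto
 then show ?thesis by (rule that)
qed

subsection \<open>Test functions\<close>

text \<open>The classical \<open>exp (- c / t)\<close>, with negative powers of \<open>t\<close>
  added so that the family is stable under differentiation up to linear combinations. As
  \<open>c\<close> tends to zero, \<open>flat 0 c\<close> tends to the indicator of the positive
  axis.\<close>

definition flat :: "nat => real => real => real" where
 "flat k c t = (if t > 0 then exp (- c / t) / t ^ k else 0)"

lemma flat_nonneg: "0 <= flat k c t"
 by (simp add: flat_def)

lemma flat_pos: "t > 0 ==> 0 < flat k c t"
 by (simp add: flat_def)

lemma flat_0_le_1: "c > 0 ==> flat 0 c t <= 1"
 by (simp add: flat_def)

lemma flat_tendsto_0: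
 assumes c: "c > 0" shows "(flat k c \<longlongrightarrow> 0) (at 0)"
proof -
 have "((%s. s ^ k / exp (c * s)) \<longlongrightarrow> 0) at_top"
 proof -
  have "((%s. (1/c)^k * ((c * s) ^ k / exp (c * s))) \<longlongrightarrow> (1/c)^k * 0) at_top"
   by (intro tendsto_intros filterlim_compose[OF tendsto_power_div_exp_0]
     filterlim_tendsto_pos_mult_at_top[OF tendsto_const c filterlim_ident])
  then show ?thesis using c by (simp add: power_mult_distrib field_simps)
 qed
 then have "((%t. (inverse t) ^ k / exp (c * inverse t)) \<longlongrightarrow> 0) (at_right 0)"
  by (rule filterlim_compose[OF _ filterlim_inverse_at_top_right])
 then have "(flat k c \<longlongrightarrow> 0) (at_right 0)"
  by (rule Lim_transform_eventually)
   (auto simp: eventually_at_right_field flat_def exp_minus field_simps intro!: exI[of _ 1])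
 moreover have "(flat k c \<longlongrightarrow> 0) (at_left 0)"
  by (rule tendsto_eventually) (auto simp: eventually_at_left_field flat_def intro!: exI[of _ "-1"])
 ultimately show ?thesis by (simp add: filterlim_at_split)
qed

lemma flat_DERIV:
 assumes c: "c > 0"
 shows "(flat k c has_real_derivative (c * flat (k + 2) c t - real k * flat (k + 1) c t)) (at t)"
proof (cases t "0 :: real" rule: linorder_cases)
 case less
 have "((%_. 0) has_real_derivative 0) (at t)" by simp
 then have "(flat k c has_real_derivative 0) (at t)"
  by (rule has_field_derivative_transform_within_open[of _ _ _ "{..<0}"]) (use less in \<open>auto simp: flat_def\<close>)
 then show ?thesis using less by (simp add: flat_def)
next
 case equal
 \<comment> \<open>At the origin the difference quotient of the function with index \<open>k\<close>
   is exactly the function with index \<open>k + 1\<close>, which tends to zero there.\<close>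
 have "((%h. (flat k c (0 + h) - flat k c 0) / h) \<longlongrightarrow> 0) (at 0)"
 proof -
  have "(%h. (flat k c (0 + h) - flat k c 0) / h) = flat (Suc k) c" by (auto simp: fun_eq_iff flat_def)
  then show ?thesis using flat_tendsto_0[OF c, of "Suc k"] by simp
 qed
 then have "(flat k c has_real_derivative 0) (at 0)" by (simp add: DERIV_def)
 then show ?thesis using equal by (simp add: flat_def)
next
 case greater
 have "((%t. exp (- c / t) / t ^ k) has_real_derivative
   ((exp (- c / t) * (c / t^2)) * t ^ k - exp (- c / t) * (real k * t ^ (k - 1))) / (t ^ k * t ^ k)) (at t)"
  using greater by (auto intro!: derivative_eq_intros simp: power2_eq_square)
 also have "((exp (- c / t) * (c / t^2)) * t ^ k - exp (- c / t) * (real k * t ^ (k - 1))) / (t ^ k * t ^ k)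
   = c * flat (k + 2) c t - real k * flat (k + 1) c t"
  using greater by (cases k) (auto simp: flat_def field_simps power2_eq_square)
 finally show ?thesis
  by (rule has_field_derivative_transform_within_open[of _ _ _ "{0<..}"]) (use greater in \<open>auto simp: flat_def\<close>)
qed

text \<open>An algebra of smooth functions, closed under partial derivatives, that contains enough
 compactly supported functions.\<close>

inductive_set flat_algebra :: "(real ^ 'n => real) set" where
 const: "(%x. r) \<in> flat_algebra"
| flat: "c > 0 ==> (%x. flat k c (s * (x $ i) + d)) \<in> flat_algebra"
| add: "f \<in> flat_algebra ==> g \<in> flat_algebra ==> (%x. f x + g x) \<in> flat_algebra"
| mult: "f \<in> flat_algebra ==> g \<in> flat_algebra ==> (%x. f x * g x) \<in> flat_algebra"

lemma flat_algebra_prod: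
 "finite A ==> (!!i. i \<in> A ==> f i \<in> flat_algebra) ==> (%x. \<Prod>i\<in>A. f i x) \<in> flat_algebra"
 by (induction A rule: finite_induct) (auto intro: flat_algebra.intros)

text \<open>Writing the derivative as a sum over coordinates with coefficients in the algebra makes
  the induction close and identifies the partial derivatives at the same time.\<close>

lemma flat_algebra_derivative:
 fixes f :: "real ^ 'n => real"
 assumes "f \<in> flat_algebra"
 shows "\<exists>g. (\<forall>j. g j \<in> flat_algebra) & (\<forall>x. (f has_derivative (%h. \<Sum>j\<in>UNIV. h $ j * g j x)) (at x))"
 using assms
proof induction
 case (const r)
 show ?case by (rule exI[of _ "%j x. 0"]) (auto intro: flat_algebra.intros)
next
 case (flat c k s i d)
 let ?g = "%j x. if j = i then s * (c * flat (k + 2) c (s * (x $ i) + d) + (- real k) * flat (k + 1) c (s * (x $ i) + d)) else 0"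
 have "(%x::real^'n. s * (c * flat (k + 2) c (s * (x $ i) + d) + (- real k) * flat (k + 1) c (s * (x $ i) + d))) \<in> flat_algebra"
  by (intro flat_algebra.intros flat)
 then have 1: "?g j \<in> flat_algebra" for j
  using flat_algebra.const[of 0] by (cases "j = i") simp_all
 have "((%x. flat k c (s * (x $ i) + d)) has_derivative (%h. \<Sum>j\<in>UNIV. h $ j * ?g j x)) (at x)" for x
 proof -
  have l: "((%x::real^'n. s * (x $ i) + d) has_derivative (%h. s * (h $ i))) (at x)"
   using bounded_linear_imp_has_derivative[OF bounded_linear_vec_nth, of i "at x"]
   by (auto intro!: derivative_eq_intros)
  have "(flat k c has_derivative (%h. h * (c * flat (k + 2) c (s * (x $ i) + d) - real k * flat (k + 1) c (s * (x $ i) + d))))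
    (at (s * (x $ i) + d))"
   using flat_DERIV[OF flat, of k "s * (x $ i) + d"]
   by (simp add: has_field_derivative_def mult_commute_abs)
  from has_derivative_compose[OF l this] show ?thesis
   by (rule has_derivative_eq_rhs) (auto simp: if_distrib if_distribR sum.delta algebra_simps cong: if_cong)
 qed
 then show ?case by (intro exI[of _ ?g] conjI allI 1)
next
 case (add f g)
 then obtain f' g' where "!!j. f' j \<in> flat_algebra" "!!x. (f has_derivative (%h. \<Sum>j\<in>UNIV. h $ j * f' j x)) (at x)"
  "!!j. g' j \<in> flat_algebra" "!!x. (g has_derivative (%h. \<Sum>j\<in>UNIV. h $ j * g' j x)) (at x)" by blast
 then show ?case
  by (intro exI[of _ "%j x. f' j x + g' j x"] conjI allI flat_algebra.intros)
   (auto simp: distrib_left sum.distrib intro!: has_derivative_add)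
next
 case (mult f g)
 then obtain f' g' where d: "!!j. f' j \<in> flat_algebra" "!!x. (f has_derivative (%h. \<Sum>j\<in>UNIV. h $ j * f' j x)) (at x)"
  "!!j. g' j \<in> flat_algebra" "!!x. (g has_derivative (%h. \<Sum>j\<in>UNIV. h $ j * g' j x)) (at x)" by blast
 have "((%x. f x * g x) has_derivative (%h. \<Sum>j\<in>UNIV. h $ j * (f x * g' j x + f' j x * g x))) (at x)" for x
  by (rule has_derivative_eq_rhs[OF has_derivative_mult[OF d(2,4)]])
   (simp add: sum_distrib_left sum_distrib_right sum.distrib[symmetric] algebra_simps)
 then show ?case using mult d
  by (intro exI[of _ "%j x. f x * g' j x + f' j x * g x"] conjI allI flat_algebra.intros) auto
qed

lemma partial_derivative_eq:
 assumes "(f has_derivative (%h. \<Sum>j\<in>UNIV. h $ j * g j x)) (at x)"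
 shows "partial_derivative i f x = g i x"
proof -
 have "frechet_derivative f (at x) = (%h. \<Sum>j\<in>UNIV. h $ j * g j x)"
  using frechet_derivative_at[OF assms] by simp
 then show ?thesis unfolding partial_derivative_def by (simp add: axis_def if_distrib if_distribR cong: if_cong)
qed

lemma flat_algebra_partial: "f \<in> flat_algebra ==> partial_derivative i f \<in> flat_algebra"
proof -
 assume "f \<in> flat_algebra"
 then obtain g where g: "!!j. g j \<in> flat_algebra"
   "!!x. (f has_derivative (%h. \<Sum>j\<in>UNIV. h $ j * g j x)) (at x)"
  using flat_algebra_derivative by blast
 then have "partial_derivative i f = g i" using partial_derivative_eq by blast
 with g show ?thesis by simp
qed

lemma flat_algebra_differentiable: "f \<in> flat_algebra ==> f differentiable (at x)"
 using flat_algebra_derivative unfolding differentiable_def by blast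

lemma flat_algebra_C_k: "f \<in> flat_algebra ==> C_k k f"
proof (induction k arbitrary: f)
 case 0
 then show ?case
  by (auto intro!: differentiable_imp_continuous_on simp: differentiable_on_def
    intro: differentiable_at_withinI flat_algebra_differentiable)
qed (auto intro: flat_algebra_partial flat_algebra_differentiable)

lemma C_k_derivative:
 assumes "C_k (Suc 0) f"
 shows "(f has_derivative (%h. \<Sum>j\<in>UNIV. h $ j * partial_derivative j f x)) (at x)"
proof -
 have d: "(f has_derivative frechet_derivative f (at x)) (at x)"
  using assms by (simp add: frechet_derivative_works)
 interpret linear "frechet_derivative f (at x)" using d by (rule has_derivative_linear)
 have "frechet_derivative f (at x) h = (\<Sum>j\<in>UNIV. h $ j * partial_derivative j f x)" for h
 proof -
  have "h = (\<Sum>j\<in>UNIV. h $ j *\<^sub>R axis j 1)" by (simp add: vec_eq_iff axis_def if_distrib if_distribR cong: if_cong)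
  then have "frechet_derivative f (at x) h = frechet_derivative f (at x) (\<Sum>j\<in>UNIV. h $ j *\<^sub>R axis j 1)" by simp
  then show ?thesis unfolding sum scale partial_derivative_def by simp
 qed
 then show ?thesis using d by (metis (no_types, lifting) ext)
qed

lemma test_functionsD:
 assumes "phi \<in> test_functions"
 shows "C_k k phi" "continuous_on UNIV phi" "continuous_on UNIV (partial_derivative i phi)"
  "(phi has_derivative (%h. \<Sum>j\<in>UNIV. h $ j * partial_derivative j phi x)) (at x)"
  "compact (closure {x. phi x ~= 0})"
proof -
 have C: "C_k k phi" for k using assms by (simp add: test_functions_def)
 show "C_k k phi" by (rule C)
 show "continuous_on UNIV phi" using C[of 0] by simp
 show "continuous_on UNIV (partial_derivative i phi)" using C[of "Suc 0"] by simp
 show "(phi has_derivative (%h. \<Sum>j\<in>UNIV. h $ j * partial_derivative j phi x)) (at x)"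
  by (rule C_k_derivative[OF C])
 show "compact (closure {x. phi x ~= 0})" using assms by (simp add: test_functions_def)
qed

lemma partial_derivative_support:
 assumes "C_k (Suc 0) phi" "partial_derivative i phi x ~= 0"
 shows "x \<in> closure {x. phi x ~= 0}"
proof (rule ccontr)
 assume x: "x \<notin> closure {x. phi x ~= 0}"
 have "((%_. 0) has_derivative (%h. \<Sum>j\<in>UNIV. h $ j * (0::real))) (at x)" by simp
 then have "(phi has_derivative (%h. \<Sum>j\<in>UNIV. h $ j * (0::real))) (at x)"
  by (rule has_derivative_transform_within_open[of _ _ _ _ "- closure {x. phi x ~= 0}"])
   (use x closure_subset in \<open>force+\<close>)
 from partial_derivative_eq[of phi "%_ _. 0", OF this, of i] assms show False by simp
qed

lemma partial_derivative_test:
 assumes "phi \<in> test_functions" shows "partial_derivative i phi \<in> test_functions"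
proof -
 have "C_k k (partial_derivative i phi)" for k using test_functionsD(1)[OF assms, of "Suc k"] by simp
 moreover have "closure {x. partial_derivative i phi x ~= 0} \<subseteq> closure {x. phi x ~= 0}"
  using partial_derivative_support[OF test_functionsD(1)[OF assms]] by (intro closure_minimal) auto
 then have "compact (closure {x. partial_derivative i phi x ~= 0})"
  using test_functionsD(5)[OF assms] closed_closure compact_Int_closed[of "closure {x. phi x ~= 0}"]
  by (metis inf.absorb_iff2)
 ultimately show ?thesis by (simp add: test_functions_def)
qed

lemma test_function_bounded:
 assumes "phi \<in> test_functions"
 obtains B where "B > 0" "!!x. \<bar>phi x\<bar> <= B"
proof -
 let ?K = "closure {x. phi x ~= 0}"
 have "compact (phi ` ?K)"
  using test_functionsD(2,5)[OF assms] by (intro compact_continuous_image) (auto intro: continuous_on_subset)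
 then obtain B where B: "!!y. y \<in> phi ` ?K ==> \<bar>y\<bar> <= B" using compact_imp_bounded bounded_real by metis
 have "\<bar>phi x\<bar> <= \<bar>B\<bar> + 1" for x
  using B[of "phi x"] closure_subset[of "{x. phi x ~= 0}"] by (cases "phi x = 0") fastforce+
 then show ?thesis using that[of "\<bar>B\<bar> + 1"] by auto
qed

lemma test_function_L2:
 assumes "phi \<in> test_functions" shows "phi \<in> L2"
proof -
 obtain B where B: "B > 0" "!!x. \<bar>phi x\<bar> <= B" using test_function_bounded[OF assms] by blast
 let ?K = "closure {x. phi x ~= 0}"
 have K: "?K \<in> lmeasurable" using lmeasurable_compact test_functionsD(5)[OF assms] by blast
 have m: "phi \<in> lmeas"
  using measurable_completion[of phi lborel borel] borel_measurable_continuous_onI[OF test_functionsD(2)[OF assms]]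
  unfolding measurable_lborel2 by blast
 have "integrable lebesgue (%x. (phi x)^2)"
 proof (rule Bochner_Integration.integrable_bound)
  show "integrable lebesgue (%x. B^2 * indicator ?K x)" using K by (intro integrable_mult_right integrable_real_indicator) (auto simp: fmeasurable_def)
  have "(phi x)^2 <= B^2 * indicator ?K x" for x
  proof (cases "phi x = 0")
   case False
   then have "x \<in> ?K" using closure_subset[of "{x. phi x ~= 0}"] by auto
   moreover have "(phi x)^2 <= B^2"
    unfolding abs_le_square_iff[symmetric] using B(1) B(2)[of x] by linarith
   ultimately show ?thesis by (simp only: indicator_simps mult_1_right)
  qed (simp add: indicator_def)
  then show "ae x. norm ((phi x)^2) <= norm (B^2 * indicator ?K x)"
   by (intro AE_I2) (auto intro: order_trans[OF _ abs_ge_self])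
 qed (use m in auto)
 with m show ?thesis by (simp add: L2_iff)
qed

lemma test_function_translate:
 fixes phi :: "real ^ 'n => real" and a :: "real ^ 'n"
 assumes "phi \<in> test_functions" shows "(%x. phi (x + a)) \<in> test_functions"
  "partial_derivative i (%x. phi (x + a)) = (%x. partial_derivative i phi (x + a))"
proof -
 have P: "partial_derivative i (%x. phi (x + a)) = (%x. partial_derivative i phi (x + a))"
  if "!!x. phi differentiable (at x)" for phi :: "real^'n => real" and i
 proof
  fix x
  have "(phi has_derivative frechet_derivative phi (at (x + a))) (at (x + a))"
   using that by (simp add: frechet_derivative_works)
  then have "((%x. phi (x + a)) has_derivative frechet_derivative phi (at (x + a))) (at x)"
   using has_derivative_compose[of "%x. x + a" "%h. h" x UNIV phi "frechet_derivative phi (at (x + a))"]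
   by (simp add: has_derivative_add_const)
  then show "partial_derivative i (%x. phi (x + a)) x = partial_derivative i phi (x + a)"
   unfolding partial_derivative_def by (simp add: frechet_derivative_at[symmetric])
 qed
 have C: "C_k k (%x. phi (x + a))" if "C_k k phi" for k and phi :: "real^'n => real"
  using that
 proof (induction k arbitrary: phi)
  case 0
  then show ?case by (auto intro!: continuous_on_compose2[of UNIV phi] continuous_intros)
 next
  case (Suc k)
  have "(%x. phi (x + a)) differentiable (at x)" for x
   using Suc.prems differentiable_compose[of phi "%x. x + a" x UNIV] by simp
  then show ?case using Suc P[of phi] by auto
 qed
 show "partial_derivative i (%x. phi (x + a)) = (%x. partial_derivative i phi (x + a))"
  using test_functionsD(1)[OF assms, of "Suc 0"] by (intro P) auto
 have "{x. phi (x + a) ~= 0} = (%x. - a + x) ` {x. phi x ~= 0}"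
  by (auto simp: image_iff intro!: exI[of _ "_ + a"])
 then have "closure {x. phi (x + a) ~= 0} = (%x. - a + x) ` closure {x. phi x ~= 0}"
  by (simp only: closure_translation)
 moreover have "compact ((%x. - a + x) ` closure {x. phi x ~= 0})"
  using test_functionsD(5)[OF assms] by (rule compact_translation)
 ultimately have "compact (closure {x. phi (x + a) ~= 0})" by (simp only:)
 then show "(%x. phi (x + a)) \<in> test_functions"
  using C test_functionsD(1)[OF assms] unfolding test_functions_def by blast
qed

definition box_bump :: "real => real ^ 'n => real ^ 'n => real ^ 'n => real" where
 "box_bump c a b x = (\<Prod>i\<in>UNIV. flat 0 c (x $ i - a $ i) * flat 0 c (b $ i - x $ i))"

lemma box_bump_outside: "x \<notin> box a b ==> box_bump c a b x = 0"
 unfolding box_bump_def by (auto simp: mem_box_cart flat_def intro!: prod_zero)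

lemma box_bump_pos: "x \<in> box a b ==> 0 < box_bump c a b x"
 unfolding box_bump_def by (auto simp: mem_box_cart intro!: prod_pos mult_pos_pos flat_pos)

lemma box_bump_nonneg: "0 <= box_bump c a b x"
 unfolding box_bump_def by (auto intro!: prod_nonneg mult_nonneg_nonneg flat_nonneg)

lemma box_bump_le_1: "c > 0 ==> box_bump c a b x <= 1"
 unfolding box_bump_def by (auto intro!: prod_le_1 mult_le_one mult_nonneg_nonneg flat_nonneg flat_0_le_1)

lemma compact_closure_subset_box: "S \<subseteq> box a b ==> compact (closure S)"
 for a b :: "'a :: euclidean_space"
 using bounded_subset[OF bounded_box] by (auto simp: compact_closure)

lemma flat_algebra_test:
 assumes "f \<in> flat_algebra" "!!x. x \<notin> box a b ==> f x = 0" shows "f \<in> test_functions"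
 using assms flat_algebra_C_k compact_closure_subset_box[of "{x. f x ~= 0}" a b]
 by (auto simp: test_functions_def)

lemma box_bump_flat_algebra: "c > 0 ==> box_bump c a b \<in> flat_algebra"
proof -
 assume c: "c > 0"
 have "(%x. flat 0 c (x $ i - a $ i) * flat 0 c (b $ i - x $ i)) \<in> flat_algebra" for i
  using flat_algebra.mult[OF flat_algebra.flat[OF c, of 0 1 i "- a $ i"] flat_algebra.flat[OF c, of 0 "-1" i "b $ i"]]
  by (simp add: algebra_simps)
 then show ?thesis unfolding box_bump_def[abs_def] by (intro flat_algebra_prod) auto
qed

lemma box_bump_test: "c > 0 ==> box_bump c a b \<in> test_functions"
 by (rule flat_algebra_test[OF box_bump_flat_algebra box_bump_outside])

text \<open>For each positive \<open>t\<close> the factor \<open>exp (- c / t)\<close> tends to one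
  as \<open>c\<close> tends to zero. Density of test functions and uniqueness of weak gradients both
  start from this approximation of boxes.\<close>

lemma box_bump_tendsto: "(%n. box_bump (1 / real (Suc n)) a b x) ----> indicator (box a b) x"
proof (cases "x \<in> box a b")
 case True
 have F: "(%n. flat 0 (1 / real (Suc n)) t) ----> 1" if "t > 0" for t
 proof -
  have "(%n. exp (- (inverse (real (Suc n))) / t)) ----> exp (- 0 / t)"
   by (intro tendsto_intros LIMSEQ_inverse_real_of_nat) (use that in auto)
  then show ?thesis using that by (simp add: flat_def inverse_eq_divide)
 qed
 have "(%n. box_bump (1 / real (Suc n)) a b x) ----> (\<Prod>i\<in>(UNIV::'a set). 1 * 1)"
  unfolding box_bump_def using True by (intro tendsto_prod tendsto_mult F) (auto simp: mem_box_cart)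
 then show ?thesis using True by simp
qed (simp add: box_bump_outside)

section \<open>Density of test functions in L2\<close>

lemma mass_dominated_convergence:
 fixes f :: "nat => real ^ 'n => real"
 assumes f: "!!n. f n \<in> lmeas" and F: "F \<in> lmeas"
  and g: "g \<in> L2" and lim: "ae x. (%n. f n x) ----> F x"
  and le: "!!n. ae x. \<bar>f n x\<bar> <= g x"
 shows "F \<in> L2" "!!n. f n \<in> L2" "(%n. mass (%x. f n x - F x)) ----> 0"
proof -
 have le': "ae x. \<forall>n. \<bar>f n x\<bar> <= g x" using le by (simp add: AE_all_countable)
 have Fg: "ae x. \<bar>F x\<bar> <= g x"
  using lim le' by eventually_elim (rule LIMSEQ_le_const2, auto intro!: tendsto_rabs)
 show FL: "F \<in> L2" by (rule L2_dominated(1)[OF g F]) (use Fg in eventually_elim, simp)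
 show fL: "f n \<in> L2" for n by (rule L2_dominated(1)[OF g f]) (use le[of n] in eventually_elim, simp)
 have "(%n. LINT x|lebesgue. (f n x - F x)^2) ----> (LINT x|(lebesgue :: (real^'n) measure). 0)"
 proof (rule integral_dominated_convergence[where w = "%x. 4 * (g x)^2"])
  show "integrable lebesgue (%x. 4 * (g x)^2)" using g by (simp add: L2_iff)
  show "ae x. (%n. (f n x - F x)^2) ----> 0"
   using lim
  proof eventually_elim
   case (elim x)
   have "(%n. (f n x - F x)^2) ----> (F x - F x)^2" by (intro tendsto_intros elim)
   then show ?case by simp
  qed
  show "ae x. norm ((f n x - F x)^2) <= 4 * (g x)^2" for n
   using le' Fg
  proof eventually_elim
   case (elim x)
   then have "\<bar>f n x - F x\<bar> <= \<bar>2 * g x\<bar>" using elim(1)[rule_format, of n] by linarith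
   then have "(f n x - F x)^2 <= (2 * g x)^2" by (simp only: abs_le_square_iff)
   then show ?case by (simp add: power_mult_distrib)
  qed
 qed (use f F in auto)
 then show "(%n. mass (%x. f n x - F x)) ----> 0" by (simp add: mass_def)
qed

text \<open>The approximants are taken from \<open>flat_algebra\<close>, whose stability under
  linear combinations is part of its definition; bounded support then makes them test
  functions.\<close>

definition test_approximable :: "(real ^ 'n => real) => bool" where
 "test_approximable f \<longleftrightarrow> f \<in> L2 &
   (\<forall>e>0. \<exists>phi\<in>flat_algebra. bounded {x. phi x ~= 0} & mass (%x. f x - phi x) <= e)"

lemma flat_algebra_bounded_test: "phi \<in> flat_algebra ==> bounded {x. phi x ~= 0} ==> phi \<in> test_functions"
 using flat_algebra_C_k by (auto simp: test_functions_def compact_closure)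

lemma flat_algebra_bounded_L2: "phi \<in> flat_algebra ==> bounded {x. phi x ~= 0} ==> phi \<in> L2"
 by (intro test_function_L2 flat_algebra_bounded_test)

lemma test_approximable_L2: "test_approximable f ==> f \<in> L2"
 by (simp add: test_approximable_def)

lemma test_approximable_limit:
 assumes f: "!!n. test_approximable (f n)" and F: "F \<in> L2" and lim: "(%n. mass (%x. f n x - F x)) ----> 0"
 shows "test_approximable F"
 unfolding test_approximable_def
proof (intro conjI allI impI F)
 fix e :: real assume e: "e > 0"
 have "eventually (%n. mass (%x. f n x - F x) < e / 4) sequentially"
  using e by (intro order_tendstoD(2)[OF lim]) auto
 then obtain n where n: "mass (%x. f n x - F x) < e / 4" by (auto simp: eventually_sequentially)
 obtain phi where phi: "phi \<in> flat_algebra" "bounded {x. phi x ~= 0}" "mass (%x. f n x - phi x) <= e / 4"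
  using f[of n] e unfolding test_approximable_def by (meson zero_less_divide_iff zero_less_numeral)
 have "mass (%x. (f n x - phi x) - (f n x - F x)) <= 2 * mass (%x. f n x - phi x) + 2 * mass (%x. f n x - F x)"
  using flat_algebra_bounded_L2[OF phi(1,2)] test_approximable_L2[OF f, of n] F by (intro mass_diff_le L2_diff)
 then show "\<exists>phi\<in>flat_algebra. bounded {x. phi x ~= 0} & mass (%x. F x - phi x) <= e"
  using phi n by (intro bexI[of _ phi]) auto
qed

lemma test_approximable_lincomb:
 assumes f: "test_approximable f" and g: "test_approximable g"
 shows "test_approximable (%x. a * f x + b * g x)"
 unfolding test_approximable_def
proof (intro conjI allI impI L2_add L2_cmult test_approximable_L2 assms)
 fix e :: real assume e: "e > 0"
 define c where "c = 2 * a^2 + 2 * b^2 + 1"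
 have c: "c > 0" by (simp add: c_def add_nonneg_pos)
 obtain phi psi where phi: "phi \<in> flat_algebra" "bounded {x. phi x ~= 0}" "mass (%x. f x - phi x) <= e / c"
  and psi: "psi \<in> flat_algebra" "bounded {x. psi x ~= 0}" "mass (%x. g x - psi x) <= e / c"
  using f g divide_pos_pos[OF e c] unfolding test_approximable_def by meson
 have "mass (%x. a * (f x - phi x) + b * (g x - psi x)) <= 2 * mass (%x. a * (f x - phi x)) + 2 * mass (%x. b * (g x - psi x))"
  using flat_algebra_bounded_L2[OF phi(1,2)] flat_algebra_bounded_L2[OF psi(1,2)] assms
  by (intro mass_add_le L2_cmult L2_diff) (auto intro: test_approximable_L2)
 also have "... <= 2 * (a^2 * (e / c)) + 2 * (b^2 * (e / c))"
  unfolding mass_cmult using phi(3) psi(3) by (intro add_mono mult_left_mono) auto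
 also have "... = (2 * a^2 + 2 * b^2) * (e / c)" by (simp only: distrib_right mult.assoc)
 also have "... <= c * (e / c)" using e c by (intro mult_right_mono) (auto simp: c_def)
 finally have "mass (%x. a * f x + b * g x - (a * phi x + b * psi x)) <= e" using c by (simp add: algebra_simps)
 moreover have "bounded {x. a * phi x + b * psi x ~= 0}"
  by (rule bounded_subset[of "{x. phi x ~= 0} \<union> {x. psi x ~= 0}"]) (use phi psi in auto)
 ultimately show "\<exists>phi\<in>flat_algebra. bounded {x. phi x ~= 0} & mass (%x. a * f x + b * g x - phi x) <= e"
  using flat_algebra.add[OF flat_algebra.mult[OF flat_algebra.const phi(1)] flat_algebra.mult[OF flat_algebra.const psi(1)], of a b]
  by (intro bexI[of _ "%x. a * phi x + b * psi x"]) auto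
qed

lemma test_approximable_add: "test_approximable f ==> test_approximable g ==> test_approximable (%x. f x + g x)"
 using test_approximable_lincomb[of f g 1 1] by simp

lemma test_approximable_cmult: "test_approximable f ==> test_approximable (%x. c * f x)"
 using test_approximable_lincomb[of f f c 0] by simp

lemma test_approximable_diff: "test_approximable f ==> test_approximable g ==> test_approximable (%x. f x - g x)"
 using test_approximable_lincomb[of f g 1 "-1"] by simp

lemma indicator_L2: "A \<in> lmeasurable ==> (indicator A :: real ^ 'n => real) \<in> L2"
proof -
 assume A: "A \<in> lmeasurable"
 have "(%x. (indicator A x :: real)^2) = (indicator A :: real ^ 'n => real)" by (auto simp: indicator_def)
 then show ?thesis unfolding L2_iff using A by (auto simp: fmeasurable_def intro!: integrable_real_indicator)
qed

lemma test_approximable_box: "test_approximable (indicator (box a b) :: real ^ 'n => real)"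
proof -
 have T: "box_bump (1 / real (Suc n)) a b \<in> L2" for n
  by (intro test_function_L2 box_bump_test) simp
 note D = mass_dominated_convergence[where f = "%n. box_bump (1 / real (Suc n)) a b" and F = "indicator (box a b)"
   and g = "indicator (box a b)"]
 have lim: "(%n. mass (%x. box_bump (1 / real (Suc n)) a b x - indicator (box a b) x)) ----> 0"
 proof (rule D(3))
  show "(%x. indicator (box a b) x :: real) \<in> L2" by (intro indicator_L2) auto
  show "ae x. \<bar>box_bump (1 / real (Suc n)) a b x\<bar> <= indicator (box a b) x" for n
   using box_bump_le_1[of "1 / real (Suc n)" a b] box_bump_nonneg[of "1 / real (Suc n)" a b]
   by (intro AE_I2) (auto simp: indicator_def box_bump_outside)
 qed (use T L2_measurable[OF indicator_L2[OF lmeasurable_box[of a b]]] in \<open>auto simp del: of_nat_Suc intro!: AE_I2 box_bump_tendsto\<close>)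
 show ?thesis
 proof (rule test_approximable_limit[OF _ _ lim])
  fix n
  have "bounded {x. box_bump (1 / real (Suc n)) a b x ~= 0}"
   by (rule bounded_subset[OF bounded_box[of a b]]) (use box_bump_outside in blast)
  then show "test_approximable (box_bump (1 / real (Suc n)) a b)"
   unfolding test_approximable_def using T[of n] box_bump_flat_algebra[of "1 / real (Suc n)" a b]
   by (auto intro!: bexI[of _ "box_bump (1 / real (Suc n)) a b"])
 qed (auto intro: indicator_L2)
qed

lemma test_approximable_zero: "test_approximable (%x. 0)"
 using test_approximable_cmult[OF test_approximable_box, of 0] by simp

lemma borel_sigma_sets_box: "sets (borel :: (real ^ 'n) measure) = sigma_sets UNIV (range (%(a, b). box a b))"
 by (subst borel_eq_box) (simp add: sets_measure_of)

lemma Int_stable_box: "Int_stable (range (%(a, b). box a b :: (real ^ 'n) set))"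
 by (auto simp: Int_stable_def box_Int_box)

lemma subset_Pow_UNIV: "G \<subseteq> Pow UNIV"
 by simp

text \<open>Dynkin's argument over the boxes, which are stable under intersection and generate the
  Borel sets. Intersecting with one fixed box keeps complements and countable unions of finite
  measure, hence in \<open>L2\<close>.\<close>

lemma test_approximable_indicator:
 fixes A :: "(real ^ 'n) set"
 assumes A: "A \<in> sets borel"
 shows "test_approximable (indicator (A \<inter> box a b))"
proof -
 let ?B = "box a b"
 have AL: "A \<inter> ?B \<in> lmeasurable" if "A \<in> sets borel" for A
  by (rule fmeasurableI2[OF lmeasurable_box[of a b]]) (use that in auto)
 show ?thesis
  using Int_stable_box subset_Pow_UNIV A[unfolded borel_sigma_sets_box]
 proof (induction rule: sigma_sets_induct_disjoint)
  case (basic A)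
  then obtain c d where "A = box c d" by auto
  then show ?case using test_approximable_box by (auto simp: box_Int_box)
 next
  case empty
  then show ?case using test_approximable_zero by simp
 next
  case (compl A)
  have "(indicator ((UNIV - A) \<inter> ?B) :: real^'n => real) = (%x. indicator ?B x - indicator (A \<inter> ?B) x)"
   by (auto simp: indicator_def)
  then show ?case using test_approximable_diff[OF test_approximable_box compl(2)] by simp
 next
  case (union A)
  then have Am: "A i \<in> sets borel" for i unfolding borel_sigma_sets_box by auto
  have T: "test_approximable (indicator ((\<Union>i<n. A i) \<inter> ?B) :: real^'n => real)" for n
  proof (induction n)
   case 0
   then show ?case using test_approximable_zero by simp
  next
   case (Suc n)
   have "A n \<inter> A i = {}" if "i < n" for i using union(1) that by (auto simp: disjoint_family_on_def)
   then have "A n \<inter> (\<Union>i<n. A i) = {}" by blast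
   then have "(indicator ((\<Union>i<Suc n. A i) \<inter> ?B) :: real^'n => real) =
     (%x. indicator ((\<Union>i<n. A i) \<inter> ?B) x + indicator (A n \<inter> ?B) x)"
    by (auto simp: indicator_def lessThan_Suc fun_eq_iff)
   then show ?case using test_approximable_add[OF Suc union(3)[of n]] by simp
  qed
  have U: "(\<Union>i. A i) \<in> sets borel" using Am by auto
  note D = mass_dominated_convergence[where f = "%n. indicator ((\<Union>i<n. A i) \<inter> ?B)" and F = "indicator ((\<Union>i. A i) \<inter> ?B)"
   and g = "indicator ?B"]
  have "(%n. mass (%x. indicator ((\<Union>i<n. A i) \<inter> ?B) x - indicator ((\<Union>i. A i) \<inter> ?B) x)) ----> 0"
  proof (rule D(3))
   show "(indicator ?B :: real^'n => real) \<in> L2" by (intro indicator_L2) auto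
   show "ae x. (%n. indicator ((\<Union>i<n. A i) \<inter> ?B) x :: real) ----> indicator ((\<Union>i. A i) \<inter> ?B) x"
   proof (intro AE_I2)
    fix x
    show "(%n. indicator ((\<Union>i<n. A i) \<inter> ?B) x :: real) ----> indicator ((\<Union>i. A i) \<inter> ?B) x"
    proof (cases "x \<in> (\<Union>i. A i) \<inter> ?B")
     case True
     then obtain i where "x \<in> A i" "x \<in> ?B" by auto
     then show ?thesis
      by (intro tendsto_eventually eventually_sequentiallyI[of "Suc i"]) (auto simp: indicator_def)
    qed (auto simp: indicator_def)
   qed
  qed (use AL[OF U] AL[of "\<Union>i<n. A i" for n] Am in \<open>auto simp: indicator_def intro!: borel_measurable_indicator\<close>)
  from test_approximable_limit[OF T _ this] show ?case using indicator_L2[OF AL[OF U]] by simp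
 qed
qed

lemma test_approximable_bounded_support:
 fixes u :: "real ^ 'n => real"
 assumes "u \<in> borel_measurable borel" "!!x. 0 <= u x" "u \<in> L2"
 shows "test_approximable (%x. u x * indicator (box a b) x)"
proof -
 let ?B = "box a b"
 have bm: "f \<in> lmeas" if "f \<in> borel_measurable borel" for f :: "real ^ 'n => real"
  using measurable_completion[of f lborel borel] that by simp
 have "u \<in> L2 --> test_approximable (%x. u x * indicator ?B x)"
  using assms(1,2)
 proof (induction rule: borel_measurable_induct_real)
  case (set A)
  have "(%x. indicator A x * indicator ?B x) = (indicator (A \<inter> ?B) :: real ^ 'n => real)"
   by (auto simp: indicator_def fun_eq_iff)
  then show ?case using test_approximable_indicator[of A a b] set by simp
 next
  case (mult u c)
  show ?case
  proof (cases "c = 0")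
   case True
   then show ?thesis using test_approximable_cmult[OF test_approximable_box[of a b], of 0] by simp
  next
   case False
   show ?thesis
   proof
    assume "(%x. c * u x) \<in> L2"
    from L2_cmult[OF this, of "1/c"] have "u \<in> L2" using False by simp
    then show "test_approximable (%x. c * u x * indicator ?B x)"
     using test_approximable_cmult[of "%x. u x * indicator ?B x" c] mult by (simp add: mult.assoc)
   qed
  qed
 next
  case (add u v)
  show ?case
  proof
   assume s: "(%x. v x + u x) \<in> L2"
   have "u \<in> L2" "v \<in> L2"
    using add by (auto intro!: L2_dominated(1)[OF s] bm AE_I2)
   then show "test_approximable (%x. (v x + u x) * indicator ?B x)"
    using test_approximable_add[of "%x. v x * indicator ?B x" "%x. u x * indicator ?B x"] add
    by (simp add: distrib_right)
  qed
 next
  case (seq U)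
  show ?case
  proof
   assume u: "u \<in> L2"
   have le: "U i x <= u x" for i x
    using seq.hyps(3,4) by (intro incseq_le[of "%i. U i x"]) (auto simp: incseq_def le_fun_def)
   have ui: "(%x. \<bar>u x\<bar>) \<in> L2" using u by auto
   have UL: "U i \<in> L2" for i
    by (rule L2_dominated(1)[OF u bm[OF seq.hyps(1)]]) (use le seq.hyps(2) order_trans[OF seq.hyps(2) le] in auto)
   have Bm: "(indicator ?B :: real^'n => real) \<in> lmeas"
    by (rule L2_measurable[OF indicator_L2[OF lmeasurable_box]])
   note D = mass_dominated_convergence[where f = "%n x. U n x * indicator ?B x" and F = "%x. u x * indicator ?B x" and g = "%x. \<bar>u x\<bar>"]
   have m: "(%x. U n x * indicator ?B x) \<in> lmeas"
    "(%x. u x * indicator ?B x) \<in> lmeas" for n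
    using UL[of n] u Bm by (auto intro!: borel_measurable_times)
   have ae: "ae x. \<bar>U n x * indicator ?B x\<bar> <= \<bar>u x\<bar>" for n
    using order_trans[OF le abs_ge_self] seq.hyps(2) by (intro AE_I2) (auto simp: indicator_def)
   have l: "ae x. (%n. U n x * indicator ?B x) ----> u x * indicator ?B x"
    using seq.hyps(4) by (intro AE_I2 tendsto_intros) auto
   show "test_approximable (%x. u x * indicator ?B x)"
    by (rule test_approximable_limit[OF _ D(1)[OF m ui l ae] D(3)[OF m ui l ae]]) (use seq.IH UL in auto)
  qed
 qed
 then show ?thesis using assms(3) by blast
qed

lemma exhaust_box: "\<exists>n0. \<forall>n\<ge>n0. x \<in> box (\<chi> i. - real n) (\<chi> i. real n)" for x :: "real ^ 'n"
proof -
 obtain n0 :: nat where n0: "norm x < n0" using reals_Archimedean2 by blast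
 have "\<bar>x $ i\<bar> < n0" for i using component_le_norm_cart[of x i] n0 by linarith
 note c = this
 have "x \<in> box (\<chi> i. - real n) (\<chi> i. real n)" if "n >= n0" for n
  unfolding mem_box_cart
 proof
  fix i
  have "real n0 <= real n" using that by simp
  then show "(\<chi> i. - real n) $ i < x $ i & x $ i < (\<chi> i. real n) $ i"
   using c[of i] by (auto simp: abs_less_iff)
 qed
 then show ?thesis by blast
qed

theorem test_functions_dense:
 fixes f :: "real ^ 'n => real"
 assumes f: "f \<in> L2"
 shows "test_approximable f"
proof -
 have P: "test_approximable u" if u: "u \<in> borel_measurable borel" "!!x. 0 <= u x" "u \<in> L2" for u :: "real ^ 'n => real"
 proof -
  let ?B = "%n. box (\<chi> i. - real n) (\<chi> i. real n) :: (real ^ 'n) set"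
  note D = mass_dominated_convergence[where f = "%n x. u x * indicator (?B n) x" and F = u and g = u]
  have "(%n. mass (%x. u x * indicator (?B n) x - u x)) ----> 0"
  proof (rule D(3))
   show "ae x. (%n. u x * indicator (?B n) x) ----> u x"
   proof (intro AE_I2)
    fix x
    obtain n0 where "!!n. n >= n0 ==> x \<in> ?B n" using exhaust_box[of x] by blast
    then show "(%n. u x * indicator (?B n) x) ----> u x"
     by (intro tendsto_eventually eventually_sequentiallyI[of n0]) auto
   qed
   show "ae x. \<bar>u x * indicator (?B n) x\<bar> <= u x" for n
    using u(2) by (intro AE_I2) (auto simp: indicator_def)
  qed (use u L2_measurable[OF indicator_L2[OF lmeasurable_box]] in \<open>auto intro!: borel_measurable_times\<close>)
  from test_approximable_limit[OF test_approximable_bounded_support[OF u] u(3) this] show ?thesis .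
 qed
 obtain g where g: "g \<in> borel_measurable borel" "ae x. f x = g x" "g \<in> lmeas"
  using borel_representative L2_measurable[OF f] by blast
 have gL: "g \<in> L2" using L2_cong_AE[OF g(2,3) f] .
 have "test_approximable (%x. max 0 (g x) - max 0 (- g x))"
 proof (intro test_approximable_diff P)
  show "(%x. max 0 (g x)) \<in> L2" "(%x. max 0 (- g x)) \<in> L2"
   using g by (auto intro!: L2_dominated(1)[OF gL])
 qed (use g in auto)
 also have "(%x. max 0 (g x) - max 0 (- g x)) = g" by (auto simp: max_def)
 finally have "test_approximable g" .
 moreover have "ae x. g x - f x = 0" using g(2) by eventually_elim simp
 then have "mass (%x. g x - f x) = 0" using mass_eq_0_iff[OF L2_diff[OF gL f]] by simp
 ultimately show ?thesis
  using test_approximable_limit[of "%_. g" f] f by simp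
qed

lemma test_functions_dense':
 fixes f :: "real ^ 'n => real"
 assumes "f \<in> L2" "e > 0"
 obtains phi where "phi \<in> test_functions" "phi \<in> L2" "mass (%x. f x - phi x) <= e"
 using test_functions_dense[OF assms(1)] assms(2) flat_algebra_bounded_test flat_algebra_bounded_L2
 unfolding test_approximable_def by blast

text \<open>Duality: for \<open>phi\<close> close to \<open>D\<close> the pairing
  \<open>ip D phi\<close> is close to \<open>mass D\<close>, and the hypothesis becomes
  \<open>x^2 <= C x\<close> for \<open>x = sqrt (mass D)\<close>.\<close>

lemma mass_le_of_test:
 fixes D :: "real ^ 'n => real"
 assumes D: "D \<in> L2" and C: "C >= 0"
  and le: "!!phi. phi \<in> test_functions ==> \<bar>ip D phi\<bar> <= C * sqrt (mass phi)"
 shows "mass D <= C^2"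
proof -
 have *: "mass D <= C * (sqrt (mass D) + e) + sqrt (mass D) * e" if e: "e > 0" for e
 proof -
  obtain phi where phi: "phi \<in> test_functions" "phi \<in> L2" "mass (%x. D x - phi x) <= e^2"
   using test_functions_dense'[OF D, of "e^2"] e by auto
  have s: "sqrt (mass (%x. D x - phi x)) <= e" using phi(3) e by (simp add: real_le_lsqrt)
  have "sqrt (mass (%x. D x - (D x - phi x))) <= sqrt (mass D) + sqrt (mass (%x. D x - phi x))"
   using D phi by (intro sqrt_mass_diff) auto
  with s have s2: "sqrt (mass phi) <= sqrt (mass D) + e" by simp
  have "mass D = ip D phi + ip D (%x. D x - phi x)"
   using D phi by (simp add: ip_diff_right ip_self)
  also have "... <= C * sqrt (mass phi) + sqrt (mass D) * sqrt (mass (%x. D x - phi x))"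
   using le[OF phi(1)] ip_Cauchy_Schwarz[OF D, of "%x. D x - phi x"] D phi by (auto simp: abs_le_iff intro!: add_mono)
  also have "... <= C * (sqrt (mass D) + e) + sqrt (mass D) * e"
   using s s2 C by (intro add_mono mult_left_mono) auto
  finally show ?thesis .
 qed
 let ?s = "sqrt (mass D)"
 have "(%n. C * (?s + inverse (real (Suc n))) + ?s * inverse (real (Suc n))) ----> C * (?s + 0) + ?s * 0"
  by (intro tendsto_intros LIMSEQ_inverse_real_of_nat)
 then have "mass D <= C * (?s + 0) + ?s * 0"
  by (rule LIMSEQ_le_const) (use * in \<open>auto simp del: of_nat_Suc\<close>)
 then have le: "?s * ?s <= C * ?s" by simp
 have "?s <= C"
 proof (cases "?s = 0")
  case False
  then have "?s > 0" using real_sqrt_ge_zero[OF mass_nonneg[of D]] by linarith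
  with le show ?thesis by (rule mult_right_le_imp_le)
 qed (use C in simp)
 then show ?thesis using power_mono[of ?s C 2] by simp
qed

lemma AE_0_of_test_L2:
 fixes D :: "real ^ 'n => real"
 assumes D: "D \<in> L2" and "!!phi. phi \<in> test_functions ==> ip D phi = 0"
 shows "ae x. D x = 0"
 using mass_le_of_test[OF D, of 0] assms mass_nonneg[of D] mass_eq_0_iff[OF D] by auto

text \<open>The common bound on the masses makes the error from replacing \<open>h\<close> by a
  nearby test function uniform in \<open>n\<close>.\<close>

lemma ip_tendsto_of_test:
 fixes f :: "nat => real ^ 'n => real"
 assumes f: "!!n. f n \<in> L2" and b: "!!n. mass (f n) <= c" and g: "g \<in> L2"
  and t: "!!phi. phi \<in> test_functions ==> (%n. ip (f n) phi) ----> ip g phi" and h: "h \<in> L2"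
 shows "(%n. ip (f n) h) ----> ip g h"
proof (rule LIMSEQ_I)
 fix r :: real assume r: "r > 0"
 have c0: "c >= 0" using b[of 0] mass_nonneg[of "f 0"] by linarith
 define M where "M = sqrt c + sqrt (mass g) + 1"
 have M: "M > 0" unfolding M_def using c0 by (simp add: add_nonneg_pos)
 obtain phi where phi: "phi \<in> test_functions" "phi \<in> L2" "mass (%x. h x - phi x) <= (r / (2 * M))^2"
  using test_functions_dense'[OF h, of "(r / (2 * M))^2"] r M by auto
 have s: "sqrt (mass (%x. h x - phi x)) <= r / (2 * M)" using phi(3) r M by (intro real_le_lsqrt) auto
 obtain N where N: "!!n. n >= N ==> \<bar>ip (f n) phi - ip g phi\<bar> < r / 2"
  using LIMSEQ_D[OF t[OF phi(1)], of "r/2"] r by auto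
 have "\<bar>ip (f n) h - ip g h\<bar> < r" if "n >= N" for n
 proof -
  have hp: "(%x. h x - phi x) \<in> L2" using h phi by auto
  have "ip (f n) h - ip g h = (ip (f n) phi - ip g phi) + (ip (f n) (%x. h x - phi x) - ip g (%x. h x - phi x))"
   using f g h phi by (simp add: ip_diff_right)
  moreover have "\<bar>ip (f n) (%x. h x - phi x)\<bar> <= sqrt c * (r / (2 * M))"
   by (rule order_trans[OF ip_Cauchy_Schwarz[OF f hp]]) (intro mult_mono, use b s c0 in auto)
  moreover have "\<bar>ip g (%x. h x - phi x)\<bar> <= sqrt (mass g) * (r / (2 * M))"
   by (rule order_trans[OF ip_Cauchy_Schwarz[OF g hp]]) (intro mult_mono, use s in auto)
  moreover have "sqrt c * (r / (2 * M)) + sqrt (mass g) * (r / (2 * M)) = (M - 1) * (r / (2 * M))"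
   by (simp only: distrib_right[symmetric] M_def) simp
  moreover have "... < M * (r / (2 * M))" using r M by (intro mult_strict_right_mono) auto
  moreover have "M * (r / (2 * M)) = r / 2" using M by simp
  ultimately show ?thesis using N[OF that] by linarith
 qed
 then show "\<exists>n0. \<forall>n\<ge>n0. norm (ip (f n) h - ip g h) < r" by auto
qed

subsection \<open>Weak derivatives\<close>

lemma test_function_axis_derivative:
 assumes "phi \<in> test_functions"
 shows "((%s. phi (x + s *\<^sub>R axis i 1)) has_real_derivative partial_derivative i phi (x + s *\<^sub>R axis i 1)) (at s)"
proof -
 let ?D = "%h. \<Sum>j\<in>UNIV. h $ j * partial_derivative j phi (x + s *\<^sub>R axis i 1)"
 have "((%s. x + s *\<^sub>R axis i 1) has_derivative (%h. h *\<^sub>R axis i 1)) (at s)"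
  by (auto intro!: derivative_eq_intros)
 from has_derivative_compose[OF this test_functionsD(4)[OF assms]]
 have "((%s. phi (x + s *\<^sub>R axis i 1)) has_derivative (%h. ?D (h *\<^sub>R axis i 1))) (at s)" .
 moreover have "(%h. ?D (h *\<^sub>R axis i 1)) = (*) (partial_derivative i phi (x + s *\<^sub>R axis i 1))"
  by (simp add: axis_def if_distrib if_distribR fun_eq_iff mult.commute cong: if_cong)
 ultimately show ?thesis unfolding has_field_derivative_def by simp
qed

text \<open>Differentiation under the integral: along a null sequence of steps the difference
  quotients of a test function are bounded by the mean value theorem and supported in one ball, so
  dominated convergence applies even though \<open>u\<close> is only in \<open>L2\<close>.\<close>

lemma ip_translate_DERIV:
 assumes u: "u \<in> L2" and phi: "phi \<in> test_functions"
 shows "((%s. ip u (%x. phi (x + s *\<^sub>R axis i 1))) has_real_derivative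
  ip u (%x. partial_derivative i phi (x + s *\<^sub>R axis i 1))) (at s)"
proof -
 have zero: "((%s. ip u (%x. psi (x + s *\<^sub>R axis i 1))) has_real_derivative ip u (partial_derivative i psi)) (at 0)"
  if psi: "psi \<in> test_functions" for psi
  unfolding DERIV_def tendsto_at_iff_sequentially
 proof (intro allI impI)
  fix X :: "nat => real" assume X: "\<forall>n. X n \<in> UNIV - {0}" "X ----> 0"
  let ?psi' = "partial_derivative i psi"
  obtain B where B: "B > 0" "!!x. \<bar>?psi' x\<bar> <= B"
   using test_function_bounded[OF partial_derivative_test[OF psi]] by blast
  have "bounded {x. psi x ~= 0}"
   using test_functionsD(5)[OF psi] by (simp add: compact_closure)
  then obtain R where R: "!!x. psi x ~= 0 ==> norm x <= R" by (auto simp: bounded_iff)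
  obtain C where C: "C > 0" "!!n. \<bar>X n\<bar> <= C"
   using convergent_imp_Bseq[of X] X(2) by (auto simp: convergent_def Bseq_def)
  have t: "(%x. psi (x + s *\<^sub>R axis i 1)) \<in> L2" for s
   by (intro test_function_L2 test_function_translate psi)
  define q where "q n x = (psi (x + X n *\<^sub>R axis i 1) - psi x) / X n" for n x
  \<comment> \<open>\<open>R\<close> bounds the support of \<open>psi\<close> and \<open>C\<close>
    all the shifts \<open>X n\<close>, so every quotient vanishes outside this ball.\<close>
  let ?K = "cball 0 (R + C) :: (real ^ 'a) set"
  have qK: "\<bar>q n x\<bar> <= B * indicator ?K x" for n x
  proof (cases "x \<in> ?K")
   case True
   have Xn: "X n ~= 0" using X by auto
   have "\<exists>z. psi (x + X n *\<^sub>R axis i 1) - psi (x + 0 *\<^sub>R axis i 1) = X n * ?psi' (x + z *\<^sub>R axis i 1)"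
   proof (cases "X n > 0")
    case True
    from MVT2[of 0 "X n", OF True test_function_axis_derivative[OF psi]]
    obtain z where "psi (x + X n *\<^sub>R axis i 1) - psi (x + 0 *\<^sub>R axis i 1) = (X n - 0) * ?psi' (x + z *\<^sub>R axis i 1)" by blast
    then show ?thesis by auto
   next
    case False
    then have "X n < 0" using Xn by simp
    from MVT2[of "X n" 0, OF this test_function_axis_derivative[OF psi]]
    obtain z where "psi (x + 0 *\<^sub>R axis i 1) - psi (x + X n *\<^sub>R axis i 1) = (0 - X n) * ?psi' (x + z *\<^sub>R axis i 1)" by blast
    then show ?thesis by (intro exI[of _ z]) simp
   qed
   then obtain z where "psi (x + X n *\<^sub>R axis i 1) - psi x = X n * ?psi' (x + z *\<^sub>R axis i 1)" by auto
   then have "q n x = ?psi' (x + z *\<^sub>R axis i 1)" using Xn by (simp add: q_def)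
   then show ?thesis using B True by simp
  next
   case False
   then have n: "norm x > R + C" by simp
   have "psi x = 0" using R[of x] n C by force
   moreover have "psi (x + X n *\<^sub>R axis i 1) = 0"
   proof (rule ccontr)
    assume "psi (x + X n *\<^sub>R axis i 1) ~= 0"
    then have "norm (x + X n *\<^sub>R axis i 1) <= R" by (rule R)
    moreover have "norm x <= norm (x + X n *\<^sub>R axis i 1) + norm (X n *\<^sub>R axis i (1::real))"
     using norm_triangle_ineq4[of "x + X n *\<^sub>R axis i 1" "X n *\<^sub>R axis i 1"] by simp
    moreover have "norm (X n *\<^sub>R axis i (1::real)) <= C" using C(2)[of n] by (simp add: norm_axis_1)
    ultimately show False using n by linarith
   qed
   ultimately show ?thesis using False by (simp add: q_def)
  qed
  have um: "u \<in> lmeas" using u by auto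
  have qm: "q n \<in> lmeas" for n
   unfolding q_def using t[of "X n"] test_function_L2[OF psi]
   by (intro borel_measurable_divide borel_measurable_diff) auto
  have "(%n. LINT x|lebesgue. u x * q n x) ----> (LINT x|lebesgue. u x * ?psi' x)"
  proof (rule integral_dominated_convergence[where w = "%x. B * \<bar>u x * indicator ?K x\<bar>"])
   show "(%x. u x * ?psi' x) \<in> lmeas"
    using um test_function_L2[OF partial_derivative_test[OF psi, of i]] by auto
   show "integrable lebesgue (%x. B * \<bar>u x * indicator ?K x\<bar>)"
    using L2_mult_integrable[OF u indicator_L2[of ?K]] by auto
   show "ae x. (%n. u x * q n x) ----> u x * ?psi' x"
   proof (intro AE_I2 tendsto_intros)
    fix x
    have "((%h. (psi (x + (0 + h) *\<^sub>R axis i 1) - psi (x + 0 *\<^sub>R axis i 1)) / h) \<longlongrightarrow> ?psi' (x + 0 *\<^sub>R axis i 1)) (at 0)"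
     using test_function_axis_derivative[OF psi, of x i 0] by (simp only: DERIV_def)
    then show "(%n. q n x) ----> ?psi' x"
     using X unfolding tendsto_at_iff_sequentially q_def by (auto simp: comp_def)
   qed
   show "ae x. norm (u x * q n x) <= B * \<bar>u x * indicator ?K x\<bar>" for n
   proof (intro AE_I2)
    fix x
    have "\<bar>u x\<bar> * \<bar>q n x\<bar> <= \<bar>u x\<bar> * (B * indicator ?K x)" by (intro mult_left_mono qK) simp
    then show "norm (u x * q n x) <= B * \<bar>u x * indicator ?K x\<bar>" by (simp add: abs_mult mult.left_commute)
   qed
  qed (use um qm in auto)
  moreover have "(LINT x|lebesgue. u x * q n x) =
    (ip u (%x. psi (x + (0 + X n) *\<^sub>R axis i 1)) - ip u (%x. psi (x + 0 *\<^sub>R axis i 1))) / X n" for n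
  proof -
   have "(%x. u x * q n x) = (%x. (u x * psi (x + X n *\<^sub>R axis i 1) - u x * psi x) / X n)"
    by (simp add: q_def fun_eq_iff right_diff_distrib diff_divide_distrib)
   then show ?thesis
    using L2_mult_integrable[OF u t[of "X n"]] L2_mult_integrable[OF u test_function_L2[OF psi]]
    by (simp add: ip_def)
  qed
  ultimately show "((%h. (ip u (%x. psi (x + (0 + h) *\<^sub>R axis i 1)) - ip u (%x. psi (x + 0 *\<^sub>R axis i 1))) / h) \<circ> X)
    ----> ip u (partial_derivative i psi)"
   by (simp add: comp_def ip_def)
 qed
 \<comment> \<open>A general \<open>s\<close> reduces to the case zero, applied to a translate of
   \<open>phi\<close>.\<close>
 have "((%t. ip u (%x. phi (x + (s + t) *\<^sub>R axis i 1))) has_real_derivative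
   ip u (%x. partial_derivative i phi (x + s *\<^sub>R axis i 1))) (at 0)"
  using zero[OF test_function_translate(1)[OF phi, of "s *\<^sub>R axis i 1"]]
  unfolding test_function_translate(2)[OF phi] by (simp add: algebra_simps)
 then show ?thesis by (simp add: DERIV_def add.assoc[symmetric])
qed

text \<open>One direction at a time and with square integrability built in, so that the calculus
  takes place between scalar functions and the pairing \<open>ip\<close>.\<close>

definition weak_partial :: "'n :: finite => (real ^ 'n => real) => (real ^ 'n => real) => bool" where
 "weak_partial i u g \<longleftrightarrow> u \<in> L2 & g \<in> L2 &
   (\<forall>phi\<in>test_functions. ip u (partial_derivative i phi) = - ip g phi)"

lemma weak_partial_shift_ip:
 assumes w: "weak_partial i u g" and phi: "phi \<in> test_functions"
 shows "((%s. ip u (%x. phi (x + s *\<^sub>R axis i 1))) has_real_derivative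
  - ip g (%x. phi (x + s *\<^sub>R axis i 1))) (at s)"
proof -
 have "ip u (partial_derivative i (%x. phi (x + s *\<^sub>R axis i 1))) = - ip g (%x. phi (x + s *\<^sub>R axis i 1))"
  using w test_function_translate(1)[OF phi] unfolding weak_partial_def by blast
 then show ?thesis
  using ip_translate_DERIV[of u phi i s] w phi unfolding test_function_translate(2)[OF phi] weak_partial_def by simp
qed

text \<open>Against a test function \<open>phi\<close>, the pairing with the shifted
  \<open>u\<close> is differentiable in the shift, with derivative at most
  \<open>sqrt (mass g) * sqrt (mass phi)\<close>. The mean value inequality and duality give the
  estimate for \<open>u\<close> itself.\<close>

lemma weak_partial_difference:
 fixes u :: "real ^ 'n => real"
 assumes w: "weak_partial i u g"
 shows "mass (%x. u (x + h *\<^sub>R axis i 1) - u x) <= h^2 * mass g"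
proof -
 let ?e = "axis i 1 :: real ^ 'n"
 have uL: "u \<in> L2" "g \<in> L2" using w by (auto simp: weak_partial_def)
 define C where "C = \<bar>h\<bar> * sqrt (mass g)"
 have "mass (%x. u (x + h *\<^sub>R ?e) - u x) <= C^2"
 proof (rule mass_le_of_test)
  show "(%x. u (x + h *\<^sub>R ?e) - u x) \<in> L2" using uL by auto
  show "C >= 0" by (simp add: C_def)
  fix phi :: "real ^ 'n => real" assume phi: "phi \<in> test_functions"
  have phiL: "phi \<in> L2" using phi by (rule test_function_L2)
  let ?F = "%s. ip u (%x. phi (x + s *\<^sub>R ?e))"
  have "norm (?F (-h) - ?F 0) <= (sqrt (mass g) * sqrt (mass phi)) * norm (- h - 0)"
  proof (rule field_differentiable_bound[of UNIV])
   fix s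
   show "(?F has_field_derivative - ip g (%x. phi (x + s *\<^sub>R ?e))) (at s within UNIV)"
    using weak_partial_shift_ip[OF w phi] by simp
   have "\<bar>ip g (%x. phi (x + s *\<^sub>R ?e))\<bar> <= sqrt (mass g) * sqrt (mass (%x. phi (x + s *\<^sub>R ?e)))"
    using uL phiL by (intro ip_Cauchy_Schwarz) auto
   then show "norm (- ip g (%x. phi (x + s *\<^sub>R ?e))) <= sqrt (mass g) * sqrt (mass phi)"
    using mass_translate[OF L2_measurable[OF phiL]] by simp
  qed auto
  moreover have "ip (%x. u (x + h *\<^sub>R ?e) - u x) phi = ?F (-h) - ?F 0"
   using uL phiL ip_translate[OF uL(1) phiL, of "h *\<^sub>R ?e"] by (subst ip_diff_left) auto
  ultimately show "\<bar>ip (%x. u (x + h *\<^sub>R ?e) - u x) phi\<bar> <= C * sqrt (mass phi)"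
   by (simp add: C_def mult_ac)
 qed
 then show ?thesis by (simp add: C_def power_mult_distrib)
qed

lemma difference_quotient_test_tendsto:
 fixes u :: "real ^ 'n => real"
 assumes u: "u \<in> L2" and phi: "phi \<in> test_functions"
 shows "(%n. ip (%x. real (Suc n) * (u (x + (1 / real (Suc n)) *\<^sub>R axis i 1) - u x)) phi) ----> - ip u (partial_derivative i phi)"
proof -
 let ?e = "axis i 1 :: real ^ 'n"
 let ?F = "%s. ip u (%x. phi (x + s *\<^sub>R ?e))"
 have phiL: "phi \<in> L2" using phi by (rule test_function_L2)
 have "(?F has_real_derivative ip u (partial_derivative i phi)) (at 0)"
  using ip_translate_DERIV[OF u phi, of i 0] by simp
 then have D: "((%h. (?F h - ?F 0) / h) \<longlongrightarrow> ip u (partial_derivative i phi)) (at 0)"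
  by (simp add: DERIV_def)
 define X where "X n = - inverse (real (Suc n))" for n
 have "(%n. (?F (X n) - ?F 0) / X n) ----> ip u (partial_derivative i phi)"
 proof (rule filterlim_compose[OF D])
  have "X ----> - 0" unfolding X_def by (intro tendsto_intros LIMSEQ_inverse_real_of_nat)
  then show "filterlim X (at 0) sequentially"
   by (auto simp: filterlim_at X_def simp del: of_nat_Suc)
 qed
 then have "(%n. - ((?F (X n) - ?F 0) / X n)) ----> - ip u (partial_derivative i phi)" by (rule tendsto_minus)
 moreover have "- ((?F (X n) - ?F 0) / X n) = ip (%x. real (Suc n) * (u (x + (1 / real (Suc n)) *\<^sub>R ?e) - u x)) phi" for n
 proof -
  have "ip (%x. u (x + (1 / real (Suc n)) *\<^sub>R ?e) - u x) phi = ?F (X n) - ?F 0"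
   using u phiL ip_translate[OF u phiL, of "(1 / real (Suc n)) *\<^sub>R ?e"]
   by (subst ip_diff_left) (auto simp: X_def inverse_eq_divide simp del: of_nat_Suc)
  then show ?thesis unfolding ip_cmult_left by (simp add: X_def divide_inverse mult.commute del: of_nat_Suc)
 qed
 ultimately show ?thesis by simp
qed

lemma mass_difference_quotient:
 fixes u :: "real ^ 'n => real"
 assumes "mass (%x. u (x + (1 / real (Suc n)) *\<^sub>R axis i 1) - u x) <= (1 / real (Suc n))^2 * c"
 shows "mass (%x. real (Suc n) * (u (x + (1 / real (Suc n)) *\<^sub>R axis i 1) - u x)) <= c"
proof -
 have "(real (Suc n))^2 * mass (%x. u (x + (1 / real (Suc n)) *\<^sub>R axis i 1) - u x)
   <= (real (Suc n))^2 * ((1 / real (Suc n))^2 * c)"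
  using assms by (intro mult_left_mono) auto
 also have "... = c" by (simp add: power_divide del: of_nat_Suc)
 finally show ?thesis unfolding mass_cmult .
qed

text \<open>The converse of \<open>weak_partial_difference\<close>: difference quotients bounded in
  \<open>L2\<close> have a weak limit in the sense of \<open>L2_bounded_weak_limit\<close>, and
  their pairings with a test function converge to those of the distributional derivative.\<close>

lemma weak_partial_exists:
 fixes u :: "real ^ 'n => real"
 assumes u: "u \<in> L2" and d: "!!h. mass (%x. u (x + h *\<^sub>R axis i 1) - u x) <= h^2 * c"
 obtains g where "weak_partial i u g" "mass g <= c"
proof -
 let ?f = "%n x. real (Suc n) * (u (x + (1 / real (Suc n)) *\<^sub>R axis i 1) - u x)"
 have f: "?f n \<in> L2" for n by (intro L2_cmult L2_diff L2_translate u)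
 have m: "mass (?f n) <= c" for n by (rule mass_difference_quotient[OF d])
 obtain g where g: "g \<in> L2" "mass g <= c" "!!phi l. phi \<in> L2 ==> (%n. ip (?f n) phi) ----> l ==> ip g phi = l"
  using L2_bounded_weak_limit[of ?f c] f m by blast
 have "weak_partial i u g"
  unfolding weak_partial_def
  using g(3)[OF test_function_L2 difference_quotient_test_tendsto[OF u]] u g(1) by simp
 with g show ?thesis using that by blast
qed

lemma weak_partial_unique:
 assumes "weak_partial i u g" "weak_partial i u g'"
 shows "ae x. g x = g' x"
proof -
 have "ae x. g x - g' x = 0"
 proof (rule AE_0_of_test_L2)
  fix phi :: "real ^ 'a => real" assume phi: "phi \<in> test_functions"
  have "- ip g phi = - ip g' phi" using assms phi unfolding weak_partial_def by metis
  then show "ip (%x. g x - g' x) phi = 0"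
   using assms test_function_L2[OF phi] by (simp add: weak_partial_def ip_diff_left)
 qed (use assms in \<open>auto simp: weak_partial_def\<close>)
 then show ?thesis by eventually_elim simp
qed

text \<open>The quotients converge weakly to \<open>g\<close> and their masses do not exceed
  \<open>mass g\<close>; weak convergence gives the matching lower bound through
  \<open>0 <= mass (f n - g)\<close>.\<close>

lemma difference_quotient_mass_tendsto:
 fixes u :: "real ^ 'n => real"
 assumes w: "weak_partial i u g" and h: "h \<in> L2"
 defines "f \<equiv> %n x. real (Suc n) * (u (x + (1 / real (Suc n)) *\<^sub>R axis i 1) - u x)"
 shows "(%n. ip (f n) h) ----> ip g h" "(%n. mass (f n)) ----> mass g"
proof -
 have uL: "u \<in> L2" "g \<in> L2" using w by (auto simp: weak_partial_def)
 have f: "f n \<in> L2" for n unfolding f_def by (intro L2_cmult L2_diff L2_translate uL)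
 have m: "mass (f n) <= mass g" for n
  unfolding f_def by (rule mass_difference_quotient[OF weak_partial_difference[OF w]])
 have t: "(%n. ip (f n) phi) ----> ip g phi" if "phi \<in> test_functions" for phi
  using difference_quotient_test_tendsto[OF uL(1) that, of i] that w unfolding f_def weak_partial_def by simp
 show "(%n. ip (f n) h) ----> ip g h" by (rule ip_tendsto_of_test[OF f m uL(2) t h])
 have "(%n. ip (f n) g) ----> mass g" using ip_tendsto_of_test[OF f m uL(2) t uL(2)] by (simp add: ip_self)
 then have "(%n. 2 * ip (f n) g - mass g) ----> 2 * mass g - mass g" by (intro tendsto_intros)
 then have l: "(%n. 2 * ip (f n) g - mass g) ----> mass g" by simp
 have lo: "2 * ip (f n) g - mass g <= mass (f n)" for n
  using mass_nonneg[of "%x. f n x - g x"] f[of n] uL by (simp add: mass_diff)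
 show "(%n. mass (f n)) ----> mass g"
  by (rule tendsto_sandwich[OF _ _ l tendsto_const]) (use lo m in auto)
qed

section \<open>Uniqueness of locally integrable weak gradients\<close>

lemma locally_integrable_L2:
 fixes f :: "real ^ 'n => 'b :: {banach, second_countable_topology}"
 assumes "f \<in> L2" shows "locally_integrable f"
 unfolding locally_integrable_def set_integrable_def
proof (intro allI impI)
 fix K :: "(real ^ 'n) set" assume K: "compact K"
 have Kl: "K \<in> lmeasurable" using K by (rule lmeasurable_compact)
 show "integrable lebesgue (%x. indicat_real K x *\<^sub>R f x)"
 proof (rule Bochner_Integration.integrable_bound)
  show "integrable lebesgue (%x. indicat_real K x + (norm (f x))^2)"
   using assms Kl by (auto simp: L2_def fmeasurable_def intro!: integrable_real_indicator Bochner_Integration.integrable_add)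
  show "(%x. indicat_real K x *\<^sub>R f x) \<in> lmeas"
   using assms Kl by (auto simp: L2_def intro!: borel_measurable_scaleR borel_measurable_indicator)
  have "norm (indicat_real K x *\<^sub>R f x) <= indicat_real K x + (norm (f x))^2" for x
  proof -
   have "t <= 1 + t^2" for t :: real using zero_le_power2[of "t - 1/2"] by (auto simp: power2_eq_square algebra_simps)
   then show ?thesis by (simp add: indicator_def)
  qed
  then show "ae x. norm (indicat_real K x *\<^sub>R f x) <= norm (indicat_real K x + (norm (f x))^2)"
   by (intro AE_I2) (auto intro: order_trans[OF _ abs_ge_self])
 qed
qed

lemma locally_integrable_component:
 fixes G :: "real ^ 'n => real ^ 'n"
 assumes "locally_integrable G" shows "locally_integrable (%x. G x $ i)"
proof -
 have "integrable lebesgue (%x. indicat_real K x *\<^sub>R (G x $ i))" if "compact K" for K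
 proof -
  have "integrable lebesgue (%x. indicat_real K x *\<^sub>R G x)"
   using assms that by (simp add: locally_integrable_def set_integrable_def)
  from integrable_bounded_linear[OF bounded_linear_vec_nth[of i] this] show ?thesis by simp
 qed
 then show ?thesis by (simp add: locally_integrable_def set_integrable_def)
qed

lemma locally_integrable_measurable:
 fixes f :: "real ^ 'n => real"
 assumes "locally_integrable f" shows "f \<in> lmeas"
proof (rule borel_measurable_LIMSEQ_metric)
 fix n :: nat
 have "integrable lebesgue (%x. indicat_real (cball 0 (real n)) x *\<^sub>R f x)"
  using assms by (auto simp: locally_integrable_def set_integrable_def)
 then show "(%x. indicat_real (cball 0 (real n)) x *\<^sub>R f x) \<in> lmeas" by auto
next
 fix x :: "real ^ 'n"
 obtain n0 :: nat where "norm x <= n0" using real_arch_simple by blast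
 then show "(%n. indicat_real (cball 0 (real n)) x *\<^sub>R f x) ----> f x"
  by (intro tendsto_eventually eventually_sequentiallyI[of n0]) (auto simp: indicator_def)
qed

lemma locally_integrable_diff:
 fixes f g :: "real ^ 'n => real"
 assumes "locally_integrable f" "locally_integrable g" shows "locally_integrable (%x. f x - g x)"
 using assms by (auto simp: locally_integrable_def intro: set_integral_diff(1))

text \<open>As \<open>f\<close> may fail to be square integrable, the argument goes through sets:
  bumps tending to the indicator of a box show that all box integrals vanish, and Dynkin's argument
  extends this to all Borel subsets of a box.\<close>

lemma AE_0_of_test:
 fixes f :: "real ^ 'n => real"
 assumes f: "locally_integrable f"
  and t: "!!phi. phi \<in> test_functions ==> (LINT x|lebesgue. f x * phi x) = 0"
 shows "ae x. f x = 0"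
proof -
 have fm: "f \<in> lmeas" using f by (rule locally_integrable_measurable)
 obtain g where g: "g \<in> borel_measurable borel" "ae x. f x = g x" "g \<in> lmeas"
  using borel_representative fm by blast
 have fi: "integrable lebesgue (%x. f x * indicat_real (box a b) x)" for a b
 proof -
  have "integrable lebesgue (%x. indicat_real (cbox a b) x *\<^sub>R f x)"
   using f by (simp add: locally_integrable_def set_integrable_def)
  then show ?thesis
  proof (rule Bochner_Integration.integrable_bound)
   show "(%x. f x * indicat_real (box a b) x) \<in> lmeas"
    by (intro borel_measurable_times fm L2_measurable[OF indicator_L2[OF lmeasurable_box[of a b]]])
  qed (use box_subset_cbox[of a b] in \<open>auto simp: indicator_def intro!: AE_I2\<close>)
 qed
 have box0: "(LINT x|lebesgue. f x * indicat_real (box a b) x) = 0" for a b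
 proof -
  have "(%n. LINT x|lebesgue. f x * box_bump (1 / real (Suc n)) a b x) ----> (LINT x|lebesgue. f x * indicat_real (box a b) x)"
  proof (rule integral_dominated_convergence[where w = "%x. \<bar>f x * indicat_real (box a b) x\<bar>"])
   show "(%x. f x * indicat_real (box a b) x) \<in> lmeas" using fi[of a b] by auto
   show "(%x. f x * box_bump (1 / real (Suc n)) a b x) \<in> lmeas" for n
    using fm test_function_L2[OF box_bump_test[of "1 / real (Suc n)" a b]] by (intro borel_measurable_times) auto
   show "ae x. (%n. f x * box_bump (1 / real (Suc n)) a b x) ----> f x * indicat_real (box a b) x"
    by (intro AE_I2 tendsto_intros box_bump_tendsto)
   show "ae x. norm (f x * box_bump (1 / real (Suc n)) a b x) <= \<bar>f x * indicat_real (box a b) x\<bar>" for n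
    using box_bump_le_1[of "1 / real (Suc n)" a b] box_bump_nonneg[of "1 / real (Suc n)" a b]
    by (intro AE_I2) (auto simp: indicator_def box_bump_outside abs_mult mult_left_le)
   show "integrable lebesgue (%x. \<bar>f x * indicat_real (box a b) x\<bar>)" using fi by auto
  qed
  then show ?thesis using t[OF box_bump_test] by (simp del: of_nat_Suc add: LIMSEQ_const_iff)
 qed
 have g0: "ae x. g x * indicat_real (box a b) x = 0" for a b
 proof -
  \<comment> \<open>Restriction to a box makes the function integrable, and the Borel representative
    lets the argument run over Borel sets with respect to \<open>lborel\<close>.\<close>
  define F where "F x = g x * indicat_real (box a b) x" for x
  have tr: "integrable lborel (%x. g x * indicat_real (box c d) x)" "(LINT x|lborel. g x * indicat_real (box c d) x) = 0" for c d
  proof -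
   have m: "(%x. g x * indicat_real (box c d) x) \<in> borel_measurable lborel" using g(1) by measurable
   have ae: "ae x. f x * indicat_real (box c d) x = g x * indicat_real (box c d) x"
    using g(2) by eventually_elim simp
   have "integrable lebesgue (%x. g x * indicat_real (box c d) x)"
    by (rule integrable_cong_AE_imp[OF fi measurable_completion[OF m] ae])
   moreover from integral_cong_AE[OF _ _ ae] have "(LINT x|lebesgue. g x * indicat_real (box c d) x) = 0"
    using box0 fi[of c d] measurable_completion[OF m] by auto
   ultimately show "integrable lborel (%x. g x * indicat_real (box c d) x)" "(LINT x|lborel. g x * indicat_real (box c d) x) = 0"
    by (simp_all add: integrable_completion[OF m] integral_completion[OF m])
  qed
  have Fi: "integrable lborel F" unfolding F_def[abs_def] by (rule tr)
  have si: "set_integrable lborel A F" if "A \<in> sets borel" for A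
   unfolding set_integrable_def by (rule integrable_mult_indicator) (use that Fi in auto)
  have "(LINT x:A|lborel. F x) = 0" if A: "A \<in> sets borel" for A
   using Int_stable_box subset_Pow_UNIV A[unfolded borel_sigma_sets_box]
  proof (induction rule: sigma_sets_induct_disjoint)
   case (basic A)
   then obtain c d where A: "A = box c d" by auto
   obtain a' b' where ab: "box c d \<inter> box a b = box a' b'" using box_Int_box by blast
   have "(%x. indicat_real A x *\<^sub>R F x) = (%x. g x * indicat_real (box a' b') x)"
    by (auto simp: F_def A ab[symmetric] indicator_def)
   then show ?case unfolding set_lebesgue_integral_def using tr(2) by simp
  next
   case (compl A)
   then have Am: "A \<in> sets borel" "UNIV - A \<in> sets borel" unfolding borel_sigma_sets_box by (auto intro: sigma_sets.Compl)
   have "(LINT x:A \<union> (UNIV - A)|lborel. F x) = 0" using tr(2)[of a b] by (simp add: set_lebesgue_integral_def F_def)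
   with set_integral_Un[OF _ si[OF Am(1)] si[OF Am(2)]] compl show ?case by auto
  next
   case (union A)
   then have Am: "A i \<in> sets borel" for i unfolding borel_sigma_sets_box by auto
   have "(LINT x:(\<Union>i. A i)|lborel. F x) = (\<Sum>i. (LINT x:A i|lborel. F x))"
    using Am union(1) by (intro lebesgue_integral_countable_add si) (auto simp: disjoint_family_on_def)
   then show ?case using union(3) by simp
  qed (simp add: set_lebesgue_integral_def)
  with sigma_finite_measure.density_zero[OF lborel.sigma_finite_measure_axioms Fi] have "AE x in lborel. F x = 0" by simp
  then show ?thesis unfolding F_def by (rule AE_completion)
 qed
 have "ae x. \<forall>n. g x * indicat_real (box (\<chi> i. - real n) (\<chi> i. real n)) x = 0"
  by (intro AE_all_countable[THEN iffD2] allI g0)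
 with g(2) show ?thesis
 proof eventually_elim
  case (elim x)
  obtain n0 where "!!n. n >= n0 ==> x \<in> box (\<chi> i. - real n) (\<chi> i. real n)" using exhaust_box[of x] by blast
  then have "x \<in> box (\<chi> i. - real n0) (\<chi> i. real n0)" by blast
  with elim(2)[rule_format, of n0] elim(1) show ?case by simp
 qed
qed

lemma measurable_vec_component:
 fixes G :: "real ^ 'n => real ^ 'm"
 shows "G \<in> lmeas \<longleftrightarrow> (\<forall>i. (%x. G x $ i) \<in> lmeas)"
 by (subst borel_measurable_euclidean_space) (auto simp: Basis_vec_def inner_axis)

lemma norm_square_vec: "(norm (x :: real ^ 'n))^2 = (\<Sum>i\<in>UNIV. (x $ i)^2)"
 unfolding power2_norm_eq_inner by (simp add: inner_vec_def power2_eq_square)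

lemma L2_vec_component:
 fixes G :: "real ^ 'n => real ^ 'm"
 shows "G \<in> L2 \<longleftrightarrow> (\<forall>i. (%x. G x $ i) \<in> L2)"
proof
 assume G: "G \<in> L2"
 then have m: "(%x. G x $ i) \<in> lmeas" for i
  using measurable_vec_component[of G] by (simp add: L2_def)
 have "integrable lebesgue (%x. (G x $ i)^2)" for i
 proof (rule Bochner_Integration.integrable_bound)
  show "integrable lebesgue (%x. (norm (G x))^2)" using G by (simp add: L2_def)
  show "ae x. norm ((G x $ i)^2) <= norm ((norm (G x))^2)"
  proof (intro AE_I2)
   fix x
   have "(G x $ i)^2 <= (\<Sum>i\<in>UNIV. (G x $ i)^2)" by (rule member_le_sum) auto
   then show "norm ((G x $ i)^2) <= norm ((norm (G x))^2)"
    unfolding norm_square_vec by (auto intro: order_trans[OF _ abs_ge_self])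
  qed
 qed (use m in auto)
 with m show "\<forall>i. (%x. G x $ i) \<in> L2" by (simp add: L2_iff)
next
 assume "\<forall>i. (%x. G x $ i) \<in> L2"
 then show "G \<in> L2"
  unfolding L2_def using measurable_vec_component[of G] by (auto simp: norm_square_vec)
qed

section \<open>Calculus in H1\<close>

definition gradp :: "'n :: finite => (real ^ 'n => real) => real ^ 'n => real" where
 "gradp i u x = grad u x $ i"

lemma weak_gradient_of_partials:
 assumes "!!i. weak_partial i u (g i)"
 shows "is_weak_gradient u (%x. \<chi> i. g i x)" "(%x. \<chi> i. g i x) \<in> L2"
proof -
 show G: "(%x. \<chi> i. g i x) \<in> L2"
  unfolding L2_vec_component using assms by (simp add: weak_partial_def)
 have "u \<in> L2" using assms by (simp add: weak_partial_def)
 then show "is_weak_gradient u (%x. \<chi> i. g i x)"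
  unfolding is_weak_gradient_def using locally_integrable_L2[OF G] locally_integrable_L2[of u] assms
  by (auto simp: weak_partial_def ip_def)
qed

lemma H1I_partial:
 assumes "u \<in> L2" "!!i. \<exists>g. weak_partial i u g"
 shows "u \<in> H1"
proof -
 obtain g where "!!i. weak_partial i u (g i)" using assms(2) by metis
 from weak_gradient_of_partials[OF this] assms(1) show ?thesis unfolding H1_def by blast
qed

lemma H1_L2 [dest]: "u \<in> H1 ==> u \<in> L2"
 by (simp add: H1_def)

lemma H1_measurable: "u \<in> H1 ==> u \<in> lmeas"
 by (auto simp: H1_def)

lemma locally_integrable_mult_test:
 fixes f :: "real ^ 'n => real"
 assumes f: "locally_integrable f" and phi: "phi \<in> test_functions"
 shows "integrable lebesgue (%x. f x * phi x)"
proof -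
 obtain B where B: "B > 0" "!!x. \<bar>phi x\<bar> <= B" using test_function_bounded[OF phi] by blast
 let ?K = "closure {x. phi x ~= 0}"
 have "integrable lebesgue (%x. indicat_real ?K x *\<^sub>R f x)"
  using f test_functionsD(5)[OF phi] by (simp add: locally_integrable_def set_integrable_def)
 then have "integrable lebesgue (%x. B * (indicat_real ?K x *\<^sub>R f x))" by simp
 then show ?thesis
 proof (rule Bochner_Integration.integrable_bound)
  show "(%x. f x * phi x) \<in> lmeas"
   using locally_integrable_measurable[OF f] test_function_L2[OF phi] by auto
  have "\<bar>f x * phi x\<bar> <= B * \<bar>f x\<bar> * indicat_real ?K x" for x
  proof (cases "phi x = 0")
   case False
   then have "x \<in> ?K" using closure_subset[of "{x. phi x ~= 0}"] by auto
   moreover have "\<bar>f x\<bar> * \<bar>phi x\<bar> <= \<bar>f x\<bar> * B" using B by (intro mult_left_mono) auto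
   ultimately show ?thesis by (simp add: abs_mult mult.commute)
  qed (use B in simp)
  then show "ae x. norm (f x * phi x) <= norm (B * (indicat_real ?K x *\<^sub>R f x))"
   using B by (intro AE_I2) (simp add: abs_mult mult_ac)
 qed
qed

text \<open>The representative chosen by \<open>grad\<close> is only known to be locally integrable; that it lies
 in \<open>L^2\<close> needs the uniqueness of locally integrable weak gradients.\<close>

lemma H1_gradp:
 fixes u :: "real ^ 'n => real"
 assumes u: "u \<in> H1"
 shows "weak_partial i u (gradp i u)"
proof -
 obtain G where G: "is_weak_gradient u G" "G \<in> L2" using u unfolding H1_def by blast
 have W: "is_weak_gradient u (grad u)" unfolding grad_def using someI[of "is_weak_gradient u" G] G by blast
 have GL: "(%x. G x $ i) \<in> L2" using G(2) unfolding L2_vec_component by blast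
 have l: "locally_integrable (gradp i u)" "locally_integrable (%x. G x $ i)"
  using W G locally_integrable_component unfolding is_weak_gradient_def gradp_def[abs_def] by auto
 have "ae x. gradp i u x - G x $ i = 0"
 proof (rule AE_0_of_test)
  show "locally_integrable (%x. gradp i u x - G x $ i)" using l by (rule locally_integrable_diff)
  fix phi :: "real ^ 'n => real" assume phi: "phi \<in> test_functions"
  have "(LINT x|lebesgue. u x * partial_derivative i phi x) = - (LINT x|lebesgue. gradp i u x * phi x)"
   using W phi unfolding is_weak_gradient_def gradp_def by blast
  moreover have "(LINT x|lebesgue. u x * partial_derivative i phi x) = - (LINT x|lebesgue. G x $ i * phi x)"
   using G(1) phi unfolding is_weak_gradient_def by blast
  ultimately show "(LINT x|lebesgue. (gradp i u x - G x $ i) * phi x) = 0"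
   using locally_integrable_mult_test[OF l(1) phi] locally_integrable_mult_test[OF l(2) phi]
   by (simp add: left_diff_distrib)
 qed
 then have "ae x. G x $ i = gradp i u x" by eventually_elim simp
 from L2_cong_AE[OF this locally_integrable_measurable[OF l(1)] GL] have "gradp i u \<in> L2" .
 then show ?thesis
  unfolding weak_partial_def using u W by (auto simp: is_weak_gradient_def ip_def gradp_def)
qed

lemma gradp_L2: "u \<in> H1 ==> gradp i u \<in> L2"
 using H1_gradp unfolding weak_partial_def by blast

lemma gradp_unique: "u \<in> H1 ==> weak_partial i u g ==> ae x. gradp i u x = g x"
 using weak_partial_unique[OF H1_gradp] .

definition dirp :: "'n :: finite => (real ^ 'n => real) => real" where
 "dirp i u = mass (gradp i u)"

definition dir :: "(real ^ 'n => real) => real" where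
 "dir u = (\<Sum>i\<in>UNIV. dirp i u)"

definition gip :: "(real ^ 'n => real) => (real ^ 'n => real) => real" where
 "gip u v = (\<Sum>i\<in>UNIV. ip (gradp i u) (gradp i v))"

lemma dirp_nonneg [simp]: "0 <= dirp i u"
 by (simp add: dirp_def)

lemma dir_nonneg [simp]: "0 <= dir u"
 by (simp add: dir_def sum_nonneg)

lemma dirp_le_dir: "dirp i u <= dir u"
 unfolding dir_def by (rule member_le_sum) auto

lemma grad_integrable: "u \<in> H1 ==> integrable lebesgue (%x. (norm (grad u x))^2)"
 unfolding norm_square_vec using gradp_L2[of u] by (auto simp: L2_iff gradp_def[abs_def])

lemma dir_eq: "u \<in> H1 ==> (LINT x|lebesgue. (norm (grad u x))^2) = dir u"
 unfolding norm_square_vec dir_def dirp_def mass_def using gradp_L2[of u]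
 by (subst Bochner_Integration.integral_sum) (auto simp: L2_iff gradp_def[abs_def])

lemma dir_sum_eq:
 assumes "u \<in> H1" "v \<in> H1"
 shows "(LINT x|lebesgue. (norm (grad u x))^2 + (norm (grad v x))^2) = dir u + dir v"
 using grad_integrable[OF assms(1)] grad_integrable[OF assms(2)] dir_eq[OF assms(1)] dir_eq[OF assms(2)] by simp

lemma gip_eq:
 assumes "u \<in> H1" "v \<in> H1"
 shows "(LINT x|lebesgue. grad u x \<bullet> grad v x) = gip u v"
 unfolding inner_vec_def gip_def ip_def using L2_mult_integrable[OF gradp_L2 gradp_L2] assms
 by (subst Bochner_Integration.integral_sum) (auto simp: gradp_def[abs_def])

lemma H1_difference:
 "u \<in> H1 ==> mass (%x. u (x + h *\<^sub>R axis i 1) - u x) <= h^2 * dirp i u"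
 unfolding dirp_def by (rule weak_partial_difference[OF H1_gradp])

text \<open>The criterion behind most later membership proofs: bounds on differences are stable
  under pointwise contractions, dilations and limits, and they return both membership in
  \<open>H1\<close> and a bound with the same constant.\<close>

lemma H1_from_difference:
 fixes u :: "real ^ 'n => real"
 assumes u: "u \<in> L2" and d: "!!i h. mass (%x. u (x + h *\<^sub>R axis i 1) - u x) <= h^2 * c i"
 shows "u \<in> H1" "dirp i u <= c i"
proof -
 have *: "\<exists>g. weak_partial i u g & mass g <= c i" for i
  using weak_partial_exists[OF u d, of i] by metis
 then show uH: "u \<in> H1" using H1I_partial[OF u] by blast
 obtain g where g: "weak_partial i u g" "mass g <= c i" using * by blast
 have "mass (gradp i u) = mass g"
  using mass_cong_AE[OF gradp_unique[OF uH g(1)]] gradp_L2[OF uH, of i] g(1)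
  by (auto simp: weak_partial_def)
 then show "dirp i u <= c i" using g by (simp add: dirp_def)
qed

lemma dir_mono: "(!!i. dirp i u <= dirp i v) ==> dir u <= dir v"
 unfolding dir_def by (rule sum_mono)

text \<open>The Lipschitz bound, read at \<open>x\<close> and \<open>x + h e_i\<close>, is an
  inequality between squared differences; integrating it keeps the constant one, so the Dirichlet
  integrals simply add.\<close>

lemma H1_contraction2:
 fixes u v w :: "real ^ 'n => real"
 assumes u: "u \<in> H1" and v: "v \<in> H1" and w: "w \<in> lmeas"
  and le: "!!x. (w x)^2 <= (u x)^2 + (v x)^2"
  and lip: "!!x y. (w x - w y)^2 <= (u x - u y)^2 + (v x - v y)^2"
 shows "w \<in> H1" "dirp i w <= dirp i u + dirp i v"
proof -
 have gen: "integrable lebesgue (%x. (f x)^2) & (LINT x|lebesgue. (f x)^2) <= mass g + mass h"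
  if "g \<in> L2" "h \<in> L2" "f \<in> lmeas" "!!x. (f x)^2 <= (g x)^2 + (h x)^2" for f g h :: "real ^ 'n => real"
 proof -
  have gh: "integrable lebesgue (%x. (g x)^2 + (h x)^2)" using that by (simp add: L2_iff)
  have i: "integrable lebesgue (%x. (f x)^2)"
   by (rule Bochner_Integration.integrable_bound[OF gh]) (use that in \<open>auto intro!: AE_I2\<close>)
  have "(LINT x|lebesgue. (f x)^2) <= (LINT x|lebesgue. (g x)^2 + (h x)^2)"
   by (rule integral_mono[OF i gh]) (use that in auto)
  also have "... = mass g + mass h" using that by (simp add: mass_def L2_iff)
  finally show ?thesis using i by simp
 qed
 have wL: "w \<in> L2" using gen[OF H1_L2[OF u] H1_L2[OF v] w le] w by (simp add: L2_iff)
 have d: "mass (%x. w (x + h *\<^sub>R axis i 1) - w x) <= h^2 * (dirp i u + dirp i v)" for i h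
 proof -
  have "mass (%x. w (x + h *\<^sub>R axis i 1) - w x) <= mass (%x. u (x + h *\<^sub>R axis i 1) - u x) + mass (%x. v (x + h *\<^sub>R axis i 1) - v x)"
   unfolding mass_def[of "%x. w (x + h *\<^sub>R axis i 1) - w x"]
   using gen[of "%x. u (x + h *\<^sub>R axis i 1) - u x" "%x. v (x + h *\<^sub>R axis i 1) - v x" "%x. w (x + h *\<^sub>R axis i 1) - w x"]
    lip L2_measurable[OF L2_diff[OF L2_translate[OF wL] wL]] L2_diff[OF L2_translate] H1_L2 u v by blast
  also have "... <= h^2 * dirp i u + h^2 * dirp i v" using H1_difference u v by (intro add_mono)
  finally show ?thesis by (simp add: distrib_left)
 qed
 show "w \<in> H1" "dirp i w <= dirp i u + dirp i v" using H1_from_difference[OF wL d] by auto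
qed

lemma weak_partial_zero: "weak_partial i (%x. 0) (%x. 0)"
 by (simp add: weak_partial_def ip_def)

lemma H1_zero [simp]: "(%x. 0) \<in> H1"
 using H1I_partial[OF L2_zero] weak_partial_zero by blast

lemma gradp_zero: "ae x. gradp i (%x. 0) x = 0"
 by (rule gradp_unique[OF H1_zero weak_partial_zero])

lemma dirp_zero [simp]: "dirp i (%x. 0) = 0"
 unfolding dirp_def by (rule mass_eq_0_iff[OF gradp_L2[OF H1_zero], THEN iffD2, OF gradp_zero])

lemma dir_zero [simp]: "dir (%x. 0) = 0"
 by (simp add: dir_def)

lemma H1_contraction:
 fixes u w :: "real ^ 'n => real"
 assumes u: "u \<in> H1" and w: "w \<in> lmeas"
  and le: "!!x. \<bar>w x\<bar> <= \<bar>u x\<bar>"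
  and lip: "!!x y. \<bar>w x - w y\<bar> <= \<bar>u x - u y\<bar>"
 shows "w \<in> H1" "dirp i w <= dirp i u" "dir w <= dir u"
proof -
 have "(w x)^2 <= (u x)^2 + 0^2" "(w x - w y)^2 <= (u x - u y)^2 + (0 - 0)^2" for x y
  using le[of x] lip[of x y] by (simp_all only: abs_le_square_iff) simp_all
 from H1_contraction2[OF u H1_zero w this] show "w \<in> H1" "dirp i w <= dirp i u" for i by simp_all
 then show "dir w <= dir u" by (intro dir_mono)
qed

lemma H1_abs:
 assumes "u \<in> H1" shows "(%x. \<bar>u x\<bar>) \<in> H1" "dir (%x. \<bar>u x\<bar>) <= dir u"
 using H1_contraction[OF assms, of "%x. \<bar>u x\<bar>"] H1_measurable[OF assms] by auto

text \<open>The reverse triangle inequality for the norm of the plane.\<close>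

lemma sqrt_sum_squares_diff: "(sqrt (a^2 + b^2) - sqrt (c^2 + d^2))^2 <= (a - c)^2 + (b - d)^2"
proof -
 have "\<bar>norm (a, b) - norm (c, d)\<bar> <= norm ((a, b) - (c, d))" by (rule norm_triangle_ineq3)
 then have "(norm (a, b) - norm (c, d))^2 <= (norm ((a, b) - (c, d)))^2" by (simp add: abs_le_square_iff[symmetric])
 then show ?thesis by (simp add: norm_prod_def)
qed

lemma H1_hypot:
 fixes u v :: "real ^ 'n => real"
 assumes u: "u \<in> H1" and v: "v \<in> H1"
 defines "w \<equiv> %x. sqrt ((u x)^2 + (v x)^2)"
 shows "w \<in> H1" "dir w <= dir u + dir v" "mass w = mass u + mass v"
proof -
 have m: "w \<in> lmeas"
  unfolding w_def using H1_measurable[OF u] H1_measurable[OF v] by measurable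
 note H = H1_contraction2[OF u v m]
 show "w \<in> H1" by (rule H) (auto simp: w_def intro: sqrt_sum_squares_diff)
 have "dirp i w <= dirp i u + dirp i v" for i by (rule H) (auto simp: w_def intro: sqrt_sum_squares_diff)
 then show "dir w <= dir u + dir v" unfolding dir_def sum.distrib[symmetric] by (intro sum_mono)
 show "mass w = mass u + mass v"
  using L2_square_integrable[OF H1_L2[OF u]] L2_square_integrable[OF H1_L2[OF v]] by (simp add: mass_def w_def)
qed

lemma H1_cong_AE:
 fixes u v :: "real ^ 'n => real"
 assumes ae: "ae x. u x = v x" and u: "u \<in> H1" and v: "v \<in> lmeas"
 shows "v \<in> H1" "dir v = dir u" "mass v = mass u" "ae x. gradp i v x = gradp i u x"
proof -
 have vL: "v \<in> L2" using L2_cong_AE[OF ae v] u by blast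
 have w: "weak_partial i v (gradp i u)" for i
 proof -
  have "ip v phi = ip u phi" if "phi \<in> L2" for phi
   using ae that vL u by (intro ip_cong_AE) (auto elim: eventually_mono)
  then have "ip v (partial_derivative i phi) = - ip (gradp i u) phi" if "phi \<in> test_functions" for phi
   using H1_gradp[OF u, of i] that test_function_L2[OF partial_derivative_test[OF that], of i]
   unfolding weak_partial_def by metis
  then show ?thesis using vL gradp_L2[OF u, of i] by (simp add: weak_partial_def)
 qed
 show vH: "v \<in> H1" using H1I_partial[OF vL] w by blast
 show g: "ae x. gradp i v x = gradp i u x" for i by (rule gradp_unique[OF vH w])
 show "dir v = dir u"
  unfolding dir_def dirp_def using mass_cong_AE[OF g] gradp_L2[OF vH] gradp_L2[OF u]
  by (intro sum.cong) (auto dest: L2_measurable)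
 show "mass v = mass u" using mass_cong_AE[OF ae H1_measurable[OF u] v] by simp
qed

lemma weak_partial_lincomb:
 assumes "weak_partial i u g" "weak_partial i v h"
 shows "weak_partial i (%x. a * u x + b * v x) (%x. a * g x + b * h x)"
proof -
 have L: "u \<in> L2" "v \<in> L2" "g \<in> L2" "h \<in> L2" using assms by (auto simp: weak_partial_def)
 have "ip (%x. a * u x + b * v x) (partial_derivative i phi) = - ip (%x. a * g x + b * h x) phi"
  if phi: "phi \<in> test_functions" for phi
 proof -
  have "ip u (partial_derivative i phi) = - ip g phi" "ip v (partial_derivative i phi) = - ip h phi"
   using assms phi unfolding weak_partial_def by blast+
  then show ?thesis
   using L test_function_L2[OF partial_derivative_test[OF phi], of i] test_function_L2[OF phi]
   by (simp add: ip_add_left L2_cmult ip_cmult_left)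
 qed
 then show ?thesis using L by (auto simp: weak_partial_def)
qed

lemma H1_lincomb:
 assumes u: "u \<in> H1" and v: "v \<in> H1"
 shows "(%x. a * u x + b * v x) \<in> H1"
  "ae x. gradp i (%x. a * u x + b * v x) x = a * gradp i u x + b * gradp i v x"
proof -
 have w: "weak_partial i (%x. a * u x + b * v x) (%x. a * gradp i u x + b * gradp i v x)" for i
  by (rule weak_partial_lincomb[OF H1_gradp[OF u] H1_gradp[OF v]])
 show H: "(%x. a * u x + b * v x) \<in> H1"
 proof (rule H1I_partial)
  show "(%x. a * u x + b * v x) \<in> L2" by (intro L2_add L2_cmult H1_L2 u v)
  show "\<exists>g. weak_partial i (%x. a * u x + b * v x) g" for i using w by blast
 qed
 show "ae x. gradp i (%x. a * u x + b * v x) x = a * gradp i u x + b * gradp i v x"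
  by (rule gradp_unique[OF H w])
qed

lemma H1_add: "u \<in> H1 ==> v \<in> H1 ==> (%x. u x + v x) \<in> H1"
 using H1_lincomb(1)[of u v 1 1] by simp

lemma H1_cmult: "u \<in> H1 ==> (%x. c * u x) \<in> H1"
 using H1_lincomb(1)[of u u c 0] by simp

lemma H1_diff: "u \<in> H1 ==> v \<in> H1 ==> (%x. u x - v x) \<in> H1"
 using H1_lincomb(1)[of u v 1 "-1"] by simp

lemma gip_lincomb:
 assumes u: "u \<in> H1" and v: "v \<in> H1" and w: "w \<in> H1"
 shows "gip (%x. a * u x + b * v x) w = a * gip u w + b * gip v w"
proof -
 have "ip (gradp i (%x. a * u x + b * v x)) (gradp i w) = a * ip (gradp i u) (gradp i w) + b * ip (gradp i v) (gradp i w)" for i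
 proof -
  have "ip (gradp i (%x. a * u x + b * v x)) (gradp i w) = ip (%x. a * gradp i u x + b * gradp i v x) (gradp i w)"
   by (rule ip_cong_AE[OF H1_lincomb(2)[OF u v]]) (use gradp_L2[OF u, of i] gradp_L2[OF v, of i] gradp_L2[OF w, of i] gradp_L2[OF H1_lincomb(1)[OF u v], of i] in auto)
  also have "... = a * ip (gradp i u) (gradp i w) + b * ip (gradp i v) (gradp i w)"
   using gradp_L2[OF u, of i] gradp_L2[OF v, of i] gradp_L2[OF w, of i] by (simp add: ip_add_left L2_cmult ip_cmult_left)
  finally show ?thesis .
 qed
 then show ?thesis by (simp add: gip_def sum.distrib sum_distrib_left)
qed

lemma gip_commute: "gip u v = gip v u"
 by (simp add: gip_def ip_commute)

lemma gip_self: "gip u u = dir u"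
 by (simp add: gip_def dir_def dirp_def ip_self)

lemma dir_lincomb:
 assumes u: "u \<in> H1" and v: "v \<in> H1"
 shows "dir (%x. a * u x + b * v x) = a^2 * dir u + 2 * a * b * gip u v + b^2 * dir v"
proof -
 let ?w = "%x. a * u x + b * v x"
 have w: "?w \<in> H1" by (rule H1_lincomb[OF u v])
 have "dir ?w = a * gip u ?w + b * gip v ?w" using gip_lincomb[OF u v w, of a b] by (simp add: gip_self)
 also have "gip u ?w = a * gip u u + b * gip v u" by (subst gip_commute) (rule gip_lincomb[OF u v u])
 also have "gip v ?w = a * gip u v + b * gip v v" by (subst gip_commute) (rule gip_lincomb[OF u v v])
 finally show ?thesis by (simp add: gip_self gip_commute[of v u] power2_eq_square algebra_simps)
qed

lemma dir_cmult: "u \<in> H1 ==> dir (%x. c * u x) = c^2 * dir u"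
 using dir_lincomb[of u u c 0] by simp

lemma dir_add_scaled: "u \<in> H1 ==> v \<in> H1 ==> dir (%x. u x + t * v x) = dir u + 2 * t * gip u v + t^2 * dir v"
 using dir_lincomb[of u v 1 t] by simp

lemma dir_diff: "u \<in> H1 ==> v \<in> H1 ==> dir (%x. u x - v x) = dir u - 2 * gip u v + dir v"
 using dir_lincomb[of u v 1 "-1"] by simp

section \<open>Dilations, translations and test functions in H1\<close>

lemma L2_dilate:
 fixes u :: "real ^ 'n => real"
 assumes u: "u \<in> L2" and t: "t ~= 0"
 shows "(%x. c * u (t *\<^sub>R x + a)) \<in> L2" "mass (%x. c * u (t *\<^sub>R x + a)) = c^2 * mass u / \<bar>t\<bar> ^ CARD('n)"
proof -
 have "(%x. u (t *\<^sub>R x + a)) \<in> L2"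
  using u measurable_affine[OF L2_measurable[OF u] t, of a] integrable_affine[OF t L2_square_integrable[OF u], of a]
  by (simp add: L2_iff)
 then show "(%x. c * u (t *\<^sub>R x + a)) \<in> L2" by auto
 have "mass (%x. u (t *\<^sub>R x + a)) = mass u / \<bar>t\<bar> ^ CARD('n)"
  unfolding mass_def
  using integral_affine[OF t borel_measurable_integrable[OF L2_square_integrable[OF u]], of a] by simp
 then show "mass (%x. c * u (t *\<^sub>R x + a)) = c^2 * mass u / \<bar>t\<bar> ^ CARD('n)" by (simp add: mass_cmult)
qed

lemma H1_dilate:
 fixes u :: "real ^ 'n => real"
 assumes u: "u \<in> H1" and t: "t ~= 0"
 shows "(%x. c * u (t *\<^sub>R x + a)) \<in> H1" "dir (%x. c * u (t *\<^sub>R x + a)) = c^2 * t^2 * dir u / \<bar>t\<bar> ^ CARD('n)"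
proof -
 have gen: "(%x. c * u (t *\<^sub>R x + a)) \<in> H1 & dirp i (%x. c * u (t *\<^sub>R x + a)) <= c^2 * t^2 * dirp i u / \<bar>t\<bar> ^ CARD('n)"
  if u: "u \<in> H1" and t: "t ~= 0" for u :: "real ^ 'n => real" and c t a i
 proof -
  let ?v = "%x. c * u (t *\<^sub>R x + a)"
  have vL: "?v \<in> L2" using L2_dilate[OF H1_L2[OF u] t] by simp
  have "mass (%x. ?v (x + h *\<^sub>R axis i 1) - ?v x) <= h^2 * (c^2 * t^2 * dirp i u / \<bar>t\<bar> ^ CARD('n))" for i h
  proof -
   let ?w = "%x. u (x + (t * h) *\<^sub>R axis i 1) - u x"
   have "(%x. ?v (x + h *\<^sub>R axis i 1) - ?v x) = (%x. c * ?w (t *\<^sub>R x + a))"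
    by (simp add: fun_eq_iff algebra_simps scaleR_add_right)
   moreover have "mass (%x. c * ?w (t *\<^sub>R x + a)) = c^2 * mass ?w / \<bar>t\<bar> ^ CARD('n)"
    using u by (intro L2_dilate(2) t L2_diff) auto
   moreover have "mass ?w <= (t * h)^2 * dirp i u" by (rule H1_difference[OF u])
   then have "c^2 * mass ?w / \<bar>t\<bar> ^ CARD('n) <= c^2 * ((t * h)^2 * dirp i u) / \<bar>t\<bar> ^ CARD('n)"
    by (intro divide_right_mono mult_left_mono) auto
   ultimately show ?thesis by (simp add: power_mult_distrib mult_ac)
  qed
  from H1_from_difference[OF vL this] show ?thesis by blast
 qed
 let ?v = "%x. c * u (t *\<^sub>R x + a)"
 show v: "?v \<in> H1" using gen[OF u t] by blast
 have le: "dirp i ?v <= c^2 * t^2 * dirp i u / \<bar>t\<bar> ^ CARD('n)" for i using gen[OF u t] by blast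
 \<comment> \<open>Differences give only an upper bound for the Dirichlet integral; applying that
   bound to the inverse dilation of \<open>?v\<close> gives the reverse inequality.\<close>
 have "dirp i ?v = c^2 * t^2 * dirp i u / \<bar>t\<bar> ^ CARD('n)" for i
 proof (cases "c = 0")
  case False
  have t': "1 / t ~= 0" using t by simp
  have "u = (%x. (1/c) * ?v ((1/t) *\<^sub>R x + (- (1/t) *\<^sub>R a)))"
   using t False by (simp add: fun_eq_iff scaleR_add_right scaleR_diff_right)
  then have "dirp i u <= (1/c)^2 * (1/t)^2 * dirp i ?v / \<bar>1/t\<bar> ^ CARD('n)"
   using gen[OF v t', of "1/c" "- (1/t) *\<^sub>R a" i] by metis
  then have "c^2 * t^2 * dirp i u / \<bar>t\<bar> ^ CARD('n) <= c^2 * t^2 * ((1/c)^2 * (1/t)^2 * dirp i ?v / \<bar>1/t\<bar> ^ CARD('n)) / \<bar>t\<bar> ^ CARD('n)"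
   by (intro divide_right_mono mult_left_mono) auto
  also have "... = dirp i ?v" using t False by (simp add: field_simps power_divide)
  finally show ?thesis using le[of i] by simp
 qed (use le[of i] dirp_nonneg[of i ?v] in simp)
 then show "dir ?v = c^2 * t^2 * dir u / \<bar>t\<bar> ^ CARD('n)"
  unfolding dir_def by (simp add: sum_distrib_left sum_divide_distrib)
qed

lemma H1_translate:
 fixes u :: "real ^ 'n => real"
 assumes "u \<in> H1" shows "(%x. u (x + a)) \<in> H1" "dir (%x. u (x + a)) = dir u"
 using H1_dilate[OF assms, of 1 1 a] by auto

text \<open>Integration by parts from translation invariance: a shift of one factor by
  \<open>s\<close> is a shift of the other by \<open>-s\<close>, so the two derivatives at zero are
  opposite.\<close>

lemma weak_partial_test:
 fixes phi :: "real ^ 'n => real"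
 assumes phi: "phi \<in> test_functions"
 shows "weak_partial i phi (partial_derivative i phi)"
 unfolding weak_partial_def
proof (intro conjI ballI)
 show phiL: "phi \<in> L2" "partial_derivative i phi \<in> L2" using phi by (auto intro: test_function_L2 partial_derivative_test)
 fix psi :: "real ^ 'n => real" assume psi: "psi \<in> test_functions"
 have psiL: "psi \<in> L2" using psi by (rule test_function_L2)
 have A: "((%s. ip phi (%x. psi (x + s *\<^sub>R axis i 1))) has_real_derivative ip phi (partial_derivative i psi)) (at 0)"
  using ip_translate_DERIV[OF phiL(1) psi, of i 0] by simp
 have "((%s. ip psi (%x. phi (x + s *\<^sub>R axis i 1))) has_real_derivative ip psi (partial_derivative i phi)) (at (- 0))"
  using ip_translate_DERIV[OF psiL phi, of i 0] by simp
 from DERIV_mirror[THEN iffD1, OF this]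
 have "((%s. ip psi (%x. phi (x + (- s) *\<^sub>R axis i 1))) has_real_derivative - ip psi (partial_derivative i phi)) (at 0)" .
 also have "(%s. ip psi (%x. phi (x + (- s) *\<^sub>R axis i 1))) = (%s. ip phi (%x. psi (x + s *\<^sub>R axis i 1)))"
  using ip_translate[OF psiL phiL(1), of "_ *\<^sub>R axis i 1"] by (simp add: fun_eq_iff ip_commute)
 finally show "ip phi (partial_derivative i psi) = - ip (partial_derivative i phi) psi"
  using DERIV_unique[OF A] by (simp add: ip_commute)
qed

lemma test_function_H1: "phi \<in> test_functions ==> phi \<in> H1"
 using H1I_partial[OF test_function_L2] weak_partial_test by blast

lemma gradp_test: "phi \<in> test_functions ==> ae x. gradp i phi x = partial_derivative i phi x"
 by (rule gradp_unique[OF test_function_H1 weak_partial_test])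

lemma H1_nontrivial:
 assumes "a >= 0"
 obtains u :: "real ^ 'n => real" where "u \<in> H1" "mass u = a"
proof -
 let ?l = "(\<chi> i. -1) :: real ^ 'n" and ?r = "(\<chi> i. 1) :: real ^ 'n"
 let ?b = "box_bump 1 ?l ?r"
 have bH: "?b \<in> H1" by (intro test_function_H1 box_bump_test) simp
 have "mass ?b ~= 0"
 proof
  assume "mass ?b = 0"
  then have "ae x. ?b x = 0" using mass_eq_0_iff[OF H1_L2[OF bH]] by simp
  then have "ae x. x \<notin> box ?l ?r"
   by eventually_elim (metis box_bump_pos less_irrefl)
  then have "box ?l ?r \<in> null_sets (lebesgue :: (real ^ 'n) measure)"
   by (subst (asm) AE_iff_null_sets[symmetric]) auto
  then have "negligible (box ?l ?r :: (real ^ 'n) set)"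
   by (simp add: negligible_iff_null_sets)
  then have "box ?l ?r = ({} :: (real ^ 'n) set)"
   using open_not_negligible open_box by blast
  moreover have "0 \<in> box ?l ?r" by (simp add: mem_box_cart)
  ultimately show False by blast
 qed
 then have m: "mass ?b > 0" using mass_nonneg[of ?b] by linarith
 show ?thesis
 proof (rule that)
  show "(%x. sqrt (a / mass ?b) * ?b x) \<in> H1" by (rule H1_cmult[OF bH])
  show "mass (%x. sqrt (a / mass ?b) * ?b x) = a" using m assms by (simp add: mass_cmult)
 qed
qed

text \<open>Polarisation of the convergence of masses. It lets an inequality that is elementary for
  differences pass to the gradient form, as in \<open>H1_pos_part\<close>.\<close>

lemma gip_difference_tendsto:
 fixes u v :: "real ^ 'n => real"
 assumes u: "u \<in> H1" and v: "v \<in> H1"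
 defines "D \<equiv> %n i w x. real (Suc n) * (w (x + (1 / real (Suc n)) *\<^sub>R axis i 1) - w x :: real)"
 shows "(%n. \<Sum>i\<in>UNIV. ip (D n i u) (D n i v)) ----> gip u v"
 unfolding gip_def
proof (rule tendsto_sum)
 fix i
 have L: "D n i w \<in> L2" if "w \<in> L2" for n w unfolding D_def by (intro L2_cmult L2_diff L2_translate that)
 have t: "(%n. mass (D n i w)) ----> dirp i w" if "w \<in> H1" for w
  unfolding D_def dirp_def by (rule difference_quotient_mass_tendsto(2)[OF H1_gradp[OF that] gradp_L2[OF that]])
 have uv: "(%x. u x + v x) \<in> H1" by (rule H1_add[OF u v])
 have "(%n. (mass (D n i (%x. u x + v x)) - mass (D n i u) - mass (D n i v)) / 2) ---->
   (dirp i (%x. u x + v x) - dirp i u - dirp i v) / 2"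
  by (intro tendsto_intros t u v uv) simp
 moreover have "D n i (%x. u x + v x) = (%x. D n i u x + D n i v x)" for n
  by (simp add: D_def fun_eq_iff algebra_simps)
 then have "(mass (D n i (%x. u x + v x)) - mass (D n i u) - mass (D n i v)) / 2 = ip (D n i u) (D n i v)" for n
  using L[OF H1_L2[OF u]] L[OF H1_L2[OF v]] by (simp add: mass_add)
 moreover have "dirp i (%x. u x + v x) = mass (%x. gradp i u x + gradp i v x)"
  unfolding dirp_def using H1_lincomb(2)[OF u v, of i 1 1] gradp_L2[OF uv] gradp_L2[OF u] gradp_L2[OF v]
  by (intro mass_cong_AE L2_measurable L2_add) auto
 then have "(dirp i (%x. u x + v x) - dirp i u - dirp i v) / 2 = ip (gradp i u) (gradp i v)"
  using gradp_L2[OF u] gradp_L2[OF v] by (simp add: mass_add dirp_def)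
 ultimately show "(%n. ip (D n i u) (D n i v)) ----> ip (gradp i u) (gradp i v)" by simp
qed

subsection \<open>Sobolev inequalities\<close>

definition cube :: "real => (real ^ 'n) set" where
 "cube e = cbox 0 (\<chi> i. e)"

text \<open>The mean over the cube translated to \<open>x\<close>, written as a pairing with a fixed
  indicator so that Cauchy-Schwarz and weak convergence apply to it directly.\<close>

definition cube_avg :: "real => (real ^ 'n => real) => real ^ 'n => real" where
 "cube_avg e u x = ip (%y. u (y + x)) (indicator (cube e)) / e ^ CARD('n)"

lemma mem_cube: "h \<in> cube e \<longleftrightarrow> (\<forall>i. 0 <= h $ i & h $ i <= e)"
 by (simp add: cube_def mem_box_cart)

lemma cube_lmeasurable [simp]: "cube e \<in> lmeasurable"
 by (simp add: cube_def)

lemma measure_cube: "e >= 0 ==> measure lebesgue (cube e :: (real ^ 'n) set) = e ^ CARD('n)"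
 unfolding cube_def by (simp add: content_cbox_if_cart interval_eq_empty_cart)

lemma emeasure_cube: "e >= 0 ==> emeasure lborel (cube e :: (real ^ 'n) set) = ennreal (e ^ CARD('n))"
proof -
 assume e: "e >= 0"
 have "emeasure lebesgue (cube e :: (real ^ 'n) set) = ennreal (measure lebesgue (cube e :: (real ^ 'n) set))"
  by (rule emeasure_eq_ennreal_measure) (use cube_lmeasurable[of e] in \<open>auto simp: fmeasurable_def less_top\<close>)
 moreover have "emeasure lebesgue (cube e :: (real ^ 'n) set) = emeasure lborel (cube e :: (real ^ 'n) set)"
  by (simp add: cube_def)
 ultimately show ?thesis using measure_cube[OF e, where 'n = 'n] by simp
qed

lemma mass_indicator_cube: "e >= 0 ==> mass (indicator (cube e) :: real ^ 'n => real) = e ^ CARD('n)"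
proof -
 have "(%x. (indicator (cube e) x :: real)^2) = (indicator (cube e) :: real ^ 'n => real)" by (auto simp: indicator_def)
 then show "e >= 0 ==> ?thesis" by (simp add: mass_def measure_cube)
qed

lemma cube_avg_bound:
 fixes u :: "real ^ 'n => real"
 assumes u: "u \<in> L2" and e: "e > 0"
 shows "\<bar>cube_avg e u x\<bar> <= sqrt (mass u) / sqrt (e ^ CARD('n))"
proof -
 have "\<bar>ip (%y. u (y + x)) (indicator (cube e))\<bar> <= sqrt (mass (%y. u (y + x))) * sqrt (mass (indicator (cube e) :: real ^ 'n => real))"
  by (rule ip_Cauchy_Schwarz[OF L2_translate[OF u] indicator_L2[OF cube_lmeasurable]])
 also have "... = sqrt (mass u) * sqrt (e ^ CARD('n))"
  using e mass_translate[OF L2_measurable[OF u], of x] by (simp add: mass_indicator_cube)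
 finally have "\<bar>cube_avg e u x\<bar> <= sqrt (mass u) * sqrt (e ^ CARD('n)) / e ^ CARD('n)"
  unfolding cube_avg_def abs_divide using e by (simp add: divide_right_mono)
 also have "... = sqrt (mass u) / sqrt (e ^ CARD('n))"
  using e by (simp add: field_simps)
 finally show ?thesis .
qed

lemma cube_avg_diff:
 assumes "u \<in> L2" "v \<in> L2"
 shows "cube_avg e (%x. u x - v x) x = cube_avg e u x - cube_avg e v x"
 unfolding cube_avg_def using assms
 by (subst ip_diff_left) (auto simp: diff_divide_distrib intro: indicator_L2)

lemma cube_avg_translate: "cube_avg e (%x. u (x + a)) x = cube_avg e u (x + a)"
 unfolding cube_avg_def by (simp add: add.assoc)

lemma vec_sum_axis: "h = (\<Sum>i\<in>UNIV. (h $ i) *\<^sub>R axis i 1)" for h :: "real ^ 'n"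
 by (simp add: vec_eq_iff axis_def if_distrib if_distribR cong: if_cong)

text \<open>The shift by \<open>h\<close> is composed of shifts along the axes, each controlled by a
  directional Dirichlet integral; the triangle inequality for \<open>sqrt (mass f)\<close> adds them
  up.\<close>

lemma H1_translate_difference:
 fixes u :: "real ^ 'n => real"
 assumes u: "u \<in> H1"
 shows "sqrt (mass (%x. u (x + h) - u x)) <= (\<Sum>i\<in>UNIV. \<bar>h $ i\<bar>) * sqrt (dir u)"
proof -
 have uL: "u \<in> L2" using u by auto
 have "sqrt (mass (%x. u (x + (\<Sum>i\<in>A. (h $ i) *\<^sub>R axis i 1)) - u x)) <= (\<Sum>i\<in>A. \<bar>h $ i\<bar>) * sqrt (dir u)"
  if "finite A" for A
  using that
 proof induction
  case empty then show ?case by simp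
 next
  case (insert j A)
  let ?k = "\<Sum>i\<in>A. (h $ i) *\<^sub>R axis i 1 :: real ^ 'n"
  let ?e = "(h $ j) *\<^sub>R axis j 1 :: real ^ 'n"
  have "(%x. u (x + (?e + ?k)) - u x) = (%x. (u ((x + ?e) + ?k) - u (x + ?e)) + (u (x + ?e) - u x))"
   by (simp add: add.assoc)
  then have "sqrt (mass (%x. u (x + (?e + ?k)) - u x)) <=
    sqrt (mass (%x. u ((x + ?e) + ?k) - u (x + ?e))) + sqrt (mass (%x. u (x + ?e) - u x))"
   using sqrt_mass_add[of "%x. u ((x + ?e) + ?k) - u (x + ?e)" "%x. u (x + ?e) - u x"] uL
    L2_translate[OF L2_diff[OF L2_translate[OF uL, of ?k] uL], of ?e] L2_diff[OF L2_translate[OF uL, of ?e] uL] by auto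
  also have "mass (%x. u ((x + ?e) + ?k) - u (x + ?e)) = mass (%x. u (x + ?k) - u x)"
   using mass_translate[OF L2_measurable[OF L2_diff[OF L2_translate[OF uL, of ?k] uL]], of ?e] .
  also have "sqrt (mass (%x. u (x + ?e) - u x)) <= sqrt ((h $ j)^2 * dir u)"
   using H1_difference[OF u, of "h $ j" j] dirp_le_dir[of j u]
   by (intro real_sqrt_le_mono) (meson mult_left_mono order_trans zero_le_power2)
  also have "... = \<bar>h $ j\<bar> * sqrt (dir u)" by (simp add: real_sqrt_mult)
  finally show ?case using insert by (simp add: distrib_right)
 qed
 from this[of UNIV] show ?thesis by (simp add: vec_sum_axis[symmetric])
qed

lemma H1_translate_mass:
 fixes u :: "real ^ 'n => real" and h :: "real ^ 'n" and e :: real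
 assumes u: "u \<in> H1" and h: "!!i. \<bar>h $ i\<bar> <= e"
 shows "mass (%x. u (x + h) - u x) <= (CARD('n) * e)^2 * dir u"
proof -
 have "(\<Sum>i\<in>UNIV. \<bar>h $ i\<bar>) <= (\<Sum>i\<in>(UNIV :: 'n set). e)" using h by (intro sum_mono)
 then have s: "(\<Sum>i\<in>UNIV. \<bar>h $ i\<bar>) <= CARD('n) * e" by simp
 have "sqrt (mass (%x. u (x + h) - u x)) <= (CARD('n) * e) * sqrt (dir u)"
  by (rule order_trans[OF H1_translate_difference[OF u]]) (intro mult_right_mono s, simp)
 then have "(sqrt (mass (%x. u (x + h) - u x)))^2 <= ((CARD('n) * e) * sqrt (dir u))^2"
  by (rule power_mono) simp
 then show ?thesis by (simp add: power_mult_distrib)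
qed

text \<open>The difference of two averages is the average of \<open>u (z + (x - y)) - u z\<close>,
  so the bound on averages and the translation estimate combine.\<close>

lemma cube_avg_Lipschitz:
 fixes u :: "real ^ 'n => real"
 assumes u: "u \<in> H1" and e: "e > 0"
 shows "\<bar>cube_avg e u x - cube_avg e u y\<bar> <= CARD('n) * norm (x - y) * sqrt (dir u) / sqrt (e ^ CARD('n))"
proof -
 have uL: "u \<in> L2" using u by auto
 have "cube_avg e u x - cube_avg e u y = cube_avg e (%z. u (z + (x - y)) - u z) y"
  using cube_avg_diff[OF L2_translate[OF uL] uL] cube_avg_translate[of e u "x - y" y] by simp
 also have "\<bar>...\<bar> <= sqrt (mass (%z. u (z + (x - y)) - u z)) / sqrt (e ^ CARD('n))"
  using uL e by (intro cube_avg_bound) auto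
 also have "sqrt (mass (%z. u (z + (x - y)) - u z)) <= sqrt ((CARD('n) * norm (x - y))^2 * dir u)"
  by (intro real_sqrt_le_mono H1_translate_mass[OF u] component_le_norm_cart)
 also have "... = CARD('n) * norm (x - y) * sqrt (dir u)" by (simp add: real_sqrt_mult)
 finally show ?thesis using e by (simp add: divide_right_mono)
qed

lemma cube_avg_measurable:
 fixes u :: "real ^ 'n => real"
 assumes u: "u \<in> H1" and e: "e > 0"
 shows "cube_avg e u \<in> lmeas"
proof -
 let ?L = "CARD('n) * sqrt (dir u) / sqrt (e ^ CARD('n))"
 have "?L-lipschitz_on UNIV (cube_avg e u)"
  using cube_avg_Lipschitz[OF u e] e by (intro lipschitz_onI) (auto simp: dist_norm mult_ac)
 then have "continuous_on UNIV (cube_avg e u)" by (rule lipschitz_on_continuous_on)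
 then have "cube_avg e u \<in> borel_measurable borel" by (rule borel_measurable_continuous_onI)
 then show ?thesis by (intro measurable_completion) simp
qed

lemma cube_avg_cong_AE:
 fixes u v :: "real ^ 'n => real"
 assumes "ae x. u x = v x" "u \<in> L2" "v \<in> L2"
 shows "cube_avg e u x = cube_avg e v x"
 unfolding cube_avg_def using assms AE_translate[OF assms(1), of x]
 by (subst ip_cong_AE[of _ "%y. v (y + x)" _ "indicator (cube e)"]) (auto intro: indicator_L2)

text \<open>Jensen's inequality on the cube and Tonelli's theorem.\<close>

lemma mass_minus_cube_avg:
 fixes u :: "real ^ 'n => real" and e :: real
 assumes u: "u \<in> H1" and e: "e > 0"
 shows "(%x. u x - cube_avg e u x) \<in> L2" "mass (%x. u x - cube_avg e u x) <= (CARD('n) * e)^2 * dir u"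
proof -
 let ?N = "CARD('n)"
 let ?C = "cube e :: (real ^ 'n) set"
 obtain v where v: "v \<in> borel_measurable borel" "ae x. u x = v x" "v \<in> lmeas"
  using borel_representative H1_measurable[OF u] by blast
 have vH: "v \<in> H1" "dir v = dir u" using H1_cong_AE[OF v(2) u v(3)] by auto
 have vL: "v \<in> L2" using vH by auto
 note [measurable] = v(1)
 have Cb [measurable]: "?C \<in> sets borel" by (simp add: cube_def)
 have avg: "cube_avg e u x = cube_avg e v x" for x using cube_avg_cong_AE[OF v(2)] u vL by auto
 have am: "cube_avg e v \<in> lmeas" by (rule cube_avg_measurable[OF vH(1) e])
 have pw: "ennreal ((v x - cube_avg e v x)^2) <= (\<integral>\<^sup>+h. ennreal ((v (x + h) - v x)^2) * indicator ?C h \<partial>lborel) / ennreal (e ^ ?N)" for x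
 proof -
  let ?w = "%h. (v (h + x) - v x) * indicator ?C h"
  have i: "(%h. v (h + x) * indicator ?C h) \<in> L2"
  proof (rule L2_dominated(1)[OF L2_translate[OF vL, of x]])
   show "(%h. v (h + x) * indicator ?C h) \<in> lmeas"
    by (intro borel_measurable_times L2_measurable[OF L2_translate[OF vL]] L2_measurable[OF indicator_L2[OF cube_lmeasurable]])
  qed (auto simp: indicator_def)
  have wL: "?w \<in> L2" using L2_diff[OF i L2_cmult[OF indicator_L2[OF cube_lmeasurable], of "v x" e]] by (simp add: left_diff_distrib)
  have "ip ?w (indicator ?C) = ip (%y. v (y + x)) (indicator ?C) - v x * e ^ ?N"
  proof -
   have "ip ?w (indicator ?C) = (LINT h|lebesgue. v (h + x) * indicator ?C h - v x * indicator ?C h)"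
    unfolding ip_def by (intro Bochner_Integration.integral_cong) (auto simp: indicator_def)
   also have "... = (LINT h|lebesgue. v (h + x) * indicator ?C h) - (LINT h|lebesgue. v x * indicator ?C h)"
    using L2_mult_integrable[OF L2_translate[OF vL, of x] indicator_L2[OF cube_lmeasurable, of e]] cube_lmeasurable[of e]
     e by (intro Bochner_Integration.integral_diff integrable_mult_right integrable_real_indicator)
     (auto simp: fmeasurable_def emeasure_cube)
   finally show ?thesis using e measure_cube[of e, where 'n = 'n] by (simp add: ip_def)
  qed
  then have "cube_avg e v x - v x = ip ?w (indicator ?C) / e ^ ?N"
   unfolding cube_avg_def using e by (simp add: diff_divide_distrib)
  then have "(v x - cube_avg e v x)^2 = (ip ?w (indicator ?C))^2 / (e ^ ?N)^2"
   by (simp add: power2_commute[of "v x"] power_divide)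
  also have "(ip ?w (indicator ?C))^2 <= (sqrt (mass ?w) * sqrt (e ^ ?N))^2"
   using ip_Cauchy_Schwarz[OF wL indicator_L2[OF cube_lmeasurable[of e]]] e
   by (subst abs_le_square_iff[symmetric]) (simp add: mass_indicator_cube)
  also have "... = mass ?w * e ^ ?N" using e by (simp add: power_mult_distrib)
  finally have "(v x - cube_avg e v x)^2 <= mass ?w / e ^ ?N"
   using e by (simp add: divide_right_mono power2_eq_square)
  moreover have "ennreal (mass ?w) = (\<integral>\<^sup>+h. ennreal ((v (x + h) - v x)^2) * indicator ?C h \<partial>lborel)"
  proof -
   have "ennreal (mass ?w) = (\<integral>\<^sup>+h. ennreal ((?w h)^2) \<partial>lebesgue)"
    unfolding mass_def using wL by (subst nn_integral_eq_integral) (auto simp: L2_iff)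
   also have "... = (\<integral>\<^sup>+h. ennreal ((?w h)^2) \<partial>lborel)" by (rule nn_integral_completion)
   also have "... = (\<integral>\<^sup>+h. ennreal ((v (x + h) - v x)^2) * indicator ?C h \<partial>lborel)"
    by (intro nn_integral_cong) (auto simp: indicator_def add.commute)
   finally show ?thesis .
  qed
  moreover have "ennreal (mass ?w / e ^ ?N) = ennreal (mass ?w) / ennreal (e ^ ?N)"
   using e by (intro divide_ennreal[symmetric]) auto
  ultimately show ?thesis using ennreal_leI[of "(v x - cube_avg e v x)^2" "mass ?w / e ^ ?N"] by simp
 qed
 have "(\<integral>\<^sup>+x. ennreal ((v x - cube_avg e v x)^2) \<partial>lebesgue) <=
   (\<integral>\<^sup>+x. (\<integral>\<^sup>+h. ennreal ((v (x + h) - v x)^2) * indicator ?C h \<partial>lborel) / ennreal (e ^ ?N) \<partial>lebesgue)"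
  by (intro nn_integral_mono pw)
 also have "... = (\<integral>\<^sup>+x. (\<integral>\<^sup>+h. ennreal ((v (x + h) - v x)^2) * indicator ?C h \<partial>lborel) / ennreal (e ^ ?N) \<partial>lborel)"
  by (rule nn_integral_completion)
 also have "... = (\<integral>\<^sup>+x. (\<integral>\<^sup>+h. ennreal ((v (x + h) - v x)^2) * indicator ?C h \<partial>lborel) \<partial>lborel) / ennreal (e ^ ?N)"
  by (intro nn_integral_divide) measurable
 also have "(\<integral>\<^sup>+x. (\<integral>\<^sup>+h. ennreal ((v (x + h) - v x)^2) * indicator ?C h \<partial>lborel) \<partial>lborel) =
   (\<integral>\<^sup>+h. (\<integral>\<^sup>+x. ennreal ((v (x + h) - v x)^2) * indicator ?C h \<partial>lborel) \<partial>lborel)"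
  by (rule lborel_pair.Fubini') measurable
 also have "... <= (\<integral>\<^sup>+h. ennreal ((?N * e)^2 * dir u) * indicator ?C h \<partial>lborel)"
 proof (intro nn_integral_mono)
  fix h :: "real ^ 'n"
  show "(\<integral>\<^sup>+x. ennreal ((v (x + h) - v x)^2) * indicator ?C h \<partial>lborel) <= ennreal ((?N * e)^2 * dir u) * indicator ?C h"
  proof (cases "h \<in> ?C")
   case True
   have "(\<integral>\<^sup>+x. ennreal ((v (x + h) - v x)^2) \<partial>lborel) = (\<integral>\<^sup>+x. ennreal ((v (x + h) - v x)^2) \<partial>lebesgue)"
    by (rule nn_integral_completion[symmetric])
   also have "... = ennreal (mass (%x. v (x + h) - v x))"
    unfolding mass_def using L2_diff[OF L2_translate[OF vL, of h] vL]
    by (subst nn_integral_eq_integral) (auto simp: L2_iff)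
   also have "... <= ennreal ((?N * e)^2 * dir u)"
   proof (intro ennreal_leI)
    have "\<bar>h $ i\<bar> <= e" for i using True by (simp add: mem_cube)
    from H1_translate_mass[OF vH(1) this] show "mass (%x. v (x + h) - v x) <= (?N * e)^2 * dir u"
     using vH(2) by simp
   qed
   finally show ?thesis using True by simp
  qed simp
 qed
 also have "... = ennreal ((?N * e)^2 * dir u) * ennreal (e ^ ?N)"
  using e by (subst nn_integral_cmult_indicator) (auto simp: emeasure_cube)
 finally have "(\<integral>\<^sup>+x. ennreal ((v x - cube_avg e v x)^2) \<partial>lebesgue) <=
   ennreal ((?N * e)^2 * dir u) * ennreal (e ^ ?N) / ennreal (e ^ ?N)"
  by (simp add: divide_right_mono_ennreal)
 also have "... = ennreal ((?N * e)^2 * dir u)"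
  using e by (simp add: ennreal_mult[symmetric] divide_ennreal)
 finally have le: "(\<integral>\<^sup>+x. ennreal ((v x - cube_avg e v x)^2) \<partial>lebesgue) <= ennreal ((?N * e)^2 * dir u)" .
 have m: "(%x. v x - cube_avg e v x) \<in> lmeas" using am v(3) by auto
 have int: "integrable lebesgue (%x. (v x - cube_avg e v x)^2)"
  using le m by (intro integrableI_nonneg) (auto simp: top_unique intro: le_less_trans)
 then have L: "(%x. v x - cube_avg e v x) \<in> L2" using m by (simp add: L2_iff)
 have "ennreal (mass (%x. v x - cube_avg e v x)) <= ennreal ((?N * e)^2 * dir u)"
  using le int unfolding mass_def by (subst nn_integral_eq_integral[symmetric]) auto
 then have mv: "mass (%x. v x - cube_avg e v x) <= (?N * e)^2 * dir u" by simp
 have ae: "ae x. v x - cube_avg e v x = u x - cube_avg e u x"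
  using v(2) by eventually_elim (simp add: avg)
 have um: "(%x. u x - cube_avg e u x) \<in> lmeas"
  using H1_measurable[OF u] cube_avg_measurable[OF u e] by auto
 show "(%x. u x - cube_avg e u x) \<in> L2" by (rule L2_cong_AE[OF ae um L])
 show "mass (%x. u x - cube_avg e u x) <= (?N * e)^2 * dir u"
  using mv mass_cong_AE[OF ae m um] by simp
qed

section \<open>Level sets and subcritical Sobolev inequalities\<close>

definition clip :: "real => real => real" where
 "clip s t = min (max (\<bar>t\<bar> - s) 0) s"

lemma clip_bounds: "s >= 0 ==> 0 <= clip s t" "clip s t <= s" "s >= 0 ==> clip s t <= \<bar>t\<bar>"
 by (auto simp: clip_def)

lemma clip_lip: "\<bar>clip s t - clip s t'\<bar> <= \<bar>t - t'\<bar>"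
 unfolding clip_def min_def max_def by (auto simp: abs_if)

lemma clip_eq_0: "s >= 0 ==> \<bar>t\<bar> <= s ==> clip s t = 0"
 by (auto simp: clip_def)

lemma clip_eq: "s >= 0 ==> \<bar>t\<bar> >= 2 * s ==> clip s t = s"
 by (auto simp: clip_def)

text \<open>The distribution function of \<open>|u|\<close>, in terms of which the Sobolev
  inequality becomes a recursion over dyadic levels.\<close>

definition super :: "(real ^ 'n => real) => real => real" where
 "super u s = measure lebesgue {x. \<bar>u x\<bar> > s}"

lemma super_set:
 fixes u :: "real ^ 'n => real"
 assumes u: "u \<in> L2" and s: "s > 0"
 shows "{x. \<bar>u x\<bar> > s} \<in> lmeasurable" "super u s <= mass u / s^2"
proof -
 have m: "{x. \<bar>u x\<bar> > s} \<in> sets lebesgue"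
 proof -
  have "Measurable.pred lebesgue (%x. \<bar>u x\<bar> > s)" using L2_measurable[OF u] by measurable
  then show ?thesis by (simp add: pred_def)
 qed
 have i: "integrable lebesgue (%x. (u x)^2 / s^2)" using u by (simp add: L2_iff)
 have le: "indicat_real {x. \<bar>u x\<bar> > s} x <= (u x)^2 / s^2" for x
 proof (cases "\<bar>u x\<bar> > s")
  case True
  then have "s^2 <= \<bar>u x\<bar>^2" using s by (intro power_mono) auto
  then show ?thesis using True s by simp
 qed simp
 have ii: "integrable lebesgue (indicat_real {x. \<bar>u x\<bar> > s})"
  by (rule Bochner_Integration.integrable_bound[OF i]) (use m le in \<open>auto intro!: AE_I2 simp: indicator_def\<close>)
 then show l: "{x. \<bar>u x\<bar> > s} \<in> lmeasurable"
  using m by (auto simp: fmeasurable_def integrable_indicator_iff)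
 have "super u s = (LINT x|lebesgue. indicat_real {x. \<bar>u x\<bar> > s} x)"
  unfolding super_def using m by simp
 also have "... <= (LINT x|lebesgue. (u x)^2 / s^2)" using ii i le by (intro integral_mono) auto
 also have "... = mass u / s^2" by (simp add: mass_def)
 finally show "super u s <= mass u / s^2" .
qed

lemma super_antimono:
 fixes u :: "real ^ 'n => real"
 assumes "u \<in> L2" "0 < s" "s <= t" shows "super u t <= super u s"
 unfolding super_def using super_set(1)[OF assms(1)] assms
 by (intro measure_mono_fmeasurable) auto

lemma H1_clip:
 assumes u: "u \<in> H1" and s: "s >= 0"
 shows "(%x. clip s (u x)) \<in> H1" "dir (%x. clip s (u x)) <= dir u"
proof -
 have "(%x. clip s (u x)) \<in> lmeas"
  unfolding clip_def using H1_measurable[OF u] by measurable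
 note H = H1_contraction[OF u this]
 show "(%x. clip s (u x)) \<in> H1" by (rule H) (use s clip_bounds clip_lip in auto)
 show "dir (%x. clip s (u x)) <= dir u" by (rule H) (use s clip_bounds clip_lip in auto)
qed

text \<open>On \<open>{\<bar>u\<bar> > 2 s}\<close> the truncation \<open>clip s u\<close> equals \<open>s\<close>, while its average over cubes of side
 \<open>(4 a)\<^sup>1\<^sup>/\<^sup>N\<close>, \<open>a = \<bar>{\<bar>u\<bar> > s}\<bar>\<close>, is at most \<open>s/2\<close>.\<close>

lemma super_step:
 fixes u :: "real ^ 'n => real"
 assumes u: "u \<in> H1" and s: "s > 0" and d: "dir u <= 1"
 shows "super u (2 * s) <= 4 * (CARD('n))^2 * (4 * super u s) powr (2 / CARD('n)) / s^2"
proof (cases "super u s = 0")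
 case True
 have "super u (2 * s) <= super u s" using u s by (intro super_antimono) auto
 then show ?thesis using True by simp
next
 case False
 let ?N = "CARD('n)"
 define a where "a = super u s"
 have a: "a > 0" using False unfolding a_def super_def by (simp add: zero_less_measure_iff)
 define e where "e = (4 * a) powr (1 / ?N)"
 have e: "e > 0" using a by (simp add: e_def)
 have "e ^ ?N = e powr real ?N" using e by (simp add: powr_realpow)
 also have "... = 4 * a" using a by (simp add: e_def powr_powr)
 finally have eN: "e ^ ?N = 4 * a" .
 have "e^2 = e powr 2" using e by simp
 also have "... = (4 * a) powr (2 / ?N)" by (simp add: e_def powr_powr)
 finally have e2: "e^2 = (4 * a) powr (2 / ?N)" .
 let ?v = "%x. clip s (u x)"
 have v: "?v \<in> H1" "dir ?v <= 1" using H1_clip[OF u, of s] s d by auto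
 have A: "{x. \<bar>u x\<bar> > s} \<in> lmeasurable" using super_set(1)[of u s] u s by auto
 have mv: "mass ?v <= s^2 * a"
 proof -
  have vi: "integrable lebesgue (%x. (?v x)^2)" using v by (auto intro: L2_square_integrable)
  have ind: "integrable lebesgue (%x. s^2 * indicat_real {x. \<bar>u x\<bar> > s} x)"
   using A by (intro integrable_mult_right integrable_real_indicator) (auto simp: fmeasurable_def)
  have "(?v x)^2 <= s^2 * indicat_real {x. \<bar>u x\<bar> > s} x" for x
   using s clip_bounds[of s "u x"] clip_eq_0[of s "u x"] power_mono[of "?v x" s 2] by (cases "\<bar>u x\<bar> > s") auto
  then have "mass ?v <= (LINT x|lebesgue. s^2 * indicat_real {x. \<bar>u x\<bar> > s} x)"
   unfolding mass_def using vi ind by (intro integral_mono) auto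
  also have "... = s^2 * a" by (simp add: a_def super_def)
  finally show ?thesis .
 qed
 have avg: "\<bar>cube_avg e ?v x\<bar> <= s / 2" for x
 proof -
  have "\<bar>cube_avg e ?v x\<bar> <= sqrt (mass ?v) / sqrt (e ^ ?N)" using v e by (intro cube_avg_bound) auto
  also have "... <= sqrt (s^2 * a) / sqrt (e ^ ?N)" using mv a e by (intro divide_right_mono real_sqrt_le_mono) auto
  also have "... = s / 2" unfolding eN using s a by (simp add: real_sqrt_mult)
  finally show ?thesis .
 qed
 note M = mass_minus_cube_avg[OF v(1) e]
 have "s / 2 > 0" using s by simp
 have "super u (2 * s) <= 4 * ((?N * e)^2) / s^2"
 proof -
  let ?S = "{x. \<bar>u x\<bar> > 2 * s}"
  have S: "?S \<in> lmeasurable" using super_set(1)[of u "2 * s"] u s by auto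
  let ?w = "%x. ?v x - cube_avg e ?v x"
  have i: "integrable lebesgue (%x. 4 * (?w x)^2 / s^2)" using M(1) by (simp add: L2_iff)
  \<comment> \<open>Chebyshev: on \<open>?S\<close> the truncation equals \<open>s\<close> while its
    average is at most \<open>s/2\<close>, so they differ by at least \<open>s/2\<close>.\<close>
  have le: "indicat_real ?S x <= 4 * (?w x)^2 / s^2" for x
  proof (cases "x \<in> ?S")
   case True
   then have "?v x = s" using s by (auto intro: clip_eq)
   then have "\<bar>s / 2\<bar> <= \<bar>?w x\<bar>" using avg[of x] s by (auto simp: abs_le_iff)
   then have "(s / 2)^2 <= (?w x)^2" by (simp only: abs_le_square_iff)
   then show ?thesis using True s by (simp add: power_divide field_simps)
  qed (use s in simp)
  have "super u (2 * s) = (LINT x|lebesgue. indicat_real ?S x)" using S by (simp add: super_def fmeasurable_def)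
  also have "... <= (LINT x|lebesgue. 4 * (?w x)^2 / s^2)"
   using S i le by (intro integral_mono) (auto simp: fmeasurable_def intro: integrable_real_indicator)
  also have "... = 4 * mass ?w / s^2" by (simp add: mass_def)
  also have "... <= 4 * ((?N * e)^2 * dir ?v) / s^2" using M(2) by (intro divide_right_mono) auto
  also have "... <= 4 * ((?N * e)^2 * 1) / s^2" using v(2) by (intro divide_right_mono mult_left_mono) auto
  finally show ?thesis by simp
 qed
 also have "(?N * e)^2 = (?N)^2 * (4 * a) powr (2 / ?N)"
  by (simp add: power_mult_distrib e2)
 finally show ?thesis by (simp add: a_def mult.assoc)
qed

text \<open>On the ansatz \<open>D * 2 powr (- s k)\<close> one step of the recursion gains a factor
  \<open>2 powr (- d)\<close> per level, with \<open>d = 2 + th s - s > 0\<close>. From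
  \<open>k0\<close> on this absorbs the constant, and \<open>D\<close> is so large that the levels
  up to \<open>k0\<close> satisfy the claim trivially. \<open>D\<close> is chosen before the
  sequence, which makes the Sobolev constant uniform.\<close>

lemma geometric_recursion:
 fixes C th s :: real
 assumes C: "C > 0" and th: "0 < th" "th <= 1" and s: "0 < s" "s < 2 + th * s"
 obtains D where "D >= 1" "!!a k. (!!k. 0 <= a k) ==> (!!k. a k <= 1) ==>
  (!!k. a (Suc k) <= C * (1/4) ^ k * a k powr th) ==> a k <= D * 2 powr (- s * real k)"
proof -
 define d where "d = 2 + th * s - s"
 have d: "d > 0" using s by (simp add: d_def)
 have "((%k. C * 2 powr s * (2 powr (-d)) ^ k) \<longlongrightarrow> C * 2 powr s * 0) sequentially"
  using d by (intro tendsto_intros LIMSEQ_power_zero) (simp add: powr_less_one)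
 then have "eventually (%k. C * 2 powr s * (2 powr (-d)) ^ k < 1) sequentially"
  by (intro order_tendstoD(2)) auto
 then obtain k0 where k0: "!!k. k >= k0 ==> C * 2 powr s * (2 powr (-d)) ^ k < 1"
  by (auto simp: eventually_sequentially)
 define D where "D = 2 powr (s * real k0)"
 have D1: "D >= 1" using s by (simp add: D_def ge_one_powr_ge_zero)
 have "a k <= D * 2 powr (- s * real k)" if a0: "!!k. 0 <= a k" and a1: "!!k. a k <= 1"
  and step: "!!k. a (Suc k) <= C * (1/4) ^ k * a k powr th" for a :: "nat => real" and k
 proof (induction k)
  case 0 then show ?case using a1[of 0] D1 by simp
 next
  case (Suc k)
  show ?case
  proof (cases "Suc k <= k0")
   case True
   have "1 <= 2 powr (s * (real k0 - real (Suc k)))" using True s by (intro ge_one_powr_ge_zero) auto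
   also have "... = D * 2 powr (- s * real (Suc k))" by (simp add: D_def flip: powr_add) (simp add: algebra_simps)
   finally show ?thesis using a1[of "Suc k"] by linarith
  next
   case False
   then have k: "k >= k0" by simp
   have "a (Suc k) <= C * (1/4) ^ k * a k powr th" by (rule step)
   also have "... <= C * (1/4) ^ k * (D * 2 powr (- s * real k)) powr th"
    using Suc a0 C th by (intro mult_left_mono powr_mono2) auto
   also have "(D * 2 powr (- s * real k)) powr th = D powr th * 2 powr (- s * real k * th)"
    using D1 by (simp add: powr_mult powr_powr)
   also have "C * (1/4) ^ k * (D powr th * 2 powr (- s * real k * th)) <= C * (1/4) ^ k * (D * 2 powr (- s * real k * th))"
    using C D1 th powr_mono[of th 1 D] by (intro mult_left_mono mult_right_mono) auto
   also have "(1/4 :: real) ^ k = 2 powr (- 2 * real k)"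
   proof -
    have "(1/4 :: real) ^ k = (2 powr (-2)) ^ k" by (simp add: powr_minus powr_numeral)
    then show ?thesis by (simp add: powr_powr flip: powr_realpow)
   qed
   also have "C * 2 powr (- 2 * real k) * (D * 2 powr (- s * real k * th)) =
     (C * 2 powr s * (2 powr (-d)) ^ k) * (D * 2 powr (- s * real (Suc k)))"
   proof -
    have "2 powr (- 2 * real k) * 2 powr (- s * real k * th) = 2 powr (- 2 * real k + (- s * real k * th))"
     by (simp only: powr_add)
    also have "- 2 * real k + (- s * real k * th) = s + (-d) * real k + (- s * real (Suc k))"
     by (simp add: d_def algebra_simps)
    also have "2 powr (s + (-d) * real k + (- s * real (Suc k))) = 2 powr s * 2 powr ((-d) * real k) * 2 powr (- s * real (Suc k))"
     by (simp only: powr_add)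
    also have "2 powr ((-d) * real k) = (2 powr (-d)) ^ k"
     by (simp add: powr_powr flip: powr_realpow)
    finally have "2 powr (- 2 * real k) * 2 powr (- s * real k * th) = 2 powr s * (2 powr (-d)) ^ k * 2 powr (- s * real (Suc k))" .
    then show ?thesis by (simp add: mult_ac)
   qed
   also have "... <= 1 * (D * 2 powr (- s * real (Suc k)))"
    using k0[OF k] D1 by (intro mult_right_mono) auto
   finally show ?thesis by simp
  qed
 qed
 with D1 show ?thesis by (rule that)
qed

lemma powr_layer_bound:
 fixes t p :: real
 assumes p: "p > 0" and t: "t >= 0"
 shows "ennreal (t powr p) <= ennreal (if t <= 1 then t powr p else 0) + (\<Sum>k. ennreal (2 powr (p * (real k + 1))) * indicator {x. x > 2 ^ k} t)"
proof (cases "t <= 1")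
 case False
 \<comment> \<open>Ceiling minus one gives \<open>2 ^ k < t <= 2 ^ (k + 1)\<close>, with the strict
   side below even if \<open>t\<close> is a power of two; the single term \<open>k\<close> of the
   series then suffices.\<close>
 define k where "k = nat \<lceil>log 2 t\<rceil> - 1"
 have l: "log 2 t > 0" using False by simp
 then have c: "\<lceil>log 2 t\<rceil> >= 1" by linarith
 then have "int k = \<lceil>log 2 t\<rceil> - 1" unfolding k_def by arith
 then have rk: "real k = of_int \<lceil>log 2 t\<rceil> - 1" by linarith
 have k1: "real k < log 2 t" "log 2 t <= real k + 1" unfolding rk by linarith+
 have "2 powr real k < t" using k1(1) False by (simp add: less_log_iff)
 then have a: "2 ^ k < t" by (simp add: powr_realpow)
 have "t <= 2 powr (real k + 1)" using k1(2) False by (simp add: log_le_iff)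
 then have "t powr p <= (2 powr (real k + 1)) powr p" using p t by (intro powr_mono2) auto
 then have "t powr p <= 2 powr (p * (real k + 1))" by (simp add: powr_powr mult.commute)
 then have "ennreal (t powr p) <= ennreal (2 powr (p * (real k + 1))) * indicator {x. x > 2 ^ k} t"
  using a by (simp add: ennreal_leI)
 also have "... = (\<Sum>j\<in>{k}. ennreal (2 powr (p * (real j + 1))) * indicator {x. x > 2 ^ j} t)"
  by (simp only: sum.insert finite.emptyI empty_iff not_False_eq_True sum.empty add_0_right)
 also have "... <= (\<Sum>k. ennreal (2 powr (p * (real k + 1))) * indicator {x. x > 2 ^ k} t)"
  by (rule sum_le_suminf) auto
 finally show ?thesis using False by simp
qed simp

text \<open>\<open>super_step\<close> on the levels \<open>2 ^ k\<close> gives decay like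
  \<open>2 powr (- s k)\<close> for every \<open>s\<close> with \<open>s < 2 + th s\<close>; for
  \<open>N >= 3\<close> this means \<open>s\<close> below the critical exponent. Taking
  \<open>s\<close> larger than \<open>p\<close> makes the sum over the layers of
  \<open>|u| powr p\<close> geometric.\<close>

lemma Sobolev_unit:
 fixes p :: real
 assumes p: "2 < p" "ereal p < critical_exponent (CARD('n))"
 obtains K where "K > 0" "!!u :: real ^ 'n => real. u \<in> H1 ==> mass u <= 1 ==> dir u <= 1 ==>
  integrable lebesgue (%x. \<bar>u x\<bar> powr p) & (LINT x|lebesgue. \<bar>u x\<bar> powr p) <= K"
proof -
 let ?N = "CARD('n)"
 \<comment> \<open>Capped at one, as \<open>geometric_recursion\<close> requires. The level sets
   have measure at most one, so lowering the exponent from \<open>2 / N\<close> only enlarges the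
   right-hand side.\<close>
 define th where "th = min (2 / real ?N) 1"
 have th: "0 < th" "th <= 1" by (auto simp: th_def)
 have "\<exists>s. s > p & s < 2 + th * s"
 proof (cases "?N >= 3")
  case True
  then have th2: "th = 2 / real ?N" by (auto simp: th_def field_simps)
  have N3: "real ?N >= 3" using True by simp
  have "p < 2 * real ?N / (real ?N - 2)" using p(2) True by (simp add: critical_exponent_def)
  then obtain s where s: "p < s" "s < 2 * real ?N / (real ?N - 2)" using dense by blast
  have "s * (real ?N - 2) < 2 * real ?N" using s(2) N3 by (simp add: pos_less_divide_eq)
  then have "s < 2 + th * s" unfolding th2 using N3 by (simp add: field_simps)
  with s show ?thesis by blast
 next
  case False
  then have "?N <= 2" by simp
  then have "real ?N <= 2" by linarith
  then have "th = 1" by (simp add: th_def field_simps min_def)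
  then show ?thesis by (intro exI[of _ "p + 1"]) auto
 qed
 then obtain s where s: "s > p" "s < 2 + th * s" by blast
 define C where "C = 4 * (real ?N)^2 * 4 powr (2 / real ?N)"
 have C: "C > 0" by (simp add: C_def)
 have rec: "super u (2 ^ Suc k) <= C * (1/4) ^ k * super u (2 ^ k) powr th" "super u (2 ^ k) <= 1"
  if u: "u \<in> H1" "mass u <= 1" "dir u <= 1" for u :: "real ^ 'n => real" and k
 proof -
  have "super u (2 ^ k) <= mass u / (2 ^ k)^2" using u by (intro super_set(2)) auto
  also have "... <= 1 / 1" using u(2) by (intro frac_le) (auto intro: one_le_power)
  finally show l: "super u (2 ^ k) <= 1" by simp
  have n: "0 <= super u (2 ^ k)" by (simp add: super_def)
  have "super u (2 * 2 ^ k) <= 4 * (real ?N)^2 * (4 * super u (2 ^ k)) powr (2 / real ?N) / (2 ^ k)^2"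
   using super_step[OF u(1) _ u(3), of "2 ^ k"] by simp
  also have "... = C * super u (2 ^ k) powr (2 / real ?N) * (1/4) ^ k"
   using n by (simp add: C_def powr_mult power_one_over power_mult[symmetric] mult.commute[of _ 2]) (simp add: power_mult)
  also have "... <= C * super u (2 ^ k) powr th * (1/4) ^ k"
  proof -
   have "super u (2 ^ k) powr (2 / real ?N) <= super u (2 ^ k) powr th"
    using l n by (cases "super u (2 ^ k) = 0") (auto simp: th_def intro!: powr_mono')
   then show ?thesis using C by (intro mult_right_mono mult_left_mono) auto
  qed
  finally show "super u (2 ^ Suc k) <= C * (1/4) ^ k * super u (2 ^ k) powr th" by (simp add: mult_ac)
 qed
 obtain D where D: "D >= 1" "!!a k. (!!k. 0 <= a k) ==> (!!k. a k <= 1) ==>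
  (!!k. a (Suc k) <= C * (1/4) ^ k * a k powr th) ==> a k <= D * 2 powr (- s * real k)"
  by (rule geometric_recursion[OF C th, of s]) (use s p in auto)
 define q where "q = 2 powr (p - s)"
 have q: "0 < q" "q < 1" using s by (auto simp: q_def powr_less_one)
 define K where "K = 1 + D * 2 powr p / (1 - q)"
 have K: "K > 0" unfolding K_def using q D by (intro add_pos_nonneg) auto
 have main: "integrable lebesgue (%x. \<bar>u x\<bar> powr p) & (LINT x|lebesgue. \<bar>u x\<bar> powr p) <= K"
  if u: "u \<in> H1" "mass u <= 1" "dir u <= 1" for u :: "real ^ 'n => real"
 proof -
  have up: "super u (2 ^ k) <= D * 2 powr (- s * real k)" for k
   by (rule D(2)[of "%k. super u (2 ^ k)"]) (use rec[OF u] in \<open>auto simp: super_def\<close>)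
  have um: "u \<in> lmeas" using u by (simp add: H1_measurable)
  have Ss: "{x. \<bar>u x\<bar> > 2 ^ k} \<in> lmeasurable" for k using super_set(1)[of u "2 ^ k"] u by auto
  have "(\<integral>\<^sup>+x. ennreal (\<bar>u x\<bar> powr p) \<partial>lebesgue) <=
   (\<integral>\<^sup>+x. ennreal ((u x)^2) + (\<Sum>k. ennreal (2 powr (p * (real k + 1))) * indicator {x. \<bar>u x\<bar> > 2 ^ k} x) \<partial>lebesgue)"
  proof (intro nn_integral_mono)
   fix x
   have "(if \<bar>u x\<bar> <= 1 then \<bar>u x\<bar> powr p else 0) <= (u x)^2"
   proof (cases "\<bar>u x\<bar> <= 1")
    case True
    have "\<bar>u x\<bar> powr p <= \<bar>u x\<bar> powr 2" by (rule powr_mono') (use True p in auto)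
    also have "\<bar>u x\<bar> powr 2 = (u x)^2" by (cases "u x = 0") simp_all
    finally show ?thesis using True by simp
   qed simp
   moreover have "indicator {y. y > 2 ^ k} \<bar>u x\<bar> = (indicator {x. \<bar>u x\<bar> > 2 ^ k} x :: ennreal)" for k :: nat
    by (simp add: indicator_def)
   ultimately show "ennreal (\<bar>u x\<bar> powr p) <= ennreal ((u x)^2) + (\<Sum>k. ennreal (2 powr (p * (real k + 1))) * indicator {x. \<bar>u x\<bar> > 2 ^ k} x)"
    using powr_layer_bound[of p "\<bar>u x\<bar>"] p by (auto intro: order_trans add_right_mono ennreal_leI)
  qed
  also have "... = ennreal (mass u) + (\<Sum>k. ennreal (2 powr (p * (real k + 1))) * emeasure lebesgue {x. \<bar>u x\<bar> > 2 ^ k})"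
  proof -
   have Sm: "(%x. ennreal (2 powr (p * (real k + 1))) * indicator {x. \<bar>u x\<bar> > 2 ^ k} x) \<in> lmeas" for k :: nat
    by (intro borel_measurable_times_ennreal borel_measurable_const borel_measurable_indicator fmeasurableD Ss)
   have "(\<integral>\<^sup>+x. ennreal ((u x)^2) \<partial>lebesgue) = ennreal (mass u)"
    unfolding mass_def using u by (intro nn_integral_eq_integral L2_square_integrable) auto
   moreover have "(\<integral>\<^sup>+x. (\<Sum>k. ennreal (2 powr (p * (real k + 1))) * indicator {x. \<bar>u x\<bar> > 2 ^ k} x) \<partial>lebesgue) =
    (\<Sum>k. ennreal (2 powr (p * (real k + 1))) * emeasure lebesgue {x. \<bar>u x\<bar> > 2 ^ k})"
    by (subst nn_integral_suminf[OF Sm]) (intro suminf_cong nn_integral_cmult_indicator fmeasurableD Ss)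
   moreover have "(%x. ennreal ((u x)^2)) \<in> lmeas" using um by measurable
   ultimately show ?thesis
    using nn_integral_add[OF _ borel_measurable_suminf_order[OF Sm]] by simp
  qed
  also have "... <= ennreal 1 + (\<Sum>k. ennreal (D * 2 powr p * q ^ k))"
  proof (intro add_mono ennreal_leI u(2) suminf_le allI)
   fix k
   have "emeasure lebesgue {x. \<bar>u x\<bar> > 2 ^ k} = ennreal (super u (2 ^ k))"
    unfolding super_def using Ss[of k] by (intro emeasure_eq_ennreal_measure) (auto simp: fmeasurable_def)
   then have "ennreal (2 powr (p * (real k + 1))) * emeasure lebesgue {x. \<bar>u x\<bar> > 2 ^ k} = ennreal (2 powr (p * (real k + 1)) * super u (2 ^ k))"
    by (simp add: ennreal_mult super_def)
   also have "... <= ennreal (2 powr (p * (real k + 1)) * (D * 2 powr (- s * real k)))"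
    using up by (intro ennreal_leI mult_left_mono) auto
   also have "2 powr (p * (real k + 1)) * (D * 2 powr (- s * real k)) = D * (2 powr (p * (real k + 1)) * 2 powr (- s * real k))"
    by simp
   also have "2 powr (p * (real k + 1)) * 2 powr (- s * real k) = 2 powr (p + (p - s) * real k)"
    by (simp only: powr_add[symmetric]) (simp add: algebra_simps)
   also have "... = 2 powr p * q ^ k" by (simp add: q_def powr_add powr_powr flip: powr_realpow)
   finally show "ennreal (2 powr (p * (real k + 1))) * emeasure lebesgue {x. \<bar>u x\<bar> > 2 ^ k} <= ennreal (D * 2 powr p * q ^ k)"
    by (simp add: mult.assoc)
  qed auto
  also have "(\<Sum>k. ennreal (D * 2 powr p * q ^ k)) = ennreal (D * 2 powr p / (1 - q))"
  proof -
   have "(%k. D * 2 powr p * q ^ k) sums (D * 2 powr p * (1 / (1 - q)))"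
    using q by (intro sums_mult geometric_sums) auto
   then show ?thesis using q D by (intro sums_unique[symmetric] sums_ennreal[THEN iffD2]) auto
  qed
  also have "ennreal 1 + ennreal (D * 2 powr p / (1 - q)) = ennreal K"
   unfolding K_def using q D by (subst ennreal_plus) auto
  finally have le: "(\<integral>\<^sup>+x. ennreal (\<bar>u x\<bar> powr p) \<partial>lebesgue) <= ennreal K" .
  have i: "integrable lebesgue (%x. \<bar>u x\<bar> powr p)"
   using le um by (intro integrableI_nonneg) (auto simp: top_unique intro: le_less_trans)
  then have "ennreal (LINT x|lebesgue. \<bar>u x\<bar> powr p) <= ennreal K"
   using le by (subst nn_integral_eq_integral[symmetric]) auto
  then show ?thesis using i K by simp
 qed
 show ?thesis using that[OF K main] by blast
qed

text \<open>With zero Dirichlet integral \<open>u\<close> equals its average over cubes of every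
  size, while the average over a large cube is small by Cauchy-Schwarz.\<close>

lemma dir_0_imp_mass_0:
 fixes u :: "real ^ 'n => real"
 assumes u: "u \<in> H1" and d: "dir u = 0"
 shows "mass u = 0"
proof -
 have uL: "u \<in> L2" using u by auto
 have *: "ae x. \<bar>u x\<bar> <= sqrt (mass u) / real (Suc n)" for n
 proof -
  \<comment> \<open>With this side length \<open>sqrt (e ^ N)\<close> is at least
    \<open>n + 1\<close> in every dimension.\<close>
  define e where "e = (real (Suc n))^2"
  have e: "e >= 1" "e > 0" by (auto simp: e_def one_le_power)
  note M = mass_minus_cube_avg[OF u e(2)]
  have "mass (%x. u x - cube_avg e u x) = 0" using M(2) d mass_nonneg[of "%x. u x - cube_avg e u x"] by simp
  then have "ae x. u x - cube_avg e u x = 0" using mass_eq_0_iff[OF M(1)] by simp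
  then show ?thesis
  proof eventually_elim
   case (elim x)
   have "\<bar>u x\<bar> <= sqrt (mass u) / sqrt (e ^ CARD('n))" using cube_avg_bound[OF uL e(2), of x] elim by simp
   also have "... <= sqrt (mass u) / sqrt (e ^ 1)"
    using e by (intro divide_left_mono real_sqrt_le_mono power_increasing mult_pos_pos) (auto simp: Suc_leI)
   also have "sqrt (e ^ 1) = real (Suc n)" by (simp add: e_def)
   finally show ?case .
  qed
 qed
 then have "ae x. \<forall>n. \<bar>u x\<bar> <= sqrt (mass u) / real (Suc n)"
  by (intro AE_all_countable[THEN iffD2] allI)
 then have "ae x. u x = 0"
 proof eventually_elim
  case (elim x)
  have "(%n. sqrt (mass u) * inverse (real (Suc n))) ----> sqrt (mass u) * 0"
   by (intro tendsto_intros LIMSEQ_inverse_real_of_nat)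
  then have "\<bar>u x\<bar> <= sqrt (mass u) * 0"
   by (rule LIMSEQ_le_const) (use elim in \<open>auto simp: divide_inverse simp del: of_nat_Suc\<close>)
  then show ?case by simp
 qed
 then show ?thesis using mass_eq_0_iff[OF uL] by simp
qed

lemma powr_integral_dilate:
 fixes u :: "real ^ 'n => real"
 assumes u: "u \<in> lmeas" and t: "t > 0" and c: "c > 0"
 shows "(LINT x|lebesgue. \<bar>c * u (t *\<^sub>R x + a)\<bar> powr p) = c powr p * (LINT x|lebesgue. \<bar>u x\<bar> powr p) / t ^ CARD('n)"
  "integrable lebesgue (%x. \<bar>c * u (t *\<^sub>R x + a)\<bar> powr p) \<longleftrightarrow> integrable lebesgue (%x. \<bar>u x\<bar> powr p)"
proof -
 have e: "(%x. \<bar>c * u (t *\<^sub>R x + a)\<bar> powr p) = (%x. c powr p * \<bar>u (t *\<^sub>R x + a)\<bar> powr p)"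
  using c by (simp add: abs_mult powr_mult)
 have m: "(%x. \<bar>u x\<bar> powr p) \<in> lmeas" using u by measurable
 show "(LINT x|lebesgue. \<bar>c * u (t *\<^sub>R x + a)\<bar> powr p) = c powr p * (LINT x|lebesgue. \<bar>u x\<bar> powr p) / t ^ CARD('n)"
  unfolding e using integral_affine[of t "%x. \<bar>u x\<bar> powr p" a] t m by simp
 have "integrable lebesgue (%x. \<bar>u (t *\<^sub>R x + a)\<bar> powr p) \<longleftrightarrow> integrable lebesgue (%x. \<bar>u x\<bar> powr p)"
 proof
  assume "integrable lebesgue (%x. \<bar>u (t *\<^sub>R x + a)\<bar> powr p)"
  from integrable_affine[of "1/t", OF _ this, of "- (1/t) *\<^sub>R a"]
  show "integrable lebesgue (%x. \<bar>u x\<bar> powr p)" using t by (simp add: scaleR_add_right scaleR_diff_right)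
 qed (use integrable_affine[of t "%x. \<bar>u x\<bar> powr p" a] t in auto)
 then show "integrable lebesgue (%x. \<bar>c * u (t *\<^sub>R x + a)\<bar> powr p) \<longleftrightarrow> integrable lebesgue (%x. \<bar>u x\<bar> powr p)"
  unfolding e using c by (simp add: integrable_mult_right_iff)
qed

text \<open>This is the exponent of the mass in the Gagliardo-Nirenberg inequality; its positivity
  allows a mass at most \<open>m\<close> to be replaced by \<open>m\<close>.\<close>

lemma subcritical_exponent_pos:
 assumes p: "2 < p" "ereal p < critical_exponent N" and N: "N > 0"
 shows "p / 2 - real N * (p - 2) / 4 > 0"
proof (cases "N >= 3")
 case True
 then have "p < 2 * real N / (real N - 2)" using p(2) by (simp add: critical_exponent_def)
 then have "p * (real N - 2) < 2 * real N" using True by (simp add: pos_less_divide_eq)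
 then show ?thesis by (simp add: field_simps)
next
 case False
 then consider "N = 1" | "N = 2" using N by linarith
 then show ?thesis using p by cases (auto simp: field_simps)
qed

text \<open>Amplitude and scale are two free parameters, used to normalise both mass and Dirichlet
  integral to one; undoing the normalisation in \<open>Sobolev_unit\<close> produces the
  exponents.\<close>

lemma Gagliardo_Nirenberg:
 fixes p :: real and m :: real
 assumes p: "2 < p" "ereal p < critical_exponent (CARD('n))" and m: "m > 0"
 obtains K where "K > 0" "!!u :: real ^ 'n => real. u \<in> H1 ==> integrable lebesgue (%x. \<bar>u x\<bar> powr p)"
  "!!u :: real ^ 'n => real. u \<in> H1 ==> mass u <= m ==>
   (LINT x|lebesgue. \<bar>u x\<bar> powr p) <= K * dir u powr (real CARD('n) * (p - 2) / 4)"
proof -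
 let ?N = "CARD('n)"
 obtain K where K: "K > 0" "!!u :: real ^ 'n => real. u \<in> H1 ==> mass u <= 1 ==> dir u <= 1 ==>
  integrable lebesgue (%x. \<bar>u x\<bar> powr p) & (LINT x|lebesgue. \<bar>u x\<bar> powr p) <= K"
  using Sobolev_unit[OF p] by blast
 define \<delta> where "\<delta> = p / 2 - real ?N * (p - 2) / 4"
 have \<delta>: "\<delta> > 0" unfolding \<delta>_def using p by (intro subcritical_exponent_pos) auto
 have main: "integrable lebesgue (%x. \<bar>u x\<bar> powr p) &
   (mass u <= m --> (LINT x|lebesgue. \<bar>u x\<bar> powr p) <= (K * m powr \<delta>) * dir u powr (real ?N * (p - 2) / 4))"
  if u: "u \<in> H1" for u :: "real ^ 'n => real"
 proof (cases "mass u = 0")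
  case True
  then have ae: "ae x. \<bar>u x\<bar> powr p = 0"
   using mass_eq_0_iff[OF H1_L2[OF u]] by (auto elim!: eventually_mono)
  have "(%x. \<bar>u x\<bar> powr p) \<in> lmeas" using H1_measurable[OF u] by measurable
  then have "integrable lebesgue (%x. \<bar>u x\<bar> powr p)"
   using integrable_cong_AE[of "%x. \<bar>u x\<bar> powr p" lebesgue "%x. 0"] ae by simp
  moreover have "(LINT x|lebesgue. \<bar>u x\<bar> powr p) = 0" by (rule integral_eq_zero_AE[OF ae])
  ultimately show ?thesis using K m by simp
 next
  case False
  define M A where "M = mass u" and "A = dir u"
  have M: "M > 0" using False mass_nonneg[of u] by (simp add: M_def less_le)
  have A: "A > 0" using dir_0_imp_mass_0[OF u] False dir_nonneg[of u] unfolding A_def by (simp add: less_le) metis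
  \<comment> \<open>\<open>t\<close> and \<open>c\<close> solve the two normalising equations
    \<open>c^2 M = t ^ N\<close> and \<open>c^2 t^2 A = t ^ N\<close>.\<close>
  define t where "t = sqrt (M / A)"
  have t: "t > 0" using M A by (simp add: t_def)
  have t2: "t^2 = M / A" using M A by (simp add: t_def)
  define c where "c = sqrt (t ^ ?N / M)"
  have c: "c > 0" using t M by (simp add: c_def)
  have c2: "c^2 = t ^ ?N / M" using t M by (simp add: c_def)
  let ?v = "%x. c * u (t *\<^sub>R x + 0)"
  have "mass ?v = 1" using L2_dilate(2)[OF H1_L2[OF u], of t c 0] t M by (simp add: c2 M_def[symmetric])
  moreover have "dir ?v = 1" using H1_dilate(2)[OF u, of t c 0] t M A by (simp add: c2 t2 A_def[symmetric])
  moreover have "?v \<in> H1" using H1_dilate(1)[OF u, of t c 0] t by simp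
  ultimately have v: "integrable lebesgue (%x. \<bar>?v x\<bar> powr p)" "(LINT x|lebesgue. \<bar>?v x\<bar> powr p) <= K"
   using K(2)[of ?v] by auto
  have i: "integrable lebesgue (%x. \<bar>u x\<bar> powr p)"
   using v(1) powr_integral_dilate(2)[OF H1_measurable[OF u] t c] by blast
  have "c powr p * (LINT x|lebesgue. \<bar>u x\<bar> powr p) / t ^ ?N <= K"
   using v(2) powr_integral_dilate(1)[OF H1_measurable[OF u] t c, of 0 p] by simp
  then have "(LINT x|lebesgue. \<bar>u x\<bar> powr p) <= K * t ^ ?N / c powr p"
   using t c by (simp add: pos_divide_le_eq pos_le_divide_eq mult.commute)
  also have "c powr p = (t ^ ?N / M) powr (p / 2)"
  proof -
   have "c powr p = (c powr 2) powr (p / 2)" by (simp add: powr_powr)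
   also have "c powr 2 = c^2" using c by simp
   finally show ?thesis by (simp add: c2)
  qed
  also have "K * t ^ ?N / (t ^ ?N / M) powr (p / 2) = K * M powr \<delta> * A powr (real ?N * (p - 2) / 4)"
  proof -
   have tN: "t ^ ?N = exp (real ?N * ln t)" using t by (simp add: exp_of_nat_mult)
   have lt: "ln t = (ln M - ln A) / 2" using M A by (simp add: t_def ln_sqrt ln_div)
   have "t ^ ?N / (t ^ ?N / M) powr (p / 2) = exp (real ?N * ln t - (p / 2) * (real ?N * ln t - ln M))"
    using t M by (simp add: powr_def ln_div tN exp_diff)
   also have "real ?N * ln t - (p / 2) * (real ?N * ln t - ln M) = \<delta> * ln M + (real ?N * (p - 2) / 4) * ln A"
    unfolding lt \<delta>_def by (simp add: field_simps)
   also have "exp ... = M powr \<delta> * A powr (real ?N * (p - 2) / 4)"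
    using M A by (simp add: powr_def exp_add)
   finally have "t ^ ?N / (t ^ ?N / M) powr (p / 2) = M powr \<delta> * A powr (real ?N * (p - 2) / 4)" .
   then show ?thesis by (metis mult.assoc times_divide_eq_right)
  qed
  finally have "(LINT x|lebesgue. \<bar>u x\<bar> powr p) <= K * M powr \<delta> * A powr (real ?N * (p - 2) / 4)" .
  moreover have "K * M powr \<delta> * A powr (real ?N * (p - 2) / 4) <= K * m powr \<delta> * A powr (real ?N * (p - 2) / 4)" if "M <= m"
   using that M K \<delta> by (intro mult_right_mono mult_left_mono powr_mono2) auto
  ultimately show ?thesis using i unfolding M_def A_def by fastforce
 qed
 show ?thesis by (rule that[of "K * m powr \<delta>"]) (use main K m in auto)
qed

lemma Sobolev_bounded:
 fixes q m d :: real
 assumes q: "2 < q" "ereal q < critical_exponent (CARD('n))"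
 obtains K where "K > 0" "!!u :: real ^ 'n => real. u \<in> H1 ==> mass u <= m ==> dir u <= d ==>
  (LINT x|lebesgue. \<bar>u x\<bar> powr q) <= K"
proof -
 have "\<bar>m\<bar> + 1 > 0" by simp
 then obtain K where K: "K > 0" "!!u :: real ^ 'n => real. u \<in> H1 ==> integrable lebesgue (%x. \<bar>u x\<bar> powr q)"
   "!!u :: real ^ 'n => real. u \<in> H1 ==> mass u <= \<bar>m\<bar> + 1 ==>
   (LINT x|lebesgue. \<bar>u x\<bar> powr q) <= K * dir u powr (real CARD('n) * (q - 2) / 4)"
  using Gagliardo_Nirenberg[OF q] by blast
 show ?thesis
 proof (rule that[of "K * (\<bar>d\<bar> + 1) powr (real CARD('n) * (q - 2) / 4)"])
  fix u :: "real ^ 'n => real" assume u: "u \<in> H1" "mass u <= m" "dir u <= d"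
  have "(LINT x|lebesgue. \<bar>u x\<bar> powr q) <= K * dir u powr (real CARD('n) * (q - 2) / 4)"
   using u by (intro K) auto
  also have "... <= K * (\<bar>d\<bar> + 1) powr (real CARD('n) * (q - 2) / 4)"
   using u K q by (intro mult_left_mono powr_mono2) auto
  finally show "(LINT x|lebesgue. \<bar>u x\<bar> powr q) <= K * (\<bar>d\<bar> + 1) powr (real CARD('n) * (q - 2) / 4)" .
 qed (use K in auto)
qed

lemma H1_powr_integrable:
 fixes u :: "real ^ 'n => real"
 assumes "2 < p" "ereal p < critical_exponent (CARD('n))" "u \<in> H1"
 shows "integrable lebesgue (%x. \<bar>u x\<bar> powr p)"
 using Gagliardo_Nirenberg[OF assms(1,2), of 1] assms(3) by (metis zero_less_one)

subsection \<open>Vanishing and compactness\<close>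

text \<open>Vanishing in the sense of concentration compactness, tested on all cubes of side
  \<open>1/(j+1)\<close>. Its negation directly supplies one cube size and, along a subsequence,
  centres at which the averages stay away from zero.\<close>

definition vanishing :: "(nat => real ^ 'n => real) => bool" where
 "vanishing u \<longleftrightarrow> (\<forall>j \<eta>. \<eta> > 0 --> (\<forall>\<^sub>F n in sequentially. \<forall>x. \<bar>cube_avg (1 / real (Suc j)) (u n) x\<bar> <= \<eta>))"

text \<open>Values fall into three ranges. Below \<open>2 \<eta>\<close> the mass suffices; between
  \<open>2 \<eta>\<close> and \<open>L\<close> the function differs from its average by at least
  half of itself, and this difference has mass of order \<open>e^2\<close>; above \<open>L\<close> a
  larger subcritical power \<open>q'\<close> leaves a negative power of \<open>L\<close>.\<close>

lemma vanishing_powr: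
 fixes u :: "nat => real ^ 'n => real"
 assumes u: "!!n. u n \<in> H1" and m: "!!n. mass (u n) <= m" and d: "!!n. dir (u n) <= d"
  and v: "vanishing u" and q: "2 < q" "ereal q < critical_exponent (CARD('n))"
 shows "(%n. LINT x|lebesgue. \<bar>u n x\<bar> powr q) ----> 0"
proof -
 let ?N = "real CARD('n)"
 obtain q' where q': "q < q'" "ereal q' < critical_exponent (CARD('n))"
  using q(2) ereal_dense2[OF q(2)] by auto
 have q2': "2 < q'" using q q' by simp
 obtain K where K: "K > 0" "!!u :: real ^ 'n => real. u \<in> H1 ==> mass u <= m ==> dir u <= d ==>
  (LINT x|lebesgue. \<bar>u x\<bar> powr q') <= K" using Sobolev_bounded[OF q2' q'(2)] by metis
 have m0: "m >= 0" using m[of 0] mass_nonneg[of "u 0"] by linarith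
 have d0: "d >= 0" using d[of 0] dir_nonneg[of "u 0"] by linarith
 have i: "integrable lebesgue (%x. \<bar>u n x\<bar> powr q)" "integrable lebesgue (%x. \<bar>u n x\<bar> powr q')" for n
  by (rule H1_powr_integrable[OF q u], rule H1_powr_integrable[OF q2' q'(2) u])
 have bound: "(LINT x|lebesgue. \<bar>u n x\<bar> powr q) <= (2 * \<eta>) powr (q - 2) * m + L powr (q - 2) * (4 * ((?N * e)^2 * d)) + L powr (q - q') * K"
  if L: "L > 0" and e: "e > 0" and \<eta>: "\<eta> > 0" and avg: "!!x. \<bar>cube_avg e (u n) x\<bar> <= \<eta>" for L e \<eta> n
 proof -
  note M = mass_minus_cube_avg[OF u[of n] e]
  have Md: "mass (%x. u n x - cube_avg e (u n) x) <= (?N * e)^2 * d"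
   by (rule order_trans[OF M(2) mult_left_mono[OF d]]) simp
  have pw: "\<bar>u n x\<bar> powr q <= (2 * \<eta>) powr (q - 2) * (u n x)^2 + L powr (q - 2) * (4 * (u n x - cube_avg e (u n) x)^2) + L powr (q - q') * \<bar>u n x\<bar> powr q'" for x
  proof -
   define a where "a = \<bar>u n x\<bar>"
   have a0: "a >= 0" by (simp add: a_def)
   have a2: "a powr q = a powr (q - 2) * a^2"
   proof (cases "a = 0")
    case False
    then have "a powr q = a powr (q - 2) * a powr 2" by (simp flip: powr_add)
    then show ?thesis using False a0 by simp
   qed simp
   have nn: "0 <= (2 * \<eta>) powr (q - 2) * a^2" "0 <= L powr (q - 2) * (4 * (u n x - cube_avg e (u n) x)^2)" "0 <= L powr (q - q') * a powr q'"
    by auto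
   consider "a <= 2 * \<eta>" | "a > 2 * \<eta>" "a <= L" | "a > L" by linarith
   then have "a powr q <= (2 * \<eta>) powr (q - 2) * a^2 + L powr (q - 2) * (4 * (u n x - cube_avg e (u n) x)^2) + L powr (q - q') * a powr q'"
   proof cases
    case 1
    have "a powr (q - 2) * a^2 <= (2 * \<eta>) powr (q - 2) * a^2"
     using 1 a0 q by (intro mult_right_mono powr_mono2) auto
    then show ?thesis using nn a2 by linarith
   next
    case 2
    have "a / 2 <= \<bar>u n x - cube_avg e (u n) x\<bar>" using avg[of x] 2 unfolding a_def by linarith
    then have "(a / 2)^2 <= \<bar>u n x - cube_avg e (u n) x\<bar>^2" using a0 by (intro power_mono) auto
    then have "a^2 <= 4 * (u n x - cube_avg e (u n) x)^2" by (simp add: power_divide)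
    then have "a powr (q - 2) * a^2 <= L powr (q - 2) * (4 * (u n x - cube_avg e (u n) x)^2)"
     using 2 a0 q by (intro mult_mono powr_mono2) auto
    then show ?thesis using nn a2 by linarith
   next
    case 3
    have "a powr q = a powr (q - q') * a powr q'" using 3 L by (simp flip: powr_add)
    also have "... <= L powr (q - q') * a powr q'"
     using 3 L q' by (intro mult_right_mono powr_mono2') auto
    finally show ?thesis using nn by linarith
   qed
   then show ?thesis by (simp add: a_def)
  qed
  have iu: "integrable lebesgue (%x. (u n x)^2)" using u by (auto intro: L2_square_integrable)
  have iM: "integrable lebesgue (%x. (u n x - cube_avg e (u n) x)^2)" by (rule L2_square_integrable[OF M(1)])
  have "(LINT x|lebesgue. \<bar>u n x\<bar> powr q) <= (LINT x|lebesgue. (2 * \<eta>) powr (q - 2) * (u n x)^2 + L powr (q - 2) * (4 * (u n x - cube_avg e (u n) x)^2) + L powr (q - q') * \<bar>u n x\<bar> powr q')"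
   using i iu iM pw by (intro integral_mono) auto
  also have "... = (2 * \<eta>) powr (q - 2) * mass (u n) + L powr (q - 2) * (4 * mass (%x. u n x - cube_avg e (u n) x)) + L powr (q - q') * (LINT x|lebesgue. \<bar>u n x\<bar> powr q')"
   using i iu iM by (simp add: mass_def)
  also have "... <= (2 * \<eta>) powr (q - 2) * m + L powr (q - 2) * (4 * ((?N * e)^2 * d)) + L powr (q - q') * K"
   using m K(2)[OF u m d] Md by (intro add_mono mult_left_mono) auto
  finally show ?thesis .
 qed
 show ?thesis
 proof (rule LIMSEQ_I)
  fix r :: real assume r: "r > 0"
  \<comment> \<open>The order of choices matters: first the height \<open>L\<close>, then the cube
    size, whose error carries the factor \<open>L powr (q - 2)\<close>, and only then the level
    \<open>1/(k+1)\<close> of the averages.\<close>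
  have "((%L. L powr (q - q') * K) \<longlongrightarrow> 0 * K) at_top"
   using q' by (intro tendsto_intros tendsto_neg_powr filterlim_ident) auto
  then have "eventually (%L. L powr (q - q') * K < r / 3 & L > 0) at_top"
   using r by (intro eventually_conj order_tendstoD(2) eventually_gt_at_top) auto
  then obtain L where L: "L powr (q - q') * K < r / 3" "L > 0" by (auto simp: eventually_at_top_linorder)
  have "(%j. L powr (q - 2) * (4 * ((?N * inverse (real (Suc j)))^2 * d))) ----> L powr (q - 2) * (4 * ((?N * 0)^2 * d))"
   by (intro tendsto_intros LIMSEQ_inverse_real_of_nat)
  then have "eventually (%j. L powr (q - 2) * (4 * ((?N * inverse (real (Suc j)))^2 * d)) < r / 3) sequentially"
   using r by (intro order_tendstoD(2)) auto
  then obtain j where j: "L powr (q - 2) * (4 * ((?N * (1 / real (Suc j)))^2 * d)) < r / 3"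
   by (auto simp: eventually_sequentially inverse_eq_divide simp del: of_nat_Suc)
  have "((%k. (2 * inverse (real (Suc k))) powr (q - 2) * m) \<longlongrightarrow> (2 * 0) powr (q - 2) * m) sequentially"
   using q by (intro tendsto_intros LIMSEQ_inverse_real_of_nat tendsto_powr') auto
  then have "eventually (%k. (2 * inverse (real (Suc k))) powr (q - 2) * m < r / 3) sequentially"
   using r by (intro order_tendstoD(2)) auto
  then obtain k where k: "(2 * inverse (real (Suc k))) powr (q - 2) * m < r / 3"
   by (auto simp: eventually_sequentially simp del: of_nat_Suc)
  have "eventually (%n. \<forall>x. \<bar>cube_avg (1 / real (Suc j)) (u n) x\<bar> <= inverse (real (Suc k))) sequentially"
   using v unfolding vanishing_def by simp
  then obtain n0 where n0: "!!n x. n >= n0 ==> \<bar>cube_avg (1 / real (Suc j)) (u n) x\<bar> <= inverse (real (Suc k))"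
   by (auto simp: eventually_sequentially)
  have "(LINT x|lebesgue. \<bar>u n x\<bar> powr q) < r" if "n >= n0" for n
   using bound[OF L(2) _ _ n0[OF that]] L(1) j k by (fastforce simp del: of_nat_Suc)
  moreover have "0 <= (LINT x|lebesgue. \<bar>u n x\<bar> powr q)" for n by simp
  ultimately show "\<exists>n0. \<forall>n\<ge>n0. norm ((LINT x|lebesgue. \<bar>u n x\<bar> powr q) - 0) < r"
   by (intro exI[of _ n0]) auto
 qed
qed

text \<open>Averages over cubes of side \<open>1/(j+1)\<close> are equi-Lipschitz and bounded, hence converge along a
 diagonal subsequence; the averages approximate uniformly in \<open>n\<close>.\<close>

lemma Rellich:
 fixes u :: "nat => real ^ 'n => real"
 assumes u: "!!n. u n \<in> H1" and m: "!!n. mass (u n) <= m" and d: "!!n. dir (u n) <= d"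
 obtains sg w where "strict_mono (sg :: nat => nat)" "w \<in> H1" "ae x. (%n. u (sg n) x) ----> w x"
proof -
 let ?N = "real CARD('n)"
 have uL: "u n \<in> L2" for n using u by auto
 have m0: "m >= 0" using m[of 0] mass_nonneg[of "u 0"] by linarith
 have d0: "d >= 0" using d[of 0] dir_nonneg[of "u 0"] by linarith
 define e where "e j = 1 / real (Suc j)" for j
 have e: "e j > 0" for j by (simp add: e_def)
 define B where "B j = (sqrt m + 1) / sqrt (e j ^ CARD('n))" for j
 have B: "B j > 0" for j using e m0 by (simp add: B_def add_nonneg_pos)
 have avgB: "\<bar>cube_avg (e j) (u n) x\<bar> <= B j" for j n x
 proof -
  have "\<bar>cube_avg (e j) (u n) x\<bar> <= sqrt (mass (u n)) / sqrt (e j ^ CARD('n))" by (rule cube_avg_bound[OF uL e])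
  also have "... <= B j" unfolding B_def using m[of n] e[of j]
   by (intro divide_right_mono) (auto intro: order_trans[OF real_sqrt_le_mono[OF m[of n]]])
  finally show ?thesis .
 qed
 obtain D :: "(real ^ 'n) set" where D: "countable D" "!!X. open X ==> X ~= {} ==> \<exists>d\<in>D. d \<in> X"
  using countable_dense_setE by blast
 \<comment> \<open>Division by \<open>B\<close> bounds all averages by one, so that a single
   diagonal extraction over all scales and dense points serves them together.\<close>
 define g where "g n jx = cube_avg (e (fst jx)) (u n) (snd jx) / B (fst jx)" for n jx
 have "countable ((UNIV :: nat set) \<times> D)" using D(1) by auto
 moreover have "norm (g n jx) <= 1" for n jx
  using avgB[of "fst jx" n "snd jx"] B[of "fst jx"] by (simp add: g_def)
 ultimately obtain sg where sg: "strict_mono sg" "!!jx. jx \<in> UNIV \<times> D ==> \<exists>l. (%n. g (sg n) jx) ----> l"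
  using function_convergent_subsequence[of "UNIV \<times> D" g 1] by metis
 have convD: "convergent (%n. cube_avg (e j) (u (sg n)) x)" if "x \<in> D" for j x
 proof -
  have "(j, x) \<in> UNIV \<times> D" using that by simp
  then obtain l where "(%n. g (sg n) (j, x)) ----> l" using sg(2) by blast
  then have "(%n. B j * g (sg n) (j, x)) ----> B j * l" by (intro tendsto_intros)
  then show ?thesis using B[of j] by (auto simp: g_def convergent_def)
 qed
 define L where "L j = ?N * (sqrt d + 1) / sqrt (e j ^ CARD('n))" for j
 have L: "L j > 0" for j using e d0 by (simp add: L_def add_nonneg_pos)
 have lip: "\<bar>cube_avg (e j) (u n) x - cube_avg (e j) (u n) y\<bar> <= L j * norm (x - y)" for j n x y
 proof -
  have "\<bar>cube_avg (e j) (u n) x - cube_avg (e j) (u n) y\<bar> <= ?N * norm (x - y) * sqrt (dir (u n)) / sqrt (e j ^ CARD('n))"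
   by (rule cube_avg_Lipschitz[OF u e])
  also have "... <= ?N * norm (x - y) * (sqrt d + 1) / sqrt (e j ^ CARD('n))"
   using e[of j] order_trans[OF real_sqrt_le_mono[OF d[of n]], of "sqrt d + 1"]
   by (intro divide_right_mono mult_left_mono) auto
  finally show ?thesis by (simp add: L_def mult_ac)
 qed
 have conv: "convergent (%n. cube_avg (e j) (u (sg n)) x)" for j x
 proof -
  have "Cauchy (%n. cube_avg (e j) (u (sg n)) x)"
  proof (rule CauchyI)
   fix r :: real assume r: "r > 0"
   have "0 < r / (3 * L j)" using r L[of j] by simp
   then have "ball x (r / (3 * L j)) ~= {}" unfolding ball_eq_empty not_le .
   then obtain y where y: "y \<in> D" "dist x y < r / (3 * L j)" using D(2)[of "ball x (r / (3 * L j))"] by auto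
   have Ly: "L j * norm (x - y) < r / 3" using y(2) L[of j] by (simp add: dist_norm field_simps)
   have "Cauchy (%n. cube_avg (e j) (u (sg n)) y)" using convD[OF y(1)] by (rule convergent_Cauchy)
   then obtain M where M: "!!a b. a >= M ==> b >= M ==> norm (cube_avg (e j) (u (sg a)) y - cube_avg (e j) (u (sg b)) y) < r / 3"
    using CauchyD[of _ "r/3"] r by (metis zero_less_divide_iff zero_less_numeral)
   have "norm (cube_avg (e j) (u (sg a)) x - cube_avg (e j) (u (sg b)) x) < r" if "a >= M" "b >= M" for a b
    using M[OF that] lip[of j "sg a" x y] lip[of j "sg b" x y] Ly unfolding real_norm_def by linarith
   then show "\<exists>M. \<forall>a\<ge>M. \<forall>b\<ge>M. norm (cube_avg (e j) (u (sg a)) x - cube_avg (e j) (u (sg b)) x) < r" by blast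
  qed
  then show ?thesis by (rule Cauchy_convergent)
 qed
 define a where "a j x = lim (%n. cube_avg (e j) (u (sg n)) x)" for j x
 have a: "(%n. cube_avg (e j) (u (sg n)) x) ----> a j x" for j x
  using conv unfolding a_def by (simp add: convergent_LIMSEQ_iff)
 \<comment> \<open>The averages converge pointwise with a constant bound, which is not square
   integrable; the weight \<open>s\<close> supplies the majorant \<open>B j * s\<close> for
   dominated convergence and is divided out at the end.\<close>
 obtain s :: "real ^ 'n => real" where sL: "s \<in> L2" and s0: "!!x. 0 < s x" and s1: "!!x. s x <= 1" by (rule positive_L2_weight) blast
 have sm: "s \<in> lmeas" using sL by auto
 have am: "cube_avg (e j) (u n) \<in> lmeas" for j n by (rule cube_avg_measurable[OF u e])
 have aam: "a j \<in> lmeas" for j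
  by (rule borel_measurable_LIMSEQ_metric[OF am a])
 have mL: "(%x. f x * s x) \<in> L2 & mass (%x. f x * s x) <= mass f" if "f \<in> L2" for f
 proof -
  have 1: "(%x. f x * s x) \<in> lmeas" by (intro borel_measurable_times L2_measurable[OF that] sm)
  have 2: "ae x. \<bar>f x * s x\<bar> <= \<bar>f x\<bar>"
  proof (intro AE_I2)
   fix x
   have "\<bar>f x\<bar> * s x <= \<bar>f x\<bar> * 1" using s1[of x] by (intro mult_left_mono) auto
   then show "\<bar>f x * s x\<bar> <= \<bar>f x\<bar>" using s0[of x] by (simp add: abs_mult)
  qed
  show ?thesis using L2_dominated[OF that 1 2] by blast
 qed
 have avL: "(%x. cube_avg (e j) (u (sg n)) x * s x) \<in> L2"
  and avl: "(%n. mass (%x. cube_avg (e j) (u (sg n)) x * s x - a j x * s x)) ----> 0"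
  and ajL: "(%x. a j x * s x) \<in> L2" for j n
 proof -
  note D = mass_dominated_convergence[where f = "%n x. cube_avg (e j) (u (sg n)) x * s x" and F = "%x. a j x * s x" and g = "%x. B j * s x"]
  have 1: "(%x. cube_avg (e j) (u (sg n)) x * s x) \<in> lmeas" "(%x. a j x * s x) \<in> lmeas" for n
   using am aam sm by (auto intro!: borel_measurable_times)
  have 2: "(%x. B j * s x) \<in> L2" using sL by auto
  have 3: "ae x. (%n. cube_avg (e j) (u (sg n)) x * s x) ----> a j x * s x"
   by (intro AE_I2 tendsto_mult[OF a tendsto_const])
  have 4: "ae x. \<bar>cube_avg (e j) (u (sg n)) x * s x\<bar> <= B j * s x" for n
   using avgB s0 by (intro AE_I2) (auto simp: abs_mult less_imp_le intro!: mult_right_mono)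
  show "(%x. cube_avg (e j) (u (sg n)) x * s x) \<in> L2" "(%n. mass (%x. cube_avg (e j) (u (sg n)) x * s x - a j x * s x)) ----> 0"
   "(%x. a j x * s x) \<in> L2"
   using D[OF 1 2 3 4] by auto
 qed
 define f where "f n x = u (sg n) x * s x" for n x
 have fL: "f n \<in> L2" for n unfolding f_def using mL[OF uL] by blast
 \<comment> \<open>The first term is small for small cubes uniformly in \<open>n\<close>, the second
   tends to zero for each fixed \<open>j\<close>; so \<open>j\<close> is fixed before
   \<open>n\<close>.\<close>
 have key: "mass (%x. f n x - a j x * s x) <= 2 * ((?N * e j)^2 * d) + 2 * mass (%x. cube_avg (e j) (u (sg n)) x * s x - a j x * s x)" for n j
 proof -
  note M = mass_minus_cube_avg[OF u[of "sg n"] e[of j]]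
  have "mass (%x. (u (sg n) x - cube_avg (e j) (u (sg n)) x) * s x + (cube_avg (e j) (u (sg n)) x * s x - a j x * s x))
   <= 2 * mass (%x. (u (sg n) x - cube_avg (e j) (u (sg n)) x) * s x) + 2 * mass (%x. cube_avg (e j) (u (sg n)) x * s x - a j x * s x)"
   using mL[OF M(1)] avL ajL by (intro mass_add_le L2_diff) auto
  also have "mass (%x. (u (sg n) x - cube_avg (e j) (u (sg n)) x) * s x) <= (?N * e j)^2 * dir (u (sg n))"
   using mL[OF M(1)] M(2) by linarith
  also have "... <= (?N * e j)^2 * d" using d by (intro mult_left_mono) auto
  finally show ?thesis by (simp add: f_def algebra_simps)
 qed
 have "\<exists>N. \<forall>p\<ge>N. \<forall>q\<ge>N. mass (%x. f p x - f q x) <= r" if r: "r > 0" for r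
 proof -
  have "(%j. (?N * inverse (real (Suc j)))^2 * d) ----> (?N * 0)^2 * d"
   by (intro tendsto_intros LIMSEQ_inverse_real_of_nat)
  then have "eventually (%j. (?N * inverse (real (Suc j)))^2 * d < r / 16) sequentially"
   using r by (intro order_tendstoD(2)) auto
  then obtain j where j: "(?N * e j)^2 * d < r / 16"
   by (auto simp: eventually_sequentially e_def inverse_eq_divide simp del: of_nat_Suc)
  have "eventually (%n. mass (%x. cube_avg (e j) (u (sg n)) x * s x - a j x * s x) < r / 16) sequentially"
   using r by (intro order_tendstoD(2)[OF avl]) auto
  then obtain n0 where n0: "!!n. n >= n0 ==> mass (%x. cube_avg (e j) (u (sg n)) x * s x - a j x * s x) < r / 16"
   by (auto simp: eventually_sequentially)
  have F: "mass (%x. f n x - a j x * s x) <= r / 4" if "n >= n0" for n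
   using key[of n j] n0[OF that] j by linarith
  have "mass (%x. f p x - f q x) <= r" if "p >= n0" "q >= n0" for p q
  proof -
   have "mass (%x. (f p x - a j x * s x) - (f q x - a j x * s x)) <= 2 * mass (%x. f p x - a j x * s x) + 2 * mass (%x. f q x - a j x * s x)"
    using fL ajL by (intro mass_diff_le L2_diff)
   then show ?thesis using F[OF that(1)] F[OF that(2)] by simp
  qed
  then show ?thesis by blast
 qed
 from L2_complete[OF fL this] obtain h tau where h: "h \<in> L2" "strict_mono tau" "ae x. (%n. f (tau n) x) ----> h x"
  by blast
 define w where "w x = h x / s x" for x
 have wm: "w \<in> lmeas" unfolding w_def using L2_measurable[OF h(1)] sm by measurable
 have ae: "ae x. (%n. u ((sg \<circ> tau) n) x) ----> w x"
  using h(3)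
 proof eventually_elim
  case (elim x)
  then have "(%n. f (tau n) x / s x) ----> h x / s x" using s0[of x] by (intro tendsto_divide[OF elim tendsto_const]) auto
  then show ?case using s0[of x] by (simp add: f_def w_def)
 qed
 have wL: "w \<in> L2" by (rule Fatou_L2(1)[OF _ wm ae, of m]) (use uL m in auto)
 have "mass (%x. w (x + h *\<^sub>R axis i 1) - w x) <= h^2 * d" for i h
 proof (rule Fatou_L2(2))
  show "(%x. u ((sg \<circ> tau) n) (x + h *\<^sub>R axis i 1) - u ((sg \<circ> tau) n) x) \<in> L2" for n
   by (intro L2_diff L2_translate uL)
  show "(%x. w (x + h *\<^sub>R axis i 1) - w x) \<in> lmeas" using L2_diff[OF L2_translate[OF wL] wL] by blast
  show "ae x. (%n. u ((sg \<circ> tau) n) (x + h *\<^sub>R axis i 1) - u ((sg \<circ> tau) n) x) ----> w (x + h *\<^sub>R axis i 1) - w x"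
   using ae AE_translate[OF ae, of "h *\<^sub>R axis i 1"] by eventually_elim (intro tendsto_diff)
  show "\<forall>\<^sub>F n in sequentially. mass (%x. u ((sg \<circ> tau) n) (x + h *\<^sub>R axis i 1) - u ((sg \<circ> tau) n) x) <= h^2 * d"
  proof (intro always_eventually allI)
   fix n
   have "mass (%x. u ((sg \<circ> tau) n) (x + h *\<^sub>R axis i 1) - u ((sg \<circ> tau) n) x) <= h^2 * dirp i (u ((sg \<circ> tau) n))"
    by (rule H1_difference[OF u])
   also have "... <= h^2 * d" using dirp_le_dir d order_trans by (intro mult_left_mono) (blast, simp)
   finally show "mass (%x. u ((sg \<circ> tau) n) (x + h *\<^sub>R axis i 1) - u ((sg \<circ> tau) n) x) <= h^2 * d" .
  qed
 qed
 then have "w \<in> H1" by (rule H1_from_difference(1)[OF wL])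
 then show ?thesis using that[of "sg \<circ> tau" w] ae strict_mono_o[OF sg(1) h(2)] by blast
qed

section \<open>Asymptotic splitting of mass, Dirichlet integral and nonlinear terms\<close>

lemma mass_splitting:
 fixes v :: "nat => real ^ 'n => real"
 assumes v: "!!n. v n \<in> L2" and b: "!!n. mass (v n) <= c" and w: "w \<in> L2"
  and ae: "ae x. (%n. v n x) ----> 0"
 shows "(%n. mass (%x. v n x + w x) - mass (v n)) ----> mass w"
proof -
 have "(%n. 2 * ip (v n) w + mass w) ----> 2 * 0 + mass w"
  by (intro tendsto_intros ip_tendsto_0_AE(2)[OF v b w ae])
 then show ?thesis using v w by (simp add: mass_add)
qed

text \<open>The cross term \<open>gip (v n) w\<close> tends to zero: against a test function the
  derivative moves over from \<open>v n\<close>, and the bound on \<open>dir (v n)\<close> extends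
  this to all of \<open>L2\<close>.\<close>

lemma dir_splitting:
 fixes v :: "nat => real ^ 'n => real"
 assumes v: "!!n. v n \<in> H1" and b: "!!n. mass (v n) <= c" and d: "!!n. dir (v n) <= d" and w: "w \<in> H1"
  and ae: "ae x. (%n. v n x) ----> 0"
 shows "(%n. dir (%x. v n x + w x) - dir (v n)) ----> dir w"
proof -
 have "(%n. gip (v n) w) ----> (\<Sum>i\<in>(UNIV :: 'n set). 0)"
  unfolding gip_def
 proof (rule tendsto_sum)
  fix i
  have t: "(%n. ip (gradp i (v n)) phi) ----> ip (%x. 0) phi" if phi: "phi \<in> test_functions" for phi
  proof -
   have "(%n. - ip (v n) (partial_derivative i phi)) ----> - 0"
    by (intro tendsto_intros ip_tendsto_0_AE(2)[OF H1_L2[OF v] b _ ae] test_function_L2 partial_derivative_test phi)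
   moreover have "- ip (v n) (partial_derivative i phi) = ip (gradp i (v n)) phi" for n
    using H1_gradp[OF v, of i n] phi unfolding weak_partial_def by simp
   ultimately show ?thesis by (simp add: ip_def)
  qed
  have "(%n. ip (gradp i (v n)) (gradp i w)) ----> ip (%x. 0) (gradp i w)"
  proof (rule ip_tendsto_of_test[OF gradp_L2[OF v] _ L2_zero t gradp_L2[OF w]])
   show "mass (gradp i (v n)) <= d" for n using dirp_le_dir[of i "v n"] d[of n] by (simp add: dirp_def)
  qed
  then show "(%n. ip (gradp i (v n)) (gradp i w)) ----> 0" by (simp add: ip_def)
 qed
 then have "(%n. 2 * 1 * gip (v n) w + 1^2 * dir w) ----> 2 * 1 * 0 + 1^2 * dir w" by (intro tendsto_intros) simp
 then show ?thesis using dir_add_scaled[OF v w, of _ 1] by simp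
qed

text \<open>Comparable to \<open>norm z powr r\<close>, but its integral splits into the two powers
  that the Sobolev inequality bounds.\<close>

definition psum :: "real => real \<times> real => real" where
 "psum r z = \<bar>fst z\<bar> powr r + \<bar>snd z\<bar> powr r"

lemma norm_powr_le_psum: "r > 0 ==> norm z powr r <= 2 powr r * psum r z"
proof -
 assume r: "r > 0"
 define M where "M = max \<bar>fst z\<bar> \<bar>snd z\<bar>"
 have "norm z <= \<bar>fst z\<bar> + \<bar>snd z\<bar>" using norm_Pair_le[of "fst z" "snd z"] by simp
 also have "... <= 2 * M" by (simp add: M_def)
 finally have "norm z powr r <= (2 * M) powr r" using r by (intro powr_mono2) auto
 also have "... = 2 powr r * M powr r" by (simp add: powr_mult M_def)
 also have "M powr r <= psum r z" unfolding psum_def M_def max_def by auto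
 finally show ?thesis by simp
qed

lemma psum_le_norm_powr: "r > 0 ==> psum r z <= 2 * norm z powr r"
 unfolding psum_def using norm_fst_le[of "fst z" "snd z"] norm_snd_le[of "snd z" "fst z"]
  powr_mono2[of r "\<bar>fst z\<bar>" "norm z"] powr_mono2[of r "\<bar>snd z\<bar>" "norm z"] by simp

lemma psum_nonneg [simp]: "0 <= psum r z"
 by (simp add: psum_def)

lemma psum_measurable:
 assumes r: "r > 0" and Z: "Z \<in> borel_measurable M" shows "(%x. psum r (Z x)) \<in> borel_measurable M"
proof -
 have "continuous_on UNIV (psum r)"
  unfolding psum_def[abs_def] using r by (intro continuous_intros continuous_on_powr') auto
 then show ?thesis using measurable_compose[OF Z borel_measurable_continuous_onI] by blast
qed

text \<open>If \<open>w\<close> is small relative to \<open>z\<close>, homogeneity rescales to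
  \<open>norm z = 1\<close> and uniform continuity on a ball gives the small constant. Otherwise
  \<open>z\<close> is bounded by a multiple of \<open>w\<close>, and growth of order
  \<open>r\<close> absorbs everything into \<open>norm w powr r\<close>.\<close>

lemma homogeneous_difference:
 fixes F :: "real \<times> real => real"
 assumes F: "continuous_on UNIV F" and hom: "!!t z. t > 0 ==> F (t *\<^sub>R z) = t powr r * F z" and r: "r > 0" and \<epsilon>: "\<epsilon> > 0"
 shows "\<exists>C>0. (\<forall>z w. \<bar>F (z + w) - F z\<bar> <= \<epsilon> * norm z powr r + C * norm w powr r) & (\<forall>w. \<bar>F w\<bar> <= C * norm w powr r)"
proof -
 have "compact (F ` sphere 0 1)" using F by (intro compact_continuous_image) (auto intro: continuous_on_subset)
 then obtain M0 where M0: "!!y. y \<in> F ` sphere 0 1 ==> \<bar>y\<bar> <= M0" using compact_imp_bounded bounded_real by metis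
 define M where "M = \<bar>M0\<bar> + 1"
 have M: "M > 0" by (simp add: M_def)
 have F0: "F 0 = 0"
 proof -
  have "F 0 = 2 powr r * F 0" using hom[of 2 0] by simp
  moreover have "2 powr r > (1 :: real)" using r by (simp add: gr_one_powr)
  ultimately show ?thesis using r by simp
 qed
 have FM: "\<bar>F z\<bar> <= M * norm z powr r" for z
 proof (cases "z = 0")
  case False
  have "F z = norm z powr r * F ((1 / norm z) *\<^sub>R z)" using hom[of "norm z" "(1 / norm z) *\<^sub>R z"] False by simp
  moreover have "\<bar>F ((1 / norm z) *\<^sub>R z)\<bar> <= M"
   using M0[of "F ((1 / norm z) *\<^sub>R z)"] False by (force simp: M_def)
  ultimately show ?thesis using mult_left_mono[of "\<bar>F ((1 / norm z) *\<^sub>R z)\<bar>" M "norm z powr r"]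
   by (simp add: abs_mult mult.commute)
 qed (simp add: F0)
 have "uniformly_continuous_on (cball 0 2) F"
  using F by (intro compact_uniformly_continuous) (auto intro: continuous_on_subset)
 then obtain \<delta>0 where \<delta>0: "\<delta>0 > 0" "!!x y. x \<in> cball 0 2 ==> y \<in> cball 0 2 ==> dist y x < \<delta>0 ==> dist (F y) (F x) < \<epsilon>"
  using \<epsilon> unfolding uniformly_continuous_on_def by metis
 define \<delta> where "\<delta> = min \<delta>0 1"
 have \<delta>: "0 < \<delta>" "\<delta> <= 1" using \<delta>0 by (auto simp: \<delta>_def)
 define C where "C = M * ((1 / \<delta> + 1) powr r + (1 / \<delta>) powr r) + M"
 have C: "C > 0" unfolding C_def using M by (intro add_nonneg_pos) auto
 have "\<bar>F (z + w) - F z\<bar> <= \<epsilon> * norm z powr r + C * norm w powr r" for z w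
 proof (cases "norm w < \<delta> * norm z")
  case True
  then have z: "z ~= 0" by auto
  let ?t = "1 / norm z"
  have "F (z + w) - F z = norm z powr r * (F (?t *\<^sub>R z + ?t *\<^sub>R w) - F (?t *\<^sub>R z))"
   using hom[of "norm z" "?t *\<^sub>R z + ?t *\<^sub>R w"] hom[of "norm z" "?t *\<^sub>R z"] z
   by (simp add: scaleR_add_right right_diff_distrib)
  moreover have "dist (F (?t *\<^sub>R z + ?t *\<^sub>R w)) (F (?t *\<^sub>R z)) < \<epsilon>"
  proof (rule \<delta>0(2))
   have n: "norm (?t *\<^sub>R w) < \<delta>" using True z by (simp add: field_simps)
   show "?t *\<^sub>R z \<in> cball 0 2" using z by simp
   have "norm (?t *\<^sub>R z + ?t *\<^sub>R w) <= norm (?t *\<^sub>R z) + norm (?t *\<^sub>R w)" by (rule norm_triangle_ineq)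
   also have "norm (?t *\<^sub>R z) = 1" using z by simp
   also have "1 + norm (?t *\<^sub>R w) <= 2" using n \<delta> by linarith
   finally show "?t *\<^sub>R z + ?t *\<^sub>R w \<in> cball 0 2" by simp
   show "dist (?t *\<^sub>R z + ?t *\<^sub>R w) (?t *\<^sub>R z) < \<delta>0" using n by (simp add: dist_norm \<delta>_def)
  qed
  ultimately have "\<bar>F (z + w) - F z\<bar> <= norm z powr r * \<epsilon>"
   by (simp add: abs_mult dist_real_def mult_left_mono)
  moreover have "0 <= C * norm w powr r" using C by simp
  ultimately show ?thesis by (simp add: mult.commute)
 next
  case False
  then have zw: "norm z <= norm w / \<delta>" using \<delta> by (simp add: field_simps)
  have "\<bar>F (z + w) - F z\<bar> <= M * norm (z + w) powr r + M * norm z powr r"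
   using FM[of "z + w"] FM[of z] by linarith
  also have "... <= M * ((1 / \<delta> + 1) * norm w) powr r + M * ((1 / \<delta>) * norm w) powr r"
  proof (intro add_mono mult_left_mono powr_mono2)
   have "norm (z + w) <= norm z + norm w" by (rule norm_triangle_ineq)
   then show "norm (z + w) <= (1 / \<delta> + 1) * norm w" using zw by (simp add: distrib_right)
  qed (use zw M r in auto)
  also have "... = M * ((1 / \<delta> + 1) powr r + (1 / \<delta>) powr r) * norm w powr r"
  proof -
   have "((1 / \<delta> + 1) * norm w) powr r = (1 / \<delta> + 1) powr r * norm w powr r"
    "((1 / \<delta>) * norm w) powr r = (1 / \<delta>) powr r * norm w powr r"
    using \<delta> by (intro powr_mult; simp)+
   then show ?thesis by (simp only: distrib_left distrib_right mult.assoc)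
  qed
  also have "... <= C * norm w powr r" unfolding C_def using M by (intro mult_right_mono) auto
  finally show ?thesis using \<epsilon> by (smt (verit) mult_nonneg_nonneg powr_ge_zero)
 qed
 moreover have "\<bar>F w\<bar> <= C * norm w powr r" for w
 proof -
  have "M * norm w powr r <= C * norm w powr r" unfolding C_def using M by (intro mult_right_mono) auto
  then show ?thesis using FM[of w] by linarith
 qed
 ultimately show ?thesis using C by blast
qed

text \<open>Stated for a continuous homogeneous function of two variables, so that the single powers
  and the coupling term are instances of one statement.\<close>

lemma Brezis_Lieb:
 fixes F :: "real \<times> real => real" and V :: "nat => 'a => real \<times> real" and W :: "'a => real \<times> real"
 assumes F: "continuous_on UNIV F" and hom: "!!t z. t > 0 ==> F (t *\<^sub>R z) = t powr r * F z" and r: "r > 0"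
  and Vm: "!!n. V n \<in> borel_measurable M" and Wm: "W \<in> borel_measurable M"
  and Vi: "!!n. integrable M (%x. psum r (V n x))" and Vb: "!!n. (LINT x|M. psum r (V n x)) <= K"
  and Wi: "integrable M (%x. psum r (W x))"
  and ae: "AE x in M. (%n. V n x) ----> 0"
 shows "(%n. (LINT x|M. F (V n x + W x)) - (LINT x|M. F (V n x))) ----> (LINT x|M. F (W x))"
  "integrable M (%x. F (W x))"
proof -
 have Fm: "F \<in> borel_measurable borel" using F by (rule borel_measurable_continuous_onI)
 have Fint: "integrable M (%x. F (Z x))" if "Z \<in> borel_measurable M" "integrable M (%x. psum r (Z x))" for Z
 proof -
  obtain C where C: "C > 0" "!!w. \<bar>F w\<bar> <= C * norm w powr r"
   using homogeneous_difference[OF F hom r, of 1] by auto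
  have "\<bar>F w\<bar> <= C * 2 powr r * psum r w" for w
  proof -
   have "C * norm w powr r <= C * (2 powr r * psum r w)"
    using C(1) norm_powr_le_psum[OF r, of w] by (intro mult_left_mono) auto
   then show ?thesis using C(2)[of w] by (simp add: mult.assoc)
  qed
  then show ?thesis
   by (intro Bochner_Integration.integrable_bound[where M = M and f = "%x. C * 2 powr r * psum r (Z x)" and g = "%x. F (Z x)"])
    (use that Fm C in \<open>auto intro!: AE_I2 measurable_compose[OF that(1) Fm] intro: order_trans[OF _ abs_ge_self]\<close>)
 qed
 have psum_add: "integrable M (%x. psum r (V n x + W x))" for n
 proof (rule Bochner_Integration.integrable_bound)
  show "integrable M (%x. 2 * 2 powr r * (2 powr r * psum r (V n x) + 2 powr r * psum r (W x)))"
   using Vi Wi by simp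
  show "(%x. psum r (V n x + W x)) \<in> borel_measurable M" by (intro psum_measurable r borel_measurable_add Vm Wm)
  have "psum r (z + w) <= 2 * 2 powr r * (2 powr r * psum r z + 2 powr r * psum r w)" for z w
  proof -
   have "norm (z + w) <= 2 * max (norm z) (norm w)" using norm_triangle_ineq[of z w] by simp
   then have "norm (z + w) powr r <= (2 * max (norm z) (norm w)) powr r" using r by (intro powr_mono2) auto
   also have "... = 2 powr r * max (norm z) (norm w) powr r" by (simp add: powr_mult)
   also have "max (norm z) (norm w) powr r <= norm z powr r + norm w powr r" by (auto simp: max_def)
   finally have "norm (z + w) powr r <= 2 powr r * (2 powr r * psum r z + 2 powr r * psum r w)"
    using norm_powr_le_psum[OF r, of z] norm_powr_le_psum[OF r, of w]
    by (smt (verit) mult_left_mono powr_ge_zero)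
   then show ?thesis using psum_le_norm_powr[OF r, of "z + w"] by simp
  qed
  then show "AE x in M. norm (psum r (V n x + W x)) <= norm (2 * 2 powr r * (2 powr r * psum r (V n x) + 2 powr r * psum r (W x)))"
   by (intro AE_I2) (auto intro: order_trans[OF _ abs_ge_self])
 qed
 have iV: "integrable M (%x. F (V n x))" and iVW: "integrable M (%x. F (V n x + W x))" for n
  using Fint[OF Vm Vi] Fint[OF borel_measurable_add[OF Vm Wm] psum_add] by auto
 show iW: "integrable M (%x. F (W x))" by (rule Fint[OF Wm Wi])
 define H where "H n x = \<bar>F (V n x + W x) - F (V n x) - F (W x)\<bar>" for n x
 have iH: "integrable M (H n)" for n unfolding H_def using iV iVW iW by auto
 have "0 <= (LINT x|M. psum r (V 0 x))" by simp
 then have K0: "K >= 0" using Vb[of 0] by linarith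
 have lim: "(%n. LINT x|M. H n x) ----> 0"
 proof (rule LIMSEQ_I)
  fix \<rho> :: real assume \<rho>: "\<rho> > 0"
  define \<epsilon> where "\<epsilon> = \<rho> / (4 * 2 powr r * (K + 1))"
  define \<epsilon>' where "\<epsilon>' = \<epsilon> * 2 powr r"
  have \<epsilon>: "\<epsilon> > 0" using \<rho> K0 by (auto simp: \<epsilon>_def)
  have \<epsilon>': "\<epsilon>' > 0" "\<epsilon>' * K < \<rho> / 2"
  proof -
   have "\<epsilon>' = \<rho> / (4 * (K + 1))" by (simp add: \<epsilon>'_def \<epsilon>_def)
   then show pos: "\<epsilon>' > 0" using \<rho> K0 by simp
   have K1: "K + 1 ~= 0" using K0 by linarith
   have "\<epsilon>' = (\<rho> / 4) / (K + 1)" using \<open>\<epsilon>' = \<rho> / (4 * (K + 1))\<close> by simp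
   then have "\<epsilon>' * (K + 1) = \<rho> / 4" by (rule iffD1[OF nonzero_eq_divide_eq[OF K1]])
   then have "\<epsilon>' * K + \<epsilon>' = \<rho> / 4" by (simp add: distrib_left)
   then show "\<epsilon>' * K < \<rho> / 2" using pos \<rho> by linarith
  qed
  obtain C where C: "C > 0" "!!z w. \<bar>F (z + w) - F z\<bar> <= \<epsilon> * norm z powr r + C * norm w powr r" "!!w. \<bar>F w\<bar> <= C * norm w powr r"
   using homogeneous_difference[OF F hom r \<epsilon>] by auto
  \<comment> \<open>The part of the defect \<open>H n\<close> above a small multiple of
    \<open>psum r (V n x)\<close>: what is cut off is small in integral because the integrals of
    \<open>psum r (V n x)\<close> are bounded, and what remains is dominated by a multiple of
    \<open>psum r (W x)\<close>.\<close>
  define Q where "Q n x = max 0 (H n x - \<epsilon>' * psum r (V n x))" for n x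
  have Hle: "H n x <= \<epsilon>' * psum r (V n x) + 2 * C * 2 powr r * psum r (W x)" for n x
  proof -
   have "H n x <= \<epsilon> * norm (V n x) powr r + 2 * (C * norm (W x) powr r)"
    using C(2)[of "V n x" "W x"] C(3)[of "W x"] unfolding H_def by linarith
   also have "... <= \<epsilon> * (2 powr r * psum r (V n x)) + 2 * (C * (2 powr r * psum r (W x)))"
    using norm_powr_le_psum[OF r] C(1) \<epsilon> by (intro add_mono mult_left_mono) auto
   finally show ?thesis by (simp add: \<epsilon>'_def mult.assoc)
  qed
  have Qi: "integrable M (Q n)" for n unfolding Q_def using iH Vi by auto
  have F0: "F 0 = 0" using C(3)[of 0] by simp
  have "(%n. LINT x|M. Q n x) ----> (LINT x|M. 0)"
  proof (rule integral_dominated_convergence[where w = "%x. 2 * C * 2 powr r * psum r (W x)"])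
   show "integrable M (%x. 2 * C * 2 powr r * psum r (W x))" using Wi by simp
   show "AE x in M. (%n. Q n x) ----> 0"
    using ae
   proof eventually_elim
    case (elim x)
    have cF: "(%n. F (Z n)) ----> F z" if "Z ----> z" for Z z
     using F that by (simp add: continuous_on_tendsto_compose)
    have "(%n. V n x + W x) ----> 0 + W x" by (intro tendsto_intros elim)
    then have "(%n. \<bar>F (V n x + W x) - F (V n x) - F (W x)\<bar>) ----> \<bar>F (0 + W x) - F 0 - F (W x)\<bar>"
     by (intro tendsto_intros cF elim)
    then have "(%n. H n x) ----> 0" by (simp add: H_def F0)
    then show ?case
     by (rule Lim_null_comparison[rotated]) (use \<epsilon>' in \<open>auto simp: Q_def H_def\<close>)
   qed
   show "AE x in M. norm (Q n x) <= 2 * C * 2 powr r * psum r (W x)" for n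
    using Hle[of n] C(1) by (intro AE_I2) (auto simp: Q_def max_def algebra_simps)
  qed (use Qi in auto)
  then have "eventually (%n. (LINT x|M. Q n x) < \<rho> / 2) sequentially"
   using \<rho> by (intro order_tendstoD(2)) auto
  then obtain n0 where n0: "!!n. n >= n0 ==> (LINT x|M. Q n x) < \<rho> / 2"
   by (auto simp: eventually_sequentially)
  have "norm ((LINT x|M. H n x) - 0) < \<rho>" if "n >= n0" for n
  proof -
   have "(LINT x|M. H n x) <= (LINT x|M. \<epsilon>' * psum r (V n x) + Q n x)"
    using iH Vi Qi by (intro integral_mono) (auto simp: Q_def)
   also have "... = \<epsilon>' * (LINT x|M. psum r (V n x)) + (LINT x|M. Q n x)" using Vi Qi by simp
   also have "... <= \<epsilon>' * K + (LINT x|M. Q n x)" using Vb \<epsilon>' by (intro add_right_mono mult_left_mono) auto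
   also have "... < \<rho>" using n0[OF that] \<epsilon>'(2) by linarith
   finally have "(LINT x|M. H n x) < \<rho>" .
   moreover have "0 <= (LINT x|M. H n x)" by (simp add: H_def)
   ultimately show ?thesis by simp
  qed
  then show "\<exists>n0. \<forall>n\<ge>n0. norm ((LINT x|M. H n x) - 0) < \<rho>" by blast
 qed
 show "(%n. (LINT x|M. F (V n x + W x)) - (LINT x|M. F (V n x))) ----> (LINT x|M. F (W x))"
 proof (rule LIM_zero_cancel, rule Lim_null_comparison[OF _ lim])
  show "\<forall>\<^sub>F n in sequentially. norm ((LINT x|M. F (V n x + W x)) - (LINT x|M. F (V n x)) - (LINT x|M. F (W x))) <= (LINT x|M. H n x)"
  proof (intro always_eventually allI)
   fix n
   have "(LINT x|M. F (V n x + W x)) - (LINT x|M. F (V n x)) - (LINT x|M. F (W x)) = (LINT x|M. F (V n x + W x) - F (V n x) - F (W x))"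
    using iV iVW iW by simp
   then show "norm ((LINT x|M. F (V n x + W x)) - (LINT x|M. F (V n x)) - (LINT x|M. F (W x))) <= (LINT x|M. H n x)"
    unfolding H_def by (simp only: real_norm_def integral_abs_bound)
  qed
 qed
qed

subsection \<open>The nonlinear terms\<close>

definition pw :: "real => (real ^ 'n => real) => real" where
 "pw p u = (LINT x|lebesgue. \<bar>u x\<bar> powr p)"

definition cp :: "real => real => (real ^ 'n => real) => (real ^ 'n => real) => real" where
 "cp r s u v = (LINT x|lebesgue. \<bar>u x\<bar> powr r * \<bar>v x\<bar> powr s)"

definition subcrit :: "'n :: finite itself => real => bool" where
 "subcrit _ p \<longleftrightarrow> 2 < p & ereal p < critical_exponent (CARD('n))"

lemma pw_nonneg [simp]: "0 <= pw p u" by (simp add: pw_def)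

lemma cp_nonneg [simp]: "0 <= cp r s u v" by (simp add: cp_def)

lemma cp_commute: "cp r s u v = cp s r v u"
 by (simp add: cp_def mult.commute)

lemma pw_integrable:
 fixes u :: "real ^ 'n => real"
 shows "subcrit TYPE('n) p ==> u \<in> H1 ==> integrable lebesgue (%x. \<bar>u x\<bar> powr p)"
 by (simp add: subcrit_def H1_powr_integrable)

lemma young_powr:
 fixes a b r s :: real
 assumes "0 <= a" "0 <= b" "r > 0" "s > 0"
 shows "a powr r * b powr s <= a powr (r + s) + b powr (r + s)"
proof -
 define M where "M = max a b"
 have M: "M >= 0" "a <= M" "b <= M" using assms by (auto simp: M_def)
 have "a powr r * b powr s <= M powr r * M powr s" using M assms by (intro mult_mono powr_mono2) auto
 also have "... = M powr (r + s)" by (simp add: powr_add)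
 also have "... <= a powr (r + s) + b powr (r + s)" by (auto simp: M_def max_def)
 finally show ?thesis .
qed

lemma cp_integrable:
 fixes u v :: "real ^ 'n => real"
 assumes "subcrit TYPE('n) (r + s)" "r > 0" "s > 0" "u \<in> H1" "v \<in> H1"
 shows "integrable lebesgue (%x. \<bar>u x\<bar> powr r * \<bar>v x\<bar> powr s)" "cp r s u v <= pw (r + s) u + pw (r + s) v"
proof -
 have i: "integrable lebesgue (%x. \<bar>u x\<bar> powr (r + s) + \<bar>v x\<bar> powr (r + s))"
  using pw_integrable[OF assms(1,4)] pw_integrable[OF assms(1,5)] by simp
 have le: "\<bar>u x\<bar> powr r * \<bar>v x\<bar> powr s <= \<bar>u x\<bar> powr (r + s) + \<bar>v x\<bar> powr (r + s)" for x
  using assms by (intro young_powr) auto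
 show j: "integrable lebesgue (%x. \<bar>u x\<bar> powr r * \<bar>v x\<bar> powr s)"
 proof (rule Bochner_Integration.integrable_bound[OF i])
  show "(%x. \<bar>u x\<bar> powr r * \<bar>v x\<bar> powr s) \<in> lmeas"
   using H1_measurable[OF assms(4)] H1_measurable[OF assms(5)] by measurable
  show "ae x. norm (\<bar>u x\<bar> powr r * \<bar>v x\<bar> powr s) <= norm (\<bar>u x\<bar> powr (r + s) + \<bar>v x\<bar> powr (r + s))"
   using le by (intro AE_I2) (auto intro: order_trans[OF _ abs_ge_self])
 qed
 have "cp r s u v <= (LINT x|lebesgue. \<bar>u x\<bar> powr (r + s) + \<bar>v x\<bar> powr (r + s))"
  unfolding cp_def using i j le by (intro integral_mono) auto
 then show "cp r s u v <= pw (r + s) u + pw (r + s) v"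
  using pw_integrable[OF assms(1,4)] pw_integrable[OF assms(1,5)] by (simp add: pw_def)
qed

lemma pw_translate: "u \<in> lmeas ==> pw p (%x. u (x + a)) = pw p u"
 unfolding pw_def by (rule integral_translate) measurable

lemma cp_translate:
 assumes "u \<in> lmeas" "v \<in> lmeas"
 shows "cp r s (%x. u (x + a)) (%x. v (x + a)) = cp r s u v"
proof -
 have "(%x. \<bar>u x\<bar> powr r * \<bar>v x\<bar> powr s) \<in> lmeas" using assms by measurable
 from integral_translate[OF this] show ?thesis by (simp add: cp_def)
qed

lemma pw_bounded:
 fixes m d :: real
 assumes "subcrit TYPE('n) p"
 obtains K where "K > 0" "!!u :: real ^ 'n => real. u \<in> H1 ==> mass u <= m ==> dir u <= d ==> pw p u <= K"
 using Sobolev_bounded[of p, where 'n = 'n and m = m and d = d] assms unfolding subcrit_def pw_def by blast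

lemma pw_splitting:
 fixes v :: "nat => real ^ 'n => real"
 assumes p: "subcrit TYPE('n) p"
  and v: "!!n. v n \<in> H1" and b: "!!n. mass (v n) <= c" and d: "!!n. dir (v n) <= d" and w: "w \<in> H1"
  and ae: "ae x. (%n. v n x) ----> 0"
 shows "(%n. pw p (%x. v n x + w x) - pw p (v n)) ----> pw p w"
proof -
 have p0: "p > 0" using p by (simp add: subcrit_def)
 obtain K where K: "K > 0" "!!u :: real ^ 'n => real. u \<in> H1 ==> mass u <= c ==> dir u <= d ==> pw p u <= K"
  using pw_bounded[OF p] by blast
 let ?F = "%z :: real \<times> real. \<bar>fst z\<bar> powr p"
 note m = H1_measurable[OF v] H1_measurable[OF w]
 have "(%n. (LINT x|lebesgue. ?F ((v n x, 0) + (w x, 0))) - (LINT x|lebesgue. ?F (v n x, 0))) ----> (LINT x|lebesgue. ?F (w x, 0))"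
 proof (rule Brezis_Lieb[where r = p and K = K])
  show "continuous_on UNIV ?F" using p0 by (intro continuous_intros continuous_on_powr') auto
  show "?F (t *\<^sub>R z) = t powr p * ?F z" if "t > 0" for t z using that by (simp add: abs_mult powr_mult)
  show "ae x. (%n. (v n x, 0 :: real)) ----> 0"
   using ae by eventually_elim (simp add: zero_prod_def tendsto_Pair)
  show "(LINT x|lebesgue. psum p (v n x, 0)) <= K" for n using K(2)[OF v b d] p0 by (simp add: psum_def pw_def)
 qed (use p0 m pw_integrable[OF p v] pw_integrable[OF p w] in \<open>auto simp: psum_def\<close>)
 then show ?thesis by (simp add: pw_def)
qed

lemma cp_splitting:
 fixes v1 v2 :: "nat => real ^ 'n => real"
 assumes rs: "subcrit TYPE('n) (r + s)" "r > 0" "s > 0"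
  and v1: "!!n. v1 n \<in> H1" "!!n. mass (v1 n) <= c" "!!n. dir (v1 n) <= d"
  and v2: "!!n. v2 n \<in> H1" "!!n. mass (v2 n) <= c" "!!n. dir (v2 n) <= d"
  and w: "w1 \<in> H1" "w2 \<in> H1"
  and ae: "ae x. (%n. v1 n x) ----> 0" "ae x. (%n. v2 n x) ----> 0"
 shows "(%n. cp r s (%x. v1 n x + w1 x) (%x. v2 n x + w2 x) - cp r s (v1 n) (v2 n)) ----> cp r s w1 w2"
proof -
 obtain K where K: "K > 0" "!!u :: real ^ 'n => real. u \<in> H1 ==> mass u <= c ==> dir u <= d ==> pw (r + s) u <= K"
  using pw_bounded[OF rs(1)] by blast
 let ?F = "%z :: real \<times> real. \<bar>fst z\<bar> powr r * \<bar>snd z\<bar> powr s"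
 note m = H1_measurable[OF v1(1)] H1_measurable[OF v2(1)] H1_measurable[OF w(1)] H1_measurable[OF w(2)]
 note i = pw_integrable[OF rs(1) v1(1)] pw_integrable[OF rs(1) v2(1)] pw_integrable[OF rs(1) w(1)] pw_integrable[OF rs(1) w(2)]
 have "(%n. (LINT x|lebesgue. ?F ((v1 n x, v2 n x) + (w1 x, w2 x))) - (LINT x|lebesgue. ?F (v1 n x, v2 n x))) ----> (LINT x|lebesgue. ?F (w1 x, w2 x))"
 proof (rule Brezis_Lieb[where r = "r + s" and K = "K + K"])
  show "continuous_on UNIV ?F" using rs by (intro continuous_intros continuous_on_powr') auto
  show "?F (t *\<^sub>R z) = t powr (r + s) * ?F z" if "t > 0" for t z
   using that by (simp add: abs_mult powr_mult powr_add)
  show "ae x. (%n. (v1 n x, v2 n x)) ----> 0"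
   using ae by eventually_elim (simp add: zero_prod_def tendsto_Pair)
  show "(LINT x|lebesgue. psum (r + s) (v1 n x, v2 n x)) <= K + K" for n
   using add_mono[OF K(2)[OF v1, of n] K(2)[OF v2, of n]] i by (simp add: psum_def pw_def)
 qed (use rs m i in \<open>auto simp: psum_def\<close>)
 then show ?thesis by (simp add: cp_def)
qed

section \<open>Superadditivity of the nonlinear terms under merging\<close>

lemma powr_superadd:
 fixes x y q :: real
 assumes "x >= 0" "y >= 0" "q >= 1"
 shows "x powr q + y powr q <= (x + y) powr q"
proof (cases "x + y = 0")
 case False
 then have s: "x + y > 0" using assms by linarith
 have "(x / (x + y)) powr q <= (x / (x + y)) powr 1"
  by (rule powr_mono') (use assms s in auto)
 moreover have "(y / (x + y)) powr q <= (y / (x + y)) powr 1"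
  by (rule powr_mono') (use assms s in auto)
 ultimately have "(x / (x + y)) powr q + (y / (x + y)) powr q <= x / (x + y) + y / (x + y)" using assms s by simp
 also have "... = 1" using s by (simp add: add_divide_distrib[symmetric])
 finally have "((x / (x + y)) powr q + (y / (x + y)) powr q) * (x + y) powr q <= 1 * (x + y) powr q"
  by (intro mult_right_mono) auto
 then show ?thesis using assms s by (simp add: powr_divide distrib_right)
next
 case True
 then have "x = 0" "y = 0" using assms by linarith+
 then show ?thesis by simp
qed

lemma powr_superadd_strict:
 fixes x y q :: real
 assumes "x > 0" "y > 0" "q > 1"
 shows "x powr q + y powr q < (x + y) powr q"
proof -
 have "x powr q + y powr q = x * x powr (q - 1) + y * y powr (q - 1)"
  using assms powr_add[of x 1 "q - 1"] powr_add[of y 1 "q - 1"] by simp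
 also have "... < x * (x + y) powr (q - 1) + y * (x + y) powr (q - 1)"
  using assms by (intro add_strict_mono mult_strict_left_mono powr_less_mono2) auto
 also have "... = (x + y) powr q" using assms powr_add[of "x + y" 1 "q - 1"] by (simp add: distrib_right)
 finally show ?thesis .
qed

text \<open>Superadditivity of \<open>x\<^sup>\<alpha> y\<^sup>\<beta>\<close>: by homogeneity one may normalise the sums to one, and then it is
 the weighted inequality \<open>x\<^sup>\<alpha> y\<^sup>\<beta> <= (x\<^sup>\<alpha>\<^sup>+\<^sup>\<beta>)\<^sup>th (y\<^sup>\<alpha>\<^sup>+\<^sup>\<beta>)\<^sup>1\<^sup>-\<^sup>th <= th x + (1 - th) y\<close>.\<close>

lemma powr_prod_superadd:
 fixes x y x' y' \<alpha> \<beta> :: real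
 assumes n: "x >= 0" "y >= 0" "x' >= 0" "y' >= 0" and ab: "\<alpha> > 0" "\<beta> > 0" "\<alpha> + \<beta> >= 1"
 shows "x powr \<alpha> * y powr \<beta> + x' powr \<alpha> * y' powr \<beta> <= (x + x') powr \<alpha> * (y + y') powr \<beta>"
proof (cases "x + x' = 0 \<or> y + y' = 0")
 case True
 then have "x = 0 & x' = 0 \<or> y = 0 & y' = 0" using n by linarith
 then show ?thesis using ab by auto
next
 case False
 define X Y where "X = x + x'" and "Y = y + y'"
 have XY: "X > 0" "Y > 0" using False n by (auto simp: X_def Y_def)
 define th where "th = \<alpha> / (\<alpha> + \<beta>)"
 have th: "0 < th" "th < 1" "1 - th = \<beta> / (\<alpha> + \<beta>)" using ab by (auto simp: th_def field_simps)
 have key: "a powr \<alpha> * b powr \<beta> <= th * a + (1 - th) * b" if "0 <= a" "a <= 1" "0 <= b" "b <= 1" for a b :: real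
 proof (cases "a = 0 \<or> b = 0")
  case True
  then show ?thesis using ab th that by auto
 next
  case False
  then have p: "a > 0" "b > 0" using that by auto
  have "a powr \<alpha> * b powr \<beta> = (a powr th * b powr (1 - th)) powr (\<alpha> + \<beta>)"
  proof -
   have "th * (\<alpha> + \<beta>) = \<alpha>" "(1 - th) * (\<alpha> + \<beta>) = \<beta>" using ab unfolding th(3) by (auto simp: th_def)
   then show ?thesis by (simp add: powr_mult powr_powr)
  qed
  also have "... <= (a powr th * b powr (1 - th)) powr 1"
   using that ab th by (intro powr_mono') (auto intro!: mult_le_one powr_le1)
  also have "... = a powr th * b powr (1 - th)" by simp
  also have "... <= th * a + (1 - th) * b"
   using Youngs_inequality_0[of th "1 - th" a b] p th by simp
  finally show ?thesis .
 qed
 have "(x / X) powr \<alpha> * (y / Y) powr \<beta> + (x' / X) powr \<alpha> * (y' / Y) powr \<beta> <=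
   (th * (x / X) + (1 - th) * (y / Y)) + (th * (x' / X) + (1 - th) * (y' / Y))"
  using n XY by (intro add_mono key) (auto simp: X_def Y_def)
 also have "... = th * ((x + x') / X) + (1 - th) * ((y + y') / Y)"
  by (simp add: add_divide_distrib algebra_simps)
 also have "... = 1" using XY by (simp add: X_def[symmetric] Y_def[symmetric])
 finally have "((x / X) powr \<alpha> * (y / Y) powr \<beta> + (x' / X) powr \<alpha> * (y' / Y) powr \<beta>) * (X powr \<alpha> * Y powr \<beta>) <= 1 * (X powr \<alpha> * Y powr \<beta>)"
  by (intro mult_right_mono) auto
 then show ?thesis using n XY by (simp add: powr_divide distrib_right X_def Y_def)
qed

lemma hypot_powr: "sqrt (a^2 + c^2) powr p = (a^2 + c^2) powr (p / 2)"
 by (simp add: powr_half_sqrt[symmetric] powr_powr)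

lemma square_powr: "(a^2) powr (p / 2) = \<bar>a\<bar> powr p" for a :: real
 using hypot_powr[of a 0 p] by simp

lemma hypot_powr_ge:
 assumes "p >= 2" shows "\<bar>a\<bar> powr p + \<bar>c\<bar> powr p <= sqrt (a^2 + c^2) powr p"
 using powr_superadd[of "a^2" "c^2" "p / 2"] assms by (simp add: hypot_powr square_powr)

lemma hypot_powr_gt:
 assumes "p > 2" "a ~= 0" "c ~= 0" shows "\<bar>a\<bar> powr p + \<bar>c\<bar> powr p < sqrt (a^2 + c^2) powr p"
 using powr_superadd_strict[of "a^2" "c^2" "p / 2"] assms by (simp add: hypot_powr square_powr)

text \<open>Superadditivity of \<open>x powr (r/2) * y powr (s/2)\<close> applied to squares;
  \<open>r + s >= 2\<close> says that these two exponents add up to at least one.\<close>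

lemma hypot_prod_ge:
 assumes "r > 0" "s > 0" "r + s >= 2"
 shows "\<bar>a\<bar> powr r * \<bar>b\<bar> powr s + \<bar>c\<bar> powr r * \<bar>d\<bar> powr s <= sqrt (a^2 + c^2) powr r * sqrt (b^2 + d^2) powr s"
 using powr_prod_superadd[of "a^2" "b^2" "c^2" "d^2" "r / 2" "s / 2"] assms by (simp add: hypot_powr square_powr)

definition hyp :: "(real ^ 'n => real) => (real ^ 'n => real) => real ^ 'n => real" where
 "hyp u v x = sqrt ((u x)^2 + (v x)^2)"

lemma hyp_H1:
 assumes "u \<in> H1" "v \<in> H1"
 shows "hyp u v \<in> H1" "dir (hyp u v) <= dir u + dir v" "mass (hyp u v) = mass u + mass v"
 using H1_hypot[OF assms] by (simp_all add: hyp_def[abs_def])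

lemma pw_hyp:
 fixes u v :: "real ^ 'n => real"
 assumes p: "subcrit TYPE('n) p" and "u \<in> H1" "v \<in> H1"
 shows "pw p u + pw p v <= pw p (hyp u v)"
proof -
 have "pw p u + pw p v = (LINT x|lebesgue. \<bar>u x\<bar> powr p + \<bar>v x\<bar> powr p)"
  using pw_integrable[OF p] assms by (simp add: pw_def)
 also have "... <= pw p (hyp u v)"
  unfolding pw_def
 proof (rule integral_mono)
  show "\<bar>u x\<bar> powr p + \<bar>v x\<bar> powr p <= \<bar>hyp u v x\<bar> powr p" for x
   using hypot_powr_ge[of p "u x" "v x"] p by (simp add: hyp_def subcrit_def)
 qed (use pw_integrable[OF p] assms hyp_H1(1)[of u v] in auto)
 finally show ?thesis .
qed

lemma cp_hyp:
 fixes u1 u2 v1 v2 :: "real ^ 'n => real"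
 assumes rs: "subcrit TYPE('n) (r + s)" "r > 0" "s > 0" and H: "u1 \<in> H1" "u2 \<in> H1" "v1 \<in> H1" "v2 \<in> H1"
 shows "cp r s u1 u2 + cp r s v1 v2 <= cp r s (hyp u1 v1) (hyp u2 v2)"
proof -
 have "cp r s u1 u2 + cp r s v1 v2 = (LINT x|lebesgue. \<bar>u1 x\<bar> powr r * \<bar>u2 x\<bar> powr s + \<bar>v1 x\<bar> powr r * \<bar>v2 x\<bar> powr s)"
  using cp_integrable(1)[OF rs] H by (simp add: cp_def)
 also have "... <= cp r s (hyp u1 v1) (hyp u2 v2)"
  unfolding cp_def
 proof (rule integral_mono)
  show "\<bar>u1 x\<bar> powr r * \<bar>u2 x\<bar> powr s + \<bar>v1 x\<bar> powr r * \<bar>v2 x\<bar> powr s <= \<bar>hyp u1 v1 x\<bar> powr r * \<bar>hyp u2 v2 x\<bar> powr s" for x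
   using hypot_prod_ge[of r s "u1 x" "u2 x" "v1 x" "v2 x"] rs by (simp add: hyp_def subcrit_def)
 qed (use cp_integrable(1)[OF rs] H hyp_H1(1) in auto)
 finally show ?thesis .
qed

text \<open>At a point of overlap either one component is nonzero in both pairs, and its own power
  term gains, or the pairs occupy different components, and then the coupling, zero for each of them
  there, becomes positive. Each single gain may vanish, so strictness is claimed only for the
  sum.\<close>

lemma hyp_strict:
 fixes u1 u2 v1 v2 :: "real ^ 'n => real"
 assumes p: "subcrit TYPE('n) p" "subcrit TYPE('n) q"
  and rs: "subcrit TYPE('n) (r + s)" "r > 0" "s > 0" and H: "u1 \<in> H1" "u2 \<in> H1" "v1 \<in> H1" "v2 \<in> H1"
  and ov: "~ (ae x. (u1 x = 0 & u2 x = 0) \<or> (v1 x = 0 & v2 x = 0))"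
 shows "pw p u1 + pw p v1 + (pw q u2 + pw q v2) + (cp r s u1 u2 + cp r s v1 v2) <
  pw p (hyp u1 v1) + pw q (hyp u2 v2) + cp r s (hyp u1 v1) (hyp u2 v2)"
proof -
 define f g where "f x = \<bar>u1 x\<bar> powr p + \<bar>v1 x\<bar> powr p + (\<bar>u2 x\<bar> powr q + \<bar>v2 x\<bar> powr q) + (\<bar>u1 x\<bar> powr r * \<bar>u2 x\<bar> powr s + \<bar>v1 x\<bar> powr r * \<bar>v2 x\<bar> powr s)"
  and "g x = \<bar>hyp u1 v1 x\<bar> powr p + \<bar>hyp u2 v2 x\<bar> powr q + \<bar>hyp u1 v1 x\<bar> powr r * \<bar>hyp u2 v2 x\<bar> powr s" for x
 note i = pw_integrable[OF p(1)] pw_integrable[OF p(2)] cp_integrable(1)[OF rs]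
 have iff: "integrable lebesgue f" "integrable lebesgue g"
  unfolding f_def[abs_def] g_def[abs_def] by (intro Bochner_Integration.integrable_add i H hyp_H1(1))+
 have If: "integral\<^sup>L lebesgue f = pw p u1 + pw p v1 + (pw q u2 + pw q v2) + (cp r s u1 u2 + cp r s v1 v2)"
  unfolding f_def[abs_def] using i H by (simp add: pw_def cp_def)
 note ih = i(1)[OF hyp_H1(1)[OF H(1,3)]] i(2)[OF hyp_H1(1)[OF H(2,4)]] i(3)[OF hyp_H1(1)[OF H(1,3)] hyp_H1(1)[OF H(2,4)]]
 have Ig: "integral\<^sup>L lebesgue g = pw p (hyp u1 v1) + pw q (hyp u2 v2) + cp r s (hyp u1 v1) (hyp u2 v2)"
  unfolding g_def[abs_def] using ih by (simp add: pw_def cp_def)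
 have le1: "\<bar>u1 x\<bar> powr p + \<bar>v1 x\<bar> powr p <= \<bar>hyp u1 v1 x\<bar> powr p" for x
  using hypot_powr_ge[of p "u1 x" "v1 x"] p by (simp add: hyp_def subcrit_def)
 have le2: "\<bar>u2 x\<bar> powr q + \<bar>v2 x\<bar> powr q <= \<bar>hyp u2 v2 x\<bar> powr q" for x
  using hypot_powr_ge[of q "u2 x" "v2 x"] p by (simp add: hyp_def subcrit_def)
 have le3: "\<bar>u1 x\<bar> powr r * \<bar>u2 x\<bar> powr s + \<bar>v1 x\<bar> powr r * \<bar>v2 x\<bar> powr s <= \<bar>hyp u1 v1 x\<bar> powr r * \<bar>hyp u2 v2 x\<bar> powr s" for x
  using hypot_prod_ge[of r s "u1 x" "u2 x" "v1 x" "v2 x"] rs by (simp add: hyp_def subcrit_def)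
 have le: "f x <= g x" for x using le1[of x] le2[of x] le3[of x] by (simp add: f_def g_def)
 have strict: "f x < g x" if x: "~ ((u1 x = 0 & u2 x = 0) \<or> (v1 x = 0 & v2 x = 0))" for x
 proof -
  consider "u1 x ~= 0 & v1 x ~= 0" | "u2 x ~= 0 & v2 x ~= 0" | "u1 x ~= 0 & u2 x = 0 & v1 x = 0 & v2 x ~= 0"
   | "u1 x = 0 & u2 x ~= 0 & v1 x ~= 0 & v2 x = 0" using x by blast
  then show ?thesis
  proof cases
   case 1
   then have "\<bar>u1 x\<bar> powr p + \<bar>v1 x\<bar> powr p < \<bar>hyp u1 v1 x\<bar> powr p"
    using hypot_powr_gt[of p "u1 x" "v1 x"] p by (simp add: hyp_def subcrit_def)
   then show ?thesis using le2[of x] le3[of x] by (simp add: f_def g_def)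
  next
   case 2
   then have "\<bar>u2 x\<bar> powr q + \<bar>v2 x\<bar> powr q < \<bar>hyp u2 v2 x\<bar> powr q"
    using hypot_powr_gt[of q "u2 x" "v2 x"] p by (simp add: hyp_def subcrit_def)
   then show ?thesis using le1[of x] le3[of x] by (simp add: f_def g_def)
  next
   case 3
   then have "\<bar>u1 x\<bar> powr r * \<bar>u2 x\<bar> powr s + \<bar>v1 x\<bar> powr r * \<bar>v2 x\<bar> powr s < \<bar>hyp u1 v1 x\<bar> powr r * \<bar>hyp u2 v2 x\<bar> powr s"
    using rs by (simp add: hyp_def)
   then show ?thesis using le1[of x] le2[of x] by (simp add: f_def g_def)
  next
   case 4
   then have "\<bar>u1 x\<bar> powr r * \<bar>u2 x\<bar> powr s + \<bar>v1 x\<bar> powr r * \<bar>v2 x\<bar> powr s < \<bar>hyp u1 v1 x\<bar> powr r * \<bar>hyp u2 v2 x\<bar> powr s"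
    using rs by (simp add: hyp_def)
   then show ?thesis using le1[of x] le2[of x] by (simp add: f_def g_def)
  qed
 qed
 have "integral\<^sup>L lebesgue f < integral\<^sup>L lebesgue g"
 proof (rule ccontr)
  assume "~ ?thesis"
  moreover have "integral\<^sup>L lebesgue f <= integral\<^sup>L lebesgue g" using iff le by (intro integral_mono) auto
  ultimately have "(LINT x|lebesgue. g x - f x) = 0" using iff by simp
  then have "ae x. g x - f x = 0"
   using iff le by (subst (asm) integral_nonneg_eq_0_iff_AE) auto
  then have "ae x. (u1 x = 0 & u2 x = 0) \<or> (v1 x = 0 & v2 x = 0)"
   by eventually_elim (use strict in force)
  with ov show False by blast
 qed
 then show ?thesis by (simp add: If Ig)
qed

section \<open>Extraction of profiles\<close>

lemma AE_ex_overlap: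
 fixes u1 u2 v1 v2 :: "real ^ 'n => real"
 assumes H: "u1 \<in> H1" "u2 \<in> H1" "v1 \<in> H1" "v2 \<in> H1"
  and u: "mass u1 > 0 \<or> mass u2 > 0" and v: "mass v1 > 0 \<or> mass v2 > 0"
 obtains h where "~ (ae x. (u1 x = 0 & u2 x = 0) \<or> (v1 (x + h) = 0 & v2 (x + h) = 0))"
proof -
 have S: "{x. a x ~= 0 \<or> b x ~= 0} \<in> sets lebesgue & emeasure lebesgue {x. a x ~= 0 \<or> b x ~= 0} ~= 0"
  if "a \<in> H1" "b \<in> H1" "mass a > 0 \<or> mass b > 0" for a b :: "real ^ 'n => real"
 proof
  have "Measurable.pred lebesgue (%x. a x ~= 0 \<or> b x ~= 0)"
   using H1_measurable[OF that(1)] H1_measurable[OF that(2)] by measurable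
  then show s: "{x. a x ~= 0 \<or> b x ~= 0} \<in> sets lebesgue" by (simp add: pred_def)
  show "emeasure lebesgue {x. a x ~= 0 \<or> b x ~= 0} ~= 0"
  proof
   assume "emeasure lebesgue {x. a x ~= 0 \<or> b x ~= 0} = 0"
   then have "{x. a x ~= 0 \<or> b x ~= 0} \<in> null_sets lebesgue" using s by auto
   from AE_not_in[OF this] have "ae x. ~ (a x ~= 0 \<or> b x ~= 0)" by eventually_elim simp
   then have "ae x. a x = 0" "ae x. b x = 0" by (auto elim: eventually_mono)
   then have "mass a = 0" "mass b = 0" using mass_eq_0_iff H1_L2 that by blast+
   then show False using that by simp
  qed
 qed
 obtain h where h: "emeasure lebesgue {x \<in> {x. u1 x ~= 0 \<or> u2 x ~= 0}. x + h \<in> {x. v1 x ~= 0 \<or> v2 x ~= 0}} ~= 0"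
  using overlap_translate S[OF H(1,2) u] S[OF H(3,4) v] by blast
 have "~ (ae x. (u1 x = 0 & u2 x = 0) \<or> (v1 (x + h) = 0 & v2 (x + h) = 0))"
 proof
  assume "ae x. (u1 x = 0 & u2 x = 0) \<or> (v1 (x + h) = 0 & v2 (x + h) = 0)"
  then obtain N where N: "N \<in> null_sets lebesgue" "!!x. x \<notin> N ==> (u1 x = 0 & u2 x = 0) \<or> (v1 (x + h) = 0 & v2 (x + h) = 0)"
   by (auto elim!: AE_E3)
  have "emeasure lebesgue {x \<in> {x. u1 x ~= 0 \<or> u2 x ~= 0}. x + h \<in> {x. v1 x ~= 0 \<or> v2 x ~= 0}} <= emeasure lebesgue N"
   using N by (intro emeasure_mono) auto
  then show False using h N by auto
 qed
 then show ?thesis by (rule that)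
qed

text \<open>Recentring at the points where the averages stay large keeps the pairing with the
  indicator of one cube away from zero, and this pairing passes to the limit; hence \<open>w\<close>
  is nonzero. The companion sequence \<open>u'\<close> undergoes the same translations and
  subsequences.\<close>

lemma profile_one:
 fixes u u' :: "nat => real ^ 'n => real"
 assumes u: "!!n. u n \<in> H1" "!!n. mass (u n) <= m" "!!n. dir (u n) <= d"
  and u': "!!n. u' n \<in> H1" "!!n. mass (u' n) <= m" "!!n. dir (u' n) <= d"
  and nv: "~ vanishing u"
 obtains sg y w w' where "strict_mono (sg :: nat => nat)" "w \<in> H1" "w' \<in> H1" "mass w > 0"
  "ae x. (%n. u (sg n) (x + y n)) ----> w x" "ae x. (%n. u' (sg n) (x + y n)) ----> w' x"
proof -
 obtain j \<eta> where \<eta>: "\<eta> > 0" "~ (\<forall>\<^sub>F n in sequentially. \<forall>x. \<bar>cube_avg (1 / real (Suc j)) (u n) x\<bar> <= \<eta>)"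
  using nv unfolding vanishing_def by blast
 define e where "e = 1 / real (Suc j)"
 have e: "e > 0" by (simp add: e_def)
 have "infinite {n. \<exists>x. \<bar>cube_avg e (u n) x\<bar> > \<eta>}"
  using \<eta>(2) unfolding eventually_sequentially infinite_nat_iff_unbounded_le e_def[symmetric]
  by (metis linorder_not_le mem_Collect_eq)
 from infinite_enumerate[OF this] obtain tau :: "nat => nat" where tau0: "strict_mono tau" "\<forall>n. tau n \<in> {n. \<exists>x. \<bar>cube_avg e (u n) x\<bar> > \<eta>}"
  by (elim exE conjE)
 then have tau: "strict_mono tau" "!!n. \<exists>x. \<bar>cube_avg e (u (tau n)) x\<bar> > \<eta>" by auto
 then obtain z where z: "!!n. \<bar>cube_avg e (u (tau n)) (z n)\<bar> > \<eta>" by metis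
 define U where "U n x = u (tau n) (x + z n)" for n x
 define U' where "U' n x = u' (tau n) (x + z n)" for n x
 have U: "U n \<in> H1" "mass (U n) <= m" "dir (U n) <= d" for n
  unfolding U_def using H1_translate[OF u(1)] mass_translate[OF H1_measurable[OF u(1)]] u by auto
 have U': "U' n \<in> H1" "mass (U' n) <= m" "dir (U' n) <= d" for n
  unfolding U'_def using H1_translate[OF u'(1)] mass_translate[OF H1_measurable[OF u'(1)]] u' by auto
 obtain sg1 w where 1: "strict_mono sg1" "w \<in> H1" "ae x. (%n. U (sg1 n) x) ----> w x"
  by (rule Rellich[OF U])
 obtain sg2 w' where 2: "strict_mono sg2" "w' \<in> H1" "ae x. (%n. U' (sg1 (sg2 n)) x) ----> w' x"
  by (rule Rellich[of "%n. U' (sg1 n)", OF U'])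
 have ae: "ae x. (%n. U (sg1 (sg2 n)) x) ----> w x"
  using 1(3) by eventually_elim (use LIMSEQ_subseq_LIMSEQ[OF _ 2(1)] in \<open>fastforce simp: comp_def\<close>)
 have avgU: "\<bar>cube_avg e (U n) 0\<bar> > \<eta>" for n
  using z[of n] cube_avg_translate[of e "u (tau n)" "z n" 0] by (simp add: U_def[abs_def])
 have "mass w ~= 0"
 proof
  assume "mass w = 0"
  then have w0: "ae x. w x = 0" using mass_eq_0_iff[OF H1_L2[OF 1(2)]] by simp
  have ae0: "ae x. (%n. U (sg1 n) x) ----> 0" using 1(3) w0 by eventually_elim simp
  have "(%n. ip (U (sg1 n)) (indicator (cube e))) ----> 0"
   by (rule ip_tendsto_0_AE(2)[OF H1_L2[OF U(1)] U(2) indicator_L2[OF cube_lmeasurable] ae0])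
  then have "(%n. ip (U (sg1 n)) (indicator (cube e)) / e ^ CARD('n)) ----> 0 / e ^ CARD('n)"
   using e by (intro tendsto_intros) auto
  then have "(%n. \<bar>cube_avg e (U (sg1 n)) 0\<bar>) ----> \<bar>0\<bar>" unfolding cube_avg_def by (intro tendsto_rabs) simp
  then have "\<eta> <= \<bar>0\<bar>" by (rule LIMSEQ_le_const) (use avgU in \<open>auto intro: less_imp_le\<close>)
  then show False using \<eta> by simp
 qed
 then have "mass w > 0" using mass_nonneg[of w] by linarith
 then show ?thesis
  using that[of "%n. tau (sg1 (sg2 n))" w w' "%n. z (sg1 (sg2 n))"] tau(1) 1 2 ae
  unfolding U_def U'_def by (auto simp: strict_mono_def)
qed

lemma profile:
 fixes u1 u2 :: "nat => real ^ 'n => real"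
 assumes u1: "!!n. u1 n \<in> H1" "!!n. mass (u1 n) <= m" "!!n. dir (u1 n) <= d"
  and u2: "!!n. u2 n \<in> H1" "!!n. mass (u2 n) <= m" "!!n. dir (u2 n) <= d"
  and nv: "~ (vanishing u1 & vanishing u2)"
 obtains sg y w1 w2 where "strict_mono (sg :: nat => nat)" "w1 \<in> H1" "w2 \<in> H1" "mass w1 > 0 \<or> mass w2 > 0"
  "ae x. (%n. u1 (sg n) (x + y n)) ----> w1 x" "ae x. (%n. u2 (sg n) (x + y n)) ----> w2 x"
proof (cases "vanishing u1")
 case False
 obtain sg y w w' where "strict_mono (sg :: nat => nat)" "w \<in> H1" "w' \<in> H1" "mass w > 0"
  "ae x. (%n. u1 (sg n) (x + y n)) ----> w x" "ae x. (%n. u2 (sg n) (x + y n)) ----> w' x"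
  by (rule profile_one[OF u1 u2 False])
 then show ?thesis by (intro that[of sg w w' y]) auto
next
 case True
 then have "~ vanishing u2" using nv by simp
 obtain sg y w w' where "strict_mono (sg :: nat => nat)" "w \<in> H1" "w' \<in> H1" "mass w > 0"
  "ae x. (%n. u2 (sg n) (x + y n)) ----> w x" "ae x. (%n. u1 (sg n) (x + y n)) ----> w' x"
  by (rule profile_one[OF u2 u1 \<open>~ vanishing u2\<close>])
 then show ?thesis by (intro that[of sg w' w y]) auto
qed

text \<open>The functionals are translation invariant, so the splitting statements for the recentred
  sequence become additivity statements for the original one.\<close>

lemma remainder:
 fixes u v :: "nat => real ^ 'n => real"
 assumes u: "!!n. u n \<in> H1" "!!n. mass (u n) <= m" "!!n. dir (u n) <= d" and w: "w \<in> H1"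
  and ae: "ae x. (%n. u (sg n) (x + y n)) ----> w x"
  and v_def: "v = (%n x. u (sg n) (x + y n) - w x)"
 shows "!!n. v n \<in> H1" "!!n. mass (v n) <= 2 * m + 2 * mass w" "!!n. dir (v n) <= 2 * d + 2 * dir w"
  "ae x. (%n. v n x) ----> 0"
  "(%n. mass (u (sg n)) - mass (v n)) ----> mass w"
  "(%n. dir (u (sg n)) - dir (v n)) ----> dir w"
  "!!p. subcrit TYPE('n) p ==> (%n. pw p (u (sg n)) - pw p (v n)) ----> pw p w"
proof -
 have U: "(%x. u (sg n) (x + y n)) \<in> H1" "dir (%x. u (sg n) (x + y n)) = dir (u (sg n))"
  "mass (%x. u (sg n) (x + y n)) = mass (u (sg n))" "pw p (%x. u (sg n) (x + y n)) = pw p (u (sg n))" for n p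
  using H1_translate[OF u(1)] mass_translate[OF H1_measurable[OF u(1)]] pw_translate[OF H1_measurable[OF u(1)]] by auto
 have v: "v n \<in> H1" for n unfolding v_def by (rule H1_diff[OF U(1) w])
 have "mass (%x. u (sg n) (x + y n) - w x) <= 2 * mass (%x. u (sg n) (x + y n)) + 2 * mass w" for n
  by (rule mass_diff_le[OF H1_L2[OF U(1)] H1_L2[OF w]])
 then have "mass (v n) <= 2 * mass (u (sg n)) + 2 * mass w" for n by (simp add: v_def U(3))
 then have vm: "mass (v n) <= 2 * m + 2 * mass w" for n using u(2)[of "sg n"] by (meson add_right_mono mult_left_mono order_trans zero_le_numeral)
 have "dir (v n) <= 2 * dir (u (sg n)) + 2 * dir w" for n
 proof -
  have "dir (%x. u (sg n) (x + y n) + 1 * w x) = dir (u (sg n)) + 2 * gip (%x. u (sg n) (x + y n)) w + dir w"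
   using dir_add_scaled[OF U(1)[of n] w, of 1] U(2)[of n] by (simp del: mult_1)
  moreover have "dir (v n) = dir (u (sg n)) - 2 * gip (%x. u (sg n) (x + y n)) w + dir w"
   unfolding v_def using dir_diff[OF U(1)[of n] w] U(2)[of n] by simp
  ultimately show ?thesis using dir_nonneg[of "%x. u (sg n) (x + y n) + 1 * w x"] by linarith
 qed
 then have vd: "dir (v n) <= 2 * d + 2 * dir w" for n using u(3)[of "sg n"] by (meson add_right_mono mult_left_mono order_trans zero_le_numeral)
 have vae: "ae x. (%n. v n x) ----> 0"
  using ae
 proof eventually_elim
  case (elim x)
  from tendsto_diff[OF elim tendsto_const[of "w x"]] show ?case by (simp add: v_def)
 qed
 have vw: "(%x. v n x + w x) = (%x. u (sg n) (x + y n))" for n by (simp add: v_def)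
 show "v n \<in> H1" "mass (v n) <= 2 * m + 2 * mass w" "dir (v n) <= 2 * d + 2 * dir w" for n by (fact v vm vd)+
 show "ae x. (%n. v n x) ----> 0" by (fact vae)
 show "(%n. mass (u (sg n)) - mass (v n)) ----> mass w"
  using mass_splitting[OF H1_L2[OF v] vm H1_L2[OF w] vae] unfolding vw U .
 show "(%n. dir (u (sg n)) - dir (v n)) ----> dir w"
  using dir_splitting[OF v vm vd w vae] unfolding vw U .
 show "(%n. pw p (u (sg n)) - pw p (v n)) ----> pw p w" if "subcrit TYPE('n) p" for p
  using pw_splitting[OF that v vm vd w vae] unfolding vw U .
qed

lemma remainder_cp:
 fixes u1 u2 v1 v2 :: "nat => real ^ 'n => real"
 assumes rs: "subcrit TYPE('n) (r + s)" "r > 0" "s > 0"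
  and u1: "!!n. u1 n \<in> H1" "!!n. mass (u1 n) <= m" "!!n. dir (u1 n) <= d" and w1: "w1 \<in> H1"
  and ae1: "ae x. (%n. u1 (sg n) (x + y n)) ----> w1 x"
  and v1: "v1 = (%n x. u1 (sg n) (x + y n) - w1 x)"
  and u2: "!!n. u2 n \<in> H1" "!!n. mass (u2 n) <= m" "!!n. dir (u2 n) <= d" and w2: "w2 \<in> H1"
  and ae2: "ae x. (%n. u2 (sg n) (x + y n)) ----> w2 x"
  and v2: "v2 = (%n x. u2 (sg n) (x + y n) - w2 x)"
 shows "(%n. cp r s (u1 (sg n)) (u2 (sg n)) - cp r s (v1 n) (v2 n)) ----> cp r s w1 w2"
proof -
 note R1 = remainder[where u = u1 and sg = sg and y = y and w = w1 and v = v1, OF u1 w1 ae1 v1]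
  and R2 = remainder[where u = u2 and sg = sg and y = y and w = w2 and v = v2, OF u2 w2 ae2 v2]
 define c e where "c = max (2 * m + 2 * mass w1) (2 * m + 2 * mass w2)" and "e = max (2 * d + 2 * dir w1) (2 * d + 2 * dir w2)"
 have b: "mass (v1 n) <= c" "dir (v1 n) <= e" "mass (v2 n) <= c" "dir (v2 n) <= e" for n
  using R1(2,3)[of n] R2(2,3)[of n] by (auto simp: c_def e_def)
 have "(%n. cp r s (%x. v1 n x + w1 x) (%x. v2 n x + w2 x) - cp r s (v1 n) (v2 n)) ----> cp r s w1 w2"
  by (rule cp_splitting[OF rs R1(1) b(1,2) R2(1) b(3,4) w1 w2 R1(4) R2(4)])
 then show ?thesis using cp_translate[OF H1_measurable[OF u1(1)] H1_measurable[OF u2(1)]] by (simp add: v1 v2)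
qed

subsection \<open>The Euler--Lagrange equation\<close>

lemma abs_powr_DERIV:
 fixes q x :: real
 assumes q: "q > 1"
 shows "((%x. \<bar>x\<bar> powr q) has_real_derivative q * (\<bar>x\<bar> powr (q - 2) * x)) (at x)"
proof (cases x "0 :: real" rule: linorder_cases)
 case greater
 have "((%x. x powr q) has_real_derivative q * x powr (q - 1)) (at x)"
  using greater by (auto intro!: derivative_eq_intros)
 then have "((%x. \<bar>x\<bar> powr q) has_real_derivative q * x powr (q - 1)) (at x)"
  by (rule has_field_derivative_transform_within_open[of _ _ _ "{0<..}"]) (use greater in auto)
 moreover have "x powr (q - 1) = x powr (q - 2) * x" using greater powr_add[of x "q - 2" 1] by simp
 ultimately show ?thesis using greater by simp
next
 case less
 have "((%x. (- x) powr q) has_real_derivative q * (- x) powr (q - 1) * (-1)) (at x)"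
  using less by (auto intro!: derivative_eq_intros)
 then have "((%x. \<bar>x\<bar> powr q) has_real_derivative q * (- x) powr (q - 1) * (-1)) (at x)"
  by (rule has_field_derivative_transform_within_open[of _ _ _ "{..<0}"]) (use less in auto)
 moreover have "(- x) powr (q - 1) = (- x) powr (q - 2) * (- x)" using less powr_add[of "- x" "q - 2" 1] by simp
 ultimately show ?thesis using less by (simp add: mult.assoc)
next
 case equal
 have "((%h. \<bar>h\<bar> powr (q - 1)) \<longlongrightarrow> \<bar>0\<bar> powr (q - 1)) (at (0::real))"
  using q by (intro tendsto_powr' tendsto_intros) auto
 then have l: "((%h. \<bar>h\<bar> powr (q - 1)) \<longlongrightarrow> 0) (at (0::real))" by simp
 have "((%h. (\<bar>0 + h\<bar> powr q - \<bar>0\<bar> powr q) / h) \<longlongrightarrow> 0) (at (0::real))"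
 proof (rule Lim_null_comparison[OF _ l])
  have "norm ((\<bar>0 + h\<bar> powr q - \<bar>0\<bar> powr q) / h) <= \<bar>h\<bar> powr (q - 1)" if "h ~= 0" for h :: real
   using that powr_add[of "\<bar>h\<bar>" "q - 1" 1] by (simp add: field_simps)
  then show "\<forall>\<^sub>F h in at (0::real). norm ((\<bar>0 + h\<bar> powr q - \<bar>0\<bar> powr q) / h) <= \<bar>h\<bar> powr (q - 1)"
   by (auto simp: eventually_at intro!: exI[of _ 1])
 qed
 then show ?thesis using equal by (simp add: DERIV_def)
qed

lemma abs_powr_line_DERIV:
 fixes q a b t :: real
 assumes q: "q > 1"
 shows "((%t. \<bar>a + t * b\<bar> powr q) has_real_derivative q * (\<bar>a + t * b\<bar> powr (q - 2) * (a + t * b)) * b) (at t)"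
proof -
 have "((%t. a + t * b) has_real_derivative b) (at t)" by (auto intro!: derivative_eq_intros)
 from DERIV_chain2[OF abs_powr_DERIV[OF q] this] show ?thesis .
qed

text \<open>A majorant uniform in \<open>t\<close>, from the mean value theorem and the maximum of
  \<open>|a|\<close> and \<open>|b|\<close>; it dominates the quotients in
  \<open>powr_integral_DERIV\<close>.\<close>

lemma abs_powr_quotient_bound:
 fixes q a b t C :: real
 assumes q: "q > 1" and t: "t ~= 0" "\<bar>t\<bar> <= C"
 shows "\<bar>(\<bar>a + t * b\<bar> powr q - \<bar>a\<bar> powr q) / t\<bar> <= q * (1 + C) powr q * (\<bar>a\<bar> powr q + \<bar>b\<bar> powr q)"
proof -
 let ?f' = "%t. q * (\<bar>a + t * b\<bar> powr (q - 2) * (a + t * b)) * b"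
 have "\<exists>z. \<bar>z\<bar> <= \<bar>t\<bar> & \<bar>a + t * b\<bar> powr q - \<bar>a + 0 * b\<bar> powr q = t * ?f' z"
 proof (cases "t > 0")
  case True
  from MVT2[of 0 t, OF True abs_powr_line_DERIV[OF q]]
  obtain z where "z > 0" "z < t" "\<bar>a + t * b\<bar> powr q - \<bar>a + 0 * b\<bar> powr q = (t - 0) * ?f' z" by blast
  then show ?thesis by (intro exI[of _ z]) auto
 next
  case False
  then have "t < 0" using t by simp
  from MVT2[of t 0, OF this abs_powr_line_DERIV[OF q]]
  obtain z where "z > t" "z < 0" "\<bar>a + 0 * b\<bar> powr q - \<bar>a + t * b\<bar> powr q = (0 - t) * ?f' z" by blast
  then show ?thesis by (intro exI[of _ z]) auto
 qed
 then obtain z where z: "\<bar>z\<bar> <= \<bar>t\<bar>" "\<bar>a + t * b\<bar> powr q - \<bar>a\<bar> powr q = t * ?f' z" by auto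
 define M where "M = max \<bar>a\<bar> \<bar>b\<bar>"
 have M: "M >= 0" "\<bar>a\<bar> <= M" "\<bar>b\<bar> <= M" by (auto simp: M_def)
 have C: "C >= 0" using t(2) by linarith
 have "\<bar>a + z * b\<bar> <= \<bar>a\<bar> + \<bar>z\<bar> * \<bar>b\<bar>" using abs_triangle_ineq[of a "z * b"] by (simp add: abs_mult)
 also have "... <= M + C * M" by (intro add_mono mult_mono) (use z(1) t(2) M C in linarith)+
 finally have zb: "\<bar>a + z * b\<bar> <= (1 + C) * M" by (simp add: distrib_right)
 have eq: "\<bar>\<bar>y\<bar> powr (q - 2) * y\<bar> = \<bar>y\<bar> powr (q - 1)" for y :: real
 proof (cases "y = 0")
  case False
  then show ?thesis using powr_add[of "\<bar>y\<bar>" "q - 2" 1] by (simp add: abs_mult)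
 qed simp
 have "\<bar>(\<bar>a + t * b\<bar> powr q - \<bar>a\<bar> powr q) / t\<bar> = q * \<bar>a + z * b\<bar> powr (q - 1) * \<bar>b\<bar>"
  unfolding z(2) using t q eq[of "a + z * b"] by (simp add: abs_mult)
 also have "... <= q * ((1 + C) * M) powr (q - 1) * ((1 + C) * M)"
 proof (intro mult_mono powr_mono2 zb)
  have "1 * M <= (1 + C) * M" using C M by (intro mult_right_mono) auto
  then show "\<bar>b\<bar> <= (1 + C) * M" using M by linarith
 qed (use q M C in auto)
 also have "... = q * ((1 + C) * M) powr q"
 proof (cases "M = 0")
  case False
  then have "(1 + C) * M > 0" using M C by (simp add: less_le)
  then show ?thesis using powr_add[of "(1 + C) * M" "q - 1" 1] by simp
 qed (use q in simp)
 also have "... = q * (1 + C) powr q * M powr q" using M C by (simp add: powr_mult)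
 also have "... <= q * (1 + C) powr q * (\<bar>a\<bar> powr q + \<bar>b\<bar> powr q)"
  using q by (intro mult_left_mono) (auto simp: M_def max_def)
 finally show ?thesis .
qed

text \<open>The weight \<open>\<omega>\<close> unifies the two uses: the constant one for the power
  terms, \<open>|v| powr s\<close> for the coupling, where only one component moves.\<close>

lemma powr_integral_DERIV:
 fixes u phi \<omega> :: "'a => real"
 assumes q: "q > 1" and m: "u \<in> borel_measurable M" "phi \<in> borel_measurable M" "\<omega> \<in> borel_measurable M"
  and \<omega>: "!!x. \<omega> x >= 0"
  and i: "integrable M (%x. \<bar>u x\<bar> powr q * \<omega> x)" "integrable M (%x. \<bar>phi x\<bar> powr q * \<omega> x)"
  and it: "!!t. integrable M (%x. \<bar>u x + t * phi x\<bar> powr q * \<omega> x)"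
 shows "((%t. LINT x|M. \<bar>u x + t * phi x\<bar> powr q * \<omega> x) has_real_derivative
  q * (LINT x|M. \<bar>u x\<bar> powr (q - 2) * u x * phi x * \<omega> x)) (at 0)"
 unfolding DERIV_def tendsto_at_iff_sequentially
proof (intro allI impI)
 fix X :: "nat => real" assume X: "\<forall>n. X n \<in> UNIV - {0}" "X ----> 0"
 obtain C where C: "C > 0" "!!n. \<bar>X n\<bar> <= C"
  using convergent_imp_Bseq[of X] X(2) by (auto simp: convergent_def Bseq_def)
 define Q where "Q n x = (\<bar>u x + X n * phi x\<bar> powr q - \<bar>u x\<bar> powr q) / X n * \<omega> x" for n x
 have [measurable]: "u \<in> borel_measurable M" "phi \<in> borel_measurable M" "\<omega> \<in> borel_measurable M" by fact+
 have "(%n. LINT x|M. Q n x) ----> (LINT x|M. q * (\<bar>u x\<bar> powr (q - 2) * u x * phi x * \<omega> x))"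
 proof (rule integral_dominated_convergence[where w = "%x. q * (1 + C) powr q * (\<bar>u x\<bar> powr q * \<omega> x + \<bar>phi x\<bar> powr q * \<omega> x)"])
  show "integrable M (%x. q * (1 + C) powr q * (\<bar>u x\<bar> powr q * \<omega> x + \<bar>phi x\<bar> powr q * \<omega> x))"
   using i by simp
  show "AE x in M. (%n. Q n x) ----> q * (\<bar>u x\<bar> powr (q - 2) * u x * phi x * \<omega> x)"
  proof (intro AE_I2)
   fix x
   have "((%h. (\<bar>u x + (0 + h) * phi x\<bar> powr q - \<bar>u x + 0 * phi x\<bar> powr q) / h) \<longlongrightarrow>
     q * (\<bar>u x + 0 * phi x\<bar> powr (q - 2) * (u x + 0 * phi x)) * phi x) (at 0)"
    using abs_powr_line_DERIV[OF q, of "u x" "phi x" 0] unfolding DERIV_def .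
   then have "(%n. (\<bar>u x + X n * phi x\<bar> powr q - \<bar>u x\<bar> powr q) / X n) ----> q * (\<bar>u x\<bar> powr (q - 2) * u x) * phi x"
    using X unfolding tendsto_at_iff_sequentially by (auto simp: comp_def)
   from tendsto_mult[OF this tendsto_const[of "\<omega> x"]]
   show "(%n. Q n x) ----> q * (\<bar>u x\<bar> powr (q - 2) * u x * phi x * \<omega> x)" by (simp add: Q_def mult.assoc)
  qed
  show "AE x in M. norm (Q n x) <= q * (1 + C) powr q * (\<bar>u x\<bar> powr q * \<omega> x + \<bar>phi x\<bar> powr q * \<omega> x)" for n
  proof (intro AE_I2)
   fix x
   have "norm (Q n x) = \<bar>(\<bar>u x + X n * phi x\<bar> powr q - \<bar>u x\<bar> powr q) / X n\<bar> * \<omega> x"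
    unfolding Q_def using \<omega>[of x] by (simp add: abs_mult)
   also have "... <= q * (1 + C) powr q * (\<bar>u x\<bar> powr q + \<bar>phi x\<bar> powr q) * \<omega> x"
    using X(1) C(2) \<omega> by (intro mult_right_mono abs_powr_quotient_bound q) auto
   finally show "norm (Q n x) <= q * (1 + C) powr q * (\<bar>u x\<bar> powr q * \<omega> x + \<bar>phi x\<bar> powr q * \<omega> x)"
    by (simp add: algebra_simps)
  qed
 qed (unfold Q_def, measurable)
 moreover have "(LINT x|M. Q n x) = ((LINT x|M. \<bar>u x + (0 + X n) * phi x\<bar> powr q * \<omega> x) - (LINT x|M. \<bar>u x + 0 * phi x\<bar> powr q * \<omega> x)) / X n" for n
 proof -
  have "(%x. Q n x) = (%x. (\<bar>u x + X n * phi x\<bar> powr q * \<omega> x - \<bar>u x\<bar> powr q * \<omega> x) / X n)"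
   by (simp add: Q_def fun_eq_iff left_diff_distrib)
  then show ?thesis using i(1) it[of "X n"] by simp
 qed
 ultimately show "((%h. ((LINT x|M. \<bar>u x + (0 + h) * phi x\<bar> powr q * \<omega> x) - (LINT x|M. \<bar>u x + 0 * phi x\<bar> powr q * \<omega> x)) / h) \<circ> X)
   ----> q * (LINT x|M. \<bar>u x\<bar> powr (q - 2) * u x * phi x * \<omega> x)"
  by (simp add: comp_def)
qed

lemma pw_DERIV:
 fixes u phi :: "real ^ 'n => real"
 assumes p: "subcrit TYPE('n) p" and u: "u \<in> H1" and phi: "phi \<in> H1"
 shows "((%t. pw p (%x. u x + t * phi x)) has_real_derivative p * (LINT x|lebesgue. \<bar>u x\<bar> powr (p - 2) * u x * phi x)) (at 0)"
 using powr_integral_DERIV[of p u lebesgue phi "%x. 1"] p H1_measurable[OF u] H1_measurable[OF phi]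
  pw_integrable[OF p u] pw_integrable[OF p phi] pw_integrable[OF p H1_add[OF u H1_cmult[OF phi]]]
 by (simp add: pw_def subcrit_def)

lemma cp_DERIV:
 fixes u v phi :: "real ^ 'n => real"
 assumes rs: "subcrit TYPE('n) (r + s)" "r > 1" "s > 0" and u: "u \<in> H1" and v: "v \<in> H1" and phi: "phi \<in> H1"
 shows "((%t. cp r s (%x. u x + t * phi x) v) has_real_derivative
  r * (LINT x|lebesgue. \<bar>u x\<bar> powr (r - 2) * u x * phi x * \<bar>v x\<bar> powr s)) (at 0)"
proof -
 have m: "(%x. \<bar>v x\<bar> powr s) \<in> lmeas" using H1_measurable[OF v] by measurable
 have r0: "r > 0" using rs by simp
 show ?thesis unfolding cp_def
  by (rule powr_integral_DERIV) (use m rs H1_measurable[OF u] H1_measurable[OF phi] cp_integrable(1)[OF rs(1) r0 rs(3) _ v] u phi H1_add[OF u H1_cmult[OF phi]] in auto)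
qed

text \<open>The line through \<open>u\<close> in direction \<open>phi\<close>, projected back to the
  sphere of mass \<open>mass u\<close>. Where the line has mass zero the quotient is zero by
  convention, so preservation of mass is claimed only for parameters near zero.\<close>

definition curve :: "(real ^ 'n => real) => (real ^ 'n => real) => real => real ^ 'n => real" where
 "curve u phi t x = sqrt (mass u / mass (%x. u x + t * phi x)) * (u x + t * phi x)"

lemma curve_H1: "u \<in> H1 ==> phi \<in> H1 ==> curve u phi t \<in> H1"
 unfolding curve_def[abs_def] by (intro H1_cmult H1_add)

lemma pw_cmult: "pw p (%x. c * u x) = \<bar>c\<bar> powr p * pw p u"
 by (simp add: pw_def abs_mult powr_mult)

lemma cp_cmult_left: "cp r s (%x. c * u x) v = \<bar>c\<bar> powr r * cp r s u v"
 by (simp add: cp_def abs_mult powr_mult mult.assoc)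

lemma cp_cmult_right: "cp r s u (%x. c * v x) = \<bar>c\<bar> powr s * cp r s u v"
 using cp_cmult_left[of s r c v u] by (simp add: cp_commute)

lemma mass_line: "u \<in> L2 ==> phi \<in> L2 ==> mass (%x. u x + t * phi x) = mass u + 2 * t * ip u phi + t^2 * mass phi"
 using mass_add[OF _ L2_cmult, of u phi t] by (simp add: mass_cmult ip_cmult_right)

text \<open>Lagrange multiplier rule: if moving along the mass-preserving curves through \<open>u\<close> does not
 decrease the functional, evaluated at scales \<open>T tau \<rightarrow> 1\<close>, then \<open>u\<close> solves the equation.\<close>

lemma Euler_Lagrange:
 fixes u v :: "real ^ 'n => real"
 assumes p: "subcrit TYPE('n) p" and rs: "subcrit TYPE('n) (r + s)" "r > 1" "s > 0"
  and u: "u \<in> H1" "mass u > 0" and v: "v \<in> H1"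
  and min: "!!phi. phi \<in> H1 ==> \<forall>\<^sub>F tau in at 0. mass (curve u phi tau) = mass u ==>
   ((%tau. dir (curve u phi tau)) \<longlongrightarrow> dir u) (at 0) ==> ((%tau. pw p (curve u phi tau)) \<longlongrightarrow> pw p u) (at 0) ==>
   ((%tau. cp r s (curve u phi tau) v) \<longlongrightarrow> cp r s u v) (at 0) ==> \<exists>T. (T \<longlongrightarrow> 1) (at 0) &
   (\<forall>\<^sub>F tau in at 0. 0 <= (T tau)^2 / 2 * (dir (curve u phi tau) - dir u) - \<mu> / p * T tau powr \<alpha> * (pw p (curve u phi tau) - pw p u)
    - \<beta> * T tau powr \<gamma> * (cp r s (curve u phi tau) v - cp r s u v))"
 defines "l \<equiv> (dir u - \<mu> * pw p u - \<beta> * r * cp r s u v) / mass u"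
 assumes phi: "phi \<in> H1"
 shows "gip u phi = l * ip u phi + \<mu> * (LINT x|lebesgue. \<bar>u x\<bar> powr (p - 2) * u x * phi x)
  + \<beta> * r * (LINT x|lebesgue. \<bar>u x\<bar> powr (r - 2) * u x * \<bar>v x\<bar> powr s * phi x)"
proof -
 have p0: "p > 0" using p by (simp add: subcrit_def)
 have uL: "u \<in> L2" "phi \<in> L2" using u phi by auto
 define m where "m t = mass u + 2 * t * ip u phi + t^2 * mass phi" for t
 define s' where "s' t = sqrt (mass u / m t)" for t
 have cu: "curve u phi t = (%x. s' t * (u x + t * phi x))" for t
  unfolding curve_def[abs_def] s'_def m_def mass_line[OF uL] ..
 have m0: "m 0 = mass u" by (simp add: m_def)
 have s0: "s' 0 = 1" using u(2) by (simp add: s'_def m0)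
 \<comment> \<open>The derivative at zero of the normalising factor; its contribution to the first
   variation becomes the multiplier term \<open>l * ip u phi\<close>.\<close>
 define \<kappa> where "\<kappa> = - ip u phi / mass u"
 have "(m has_real_derivative 2 * ip u phi) (at 0)" unfolding m_def by (auto intro!: derivative_eq_intros)
 then have md: "((%t. mass u / m t) has_real_derivative - mass u * (2 * ip u phi) / (m 0)^2) (at 0)"
  using u(2) m0 by (auto intro!: derivative_eq_intros simp: power2_eq_square)
 have "((%t. sqrt (mass u / m t)) has_real_derivative (inverse (sqrt (mass u / m 0)) / 2) * (- mass u * (2 * ip u phi) / (m 0)^2)) (at 0)"
  by (rule DERIV_chain2[OF DERIV_real_sqrt md]) (use u(2) m0 in simp)
 moreover have "(inverse (sqrt (mass u / m 0)) / 2) * (- mass u * (2 * ip u phi) / (m 0)^2) = \<kappa>"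
  using u(2) by (simp add: m0 \<kappa>_def power2_eq_square)
 ultimately have sd: "(s' has_real_derivative \<kappa>) (at 0)" unfolding s'_def[abs_def] by simp
 have sn: "s' t >= 0" for t
  unfolding s'_def m_def mass_line[OF uL, symmetric] by simp
 have spos: "\<forall>\<^sub>F t in nhds 0. s' t > 0"
  using DERIV_isCont[OF sd] s0 order_tendstoD(1)[of s' "s' 0" "nhds 0" 0] by (simp add: isCont_def tendsto_nhds_iff)
 have spd: "((%t. \<bar>s' t\<bar> powr q) has_real_derivative q * \<kappa>) (at 0)" if "q > 1" for q
  using DERIV_chain2[OF abs_powr_DERIV[OF that] sd] s0 by simp
 have A: "((%t. dir (curve u phi t)) has_real_derivative 2 * gip u phi + 2 * \<kappa> * dir u) (at 0)"
 proof -
  have e: "(%t. dir (curve u phi t)) = (%t. (s' t)^2 * (dir u + 2 * t * gip u phi + t^2 * dir phi))"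
   unfolding cu using dir_cmult[OF H1_add[OF u(1) H1_cmult[OF phi]]] dir_add_scaled[OF u(1) phi] by simp
  show ?thesis unfolding e by (auto intro!: derivative_eq_intros sd simp: s0)
 qed
 have B: "((%t. pw p (curve u phi t)) has_real_derivative p * (LINT x|lebesgue. \<bar>u x\<bar> powr (p - 2) * u x * phi x) + p * \<kappa> * pw p u) (at 0)"
 proof -
  have e: "(%t. pw p (curve u phi t)) = (%t. \<bar>s' t\<bar> powr p * pw p (%x. u x + t * phi x))"
   unfolding cu by (simp add: pw_cmult)
  show ?thesis unfolding e
   using DERIV_mult[OF spd[of p] pw_DERIV[OF p u(1) phi]] p s0 by (simp add: subcrit_def add.commute)
 qed
 have D: "((%t. cp r s (curve u phi t) v) has_real_derivative
   r * (LINT x|lebesgue. \<bar>u x\<bar> powr (r - 2) * u x * phi x * \<bar>v x\<bar> powr s) + r * \<kappa> * cp r s u v) (at 0)"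
 proof -
  have e: "(%t. cp r s (curve u phi t) v) = (%t. \<bar>s' t\<bar> powr r * cp r s (%x. u x + t * phi x) v)"
   unfolding cu by (simp add: cp_cmult_left)
  show ?thesis unfolding e
   using DERIV_mult[OF spd[of r] cp_DERIV[OF rs u(1) v phi]] rs s0 by (simp add: add.commute)
 qed
 have c0: "curve u phi 0 = u" unfolding cu by (simp add: s0)
 define IB IC where "IB = (LINT x|lebesgue. \<bar>u x\<bar> powr (p - 2) * u x * phi x)"
  and "IC = (LINT x|lebesgue. \<bar>u x\<bar> powr (r - 2) * u x * phi x * \<bar>v x\<bar> powr s)"
 have lim: "((%tau. X (curve u phi tau)) \<longlongrightarrow> X u) (at 0)" if "((%t. X (curve u phi t)) has_real_derivative d) (at 0)" for X :: "(real^'n => real) => real" and d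
  using DERIV_isCont[OF that] by (simp add: isCont_def c0)
 have "\<forall>\<^sub>F tau in at 0. s' tau > 0" using spos by (simp add: eventually_nhds_conv_at)
 then have mc: "\<forall>\<^sub>F tau in at 0. mass (curve u phi tau) = mass u"
 proof eventually_elim
  case (elim tau)
  have nn: "0 <= m tau" unfolding m_def mass_line[OF uL, symmetric] by simp
  have ne: "m tau ~= 0" using elim by (auto simp: s'_def)
  have "mass (curve u phi tau) = (s' tau)^2 * m tau" unfolding cu mass_cmult mass_line[OF uL] by (simp add: m_def)
  also have "... = mass u" using nn ne u(2) by (simp add: s'_def)
  finally show ?case .
 qed
 obtain T where T: "(T \<longlongrightarrow> 1) (at 0)" "\<forall>\<^sub>F tau in at 0. 0 <= (T tau)^2 / 2 * (dir (curve u phi tau) - dir u)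
   - \<mu> / p * T tau powr \<alpha> * (pw p (curve u phi tau) - pw p u) - \<beta> * T tau powr \<gamma> * (cp r s (curve u phi tau) v - cp r s u v)"
  using min[OF phi mc lim[OF A] lim[OF B] lim[of "%w. cp r s w v", OF D]] by blast
 \<comment> \<open>The first variation along the curve. \<open>G\<close> is the given inequality
   divided by \<open>tau\<close>; it converges as soon as the scales \<open>T tau\<close> do, and
   the sign of \<open>tau\<close> forces \<open>L >= 0\<close> from the right and
   \<open>L <= 0\<close> from the left.\<close>
 define L where "L = 1 / 2 * (2 * gip u phi + 2 * \<kappa> * dir u) - \<mu> / p * (p * IB + p * \<kappa> * pw p u) - \<beta> * (r * IC + r * \<kappa> * cp r s u v)"
 define G where "G tau = (T tau)^2 / 2 * ((dir (curve u phi tau) - dir u) / tau) - \<mu> / p * T tau powr \<alpha> * ((pw p (curve u phi tau) - pw p u) / tau)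
   - \<beta> * T tau powr \<gamma> * ((cp r s (curve u phi tau) v - cp r s u v) / tau)" for tau
 have q: "((%tau. (X (curve u phi tau) - X u) / tau) \<longlongrightarrow> d) (at 0)" if "((%t. X (curve u phi t)) has_real_derivative d) (at 0)" for X :: "(real^'n => real) => real" and d
  using that c0 by (simp add: DERIV_def)
 have "(G \<longlongrightarrow> 1^2 / 2 * (2 * gip u phi + 2 * \<kappa> * dir u) - \<mu> / p * 1 powr \<alpha> * (p * IB + p * \<kappa> * pw p u) - \<beta> * 1 powr \<gamma> * (r * IC + r * \<kappa> * cp r s u v)) (at 0)"
  unfolding G_def[abs_def] IB_def IC_def
  by (intro tendsto_diff tendsto_mult tendsto_divide tendsto_power tendsto_powr tendsto_const T(1) q[OF A] q[OF B] q[of "%w. cp r s w v", OF D]) auto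
 then have GL: "(G \<longlongrightarrow> L) (at 0)" by (simp add: L_def)
 have ne0: "\<forall>\<^sub>F tau in at (0::real). tau ~= 0" by (auto simp: eventually_at intro: exI[of _ 1])
 have ev: "\<forall>\<^sub>F tau in at 0. 0 <= tau * G tau"
  using T(2) ne0
 proof eventually_elim
  case (elim tau)
  have *: "tau * (a * (x / tau) - b * (y / tau) - c * (z / tau)) = a * x - b * y - c * z" for a b c x y z
   using elim(2) by (simp add: right_diff_distrib)
  have "tau * G tau = (T tau)^2 / 2 * (dir (curve u phi tau) - dir u)
   - \<mu> / p * T tau powr \<alpha> * (pw p (curve u phi tau) - pw p u) - \<beta> * T tau powr \<gamma> * (cp r s (curve u phi tau) v - cp r s u v)"
   unfolding G_def by (rule *)
  with elim(1) show ?case by simp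
 qed
 have "L >= 0"
 proof (rule tendsto_lowerbound[of G L "at_right 0"])
  show "(G \<longlongrightarrow> L) (at_right 0)" using GL by (simp add: filterlim_at_split)
  have "\<forall>\<^sub>F tau in at_right 0. 0 <= tau * G tau" using ev by (simp add: eventually_at_split)
  with eventually_at_right_less[of 0] show "\<forall>\<^sub>F tau in at_right 0. 0 <= G tau"
   by eventually_elim (simp add: zero_le_mult_iff)
 qed simp
 moreover have "L <= 0"
 proof (rule tendsto_upperbound[of G L "at_left 0"])
  show "(G \<longlongrightarrow> L) (at_left 0)" using GL by (simp add: filterlim_at_split)
  have "\<forall>\<^sub>F tau in at_left 0. 0 <= tau * G tau" using ev by (simp add: eventually_at_split)
  moreover have "\<forall>\<^sub>F tau in at_left (0::real). tau < 0" by (auto simp: eventually_at_left_field intro: exI[of _ "-1"])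
  ultimately show "\<forall>\<^sub>F tau in at_left 0. G tau <= 0"
   by eventually_elim (simp add: zero_le_mult_iff)
 qed simp
 ultimately have "L = 0" by simp
 then have "gip u phi = - \<kappa> * (dir u - \<mu> * pw p u - \<beta> * r * cp r s u v) + \<mu> * IB + \<beta> * r * IC"
  unfolding L_def using p0 by (simp add: algebra_simps)
 moreover have "- \<kappa> * (dir u - \<mu> * pw p u - \<beta> * r * cp r s u v) = l * ip u phi" by (simp add: \<kappa>_def l_def)
 moreover have "IC = (LINT x|lebesgue. \<bar>u x\<bar> powr (r - 2) * u x * \<bar>v x\<bar> powr s * phi x)"
  unfolding IC_def by (intro Bochner_Integration.integral_cong) (auto simp: mult_ac)
 ultimately show ?thesis by (simp add: IB_def)
qed

subsection \<open>Supersolutions\<close>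

text \<open>For two numbers, the squared difference of their positive parts is at most their
  difference times the difference of the positive parts. The inequality for gradients follows by
  integrating this for difference quotients and passing to the limit.\<close>

lemma H1_pos_part:
 fixes w :: "real ^ 'n => real"
 assumes w: "w \<in> H1"
 shows "(%x. max 0 (w x)) \<in> H1" "dir (%x. max 0 (w x)) <= gip w (%x. max 0 (w x))"
proof -
 define p where "p = (%x. max 0 (w x))"
 have wm: "w \<in> lmeas" by (rule H1_measurable[OF w])
 have "p \<in> lmeas" unfolding p_def using wm by measurable
 then have p: "p \<in> H1" by (rule H1_contraction(1)[OF w]) (auto simp: p_def)
 define D where "D n i w x = real (Suc n) * (w (x + (1 / real (Suc n)) *\<^sub>R axis i 1) - w x :: real)"
  for n i x and w :: "real ^ 'n => real"
 have L: "D n i u \<in> L2" if "u \<in> H1" for n i u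
  unfolding D_def using H1_L2[OF that] by (intro L2_cmult L2_diff L2_translate)
 have T: "(%n. \<Sum>i\<in>UNIV. ip (D n i u) (D n i v)) ----> gip u v" if "u \<in> H1" "v \<in> H1" for u v
  unfolding D_def[abs_def] by (rule gip_difference_tendsto[OF that])
 have "gip p p <= gip w p"
 proof (rule LIMSEQ_le[OF T[OF p p] T[OF w p]], rule exI[of _ 0], intro allI impI sum_mono)
  fix n i
  show "ip (D n i p) (D n i p) <= ip (D n i w) (D n i p)"
   unfolding ip_def
  proof (rule integral_mono[OF L2_mult_integrable[OF L[OF p] L[OF p]] L2_mult_integrable[OF L[OF w] L[OF p]]])
   fix x
   have "(max 0 a - max 0 b) * (max 0 a - max 0 b) <= (a - b) * (max 0 a - max 0 b)" for a b :: real
    by (cases "a >= 0"; cases "b >= 0") (auto simp: max_def mult_nonneg_nonpos mult_nonneg_nonneg mult_nonpos_nonneg mult_mono mult_le_0_iff zero_le_mult_iff algebra_simps)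
   from mult_left_mono[OF this[of "w (x + (1 / real (Suc n)) *\<^sub>R axis i 1)" "w x"], of "(real (Suc n))^2"]
   show "D n i p x * D n i p x <= D n i w x * D n i p x" by (simp add: D_def p_def power2_eq_square ac_simps)
  qed
 qed
 then show "(%x. max 0 (w x)) \<in> H1" "dir (%x. max 0 (w x)) <= gip w (%x. max 0 (w x))"
  using p by (simp_all add: p_def gip_self)
qed

section \<open>Zero sets of supersolutions\<close>

definition cutoff :: "real => real ^ 'n => real" where
 "cutoff R x = max 0 (min 1 (R + 1 - norm x))"

lemma cutoff_bounds: "0 <= cutoff R x" "cutoff R x <= 1" "norm x <= R ==> cutoff R x = 1"
 by (auto simp: cutoff_def)

lemma cutoff_H1: "(cutoff R :: real ^ 'n => real) \<in> H1"
proof -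
 define B where "B = (indicator (cball 0 (R + 1)) :: real ^ 'n => real)"
 have B: "B \<in> L2" unfolding B_def by (rule indicator_L2) simp
 have "(cutoff R :: real ^ 'n => real) \<in> lmeas"
  unfolding cutoff_def[abs_def] by (intro measurable_completion) simp
 then have L: "(cutoff R :: real ^ 'n => real) \<in> L2"
  by (rule L2_dominated(1)[OF B]) (auto simp: cutoff_def B_def indicator_def)
 show ?thesis
 proof (rule H1_from_difference(1)[OF L])
  fix i :: 'n and h :: real
  let ?a = "h *\<^sub>R axis i (1::real) :: real ^ 'n"
  have le: "\<bar>cutoff R (x + ?a) - cutoff R x\<bar> <= \<bar>h * (B (x + ?a) + B x)\<bar>" for x :: "real ^ 'n"
  proof (cases "x \<in> cball 0 (R + 1) \<or> x + ?a \<in> cball 0 (R + 1)")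
   case True
   have "\<bar>norm (x + ?a) - norm x\<bar> <= \<bar>h\<bar>" using norm_triangle_ineq3[of "x + ?a" x] by (simp add: norm_axis_1)
   then have "\<bar>cutoff R (x + ?a) - cutoff R x\<bar> <= \<bar>h\<bar>" unfolding cutoff_def by (auto simp: max_def min_def)
   also have "... <= \<bar>h\<bar> * \<bar>B (x + ?a) + B x\<bar>"
    using True by (intro mult_le_cancel_left1[THEN iffD2]) (auto simp: B_def indicator_def)
   finally show ?thesis by (simp add: abs_mult)
  next
   case False
   then show ?thesis by (auto simp: cutoff_def)
  qed
  have S: "(%x. h * (B (x + ?a) + B x)) \<in> L2" by (intro L2_cmult L2_add L2_translate B)
  have m: "(%x. cutoff R (x + ?a) - cutoff R x) \<in> lmeas"
   using L2_diff[OF L2_translate[OF L] L] by auto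
  have "mass (%x. cutoff R (x + ?a) - cutoff R x) <= mass (%x. h * (B (x + ?a) + B x))"
   by (rule L2_dominated(2)[OF S m]) (rule AE_I2, rule le)
  also have "... = h^2 * mass (%x. B (x + ?a) + B x)" by (rule mass_cmult)
  also have "... <= h^2 * (2 * mass (%x. B (x + ?a)) + 2 * mass B)"
   by (intro mult_left_mono mass_add_le L2_translate B) simp
  also have "mass (%x. B (x + ?a)) = mass B" by (rule mass_translate) (use B in auto)
  finally show "mass (%x. cutoff R (x + h *\<^sub>R axis i 1) - cutoff R x) <= h^2 * (2 * mass B + 2 * mass B)" .
 qed
qed

text \<open>Testing the supersolution inequality with the positive part of \<open>phi - k v\<close> and letting \<open>k\<close> tend to
 infinity shows that cutting \<open>phi\<close> off outside the zero set of \<open>v\<close> does not leave \<open>H\<^sup>1\<close>.\<close>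

lemma supersolution_zero_set:
 fixes v phi :: "real ^ 'n => real"
 assumes v: "v \<in> H1" "!!x. v x >= 0" and phi: "phi \<in> H1" "!!x. phi x >= 0"
  and le: "!!\<zeta>. \<zeta> \<in> H1 ==> (!!x. \<zeta> x >= 0) ==> l * ip v \<zeta> <= gip v \<zeta>"
 shows "mass (%x. phi (x + h *\<^sub>R axis i 1) * indicator {x. v x = 0} (x + h *\<^sub>R axis i 1) - phi x * indicator {x. v x = 0} x)
  <= h^2 * (dir phi + 2 * \<bar>l\<bar> * mass phi)"
proof -
 define z where "z k x = max 0 (phi x - real k * v x)" for k x
 have H: "(%x. phi x - real k * v x) \<in> H1" for k by (intro H1_diff H1_cmult phi v)
 have z: "z k \<in> H1" "dir (z k) <= gip (%x. phi x - real k * v x) (z k)" for k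
  unfolding z_def[abs_def] by (rule H1_pos_part[OF H])+
 have zb: "0 <= z k x" "z k x <= phi x" for k x using v(2)[of x] phi(2)[of x] by (auto simp: z_def)
 have b: "dir (z k) <= dir phi + 2 * \<bar>l\<bar> * mass phi" for k
 proof -
  have "gip (%x. phi x - real k * v x) (z k) = gip phi (z k) - real k * gip v (z k)"
   using gip_lincomb[OF phi(1) v(1) z(1), of 1 "- real k" k] by simp
  moreover have "real k * (l * ip v (z k)) <= real k * gip v (z k)"
   by (intro mult_left_mono le z zb) simp
  moreover have "0 <= dir phi - 2 * gip phi (z k) + dir (z k)"
   using dir_diff[OF phi(1) z(1), of k] dir_nonneg[of "%x. phi x - z k x"] by linarith
  \<comment> \<open>Where \<open>z k\<close> is nonzero one has \<open>k v < phi\<close>, so the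
    product \<open>k v z\<close> is at most \<open>phi^2\<close> however large \<open>k\<close>
    is.\<close>
  moreover have ki: "real k * ip v (z k) <= mass phi" "0 <= real k * ip v (z k)"
  proof -
   have e: "real k * ip v (z k) = ip (%x. real k * v x) (z k)" by (simp add: ip_cmult_left)
   show "real k * ip v (z k) <= mass phi"
    unfolding e
    unfolding ip_def mass_def
   proof (rule integral_mono[OF L2_mult_integrable[OF L2_cmult[OF H1_L2[OF v(1)]] H1_L2[OF z(1)]] L2_square_integrable[OF H1_L2[OF phi(1)]]])
    fix x
    show "real k * v x * z k x <= (phi x)^2"
    proof (cases "real k * v x <= phi x")
     case True
     then show ?thesis unfolding power2_eq_square using zb phi(2) v(2) by (intro mult_mono) auto
    qed (simp add: z_def)
   qed
   show "0 <= real k * ip v (z k)"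
    unfolding ip_def using v(2) zb(1) by (intro mult_nonneg_nonneg integral_nonneg_AE[where M = lebesgue] AE_I2) auto
  qed
  moreover have "- (\<bar>l\<bar> * mass phi) <= real k * (l * ip v (z k))"
  proof -
   have "- (\<bar>l\<bar> * mass phi) <= - (\<bar>l\<bar> * (real k * ip v (z k)))"
    using ki(1) by (intro le_imp_neg_le mult_left_mono) auto
   also have "... <= l * (real k * ip v (z k))"
    using mult_right_mono[of "- \<bar>l\<bar>" l "real k * ip v (z k)"] ki(2) by simp
   finally show ?thesis by (simp add: ac_simps)
  qed
  ultimately show ?thesis using z(2)[of k] by linarith
 qed
 let ?a = "h *\<^sub>R axis i (1::real) :: real ^ 'n"
 define psi where "psi x = phi x * indicator {x. v x = 0} x" for x
 have lim: "(%k. z k x) ----> psi x" for x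
 proof (cases "v x = 0")
  case True
  then show ?thesis using phi(2)[of x] by (simp add: z_def psi_def)
 next
  case False
  then have "v x > 0" using v(2)[of x] by simp
  then obtain K :: nat where K: "phi x < real K * v x" using ex_less_of_nat_mult by blast
  have "z k x = psi x" if "k >= K" for k
  proof -
   have "real K * v x <= real k * v x" using that v(2)[of x] by (intro mult_right_mono) auto
   then show ?thesis using K False by (simp add: z_def psi_def)
  qed
  then show ?thesis by (intro tendsto_eventually eventually_sequentiallyI)
 qed
 have psim: "psi \<in> lmeas"
  by (rule borel_measurable_LIMSEQ_real[OF lim]) (rule H1_measurable[OF z(1)])
 have "mass (%x. psi (x + ?a) - psi x) <= h^2 * (dir phi + 2 * \<bar>l\<bar> * mass phi)"
 proof (rule Fatou_L2(2)[where f = "%k x. z k (x + ?a) - z k x"])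
  show "(%x. z k (x + ?a) - z k x) \<in> L2" for k by (intro L2_diff L2_translate H1_L2 z)
  show "(%x. psi (x + ?a) - psi x) \<in> lmeas"
   using measurable_translate[OF psim] psim by (intro borel_measurable_diff) auto
  show "ae x. (%k. z k (x + ?a) - z k x) ----> psi (x + ?a) - psi x"
   by (intro AE_I2 tendsto_diff lim)
  show "\<forall>\<^sub>F k in sequentially. mass (%x. z k (x + ?a) - z k x) <= h^2 * (dir phi + 2 * \<bar>l\<bar> * mass phi)"
  proof (intro always_eventually allI)
   fix k
   have "mass (%x. z k (x + ?a) - z k x) <= h^2 * dirp i (z k)" by (rule H1_difference[OF z(1)])
   also have "... <= h^2 * (dir phi + 2 * \<bar>l\<bar> * mass phi)"
    using dirp_le_dir[of i "z k"] b[of k] by (intro mult_left_mono) auto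
   finally show "mass (%x. z k (x + ?a) - z k x) <= h^2 * (dir phi + 2 * \<bar>l\<bar> * mass phi)" .
  qed
 qed
 then show ?thesis by (simp add: psi_def)
qed

text \<open>A function with values zero and one that changes between the end points changes in some
  step, so the squared differences add without the factor \<open>m\<close> that Cauchy-Schwarz would
  cost.\<close>

lemma indicator_difference_chain:
 fixes f :: "real ^ 'n => real"
 assumes f01: "!!x. f x = 0 \<or> f x = 1"
 shows "(f (x + real m *\<^sub>R a) - f x)^2 <= (\<Sum>j<m. (f (x + real (Suc j) *\<^sub>R a) - f (x + real j *\<^sub>R a))^2)"
proof (induction m)
 case (Suc m)
 have "(f (x + real (Suc m) *\<^sub>R a) - f x)^2 <= (f (x + real (Suc m) *\<^sub>R a) - f (x + real m *\<^sub>R a))^2 + (f (x + real m *\<^sub>R a) - f x)^2"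
  using f01[of "x + real (Suc m) *\<^sub>R a"] f01[of "x + real m *\<^sub>R a"] f01[of x] by (elim disjE) simp_all
 then show ?case using Suc.IH by simp
qed simp

text \<open>An indicator whose differences are of order \<open>h^2\<close> in mass must be
  invariant: cutting a shift by \<open>H\<close> into \<open>m + 1\<close> steps bounds its effect
  by \<open>m + 1\<close> terms of order \<open>(H / (m + 1))^2\<close>, and \<open>m\<close> is
  arbitrary. The cutoff is there because the indicator itself may have infinite mass.\<close>

lemma zero_set_translation_invariant:
 fixes v :: "real ^ 'n => real"
 assumes v: "v \<in> H1" "!!x. v x >= 0"
  and le: "!!\<zeta>. \<zeta> \<in> H1 ==> (!!x. \<zeta> x >= 0) ==> l * ip v \<zeta> <= gip v \<zeta>"
 shows "ae x. v (x + h) = 0 \<longleftrightarrow> v x = 0"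
proof -
 define f where "f x = (indicator {x. v x = 0} x :: real)" for x
 have f01: "f x = 0 \<or> f x = 1" for x by (simp add: f_def indicator_def)
 have vm: "v \<in> lmeas" by (rule H1_measurable[OF v(1)])
 have "f = (%x. if v x = 0 then 1 else 0)" by (simp add: f_def indicator_def fun_eq_iff)
 then have fm: "f \<in> lmeas" using vm by simp
 have axis: "ae x. f (x + H *\<^sub>R axis i 1) = f x" for H :: real and i :: 'n
 proof -
  let ?A = "H *\<^sub>R axis i (1::real) :: real ^ 'n"
  have "ae x. norm x <= real r --> f (x + ?A) = f x" for r :: nat
  proof -
   \<comment> \<open>All intermediate points of a shift by \<open>H\<close> that starts in the ball
     of radius \<open>r\<close> stay where the cutoff equals one.\<close>
   define R where "R = real r + \<bar>H\<bar>"
   define phi where "phi = (cutoff R :: real ^ 'n => real)"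
   define c where "c = dir phi + 2 * \<bar>l\<bar> * mass phi"
   define psi where "psi x = phi x * f x" for x
   define g where "g x = (f (x + ?A) - f x) * indicator (cball 0 (real r)) x" for x
   have phi: "phi \<in> H1" "!!x. phi x >= 0" "!!x. norm x <= R ==> phi x = 1"
    by (auto simp: phi_def cutoff_H1 cutoff_bounds)
   have psid: "mass (%x. psi (x + h *\<^sub>R axis i 1) - psi x) <= h^2 * c" for h
    using supersolution_zero_set[OF v phi(1,2) le, of h i] by (simp add: psi_def f_def c_def)
   have psiL: "psi \<in> L2"
   proof (rule L2_dominated(1)[OF H1_L2[OF phi(1)]])
    show "psi \<in> lmeas" unfolding psi_def[abs_def] using H1_measurable[OF phi(1)] fm by measurable
    show "ae x. \<bar>psi x\<bar> <= \<bar>phi x\<bar>"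
    proof (rule AE_I2)
     fix x show "\<bar>psi x\<bar> <= \<bar>phi x\<bar>" using f01[of x] by (elim disjE) (simp_all add: psi_def)
    qed
   qed
   have gm: "g \<in> lmeas"
    unfolding g_def[abs_def]
    by (intro borel_measurable_times borel_measurable_diff measurable_translate[OF fm] fm L2_measurable indicator_L2) simp
   have "g \<in> L2"
   proof (rule L2_dominated(1)[OF indicator_L2[of "cball 0 (real r)"] gm])
    show "ae x. \<bar>g x\<bar> <= \<bar>indicator (cball 0 (real r)) x\<bar>"
    proof (rule AE_I2)
     fix x show "\<bar>g x\<bar> <= \<bar>indicator (cball 0 (real r)) x\<bar>"
      using f01[of x] f01[of "x + ?A"] by (elim disjE) (simp_all add: g_def indicator_def)
    qed
   qed simp
   have est: "mass g <= H^2 * c / real (Suc m)" for m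
   proof -
    define t where "t = H / real (Suc m)"
    define a where "a = (t *\<^sub>R axis i (1::real) :: real ^ 'n)"
    define q where "q j x = psi (x + real j *\<^sub>R a + a) - psi (x + real j *\<^sub>R a)" for j x
    have dL: "(%x. psi (x + a) - psi x) \<in> L2" by (intro L2_diff L2_translate psiL)
    have qL: "q j \<in> L2" for j unfolding q_def[abs_def] using L2_translate[OF dL, of "real j *\<^sub>R a"] .
    have qm: "mass (q j) <= t^2 * c" for j
     unfolding q_def[abs_def] using mass_translate[OF L2_measurable[OF dL], of "real j *\<^sub>R a"] psid[of t] by (simp add: a_def)
    have A: "?A = real (Suc m) *\<^sub>R a" by (simp add: a_def t_def)
    have pt: "(g x)^2 <= (\<Sum>j<Suc m. (q j x)^2)" for x
    proof (cases "norm x <= real r")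
     case True
     have na: "norm a = \<bar>H\<bar> / real (Suc m)" by (simp add: a_def t_def norm_axis_1)
     have in_ball: "norm (x + real j *\<^sub>R a) <= R" if "j <= Suc m" for j
     proof -
      have "norm (x + real j *\<^sub>R a) <= norm x + real j * norm a" using norm_triangle_ineq[of x "real j *\<^sub>R a"] by simp
      also have "real j * norm a <= real (Suc m) * norm a" using that by (intro mult_right_mono) auto
      also have "... = \<bar>H\<bar>" by (simp add: na)
      finally show ?thesis using True by (simp add: R_def)
     qed
     have "(g x)^2 = (f (x + real (Suc m) *\<^sub>R a) - f x)^2" using True unfolding g_def A by simp
     also have "... <= (\<Sum>j<Suc m. (f (x + real (Suc j) *\<^sub>R a) - f (x + real j *\<^sub>R a))^2)"
      by (rule indicator_difference_chain[OF f01])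
     also have "... = (\<Sum>j<Suc m. (q j x)^2)"
     proof (rule sum.cong[OF refl])
      fix j assume "j \<in> {..<Suc m}"
      then have "phi (x + real j *\<^sub>R a) = 1" "phi (x + real (Suc j) *\<^sub>R a) = 1" by (auto intro!: phi(3) in_ball simp del: of_nat_Suc)
      moreover have s: "x + real (Suc j) *\<^sub>R a = x + real j *\<^sub>R a + a" by (simp add: algebra_simps)
      ultimately show "(f (x + real (Suc j) *\<^sub>R a) - f (x + real j *\<^sub>R a))^2 = (q j x)^2"
       unfolding q_def psi_def s by (simp only: mult_1)
     qed
     finally show ?thesis .
    next
     case False
     then show ?thesis by (simp add: g_def sum_nonneg)
    qed
    have "mass g <= (LINT x|lebesgue. (\<Sum>j<Suc m. (q j x)^2))"
     unfolding mass_def by (rule integral_mono[OF L2_square_integrable[OF \<open>g \<in> L2\<close>] Bochner_Integration.integrable_sum[OF L2_square_integrable[OF qL]] pt])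
    also have "... = (\<Sum>j<Suc m. mass (q j))" unfolding mass_def by (rule Bochner_Integration.integral_sum[OF L2_square_integrable[OF qL]])
    also have "... <= (\<Sum>j<Suc m. t^2 * c)" by (rule sum_mono) (rule qm)
    also have "... = H^2 * c / real (Suc m)" by (simp add: t_def power2_eq_square del: of_nat_Suc)
    finally show ?thesis .
   qed
   have "(%m. H^2 * c / real (Suc m)) ----> 0"
    using LIMSEQ_Suc[OF lim_const_over_n[of "H^2 * c"]] by simp
   from LIMSEQ_le_const[OF this, of "mass g"] est have "mass g <= 0" by auto
   then have "mass g = 0" using mass_nonneg[of g] by linarith
   then have "ae x. g x = 0" using mass_eq_0_iff[OF \<open>g \<in> L2\<close>] by simp
   then show ?thesis
   proof eventually_elim
    case (elim x)
    then show ?case by (auto simp: g_def indicator_def split: if_splits)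
   qed
  qed
  then have "ae x. \<forall>r::nat. norm x <= real r --> f (x + ?A) = f x"
   unfolding AE_all_countable by (rule allI)
  then show ?thesis
  proof eventually_elim
   case (elim x)
   then show ?case using real_arch_simple[of "norm x"] by blast
  qed
 qed
 have "ae x. f (x + (\<Sum>i\<in>S. (h $ i) *\<^sub>R axis i 1)) = f x" if "finite S" for S
  using that
 proof (induction S)
  case (insert j S)
  from AE_translate[OF axis[of "h $ j" j], of "\<Sum>i\<in>S. (h $ i) *\<^sub>R axis i 1"] insert.IH
  show ?case
  proof eventually_elim
   case (elim x)
   have s: "x + (\<Sum>i\<in>insert j S. (h $ i) *\<^sub>R axis i 1) = x + (\<Sum>i\<in>S. (h $ i) *\<^sub>R axis i 1) + (h $ j) *\<^sub>R axis j 1"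
    using insert.hyps by (simp add: algebra_simps)
   show ?case unfolding s using elim by (simp only:)
  qed
 qed simp
 from this[OF finite, of UNIV] have "ae x. f (x + h) = f x" using vec_sum_axis[of h] by simp
 then show ?thesis
 proof eventually_elim
  case (elim x)
  then show ?case by (auto simp: f_def indicator_def split: if_splits)
 qed
qed

text \<open>If both the zero set and its complement had positive measure, some translation would
  carry part of one into the other, against the translation invariance of the zero set.\<close>

theorem strong_maximum_principle:
 fixes v :: "real ^ 'n => real"
 assumes v: "v \<in> H1" "!!x. v x >= 0" "mass v > 0"
  and le: "!!\<zeta>. \<zeta> \<in> H1 ==> (!!x. \<zeta> x >= 0) ==> l * ip v \<zeta> <= gip v \<zeta>"
 shows "ae x. v x > 0"
proof -
 have vm: "v \<in> lmeas" by (rule H1_measurable[OF v(1)])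
 have Z: "{x. v x = 0} \<in> sets lebesgue" "{x. v x ~= 0} \<in> sets lebesgue"
  using borel_measurable_vimage[OF vm, of 0] borel_measurable_vimage[OF vm, of "0"] by (simp_all add: vimage_def Collect_neg_eq Compl_eq_Diff_UNIV sets.compl_sets[of _ lebesgue, simplified])
 have nz: "emeasure lebesgue {x. v x ~= 0} ~= 0"
 proof
  assume "emeasure lebesgue {x. v x ~= 0} = 0"
  then have "ae x. v x = 0" using AE_iff_measurable[OF Z(2), of "%x. v x = 0"] by simp
  then show False using mass_eq_0_iff[OF H1_L2[OF v(1)]] v(3) by simp
 qed
 have "emeasure lebesgue {x. v x = 0} = 0"
 proof (rule ccontr)
  assume "emeasure lebesgue {x. v x = 0} ~= 0"
  then obtain h where h: "emeasure lebesgue {x \<in> {x. v x = 0}. x + h \<in> {x. v x ~= 0}} ~= 0"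
   by (rule overlap_translate[OF Z(1) _ Z(2) nz])
  have "ae x. v (x + h) = 0 \<longleftrightarrow> v x = 0"
   by (rule zero_set_translation_invariant[OF v(1,2)]) (rule le)
  then have ae: "ae x. ~ (v x = 0 & v (x + h) ~= 0)" by eventually_elim auto
  have s: "{x. v x = 0 & v (x + h) ~= 0} \<in> sets lebesgue"
   using measurable_sets[OF vm, of "{0}"] measurable_sets[OF measurable_translate[OF vm, of h], of "- {0}"]
   by (auto simp: vimage_def intro!: sets.Int[of "{x. v x = 0}" lebesgue "{x. v (x + h) ~= 0}", simplified Collect_conj_eq[symmetric]])
  show False using ae h AE_iff_measurable[OF s, of "%x. ~ (v x = 0 & v (x + h) ~= 0)"] by simp
 qed
 then have "ae x. v x ~= 0" using AE_iff_measurable[OF Z(1), of "%x. v x ~= 0"] by simp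
 then show ?thesis
 proof eventually_elim
  case (elim x)
  then show ?case using v(2)[of x] by simp
 qed
qed

section \<open>Rescaled bumps and a Liouville theorem\<close>

lemma test_function_dilate_partial:
 assumes "phi \<in> test_functions"
 shows "partial_derivative i (%x. c * phi (s *\<^sub>R x)) = (%x. c * s * partial_derivative i phi (s *\<^sub>R x))"
proof
 fix x
 have d: "(phi has_derivative (%h. \<Sum>j\<in>UNIV. h $ j * partial_derivative j phi (s *\<^sub>R x))) (at (s *\<^sub>R x))"
  by (rule test_functionsD(4)[OF assms])
 have "((%x. s *\<^sub>R x) has_derivative (%h. s *\<^sub>R h)) (at x)" by (auto intro!: derivative_eq_intros)
 from diff_chain_at[OF this d] have "((%x. phi (s *\<^sub>R x)) has_derivative (%h. \<Sum>j\<in>UNIV. (s *\<^sub>R h) $ j * partial_derivative j phi (s *\<^sub>R x))) (at x)"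
  by (simp add: comp_def)
 from has_derivative_mult_right[OF this, of c]
 have "((%x. c * phi (s *\<^sub>R x)) has_derivative (%h. \<Sum>j\<in>UNIV. h $ j * (c * s * partial_derivative j phi (s *\<^sub>R x)))) (at x)"
  by (simp add: sum_distrib_left ac_simps)
 from partial_derivative_eq[where g = "%j x. c * s * partial_derivative j phi (s *\<^sub>R x)", OF this, of i] show "partial_derivative i (%x. c * phi (s *\<^sub>R x)) x = c * s * partial_derivative i phi (s *\<^sub>R x)" .
qed

lemma gip_test:
 fixes v :: "real ^ 'n => real"
 assumes v: "v \<in> H1" and phi: "phi \<in> test_functions"
 shows "gip v phi = - (\<Sum>i\<in>UNIV. ip v (partial_derivative i (partial_derivative i phi)))"
proof -
 have "ip (gradp i v) (gradp i phi) = - ip v (partial_derivative i (partial_derivative i phi))" for i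
 proof -
  have "ip (gradp i v) (gradp i phi) = ip (gradp i v) (partial_derivative i phi)"
   by (rule ip_cong_AE[OF _ gradp_test[OF phi] gradp_L2[OF v] gradp_L2[OF v] gradp_L2[OF test_function_H1[OF phi]] test_function_L2[OF partial_derivative_test[OF phi]]]) simp
  also have "... = - ip v (partial_derivative i (partial_derivative i phi))"
   using H1_gradp[OF v, of i] partial_derivative_test[OF phi, of i] by (simp add: weak_partial_def)
  finally show ?thesis .
 qed
 then show ?thesis by (simp add: gip_def sum_negf)
qed

lemma powr_mult_integrable:
 fixes v phi :: "real ^ 'n => real"
 assumes p: "subcrit TYPE('n) p" and v: "v \<in> H1" and phi: "phi \<in> H1"
 shows "integrable lebesgue (%x. \<bar>v x\<bar> powr (p - 2) * v x * phi x)"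
proof (rule Bochner_Integration.integrable_bound[OF Bochner_Integration.integrable_add[OF pw_integrable[OF p v] pw_integrable[OF p phi]]])
 show "(%x. \<bar>v x\<bar> powr (p - 2) * v x * phi x) \<in> lmeas"
  using H1_measurable[OF v] H1_measurable[OF phi] by measurable
 have p2: "p > 2" using p by (simp add: subcrit_def)
 have "\<bar>\<bar>a\<bar> powr (p - 2) * a * b\<bar> <= \<bar>a\<bar> powr p + \<bar>b\<bar> powr p" for a b :: real
 proof -
  define M where "M = max \<bar>a\<bar> \<bar>b\<bar>"
  have "\<bar>\<bar>a\<bar> powr (p - 2) * a * b\<bar> = \<bar>a\<bar> powr (p - 2) * \<bar>a\<bar> * \<bar>b\<bar>" by (simp add: abs_mult)
  also have "... <= M powr (p - 2) * M * M"
   using p2 by (intro mult_mono powr_mono2) (auto simp: M_def)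
  also have "... = M powr p"
  proof (cases "M = 0")
   case False
   then have "M > 0" by (auto simp: M_def max_def)
   then show ?thesis using powr_add[of M "p - 2" 2] by (simp add: powr_numeral power2_eq_square mult.assoc)
  qed simp
  also have "... <= \<bar>a\<bar> powr p + \<bar>b\<bar> powr p" by (auto simp: M_def max_def)
  finally show ?thesis .
 qed
 then show "ae x. norm (\<bar>v x\<bar> powr (p - 2) * v x * phi x) <= norm (\<bar>v x\<bar> powr p + \<bar>phi x\<bar> powr p)" by simp
qed

text \<open>The rescaled Laplacians \<open>s^2 (\<Delta> b) (s x)\<close> of a bump stay bounded in \<open>L^2\<close> as \<open>s\<close> tends to \<open>0\<close>
 exactly when \<open>N <= 4\<close>, and then converge weakly to \<open>0\<close>.\<close>

theorem Liouville:
 fixes v :: "real ^ 'n => real"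
 assumes N: "CARD('n) <= 4" and p: "subcrit TYPE('n) p" and \<mu>: "\<mu> > 0"
  and v: "v \<in> H1" "!!x. v x >= 0" "mass v > 0"
  and le: "!!\<zeta>. \<zeta> \<in> H1 ==> (!!x. \<zeta> x >= 0) ==> \<mu> * (LINT x|lebesgue. \<bar>v x\<bar> powr (p - 2) * v x * \<zeta> x) <= gip v \<zeta>"
 shows False
proof -
 define b where "b = box_bump 1 (- (\<chi> i. 1) :: real ^ 'n) (\<chi> i. 1)"
 have bt: "b \<in> test_functions" unfolding b_def by (rule box_bump_test) simp
 have b0: "b 0 > 0" unfolding b_def by (rule box_bump_pos) (simp add: mem_box_cart)
 have bn: "b x >= 0" for x unfolding b_def by (rule box_bump_nonneg)
 define s where "s n = 1 / real (Suc n)" for n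
 have s: "s n > 0" "s n <= 1" for n by (auto simp: s_def)
 have s0: "s ----> 0" unfolding s_def[abs_def] by (rule LIMSEQ_Suc[OF lim_const_over_n[of 1]])
 define phi where "phi n x = b (s n *\<^sub>R x)" for n x
 have fl: "flat 0 1 (a * t) = flat 0 (1 / a) t" if "a > 0" for a t :: real
  using that by (simp add: flat_def zero_less_mult_iff)
 \<comment> \<open>A rescaled bump is again a box bump with another parameter, since
   \<open>flat 0 1 (a t) = flat 0 (1 / a) t\<close>; this settles smoothness and support.\<close>
 have phi_box: "phi n = box_bump (1 / s n) (- (\<chi> i. 1 / s n)) (\<chi> i. 1 / s n)" for n
 proof
  fix x :: "real ^ 'n"
  have "s n * x $ i + 1 = s n * (x $ i + 1 / s n)" "1 - s n * x $ i = s n * (1 / s n - x $ i)" for i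
   using s(1)[of n] by (simp_all add: distrib_left right_diff_distrib)
  then have "flat 0 1 (s n * x $ i + 1) = flat 0 (1 / s n) (x $ i + 1 / s n)"
   "flat 0 1 (1 - s n * x $ i) = flat 0 (1 / s n) (1 / s n - x $ i)" for i
   by (simp_all only: fl[OF s(1)])
  then show "phi n x = box_bump (1 / s n) (- (\<chi> i. 1 / s n)) (\<chi> i. 1 / s n) x"
   by (simp add: phi_def b_def box_bump_def)
 qed
 have phit: "phi n \<in> test_functions" for n unfolding phi_box using s(1)[of n] by (intro box_bump_test) simp
 define B where "B i = partial_derivative i (partial_derivative i b)" for i
 have Bt: "B i \<in> test_functions" for i unfolding B_def by (intro partial_derivative_test bt)
 have dd: "partial_derivative i (partial_derivative i (phi n)) = (%x. (s n)^2 * B i (s n *\<^sub>R x))" for n i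
 proof -
  have "partial_derivative i (phi n) = (%x. s n * partial_derivative i b (s n *\<^sub>R x))"
   using test_function_dilate_partial[OF bt, where i = i and c = 1 and s = "s n"] by (simp add: phi_def[abs_def])
  then show ?thesis using test_function_dilate_partial[OF partial_derivative_test[OF bt, of i], where i = i and c = "s n" and s = "s n"] by (simp add: B_def power2_eq_square)
 qed
 define w where "w i n x = (s n)^2 * B i (s n *\<^sub>R x)" for i n x
 have lim: "(%n. ip (w i n) v) ----> 0" for i
 proof (rule ip_tendsto_0_AE(2)[where c = "mass (B i)"])
  fix n
  show "w i n \<in> L2" using L2_dilate(1)[OF test_function_L2[OF Bt], where t = "s n" and c = "(s n)^2" and a = 0] s(1)[of n] by (simp add: w_def[abs_def])
  have "mass (w i n) = ((s n)^2)^2 * mass (B i) / s n ^ CARD('n)"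
   using L2_dilate(2)[OF test_function_L2[OF Bt], where t = "s n" and c = "(s n)^2" and a = 0] s(1)[of n] by (simp add: w_def[abs_def])
  also have "... <= mass (B i)"
  proof -
   have "s n ^ 4 <= s n ^ CARD('n)" using s(1,2)[of n] N by (intro power_decreasing) auto
   then have "(s n) ^ 4 * mass (B i) <= s n ^ CARD('n) * mass (B i)" by (rule mult_right_mono) simp
   then show ?thesis using s(1)[of n] by (simp add: pos_divide_le_eq mult.commute)
  qed
  finally show "mass (w i n) <= mass (B i)" .
 next
  show "v \<in> L2" by (rule H1_L2[OF v(1)])
  obtain C where C: "!!x. \<bar>B i x\<bar> <= C" using test_function_bounded[OF Bt, of i] by blast
  show "ae x. (%n. w i n x) ----> 0"
  proof (rule AE_I2, rule Lim_null_comparison)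
   fix x
   show "\<forall>\<^sub>F n in sequentially. norm (w i n x) <= (s n)^2 * C"
    by (rule always_eventually) (simp add: w_def abs_mult mult_left_mono[OF C])
   show "(%n. (s n)^2 * C) ----> 0" using tendsto_mult[OF tendsto_power[OF s0, of 2] tendsto_const[of C]] by simp
  qed
 qed
 \<comment> \<open>Both derivatives sit on the bump, so the weak limit zero of its rescaled
   Laplacian sends \<open>gip v (phi n)\<close> to zero. On the other side of the inequality Fatou
   keeps the integral of \<open>b 0\<close> times the power \<open>p - 1\<close> of
   \<open>v\<close>.\<close>
 have "gip v (phi n) = - (\<Sum>i\<in>UNIV. ip (w i n) v)" for n
  unfolding gip_test[OF v(1) phit] dd w_def[abs_def] by (simp add: ip_commute)
 then have "(%n. gip v (phi n)) ----> 0"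
  using tendsto_minus[OF tendsto_sum[of UNIV "%i n. ip (w i n) v" "%i. 0", OF lim]] by simp
 from tendsto_divide[OF this tendsto_const[of \<mu>]] \<mu> have gl: "(%n. gip v (phi n) / \<mu>) ----> 0" by simp
 define f where "f n x = \<bar>v x\<bar> powr (p - 2) * v x * phi n x" for n x
 define g where "g x = \<bar>v x\<bar> powr (p - 2) * v x * b 0" for x
 have fi: "integrable lebesgue (f n)" for n
  unfolding f_def[abs_def] by (rule powr_mult_integrable[OF p v(1) test_function_H1[OF phit]])
 have fle: "integral\<^sup>L lebesgue (f n) <= gip v (phi n) / \<mu>" for n
  using le[OF test_function_H1[OF phit], of n] \<mu> bn by (simp add: f_def[abs_def] phi_def pos_le_divide_eq mult.commute)
 have gm: "g \<in> lmeas" unfolding g_def[abs_def] using H1_measurable[OF v(1)] by measurable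
 have fn: "0 <= f n x" for n x unfolding f_def phi_def using v(2)[of x] bn by simp
 have fl: "(%n. f n x) ----> g x" for x
 proof -
  have "(%n. s n *\<^sub>R x) ----> 0 *\<^sub>R x" by (intro tendsto_scaleR s0 tendsto_const)
  from isCont_tendsto_compose[OF _ this, of b] test_functionsD(2)[OF bt]
  have "(%n. phi n x) ----> b 0" by (simp add: phi_def continuous_on_eq_continuous_at)
  then show ?thesis unfolding f_def g_def by (intro tendsto_mult tendsto_const)
 qed
 have F: "integrable lebesgue g & integral\<^sup>L lebesgue g <= e" if "e > 0" for e
 proof -
  have "\<forall>\<^sub>F n in sequentially. gip v (phi n) / \<mu> < e" using order_tendstoD(2)[OF gl that] .
  then have "\<forall>\<^sub>F n in sequentially. integral\<^sup>L lebesgue (f n) <= e"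
  proof eventually_elim
   case (elim n) then show ?case using fle[of n] by linarith
  qed
  then show ?thesis
   using Fatou_integrable[OF fi AE_I2[OF fn] gm AE_I2[OF fl], of e] by blast
 qed
 have "integral\<^sup>L lebesgue g <= 0"
 proof (rule field_le_epsilon)
  fix e :: real assume "e > 0" then show "integral\<^sup>L lebesgue g <= 0 + e" using F[of e] by simp
 qed
 moreover have gn: "0 <= g x" for x unfolding g_def using v(2)[of x] b0 by simp
 moreover have "0 <= integral\<^sup>L lebesgue g" by (rule integral_nonneg_AE[where M = lebesgue]) (rule AE_I2, rule gn)
 ultimately have "integral\<^sup>L lebesgue g = 0" by linarith
 then have "ae x. g x = 0"
  using integral_nonneg_eq_0_iff_AE[of lebesgue g] F[of 1] gn by simp
 then have "ae x. v x = 0"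
 proof eventually_elim
  case (elim x)
  then show ?case using b0 by (auto simp: g_def)
 qed
 then show False using mass_eq_0_iff[OF H1_L2[OF v(1)]] v(3) by simp
qed

subsection \<open>Fibre maps\<close>

text \<open>Used with the exponents \<open>\<alpha>1 / 2\<close> and \<open>\<alpha>2 / 2\<close>,
  which lie below one: the Dirichlet term beats the power terms, with explicit room
  \<open>L\<close>.\<close>

lemma sublinear_growth:
 fixes c K1 K2 th1 th2 L :: real
 assumes c: "c > 0" and th: "th1 < 1" "th2 < 1"
 obtains X where "X > 0" "!!x. x >= X ==> L <= c * x - K1 * x powr th1 - K2 * x powr th2"
proof -
 have "((%x. c - K1 * x powr (th1 - 1) - K2 * x powr (th2 - 1)) \<longlongrightarrow> c - K1 * 0 - K2 * 0) at_top"
  by (intro tendsto_diff tendsto_mult tendsto_const tendsto_neg_powr filterlim_ident) (use th in auto)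
 then have "((%x. c - K1 * x powr (th1 - 1) - K2 * x powr (th2 - 1)) \<longlongrightarrow> c) at_top" by simp
 from filterlim_tendsto_pos_mult_at_top[OF this c filterlim_ident]
 have "\<forall>\<^sub>F x in at_top. L <= (c - K1 * x powr (th1 - 1) - K2 * x powr (th2 - 1)) * x"
  by (simp add: filterlim_at_top)
 then obtain X where X: "!!x. x >= X ==> L <= (c - K1 * x powr (th1 - 1) - K2 * x powr (th2 - 1)) * x"
  by (auto simp: eventually_at_top_linorder)
 show ?thesis
 proof (rule that[of "max X 1"])
  fix x assume x: "max X 1 <= x"
  have e: "x powr (th - 1) * x = x powr th" for th
   using powr_add[of x "th - 1" 1] x by simp
  have "(c - K1 * x powr (th1 - 1) - K2 * x powr (th2 - 1)) * x = c * x - K1 * (x powr (th1 - 1) * x) - K2 * (x powr (th2 - 1) * x)"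
   by (simp add: left_diff_distrib)
  with X[of x] x show "L <= c * x - K1 * x powr th1 - K2 * x powr th2" by (simp add: e)
 qed simp
qed

text \<open>The energy along the mass-preserving dilations of a pair. Only four numbers of the pair
  enter: its Dirichlet integral \<open>A\<close>, the two power terms and the coupling.\<close>

definition fiber :: "real => real => real => real => real => real => real => real => real" where
 "fiber \<alpha>1 \<alpha>2 \<gamma> A b1 b2 c t = t^2 / 2 * A - b1 * t powr \<alpha>1 - b2 * t powr \<alpha>2 - c * t powr \<gamma>"

text \<open>\<open>t powr k\<close> is strictly convex as a function of \<open>ln t\<close>; the weight does not depend on \<open>k\<close>.\<close>

lemma powr_log_convex:
 fixes s x t :: real
 assumes "0 < s" "s < x" "x < t"
 obtains th where "0 < th" "th < 1" "!!k. k ~= 0 ==> x powr k < (1 - th) * s powr k + th * t powr k"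
proof -
 have pos: "0 < x" "0 < t" using assms by auto
 have l: "ln s < ln x" "ln x < ln t" using assms pos by auto
 define th where "th = (ln x - ln s) / (ln t - ln s)"
 have th: "0 < th" "th < 1" using l by (auto simp: th_def field_simps)
 have mean: "(1 - th) * (ln s - ln x) + th * (ln t - ln x) = 0"
 proof -
  have "th * (ln t - ln s) = ln x - ln s" using l by (simp add: th_def)
  then show ?thesis by (simp add: algebra_simps)
 qed
 have tangent: "x powr k * (1 + k * (ln y - ln x)) < y powr k" if "y > 0" "y ~= x" "k ~= 0" for y k
 proof -
  define z where "z = (y / x) powr k"
  have z: "z > 0" "ln z = k * (ln y - ln x)" using that pos by (auto simp: z_def ln_powr ln_div)
  have "ln z ~= 0" using z(2) that pos by simp
  then have "z ~= 1" by auto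
  then have "ln z < z - 1" using ln_le_minus_one[OF z(1)] ln_eq_minus_one[OF z(1)] by linarith
  then have "1 + k * (ln y - ln x) < z" using z(2) by simp
  then have "x powr k * (1 + k * (ln y - ln x)) < x powr k * z" using pos by (intro mult_strict_left_mono) auto
  also have "x powr k * z = y powr k" using that pos by (simp add: z_def powr_divide)
  finally show ?thesis .
 qed
 show ?thesis
 proof (rule that[OF th])
  fix k :: real assume k: "k ~= 0"
  have "(1 - th) * (x powr k * (1 + k * (ln s - ln x))) < (1 - th) * s powr k"
   using tangent[of s k] assms k th by (intro mult_strict_left_mono) auto
  moreover have "th * (x powr k * (1 + k * (ln t - ln x))) < th * t powr k"
   using tangent[of t k] assms k th by (intro mult_strict_left_mono) auto
  moreover have "(1 - th) * (x powr k * (1 + k * (ln s - ln x))) + th * (x powr k * (1 + k * (ln t - ln x))) =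
    x powr k * (1 + k * ((1 - th) * (ln s - ln x) + th * (ln t - ln x)))"
   by (simp add: algebra_simps)
  ultimately show "x powr k < (1 - th) * s powr k + th * t powr k" by (simp add: mean)
 qed
qed

locale fiber_exponents =
 fixes \<alpha>1 \<alpha>2 \<gamma> :: real
 assumes \<alpha>: "0 < \<alpha>1" "\<alpha>1 < 2" "0 < \<alpha>2" "\<alpha>2 < 2" and \<gamma>: "2 < \<gamma>"
begin

abbreviation "fib \<equiv> fiber \<alpha>1 \<alpha>2 \<gamma>"

lemma fib_continuous: "0 < lo ==> continuous_on {lo..hi} (fib A b1 b2 c)"
 unfolding fiber_def[abs_def] by (intro continuous_intros) auto

text \<open>A value at least one forces the quadratic term to be at least one, which bounds
  \<open>t\<close> from below, and to exceed \<open>c0 * t powr \<gamma>\<close>, which bounds it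
  from above. The range depends on the coefficients only through \<open>D\<close> and
  \<open>c0\<close>, so it is common to whole families of pairs.\<close>

lemma fib_range:
 assumes D: "D > 0" and c0: "c0 > 0"
 obtains lo hi where "0 < lo" "!!A b1 b2 c t. A <= D ==> 0 <= b1 ==> 0 <= b2 ==> c0 <= c ==> 0 < t ==>
  1 <= fib A b1 b2 c t ==> lo <= t & t <= hi"
proof (rule that)
 define lo where "lo = sqrt (2 / D)"
 define hi where "hi = (D / (2 * c0)) powr (1 / (\<gamma> - 2))"
 show "0 < lo" using D by (simp add: lo_def)
 fix A b1 b2 c t :: real
 assume *: "A <= D" "0 <= b1" "0 <= b2" "c0 <= c" "0 < t" "1 <= fib A b1 b2 c t"
 have "t^2 / 2 * A <= t^2 / 2 * D" "0 <= b1 * t powr \<alpha>1" "0 <= b2 * t powr \<alpha>2" "c0 * t powr \<gamma> <= c * t powr \<gamma>"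
  using * by (auto intro!: mult_left_mono mult_right_mono)
 then have le: "1 + c0 * t powr \<gamma> <= t^2 / 2 * D" using *(6) unfolding fiber_def by linarith
 have c0t: "0 <= c0 * t powr \<gamma>" using c0 by simp
 have "2 / D <= t^2" using le c0t D by (simp add: pos_divide_le_eq)
 then have "lo <= t" unfolding lo_def using *(5) by (intro real_le_lsqrt) auto
 moreover have "t <= hi"
 proof -
  have "t powr \<gamma> = t powr (\<gamma> - 2) * t^2" using powr_add[of t "\<gamma> - 2" 2] *(5) by (simp add: powr_numeral)
  then have "(c0 * t powr (\<gamma> - 2)) * t^2 <= (D / 2) * t^2" using le by (simp add: mult.commute mult.left_commute)
  then have "c0 * t powr (\<gamma> - 2) <= D / 2" using *(5) by (simp add: mult_le_cancel_right)
  then have "t powr (\<gamma> - 2) <= D / (2 * c0)" using c0 by (simp add: field_simps)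
  then have "(t powr (\<gamma> - 2)) powr (1 / (\<gamma> - 2)) <= hi" unfolding hi_def using \<gamma> by (intro powr_mono2) auto
  then show ?thesis using \<gamma> *(5) by (simp add: powr_powr)
 qed
 ultimately show "lo <= t & t <= hi" ..
qed

text \<open>Points with value at least one lie in a compact range, so the maximum over that range is
  global.\<close>

lemma fib_peak_exists:
 assumes A: "0 <= A" and b: "0 <= b1" "0 <= b2" and c: "0 < c" and s: "0 < s" "1 <= fib A b1 b2 c s"
 obtains t where "0 < t" "1 <= fib A b1 b2 c t" "!!x. 0 < x ==> fib A b1 b2 c x <= fib A b1 b2 c t"
proof -
 obtain lo hi where r: "0 < lo" "!!t. 0 < t ==> 1 <= fib A b1 b2 c t ==> lo <= t & t <= hi"
  using fib_range[of "A + 1" c] A b c by (metis less_add_one le_less add_nonneg_pos zero_less_one)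
 have sI: "s \<in> {lo..hi}" using r(2)[OF s] by simp
 obtain t where t: "t \<in> {lo..hi}" "!!x. x \<in> {lo..hi} ==> fib A b1 b2 c x <= fib A b1 b2 c t"
  using continuous_attains_sup[OF compact_Icc _ fib_continuous[OF r(1), of hi A b1 b2 c]] sI by blast
 have t1: "1 <= fib A b1 b2 c t" using t(2)[OF sI] s by linarith
 show ?thesis
 proof (rule that[OF _ t1])
  show "0 < t" using t(1) r(1) by simp
  fix x :: real assume x: "0 < x"
  show "fib A b1 b2 c x <= fib A b1 b2 c t"
  proof (cases "1 <= fib A b1 b2 c x")
   case True
   then show ?thesis using r(2)[OF x] t(2)[of x] by simp
  qed (use t1 in linarith)
 qed
qed

lemma fib_DERIV:
 assumes "0 < x"
 shows "(fib A b1 b2 c has_real_derivative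
  x * (A - b1 * \<alpha>1 * x powr (\<alpha>1 - 2) - b2 * \<alpha>2 * x powr (\<alpha>2 - 2) - c * \<gamma> * x powr (\<gamma> - 2))) (at x)"
proof -
 have e: "x * x powr (k - 2) = x powr (k - 1)" for k using powr_add[of x 1 "k - 2"] assms by (simp add: algebra_simps)
 have "(fib A b1 b2 c has_real_derivative x * A - b1 * (\<alpha>1 * x powr (\<alpha>1 - 1)) - b2 * (\<alpha>2 * x powr (\<alpha>2 - 1)) - c * (\<gamma> * x powr (\<gamma> - 1))) (at x)"
  unfolding fiber_def[abs_def] using assms by (auto intro!: derivative_eq_intros has_real_derivative_powr)
 then show ?thesis by (simp add: right_diff_distrib e[symmetric] ac_simps)
qed

lemma fib_peak_derivative:
 assumes "0 < s" "!!x. 0 < x ==> fib A b1 b2 c x <= fib A b1 b2 c s"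
 shows "A - b1 * \<alpha>1 * s powr (\<alpha>1 - 2) - b2 * \<alpha>2 * s powr (\<alpha>2 - 2) - c * \<gamma> * s powr (\<gamma> - 2) = 0"
proof -
 have "fib A b1 b2 c y <= fib A b1 b2 c s" if "\<bar>s - y\<bar> < s" for y using assms(2)[of y] that by linarith
 from DERIV_local_max[OF fib_DERIV[OF assms(1)] assms(1)] this show ?thesis using assms(1) by auto
qed

text \<open>The derivative is \<open>x\<close> times a function \<open>g\<close> that is strictly
  concave in \<open>ln x\<close>, because the exponents \<open>\<alpha>1 - 2\<close>,
  \<open>\<alpha>2 - 2\<close>, \<open>\<gamma> - 2\<close> are nonzero. Between two zeros
  \<open>g\<close> is positive, so the fibre would rise strictly from one maximum to the
  other.\<close>

lemma fib_peak_unique: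
 assumes b: "0 <= b1" "0 <= b2" and c: "0 < c"
  and s: "0 < s" "!!x. 0 < x ==> fib A b1 b2 c x <= fib A b1 b2 c s"
  and t: "0 < t" "!!x. 0 < x ==> fib A b1 b2 c x <= fib A b1 b2 c t"
 shows "s = t"
proof -
 have False if st: "0 < s" "s < t" and S: "!!x. 0 < x ==> fib A b1 b2 c x <= fib A b1 b2 c s"
  and T: "!!x. 0 < x ==> fib A b1 b2 c x <= fib A b1 b2 c t" for s t
 proof -
  define g where "g x = A - b1 * \<alpha>1 * x powr (\<alpha>1 - 2) - b2 * \<alpha>2 * x powr (\<alpha>2 - 2) - c * \<gamma> * x powr (\<gamma> - 2)" for x
  have t0: "0 < t" using st by simp
  have g0: "g s = 0" "g t = 0" unfolding g_def by (rule fib_peak_derivative[OF st(1) S] fib_peak_derivative[OF t0 T]; assumption)+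
  have gpos: "0 < g x" if x: "s < x" "x < t" for x
  proof -
   obtain th where th: "0 < th" "th < 1" "!!k. k ~= 0 ==> x powr k < (1 - th) * s powr k + th * t powr k"
    by (rule powr_log_convex[OF st(1) x]) blast
   define W where "W k = (1 - th) * s powr k + th * t powr k" for k
   have "b1 * \<alpha>1 * x powr (\<alpha>1 - 2) <= b1 * \<alpha>1 * W (\<alpha>1 - 2)" "b2 * \<alpha>2 * x powr (\<alpha>2 - 2) <= b2 * \<alpha>2 * W (\<alpha>2 - 2)"
    using th(3)[of "\<alpha>1 - 2"] th(3)[of "\<alpha>2 - 2"] \<alpha> b by (auto simp: W_def intro!: mult_left_mono)
   moreover have "c * \<gamma> * x powr (\<gamma> - 2) < c * \<gamma> * W (\<gamma> - 2)"
    using th(3)[of "\<gamma> - 2"] \<gamma> c by (auto simp: W_def intro!: mult_strict_left_mono)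
   moreover have "(1 - th) * g s + th * g t = A - b1 * \<alpha>1 * W (\<alpha>1 - 2) - b2 * \<alpha>2 * W (\<alpha>2 - 2) - c * \<gamma> * W (\<gamma> - 2)"
    unfolding g_def W_def by (simp add: algebra_simps)
   ultimately show ?thesis using g0 by (simp add: g_def)
  qed
  have "fib A b1 b2 c s < fib A b1 b2 c t"
  proof (rule DERIV_pos_imp_increasing_open[OF st(2) _ fib_continuous[OF st(1)]])
   fix x assume x: "s < x" "x < t"
   have x0: "0 < x" using st x by simp
   show "\<exists>y. (fib A b1 b2 c has_real_derivative y) (at x) & 0 < y"
    using fib_DERIV[OF x0, of A b1 b2 c] gpos[OF x] x0 unfolding g_def by (intro exI conjI) (assumption, rule mult_pos_pos)
  qed
  then show False using S[OF t0] by simp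
 qed
 from this[OF s(1) _ s(2) t(2)] this[OF t(1) _ t(2) s(2)] show ?thesis by (cases s t rule: linorder_cases) auto
qed

lemma fib_diff_le:
 assumes "0 < t" "t <= hi"
 shows "\<bar>fib A b1 b2 c t - fib A' b1' b2' c' t\<bar> <=
  hi^2 / 2 * \<bar>A - A'\<bar> + hi powr \<alpha>1 * \<bar>b1 - b1'\<bar> + hi powr \<alpha>2 * \<bar>b2 - b2'\<bar> + hi powr \<gamma> * \<bar>c - c'\<bar>"
proof -
 have m: "\<bar>x * y\<bar> <= X * \<bar>y\<bar>" if "0 <= x" "x <= X" for x y X :: real
  using that by (simp add: abs_mult mult_right_mono)
 have m1: "\<bar>t^2 / 2 * (A - A')\<bar> <= hi^2 / 2 * \<bar>A - A'\<bar>" using assms by (intro m divide_right_mono power_mono) auto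
 have m2: "\<bar>t powr \<alpha>1 * (b1 - b1')\<bar> <= hi powr \<alpha>1 * \<bar>b1 - b1'\<bar>" "\<bar>t powr \<alpha>2 * (b2 - b2')\<bar> <= hi powr \<alpha>2 * \<bar>b2 - b2'\<bar>"
  "\<bar>t powr \<gamma> * (c - c')\<bar> <= hi powr \<gamma> * \<bar>c - c'\<bar>"
  using assms \<alpha> \<gamma> by (auto intro!: m powr_mono2)
 have eq: "fib A b1 b2 c t - fib A' b1' b2' c' t =
  t^2 / 2 * (A - A') - t powr \<alpha>1 * (b1 - b1') - t powr \<alpha>2 * (b2 - b2') - t powr \<gamma> * (c - c')"
  by (simp add: fiber_def right_diff_distrib left_diff_distrib diff_divide_distrib mult.commute)
 have tri: "\<bar>x - y - z - w\<bar> <= \<bar>x\<bar> + \<bar>y\<bar> + \<bar>z\<bar> + \<bar>w\<bar>" for x y z w :: real by linarith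
 show ?thesis unfolding eq by (rule order_trans[OF tri]) (intro add_mono m1 m2)
qed

text \<open>Away from \<open>1\<close> the unperturbed fibre stays below its maximum by a fixed
  \<open>\<eta>\<close> on the compact range, by uniqueness of the peak, while the perturbation is
  uniformly small there. A scale \<open>T tau\<close> at which the perturbed fibre reaches the old
  maximum must therefore be close to \<open>1\<close>.\<close>

lemma fib_peak_tendsto:
 fixes A' b1' b2' c' T :: "real => real"
 assumes nn: "0 <= A" "0 <= b1" "0 <= b2" "0 < c" "!!tau. 0 <= b1' tau" "!!tau. 0 <= b2' tau"
  and lim: "(A' \<longlongrightarrow> A) F" "(b1' \<longlongrightarrow> b1) F" "(b2' \<longlongrightarrow> b2) F" "(c' \<longlongrightarrow> c) F"
  and peak: "!!x. 0 < x ==> fib A b1 b2 c x <= fib A b1 b2 c 1" "1 <= fib A b1 b2 c 1"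
  and T: "\<forall>\<^sub>F tau in F. 0 < T tau & fib A b1 b2 c 1 <= fib (A' tau) (b1' tau) (b2' tau) (c' tau) (T tau)"
 shows "(T \<longlongrightarrow> 1) F"
proof (rule tendstoI)
 fix \<epsilon> :: real assume \<epsilon>: "\<epsilon> > 0"
 have D: "0 < A + 1" "0 < c / 2" using nn by auto
 obtain lo hi where r: "0 < lo" "!!A' b1 b2 c' t. A' <= A + 1 ==> 0 <= b1 ==> 0 <= b2 ==> c / 2 <= c' ==> 0 < t ==>
  1 <= fib A' b1 b2 c' t ==> lo <= t & t <= hi"
  by (rule fib_range[OF D]) (rule that)
 define M where "M = fib A b1 b2 c 1"
 define S where "S = {lo..hi} - ball 1 \<epsilon>"
 have S: "compact S" unfolding S_def by (intro compact_diff) auto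
 have "\<exists>\<eta>>0. \<forall>x\<in>S. fib A b1 b2 c x + \<eta> <= M"
 proof (cases "S = {}")
  case False
  obtain x where x: "x \<in> S" "!!y. y \<in> S ==> fib A b1 b2 c y <= fib A b1 b2 c x"
   using continuous_attains_sup[OF S False continuous_on_subset[OF fib_continuous[OF r(1), of hi A b1 b2 c]]] unfolding S_def by blast
  have x0: "0 < x" "x ~= 1" using x(1) r(1) \<epsilon> by (auto simp: S_def)
  have "fib A b1 b2 c x ~= M"
  proof
   assume e: "fib A b1 b2 c x = M"
   have "x = 1" by (rule fib_peak_unique[OF nn(2-4) x0(1) _ zero_less_one peak(1)]) (use peak(1) e M_def in auto)
   with x0 show False by simp
  qed
  then have "fib A b1 b2 c x < M" using peak(1)[OF x0(1)] by (simp add: M_def)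
  then show ?thesis using x(2) by (intro exI[of _ "M - fib A b1 b2 c x"]) auto
 qed (auto intro: exI[of _ 1])
 then obtain \<eta> where \<eta>: "\<eta> > 0" "!!x. x \<in> S ==> fib A b1 b2 c x + \<eta> <= M" by blast
 define err where "err tau = hi^2 / 2 * \<bar>A' tau - A\<bar> + hi powr \<alpha>1 * \<bar>b1' tau - b1\<bar> + hi powr \<alpha>2 * \<bar>b2' tau - b2\<bar> + hi powr \<gamma> * \<bar>c' tau - c\<bar>" for tau
 have "(err \<longlongrightarrow> hi^2 / 2 * \<bar>A - A\<bar> + hi powr \<alpha>1 * \<bar>b1 - b1\<bar> + hi powr \<alpha>2 * \<bar>b2 - b2\<bar> + hi powr \<gamma> * \<bar>c - c\<bar>) F"
  unfolding err_def[abs_def] by (intro tendsto_add tendsto_mult tendsto_rabs tendsto_diff tendsto_const lim)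
 then have "(err \<longlongrightarrow> 0) F" by simp
 from order_tendstoD(2)[OF this \<eta>(1)] order_tendstoD(2)[OF lim(1), of "A + 1"] order_tendstoD(1)[OF lim(4), of "c / 2"] T
 have "\<forall>\<^sub>F tau in F. err tau < \<eta>" "\<forall>\<^sub>F tau in F. A' tau < A + 1" "\<forall>\<^sub>F tau in F. c / 2 < c' tau"
  "\<forall>\<^sub>F tau in F. 0 < T tau & fib A b1 b2 c 1 <= fib (A' tau) (b1' tau) (b2' tau) (c' tau) (T tau)" using nn by auto
 then show "\<forall>\<^sub>F tau in F. dist (T tau) 1 < \<epsilon>"
 proof eventually_elim
  case (elim tau)
  have "1 <= fib (A' tau) (b1' tau) (b2' tau) (c' tau) (T tau)" using elim(4) peak(2) by linarith
  then have I: "lo <= T tau" "T tau <= hi" using r(2)[of "A' tau" "b1' tau" "b2' tau" "c' tau" "T tau"] elim nn(5,6) by auto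
  have "fib (A' tau) (b1' tau) (b2' tau) (c' tau) (T tau) <= fib A b1 b2 c (T tau) + err tau"
   using fib_diff_le[of "T tau" hi "A' tau" "b1' tau" "b2' tau" "c' tau" A b1 b2 c] I elim(4) unfolding err_def by linarith
  then have "T tau \<notin> S" using \<eta>(2)[of "T tau"] elim unfolding M_def by linarith
  then show ?case using I by (simp add: S_def dist_commute)
 qed
qed

end

lemma pw_pos:
 fixes u :: "real ^ 'n => real"
 assumes p: "subcrit TYPE('n) p" and u: "u \<in> H1" "mass u > 0"
 shows "pw p u > 0"
proof (rule ccontr)
 assume "~ pw p u > 0"
 then have "pw p u = 0" using pw_nonneg[of p u] by linarith
 then have "ae x. \<bar>u x\<bar> powr p = 0"
  using integral_nonneg_eq_0_iff_AE[OF pw_integrable[OF p u(1)]] by (simp add: pw_def)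
 then have "ae x. u x = 0" by eventually_elim simp
 then show False using mass_eq_0_iff[OF H1_L2[OF u(1)]] u(2) by simp
qed

subsection \<open>The energy on feasible pairs\<close>

locale coupled =
 fixes dim :: "'n :: finite itself" and \<mu>1 \<mu>2 p1 p2 r1 r2 :: real
 assumes \<mu>: "\<mu>1 > 0" "\<mu>2 > 0"
  and p: "2 < p1" "p1 < 2 + 4 / real CARD('n)" "2 < p2" "p2 < 2 + 4 / real CARD('n)"
  and r: "r1 > 1" "r2 > 1" "2 + 4 / real CARD('n) < r1 + r2" "ereal (r1 + r2) < critical_exponent CARD('n)"
begin

text \<open>The power of \<open>t\<close> that \<open>pw p1\<close> picks up under the
  mass-preserving dilation \<open>dil t\<close>; likewise \<open>\<alpha>2\<close> and, for the
  coupling, \<open>\<gamma>\<close>. The Dirichlet integral picks up \<open>t^2\<close>, and the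
  hypotheses on the exponents say that \<open>2\<close> separates \<open>\<alpha>1\<close>,
  \<open>\<alpha>2\<close> from \<open>\<gamma>\<close>.\<close>

definition \<alpha>1 :: real where "\<alpha>1 = real CARD('n) * (p1 - 2) / 2"
definition \<alpha>2 :: real where "\<alpha>2 = real CARD('n) * (p2 - 2) / 2"
definition \<gamma> :: real where "\<gamma> = real CARD('n) * (r1 + r2 - 2) / 2"

lemma sub: "subcrit TYPE('n) p1" "subcrit TYPE('n) p2" "subcrit TYPE('n) (r1 + r2)"
proof -
 have "ereal p1 <= ereal (r1 + r2)" "ereal p2 <= ereal (r1 + r2)" using p r by auto
 then show "subcrit TYPE('n) p1" "subcrit TYPE('n) p2" using p r unfolding subcrit_def by (auto intro: le_less_trans[OF _ r(4)])
 have "0 <= 4 / real CARD('n)" by simp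
 then have "2 < r1 + r2" using r(3) by linarith
 then show "subcrit TYPE('n) (r1 + r2)" using r(4) by (simp add: subcrit_def)
qed

sublocale fiber_exponents \<alpha>1 \<alpha>2 \<gamma>
proof
 have N: "real CARD('n) > 0" by simp
 show "0 < \<alpha>1" "0 < \<alpha>2" unfolding \<alpha>1_def \<alpha>2_def using N p by simp_all
 have "real CARD('n) * (p1 - 2) < 4" "real CARD('n) * (p2 - 2) < 4" "4 < real CARD('n) * (r1 + r2 - 2)"
  using p r N by (simp_all add: field_simps)
 then show "\<alpha>1 < 2" "\<alpha>2 < 2" "2 < \<gamma>" by (simp_all add: \<alpha>1_def \<alpha>2_def \<gamma>_def)
qed

text \<open>The energy of the pair dilated by \<open>t\<close>, written through its fibre, so that
  peaks can be found and compared before any dilated function is formed.\<close>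

definition J :: "real => real => (real ^ 'n => real) => (real ^ 'n => real) => real" where
 "J \<beta> t u v = fib (dir u + dir v) (\<mu>1 / p1 * pw p1 u) (\<mu>2 / p2 * pw p2 v) (\<beta> * cp r1 r2 u v) t"

lemma coeff_nonneg: "0 <= \<mu>1 / p1 * pw p1 u" "0 <= \<mu>2 / p2 * pw p2 v" "0 <= \<beta> ==> 0 <= \<beta> * cp r1 r2 u v"
 using \<mu> p by simp_all

lemma energy_J:
 assumes "u \<in> H1" "v \<in> H1"
 shows "energy \<mu>1 \<mu>2 p1 p2 r1 r2 \<beta> u v = J \<beta> 1 u v"
 unfolding energy_def dir_sum_eq[OF assms] by (simp add: J_def fiber_def pw_def cp_def)

definition dil :: "real => (real ^ 'n => real) => real ^ 'n => real" where
 "dil t u x = t powr (real CARD('n) / 2) * u (t *\<^sub>R x)"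

lemma dil:
 assumes t: "t > 0" and u: "u \<in> H1"
 shows "dil t u \<in> H1" "mass (dil t u) = mass u" "dir (dil t u) = t^2 * dir u"
  "pw p (dil t u) = t powr (real CARD('n) * (p - 2) / 2) * pw p u"
proof -
 define c where "c = t powr (real CARD('n) / 2)"
 have c: "c > 0" using t by (simp add: c_def)
 have "c^2 = t powr (real CARD('n))" using t by (simp add: c_def power2_eq_square powr_add[symmetric])
 then have c2: "c^2 = t ^ CARD('n)" using t by (simp add: powr_realpow)
 have e: "dil t u = (%x. c * u (t *\<^sub>R x + 0))" by (simp add: dil_def c_def fun_eq_iff)
 have t0: "t ~= 0" using t by simp
 have tN: "t ^ CARD('n) > 0" using t by simp
 show "dil t u \<in> H1" unfolding e by (rule H1_dilate(1)[OF u t0])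
 show "mass (dil t u) = mass u" unfolding e L2_dilate(2)[OF H1_L2[OF u] t0] using t tN by (simp add: c2)
 show "dir (dil t u) = t^2 * dir u" unfolding e H1_dilate(2)[OF u t0] using t tN by (simp add: c2)
 have "c powr p / t ^ CARD('n) = t powr (real CARD('n) * (p - 2) / 2)"
 proof -
  have "c powr p / t ^ CARD('n) = t powr (real CARD('n) / 2 * p) / t powr real CARD('n)"
   using t by (simp add: c_def powr_powr powr_realpow)
  also have "... = t powr (real CARD('n) / 2 * p - real CARD('n))" by (simp add: powr_diff)
  also have "real CARD('n) / 2 * p - real CARD('n) = real CARD('n) * (p - 2) / 2" by (simp add: field_simps)
  finally show ?thesis .
 qed
 moreover have "pw p (dil t u) = c powr p * pw p u / t ^ CARD('n)"
  unfolding e pw_def by (rule powr_integral_dilate(1)[OF H1_measurable[OF u] t c])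
 ultimately show "pw p (dil t u) = t powr (real CARD('n) * (p - 2) / 2) * pw p u" by (metis times_divide_eq_left)
qed

lemma cp_dil:
 assumes t: "t > 0" and u: "u \<in> H1" and v: "v \<in> H1"
 shows "cp r1 r2 (dil t u) (dil t v) = t powr \<gamma> * cp r1 r2 u v"
proof -
 define c where "c = t powr (real CARD('n) / 2)"
 have m: "(%x. \<bar>u x\<bar> powr r1 * \<bar>v x\<bar> powr r2) \<in> lmeas"
  using H1_measurable[OF u] H1_measurable[OF v] by measurable
 have "(%x. \<bar>dil t u x\<bar> powr r1 * \<bar>dil t v x\<bar> powr r2) =
   (%x. c powr (r1 + r2) * (\<bar>u (t *\<^sub>R x + 0)\<bar> powr r1 * \<bar>v (t *\<^sub>R x + 0)\<bar> powr r2))"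
  by (simp add: fun_eq_iff dil_def c_def abs_mult powr_mult powr_add)
 then have "cp r1 r2 (dil t u) (dil t v) = c powr (r1 + r2) * (cp r1 r2 u v / t ^ CARD('n))"
  unfolding cp_def using integral_affine[OF _ m, of t 0] t by simp
 moreover have "c powr (r1 + r2) / t ^ CARD('n) = t powr \<gamma>"
 proof -
  have "c powr (r1 + r2) / t ^ CARD('n) = t powr (real CARD('n) / 2 * (r1 + r2)) / t powr real CARD('n)"
   using t by (simp add: c_def powr_powr powr_realpow)
  also have "... = t powr (real CARD('n) / 2 * (r1 + r2) - real CARD('n))" by (simp add: powr_diff)
  also have "real CARD('n) / 2 * (r1 + r2) - real CARD('n) = \<gamma>" by (simp add: \<gamma>_def field_simps)
  finally show ?thesis .
 qed
 ultimately show ?thesis by (metis times_divide_eq_left times_divide_eq_right)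
qed

lemma J_dil:
 assumes t: "t > 0" and s: "s > 0" and u: "u \<in> H1" and v: "v \<in> H1"
 shows "J \<beta> s (dil t u) (dil t v) = J \<beta> (t * s) u v"
proof -
 have "s^2 / 2 * (t^2 * dir u + t^2 * dir v) = (t * s)^2 / 2 * (dir u + dir v)"
  by (simp add: power_mult_distrib algebra_simps)
 then show ?thesis
  unfolding J_def fiber_def dil(3)[OF t u] dil(3)[OF t v] dil(4)[OF t u] dil(4)[OF t v] cp_dil[OF t u v]
   \<alpha>1_def[symmetric] \<alpha>2_def[symmetric] powr_mult
  by (simp add: ac_simps)
qed

lemma J_upper:
 assumes "\<beta> >= 0"
 shows "J \<beta> t u v <= t^2 / 2 * (dir u + dir v)"
 using mult_nonneg_nonneg[OF coeff_nonneg(1)[of u] powr_ge_zero[of t \<alpha>1]] mult_nonneg_nonneg[OF coeff_nonneg(2)[of v] powr_ge_zero[of t \<alpha>2]]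
  mult_nonneg_nonneg[OF coeff_nonneg(3)[OF assms, of u v] powr_ge_zero[of t \<gamma>]]
 unfolding J_def fiber_def by linarith

text \<open>The Dirichlet term is subadditive under merging, and the terms with a minus sign are
  superadditive; at a common scale these effects point in the same direction.\<close>

lemma J_hyp:
 assumes t: "\<beta> >= 0" and H: "u \<in> H1" "v \<in> H1" "w \<in> H1" "z \<in> H1"
 shows "J \<beta> t (hyp u w) (hyp v z) <= J \<beta> t u v + J \<beta> t w z"
proof -
 have r0: "r1 > 0" "r2 > 0" using r by auto
 have d: "t^2 / 2 * (dir (hyp u w) + dir (hyp v z)) <= t^2 / 2 * ((dir u + dir v) + (dir w + dir z))"
  using hyp_H1(2)[OF H(1,3)] hyp_H1(2)[OF H(2,4)] by (intro mult_left_mono) auto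
 have b: "\<mu>1 / p1 * (pw p1 u + pw p1 w) * t powr \<alpha>1 <= \<mu>1 / p1 * pw p1 (hyp u w) * t powr \<alpha>1"
  "\<mu>2 / p2 * (pw p2 v + pw p2 z) * t powr \<alpha>2 <= \<mu>2 / p2 * pw p2 (hyp v z) * t powr \<alpha>2"
  "\<beta> * (cp r1 r2 u v + cp r1 r2 w z) * t powr \<gamma> <= \<beta> * cp r1 r2 (hyp u w) (hyp v z) * t powr \<gamma>"
  using \<mu> p t by (intro mult_right_mono mult_left_mono pw_hyp[OF sub(1) H(1,3)] pw_hyp[OF sub(2) H(2,4)] cp_hyp[OF sub(3) r0 H]; simp)+
 show ?thesis using d b unfolding J_def fiber_def distrib_left distrib_right by linarith
qed

lemma J_abs:
 assumes "u \<in> H1" "v \<in> H1"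
 shows "J \<beta> t (%x. \<bar>u x\<bar>) (%x. \<bar>v x\<bar>) <= J \<beta> t u v"
proof -
 have "t^2 / 2 * (dir (%x. \<bar>u x\<bar>) + dir (%x. \<bar>v x\<bar>)) <= t^2 / 2 * (dir u + dir v)"
  using H1_abs(2)[OF assms(1)] H1_abs(2)[OF assms(2)] by (intro mult_left_mono) auto
 then show ?thesis unfolding J_def fiber_def pw_def cp_def by simp
qed

text \<open>A small dilation lets a power term with exponent below two dominate the Dirichlet
  integral. The sign is uniform over all \<open>t <= T\<close> because the peak scale at which the
  pair will be used is not known in advance.\<close>

lemma spread:
 assumes b: "0 <= b1" "0 <= b2" "0 < b1 + b2" and T: "0 < T" and \<epsilon>: "0 < \<epsilon>" and \<beta>: "0 <= \<beta>"
 obtains z1 z2 where "z1 \<in> H1" "z2 \<in> H1" "mass z1 = b1" "mass z2 = b2" "dir z1 + dir z2 < \<epsilon>"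
  "!!t. 0 < t ==> t <= T ==> J \<beta> t z1 z2 < 0"
proof -
 obtain y1 :: "real ^ 'n => real" where y1: "y1 \<in> H1" "mass y1 = b1" by (rule H1_nontrivial[OF b(1)])
 obtain y2 :: "real ^ 'n => real" where y2: "y2 \<in> H1" "mass y2 = b2" by (rule H1_nontrivial[OF b(2)])
 define A where "A = dir y1 + dir y2"
 have A: "A >= 0" by (simp add: A_def)
 have key: "\<exists>s0>0. \<forall>s. 0 < s & s < s0 --> s^2 / 2 * A < c * s powr \<alpha>" if "c > 0" "0 < \<alpha>" "\<alpha> < 2" for c \<alpha>
 proof (intro exI conjI allI impI)
  define s0 where "s0 = (c / (A + 1)) powr (1 / (2 - \<alpha>))"
  have q: "c / (A + 1) > 0" using that A by simp
  then show "0 < s0" unfolding s0_def powr_gt_zero by linarith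
  fix s assume s: "0 < s & s < s0"
  have "s powr (2 - \<alpha>) < s0 powr (2 - \<alpha>)" using s that by (intro powr_less_mono2) auto
  also have "... = c / (A + 1)" unfolding s0_def using that q A by (auto simp: powr_powr)
  finally have "s powr (2 - \<alpha>) * (A + 1) < c" using A by (simp add: pos_less_divide_eq)
  moreover have "s powr (2 - \<alpha>) * (A / 2) <= s powr (2 - \<alpha>) * (A + 1)" using A by (intro mult_left_mono) auto
  ultimately have "s powr (2 - \<alpha>) * (A / 2) < c" by linarith
  then have "s powr (2 - \<alpha>) * (A / 2) * s powr \<alpha> < c * s powr \<alpha>" by (rule mult_strict_right_mono) (use s in simp)
  moreover have "s powr (2 - \<alpha>) * s powr \<alpha> = s^2" using s by (simp add: powr_add[symmetric] powr_numeral)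
  ultimately show "s^2 / 2 * A < c * s powr \<alpha>" by (metis mult.assoc mult.commute times_divide_eq_left times_divide_eq_right)
 qed
 have "\<exists>s0>0. \<forall>s. 0 < s & s < s0 --> J \<beta> s y1 y2 < 0"
 proof -
  have nn: "0 <= \<mu>1 / p1 * pw p1 y1 * s powr \<alpha>1" "0 <= \<mu>2 / p2 * pw p2 y2 * s powr \<alpha>2" "0 <= \<beta> * cp r1 r2 y1 y2 * s powr \<gamma>" for s
   by (intro mult_nonneg_nonneg[OF coeff_nonneg(1) powr_ge_zero] mult_nonneg_nonneg[OF coeff_nonneg(2) powr_ge_zero]
    mult_nonneg_nonneg[OF coeff_nonneg(3)[OF \<beta>] powr_ge_zero])+
  show ?thesis
  proof (cases "b1 > 0")
   case True
   have "0 < \<mu>1 / p1 * pw p1 y1" using pw_pos[OF sub(1) y1(1)] True y1 \<mu> p by simp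
   from key[OF this \<alpha>(1,2)] obtain s0 where s0: "s0 > 0" "\<forall>s. 0 < s & s < s0 --> s^2 / 2 * A < \<mu>1 / p1 * pw p1 y1 * s powr \<alpha>1" by blast
   have "J \<beta> s y1 y2 < 0" if "0 < s & s < s0" for s
    using s0(2)[rule_format, OF that] nn[of s] unfolding J_def fiber_def A_def by linarith
   then show ?thesis using s0(1) by blast
  next
   case False
   then have "b2 > 0" using b by simp
   then have "0 < \<mu>2 / p2 * pw p2 y2" using pw_pos[OF sub(2) y2(1)] y2 \<mu> p by simp
   from key[OF this \<alpha>(3,4)] obtain s0 where s0: "s0 > 0" "\<forall>s. 0 < s & s < s0 --> s^2 / 2 * A < \<mu>2 / p2 * pw p2 y2 * s powr \<alpha>2" by blast
   have "J \<beta> s y1 y2 < 0" if "0 < s & s < s0" for s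
    using s0(2)[rule_format, OF that] nn[of s] unfolding J_def fiber_def A_def by linarith
   then show ?thesis using s0(1) by blast
  qed
 qed
 then obtain s0 where s0: "s0 > 0" "!!s. 0 < s ==> s < s0 ==> J \<beta> s y1 y2 < 0" by blast
 \<comment> \<open>\<open>e T\<close> stays below \<open>s0\<close>, which gives the sign at every
   scale up to \<open>T\<close>, and \<open>e^2 (A + 1) <= \<epsilon>\<close> gives the small
   Dirichlet integral.\<close>
 define e where "e = min (s0 / (2 * T)) (sqrt (\<epsilon> / (A + 1)))"
 have e: "e > 0" using s0 T \<epsilon> A by (simp add: e_def)
 show ?thesis
 proof (rule that[of "dil e y1" "dil e y2"])
  show "dil e y1 \<in> H1" "dil e y2 \<in> H1" "mass (dil e y1) = b1" "mass (dil e y2) = b2"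
   using dil(1,2)[OF e y1(1)] dil(1,2)[OF e y2(1)] y1 y2 by auto
  have "e^2 <= (sqrt (\<epsilon> / (A + 1)))^2" using e by (intro power_mono) (auto simp: e_def)
  also have "... = \<epsilon> / (A + 1)" using \<epsilon> A by simp
  finally have "e^2 * (A + 1) <= \<epsilon>" using A by (simp add: pos_le_divide_eq)
  moreover have "0 < e^2" using e by simp
  ultimately have "e^2 * A < \<epsilon>" unfolding distrib_left by linarith
  then show "dir (dil e y1) + dir (dil e y2) < \<epsilon>" using dil(3)[OF e y1(1)] dil(3)[OF e y2(1)] by (simp add: A_def distrib_left)
  fix t assume t: "0 < t" "t <= T"
  have "e * t <= s0 / (2 * T) * T" using t e by (intro mult_mono) (auto simp: e_def)
  also have "... < s0" using T s0 by simp
  finally show "J \<beta> t (dil e y1) (dil e y2) < 0" unfolding J_dil[OF e t(1) y1(1) y2(1)] using e t by (intro s0(2)) auto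
 qed
qed

lemma pw_growth:
 assumes a: "a1 > 0" "a2 > 0"
 obtains X1 X2 where "0 <= X1" "0 <= X2" "!!(u :: real ^ 'n => real) (v :: real ^ 'n => real). u \<in> H1 ==> v \<in> H1 ==> mass u <= a1 ==> mass v <= a2 ==>
  \<mu>1 / p1 * pw p1 u <= X1 * (dir u + dir v) powr (\<alpha>1 / 2) & \<mu>2 / p2 * pw p2 v <= X2 * (dir u + dir v) powr (\<alpha>2 / 2)"
proof -
 obtain K1 where K1: "K1 > 0" "!!u :: real ^ 'n => real. u \<in> H1 ==> mass u <= a1 ==> pw p1 u <= K1 * dir u powr (real CARD('n) * (p1 - 2) / 4)"
  using Gagliardo_Nirenberg[OF _ _ a(1), of p1] sub(1) unfolding subcrit_def pw_def by metis
 obtain K2 where K2: "K2 > 0" "!!u :: real ^ 'n => real. u \<in> H1 ==> mass u <= a2 ==> pw p2 u <= K2 * dir u powr (real CARD('n) * (p2 - 2) / 4)"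
  using Gagliardo_Nirenberg[OF _ _ a(2), of p2] sub(2) unfolding subcrit_def pw_def by metis
 show ?thesis
 proof (rule that[of "\<mu>1 / p1 * K1" "\<mu>2 / p2 * K2"])
  fix u v :: "real ^ 'n => real"
  assume u: "u \<in> H1" and v: "v \<in> H1" and m: "mass u <= a1" "mass v <= a2"
  define A where "A = dir u + dir v"
  have "dir u powr (real CARD('n) * (p1 - 2) / 4) <= A powr (\<alpha>1 / 2)" "dir v powr (real CARD('n) * (p2 - 2) / 4) <= A powr (\<alpha>2 / 2)"
   using powr_mono2[of "\<alpha>1 / 2" "dir u" A] powr_mono2[of "\<alpha>2 / 2" "dir v" A] \<alpha> by (simp_all add: \<alpha>1_def \<alpha>2_def A_def)
  then have "pw p1 u <= K1 * A powr (\<alpha>1 / 2)" "pw p2 v <= K2 * A powr (\<alpha>2 / 2)"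
   using K1(2)[OF u m(1)] K2(2)[OF v m(2)] K1(1) K2(1) by (meson mult_left_mono order_trans less_imp_le)+
  then have "\<mu>1 / p1 * pw p1 u <= \<mu>1 / p1 * (K1 * A powr (\<alpha>1 / 2))" "\<mu>2 / p2 * pw p2 v <= \<mu>2 / p2 * (K2 * A powr (\<alpha>2 / 2))"
   using \<mu> p by (intro mult_left_mono; simp)+
  then show "\<mu>1 / p1 * pw p1 u <= \<mu>1 / p1 * K1 * (dir u + dir v) powr (\<alpha>1 / 2) & \<mu>2 / p2 * pw p2 v <= \<mu>2 / p2 * K2 * (dir u + dir v) powr (\<alpha>2 / 2)"
   by (simp add: A_def mult.assoc)
 qed (use \<mu> p K1 K2 in auto)
qed

text \<open>The two radii come from the uncoupled energy alone, where the Dirichlet integral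
  dominates, and so are independent of \<open>\<beta>\<close>; then \<open>\<beta>0\<close> is made
  small enough for the coupling to cost little between them. Dilation reduces the claim to
  \<open>t = 1\<close>.\<close>

lemma geometry:
 assumes a: "a1 > 0" "a2 > 0"
 obtains \<rho>' \<rho> \<beta>0 where "0 < \<rho>'" "\<rho>' < \<rho>" "0 < \<beta>0"
  "!!\<beta> u v t. 0 < \<beta> ==> \<beta> <= \<beta>0 ==> u \<in> H1 ==> v \<in> H1 ==> mass u <= a1 ==> mass v <= a2 ==> 0 < t ==>
   \<rho>' <= t^2 * (dir u + dir v) ==> t^2 * (dir u + dir v) <= \<rho> ==> 1 <= J \<beta> t u v"
proof -
 obtain X1 X2 where X: "0 <= X1" "0 <= X2" "!!(u :: real ^ 'n => real) (v :: real ^ 'n => real). u \<in> H1 ==> v \<in> H1 ==> mass u <= a1 ==> mass v <= a2 ==>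
  \<mu>1 / p1 * pw p1 u <= X1 * (dir u + dir v) powr (\<alpha>1 / 2) & \<mu>2 / p2 * pw p2 v <= X2 * (dir u + dir v) powr (\<alpha>2 / 2)"
  by (rule pw_growth[OF a]) blast
 \<comment> \<open>The level \<open>2\<close> leaves one unit for the coupling, which
   \<open>\<beta>0 = 1 / (2 K3)\<close> keeps at most one.\<close>
 obtain \<rho>' where \<rho>': "\<rho>' > 0" "!!x. x >= \<rho>' ==> 2 <= 1 / 2 * x - X1 * x powr (\<alpha>1 / 2) - X2 * x powr (\<alpha>2 / 2)"
  by (rule sublinear_growth[of "1 / 2" "\<alpha>1 / 2" "\<alpha>2 / 2" 2 X1 X2]) (use \<alpha> in auto)
 define \<rho> where "\<rho> = \<rho>' + 1"
 define a where "a = max a1 a2"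
 obtain K3 where K3: "K3 > 0" "!!u :: real ^ 'n => real. u \<in> H1 ==> mass u <= a ==> dir u <= \<rho> ==> pw (r1 + r2) u <= K3"
  using Sobolev_bounded[of "r1 + r2", where m = a and d = \<rho>] sub(3) unfolding subcrit_def pw_def by metis
 define \<beta>0 where "\<beta>0 = 1 / (2 * K3)"
 have base: "1 <= J \<beta> 1 u v" if \<beta>: "0 < \<beta>" "\<beta> <= \<beta>0" and u: "u \<in> H1" "mass u <= a1" and v: "v \<in> H1" "mass v <= a2"
  and A: "\<rho>' <= dir u + dir v" "dir u + dir v <= \<rho>" for \<beta> u v
 proof -
  define A where "A = dir u + dir v"
  have B: "\<mu>1 / p1 * pw p1 u <= X1 * A powr (\<alpha>1 / 2)" "\<mu>2 / p2 * pw p2 v <= X2 * A powr (\<alpha>2 / 2)"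
   using X(3)[OF u(1) v(1) u(2) v(2)] by (simp_all add: A_def)
  have du: "dir u <= \<rho>" "dir v <= \<rho>" using A dir_nonneg[of u] dir_nonneg[of v] by linarith+
  have "cp r1 r2 u v <= pw (r1 + r2) u + pw (r1 + r2) v"
   using cp_integrable(2)[OF sub(3) _ _ u(1) v(1)] r by simp
  also have "... <= 2 * K3"
  proof -
   have "mass u <= a" "mass v <= a" using u v by (auto simp: a_def)
   then show ?thesis using K3(2)[OF u(1) _ du(1)] K3(2)[OF v(1) _ du(2)] by simp
  qed
  finally have "\<beta> * cp r1 r2 u v <= \<beta>0 * (2 * K3)" using \<beta> K3(1) by (intro mult_mono) auto
  also have "... = 1" using K3(1) by (simp add: \<beta>0_def)
  finally show ?thesis using \<rho>'(2)[of A] A B unfolding J_def fiber_def A_def by simp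
 qed
 show ?thesis
 proof (rule that[of \<rho>' \<rho> \<beta>0])
  show "0 < \<rho>'" "\<rho>' < \<rho>" "0 < \<beta>0" using \<rho>' K3 by (auto simp: \<rho>_def \<beta>0_def)
  fix \<beta> t and u v :: "real ^ 'n => real"
  assume *: "0 < \<beta>" "\<beta> <= \<beta>0" "u \<in> H1" "v \<in> H1" "mass u <= a1" "mass v <= a2" "0 < t"
   "\<rho>' <= t^2 * (dir u + dir v)" "t^2 * (dir u + dir v) <= \<rho>"
  have "1 <= J \<beta> 1 (dil t u) (dil t v)"
   by (rule base[OF *(1,2)]) (use * dil[OF *(7,3)] dil[OF *(7,4)] in \<open>auto simp: distrib_left\<close>)
  then show "1 <= J \<beta> t u v" using J_dil[OF *(7) zero_less_one *(3,4)] by simp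
 qed
qed

text \<open>Excludes vanishing in both minimisations: only the Dirichlet term would survive, which
  is incompatible with a negative infimum and with a peak at finite height.\<close>

lemma vanishing_terms:
 assumes u: "!!n. u1 n \<in> H1" "!!n. mass (u1 n) <= m" "!!n. dir (u1 n) <= d"
  and v: "!!n. u2 n \<in> H1" "!!n. mass (u2 n) <= m" "!!n. dir (u2 n) <= d"
  and V: "vanishing u1" "vanishing u2"
 shows "(%n. J \<beta> t (u1 n) (u2 n) - t^2 / 2 * (dir (u1 n) + dir (u2 n :: real ^ 'n => real))) ----> 0"
proof -
 have V1: "(%n. pw p' (u1 n)) ----> 0" "(%n. pw p' (u2 n)) ----> 0" if "subcrit TYPE('n) p'" for p'
  using vanishing_powr[OF u V(1)] vanishing_powr[OF v V(2)] that unfolding pw_def subcrit_def by auto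
 have "(%n. cp r1 r2 (u1 n) (u2 n)) ----> 0"
 proof (rule Lim_null_comparison)
  show "\<forall>\<^sub>F n in sequentially. norm (cp r1 r2 (u1 n) (u2 n)) <= pw (r1 + r2) (u1 n) + pw (r1 + r2) (u2 n)"
   using cp_integrable(2)[OF sub(3) _ _ u(1) v(1)] r by (intro always_eventually) simp
  show "(%n. pw (r1 + r2) (u1 n) + pw (r1 + r2) (u2 n)) ----> 0"
   using tendsto_add[OF V1[OF sub(3)]] by simp
 qed
 then have "(%n. 0 - \<mu>1 / p1 * pw p1 (u1 n) * t powr \<alpha>1 - \<mu>2 / p2 * pw p2 (u2 n) * t powr \<alpha>2 - \<beta> * cp r1 r2 (u1 n) (u2 n) * t powr \<gamma>)
  ----> 0 - \<mu>1 / p1 * 0 * t powr \<alpha>1 - \<mu>2 / p2 * 0 * t powr \<alpha>2 - \<beta> * 0 * t powr \<gamma>"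
  by (intro tendsto_diff tendsto_mult tendsto_const V1 sub)
 moreover have "J \<beta> t (u1 n) (u2 n) - t^2 / 2 * (dir (u1 n) + dir (u2 n)) = 0 - \<mu>1 / p1 * pw p1 (u1 n) * t powr \<alpha>1
   - \<mu>2 / p2 * pw p2 (u2 n) * t powr \<alpha>2 - \<beta> * cp r1 r2 (u1 n) (u2 n) * t powr \<gamma>" for n
  unfolding J_def fiber_def by linarith
 ultimately show ?thesis by simp
qed

end

locale coupled_masses = coupled dim for dim :: "'n :: finite itself" +
 fixes a1 a2 \<beta> :: real
 assumes a: "a1 > 0" "a2 > 0" and \<beta>: "\<beta> > 0"
begin

text \<open>Masses at most \<open>a1\<close> and \<open>a2\<close> pass to weak limits, unlike the
  equalities, which are recovered at the end for the minimisers.\<close>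

definition feasible :: "(real ^ 'n => real) => (real ^ 'n => real) => bool" where
 "feasible u v \<longleftrightarrow> u \<in> H1 & v \<in> H1 & mass u <= a1 & mass v <= a2"

lemma feasible_abs: "feasible u v ==> feasible (%x. \<bar>u x\<bar>) (%x. \<bar>v x\<bar>)"
 unfolding feasible_def by (auto intro: H1_abs)

lemma feasible_dil: "feasible u v ==> t > 0 ==> feasible (dil t u) (dil t v)"
 unfolding feasible_def by (auto simp: dil)

lemma bounded_terms:
 obtains P1 P2 C where "P1 > 0" "P2 > 0" "C > 0"
  "!!u v. feasible u v ==> dir u + dir v <= d ==> pw p1 u <= P1 & pw p2 v <= P2 & cp r1 r2 u v <= C"
proof -
 define a where "a = max a1 a2"
 obtain P1 where P1: "P1 > 0" "!!u :: real ^ 'n => real. u \<in> H1 ==> mass u <= a ==> dir u <= d ==> pw p1 u <= P1"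
  using pw_bounded[OF sub(1), where m = a and d = d] by metis
 obtain P2 where P2: "P2 > 0" "!!u :: real ^ 'n => real. u \<in> H1 ==> mass u <= a ==> dir u <= d ==> pw p2 u <= P2"
  using pw_bounded[OF sub(2), where m = a and d = d] by metis
 obtain K where K: "K > 0" "!!u :: real ^ 'n => real. u \<in> H1 ==> mass u <= a ==> dir u <= d ==> pw (r1 + r2) u <= K"
  using pw_bounded[OF sub(3), where m = a and d = d] by metis
 show ?thesis
 proof (rule that[of P1 P2 "2 * K"])
  fix u v assume f: "feasible u v" "dir u + dir v <= d"
  have u: "u \<in> H1" "mass u <= a" "dir u <= d" and v: "v \<in> H1" "mass v <= a" "dir v <= d"
   using f dir_nonneg[of u] dir_nonneg[of v] unfolding feasible_def a_def by (auto simp del: dir_nonneg)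
  have "cp r1 r2 u v <= pw (r1 + r2) u + pw (r1 + r2) v" using cp_integrable(2)[OF sub(3) _ _ u(1) v(1)] r by simp
  then show "pw p1 u <= P1 & pw p2 v <= P2 & cp r1 r2 u v <= 2 * K"
   using P1(2)[OF u] P2(2)[OF v] K(2)[OF u] K(2)[OF v] by simp
 qed (use P1 P2 K in auto)
qed

text \<open>The superposed profiles are rescaled so that they satisfy the mass constraints exactly.\<close>

lemma dichotomy:
 assumes u: "!!n. feasible (u1 n) (u2 n)" "!!n. dir (u1 n) + dir (u2 n) <= d"
  and nv: "~ (vanishing u1 & vanishing u2)"
 obtains (S) sg y w1 w2 v1 v2 where "strict_mono (sg :: nat => nat)" "feasible w1 w2"
   "v1 = (%n x. u1 (sg n) (x + y n) - w1 x)" "v2 = (%n x. u2 (sg n) (x + y n) - w2 x)"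
   "!!n. v1 n \<in> H1" "!!n. v2 n \<in> H1"
   "(%n. mass (u1 (sg n)) - mass (v1 n)) ----> mass w1" "(%n. mass (u2 (sg n)) - mass (v2 n)) ----> mass w2"
   "dir w1 + dir w2 <= d" "(%n. cp r1 r2 (u1 (sg n)) (u2 (sg n))) ----> cp r1 r2 w1 w2"
   "!!t. (%n. J \<beta> t (u1 (sg n)) (u2 (sg n)) - t^2 / 2 * (dir (v1 n) + dir (v2 n))) ----> J \<beta> t w1 w2"
 | (D) sg k1 k2 e g1 g2 g3 where "strict_mono (sg :: nat => nat)" "!!n. feasible (k1 n) (k2 n)" "e ----> 0" "!!n. 0 <= e n"
   "0 <= g1" "0 <= g2" "0 <= g3" "0 < g1 + g2 + g3"
   "!!n. dir (k1 n) + dir (k2 n) <= dir (u1 (sg n)) + dir (u2 (sg n)) + e n"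
   "!!n. pw p1 (u1 (sg n)) + g1 <= pw p1 (k1 n) + e n" "!!n. pw p2 (u2 (sg n)) + g2 <= pw p2 (k2 n) + e n"
   "!!n. cp r1 r2 (u1 (sg n)) (u2 (sg n)) + g3 <= cp r1 r2 (k1 n) (k2 n) + e n"
proof -
 have r0: "r1 > 0" "r2 > 0" using r by auto
 have U: "u1 n \<in> H1" "mass (u1 n) <= max a1 a2" "dir (u1 n) <= d" "u2 n \<in> H1" "mass (u2 n) <= max a1 a2" "dir (u2 n) <= d" for n
  using u(1)[of n] u(2)[of n] dir_nonneg[of "u1 n"] dir_nonneg[of "u2 n"] unfolding feasible_def by (auto simp del: dir_nonneg)
 have M: "mass (u1 n) <= a1" "mass (u2 n) <= a2" for n using u(1)[of n] by (auto simp: feasible_def)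
 note U1 = U(1-3) and U2 = U(4-6) and rs = sub(3) r0
 obtain sg y w1 w2 where P: "strict_mono (sg :: nat => nat)" "w1 \<in> H1" "w2 \<in> H1" "mass w1 > 0 \<or> mass w2 > 0"
  "ae x. (%n. u1 (sg n) (x + y n)) ----> w1 x" "ae x. (%n. u2 (sg n) (x + y n)) ----> w2 x"
  by (rule profile[OF U1 U2 nv])
 define v1 where "v1 = (%n x. u1 (sg n) (x + y n) - w1 x)"
 define v2 where "v2 = (%n x. u2 (sg n) (x + y n) - w2 x)"
 note R1 = remainder[where u = u1 and sg = sg and y = y and w = w1 and v = v1, OF U1 P(2,5) v1_def]
  and R2 = remainder[where u = u2 and sg = sg and y = y and w = w2 and v = v2, OF U2 P(3,6) v2_def]
 define c e where "c = max (2 * max a1 a2 + 2 * mass w1) (2 * max a1 a2 + 2 * mass w2)" and "e = max (2 * d + 2 * dir w1) (2 * d + 2 * dir w2)"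
 have b: "mass (v1 n) <= c" "dir (v1 n) <= e" "mass (v2 n) <= c" "dir (v2 n) <= e" for n
  using R1(2,3)[of n] R2(2,3)[of n] by (auto simp: c_def e_def)
 have Rv: "(%n. cp r1 r2 (u1 (sg n)) (u2 (sg n)) - cp r1 r2 (v1 n) (v2 n)) ----> cp r1 r2 w1 w2"
  by (rule remainder_cp[where sg = sg and y = y and ?u1.0 = u1 and ?u2.0 = u2 and ?w1.0 = w1 and ?w2.0 = w2 and ?v1.0 = v1 and ?v2.0 = v2, OF rs U1 P(2,5) v1_def U2 P(3,6) v2_def])
 show thesis
 \<comment> \<open>The remainder either vanishes, and then all nonlinear terms converge to those of
   the first profile, or it carries a second profile that can be merged with the first.\<close>
 proof (cases "vanishing v1 & vanishing v2")
  case True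
  have V: "(%n. pw p' (v1 n)) ----> 0" "(%n. pw p' (v2 n)) ----> 0" if "subcrit TYPE('n) p'" for p'
   unfolding pw_def using True that unfolding subcrit_def
   by (auto intro: vanishing_powr[OF R1(1) b(1,2)] vanishing_powr[OF R2(1) b(3,4)])
  have "(%n. cp r1 r2 (v1 n) (v2 n)) ----> 0"
  proof (rule Lim_null_comparison)
   show "\<forall>\<^sub>F n in sequentially. norm (cp r1 r2 (v1 n) (v2 n)) <= pw (r1 + r2) (v1 n) + pw (r1 + r2) (v2 n)"
    using cp_integrable(2)[OF rs R1(1) R2(1)] by (intro always_eventually) simp
   show "(%n. pw (r1 + r2) (v1 n) + pw (r1 + r2) (v2 n)) ----> 0"
    using tendsto_add[OF V(1)[OF rs(1)] V(2)[OF rs(1)]] by simp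
  qed
  from tendsto_add[OF Rv this] have cl: "(%n. cp r1 r2 (u1 (sg n)) (u2 (sg n))) ----> cp r1 r2 w1 w2" by simp
  from tendsto_add[OF R1(7)[OF sub(1)] V(1)[OF sub(1)]] have pl: "(%n. pw p1 (u1 (sg n))) ----> pw p1 w1" by simp
  from tendsto_add[OF R2(7)[OF sub(2)] V(2)[OF sub(2)]] have ql: "(%n. pw p2 (u2 (sg n))) ----> pw p2 w2" by simp
  have le: "x <= l" if "f ----> x" "!!n. f n <= l" for f :: "nat => real" and x l
   using LIMSEQ_le_const2[OF that(1)] that(2) by blast
  have "mass (u1 (sg n)) - mass (v1 n) <= a1" "mass (u2 (sg n)) - mass (v2 n) <= a2"
   "dir (u1 (sg n)) - dir (v1 n) + (dir (u2 (sg n)) - dir (v2 n)) <= d" for n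
   using M[of "sg n"] u(2)[of "sg n"] mass_nonneg[of "v1 n"] mass_nonneg[of "v2 n"] dir_nonneg[of "v1 n"] dir_nonneg[of "v2 n"] by linarith+
  from le[OF R1(5) this(1)] le[OF R2(5) this(2)] le[OF tendsto_add[OF R1(6) R2(6)] this(3)] P(2,3)
  have wf: "feasible w1 w2" "dir w1 + dir w2 <= d" by (auto simp: feasible_def)
  have "(%n. J \<beta> t (u1 (sg n)) (u2 (sg n)) - t^2 / 2 * (dir (v1 n) + dir (v2 n))) ----> J \<beta> t w1 w2" for t
  proof -
   have "(%n. t^2 / 2 * ((dir (u1 (sg n)) - dir (v1 n)) + (dir (u2 (sg n)) - dir (v2 n))) - \<mu>1 / p1 * pw p1 (u1 (sg n)) * t powr \<alpha>1
    - \<mu>2 / p2 * pw p2 (u2 (sg n)) * t powr \<alpha>2 - \<beta> * cp r1 r2 (u1 (sg n)) (u2 (sg n)) * t powr \<gamma>) ----> J \<beta> t w1 w2"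
    unfolding J_def fiber_def by (intro tendsto_diff tendsto_add tendsto_mult tendsto_const R1(6) R2(6) pl ql cl)
   then show ?thesis unfolding J_def fiber_def by (simp add: algebra_simps)
  qed
  from S[OF P(1) wf(1) v1_def v2_def R1(1) R2(1) R1(5) R2(5) wf(2) cl this] show thesis .
 next
  case False
  obtain tau z y1 y2 where Q: "strict_mono (tau :: nat => nat)" "y1 \<in> H1" "y2 \<in> H1" "mass y1 > 0 \<or> mass y2 > 0"
   "ae x. (%n. v1 (tau n) (x + z n)) ----> y1 x" "ae x. (%n. v2 (tau n) (x + z n)) ----> y2 x"
   by (rule profile[OF R1(1) b(1,2) R2(1) b(3,4) False])
  define t1 where "t1 = (%n x. v1 (tau n) (x + z n) - y1 x)"
  define t2 where "t2 = (%n x. v2 (tau n) (x + z n) - y2 x)"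
  note T1 = remainder[where u = v1 and sg = tau and y = z and w = y1 and v = t1, OF R1(1) b(1,2) Q(2,5) t1_def]
   and T2 = remainder[where u = v2 and sg = tau and y = z and w = y2 and v = t2, OF R2(1) b(3,4) Q(3,6) t2_def]
  have Tv: "(%n. cp r1 r2 (v1 (tau n)) (v2 (tau n)) - cp r1 r2 (t1 n) (t2 n)) ----> cp r1 r2 y1 y2"
   by (rule remainder_cp[where sg = tau and y = z and ?u1.0 = v1 and ?u2.0 = v2 and ?w1.0 = y1 and ?w2.0 = y2 and ?v1.0 = t1 and ?v2.0 = t2, OF rs R1(1) b(1,2) Q(2,5) t1_def R2(1) b(3,4) Q(3,6) t2_def])
  \<comment> \<open>The second profile is moved onto the first; overlap is what makes the merging
    strictly favourable.\<close>
  obtain h where h: "~ (ae x. (w1 x = 0 & w2 x = 0) \<or> (y1 (x + h) = 0 & y2 (x + h) = 0))"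
   by (rule AE_ex_overlap[OF P(2,3) Q(2,3) P(4) Q(4)])
  define x1 where "x1 = (%x. y1 (x + h))"
  define x2 where "x2 = (%x. y2 (x + h))"
  have X1: "x1 \<in> H1" "dir x1 = dir y1" "mass x1 = mass y1" "pw p' x1 = pw p' y1" for p'
   unfolding x1_def using H1_translate[OF Q(2)] mass_translate[OF H1_measurable[OF Q(2)]] pw_translate[OF H1_measurable[OF Q(2)]] by auto
  have X2: "x2 \<in> H1" "dir x2 = dir y2" "mass x2 = mass y2" "pw p' x2 = pw p' y2" for p'
   unfolding x2_def using H1_translate[OF Q(3)] mass_translate[OF H1_measurable[OF Q(3)]] pw_translate[OF H1_measurable[OF Q(3)]] by auto
  have Xc: "cp r1 r2 x1 x2 = cp r1 r2 y1 y2"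
   unfolding x1_def x2_def by (rule cp_translate[OF H1_measurable[OF Q(2)] H1_measurable[OF Q(3)]])
  define s1 where "s1 = hyp w1 x1"
  define s2 where "s2 = hyp w2 x2"
  note S1 = hyp_H1[OF P(2) X1(1), folded s1_def] and S2 = hyp_H1[OF P(3) X2(1), folded s2_def]
  \<comment> \<open>Both profiles and the remaining tail are combined into one pair. The gains
    \<open>g1, g2, g3\<close> come from the two fixed profiles, so they do not depend on
    \<open>n\<close>; merging the tail in as well is covered by the nonstrict inequalities.\<close>
  define k1 where "k1 n = hyp s1 (t1 n)" for n
  define k2 where "k2 n = hyp s2 (t2 n)" for n
  note K1 = hyp_H1[OF S1(1) T1(1), folded k1_def] and K2 = hyp_H1[OF S2(1) T2(1), folded k2_def]
  define g1 g2 g3 where "g1 = pw p1 s1 - pw p1 w1 - pw p1 y1" and "g2 = pw p2 s2 - pw p2 w2 - pw p2 y2"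
   and "g3 = cp r1 r2 s1 s2 - cp r1 r2 w1 w2 - cp r1 r2 y1 y2"
  have g: "0 <= g1" "0 <= g2" "0 <= g3"
   using pw_hyp[OF sub(1) P(2) X1(1)] pw_hyp[OF sub(2) P(3) X2(1)] cp_hyp[OF rs P(2,3) X1(1) X2(1)]
   by (auto simp: g1_def g2_def g3_def s1_def s2_def X1 X2 Xc)
  have gs: "0 < g1 + g2 + g3"
  proof -
   have "pw p1 w1 + pw p1 x1 + (pw p2 w2 + pw p2 x2) + (cp r1 r2 w1 w2 + cp r1 r2 x1 x2) < pw p1 s1 + pw p2 s2 + cp r1 r2 s1 s2"
    using hyp_strict[OF sub(1,2) rs P(2,3) X1(1) X2(1)] h by (auto simp: s1_def s2_def x1_def x2_def)
   then show ?thesis using X1(4)[of p1] X2(4)[of p2] Xc unfolding g1_def g2_def g3_def by linarith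
  qed
  define err where "err X n = \<bar>(fst (X n) - fst (snd (X n))) - snd (snd (X n))\<bar>" for X :: "nat => real \<times> real \<times> real" and n
  have err0: "err (%n. (a n, b n, l)) ----> 0" if "(%n. a n - b n) ----> l" for a b :: "nat => real" and l
   using tendsto_rabs[OF tendsto_diff[OF that tendsto_const[of l]]] by (simp add: err_def[abs_def])
  have B: "l - (a n - b n) <= err (%n. (a n, b n, l)) n" "a n - b n - l <= err (%n. (a n, b n, l)) n"
   "0 <= err (%n. (a n, b n, l)) n" for a b :: "nat => real" and l n
   by (simp_all add: err_def)
  have sq: "(%n. a (tau n)) ----> l" if "a ----> l" for a :: "nat => real" and l
   using LIMSEQ_subseq_LIMSEQ[OF that Q(1)] by (simp add: comp_def)
  define \<rho> where "\<rho> = (%n. sg (tau n))"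
  have \<rho>: "strict_mono \<rho>" unfolding \<rho>_def using P(1) Q(1) by (auto simp: strict_mono_def)
  \<comment> \<open>The sum of the absolute defects in all the splittings used, so that one sequence
    tending to zero bounds them together.\<close>
  define E where "E n = err (%n. (dir (u1 (\<rho> n)), dir (v1 (tau n)), dir w1)) n + err (%n. (dir (v1 (tau n)), dir (t1 n), dir y1)) n
   + (err (%n. (dir (u2 (\<rho> n)), dir (v2 (tau n)), dir w2)) n + err (%n. (dir (v2 (tau n)), dir (t2 n), dir y2)) n)
   + (err (%n. (pw p1 (u1 (\<rho> n)), pw p1 (v1 (tau n)), pw p1 w1)) n + err (%n. (pw p1 (v1 (tau n)), pw p1 (t1 n), pw p1 y1)) n)
   + (err (%n. (pw p2 (u2 (\<rho> n)), pw p2 (v2 (tau n)), pw p2 w2)) n + err (%n. (pw p2 (v2 (tau n)), pw p2 (t2 n), pw p2 y2)) n)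
   + (err (%n. (cp r1 r2 (u1 (\<rho> n)) (u2 (\<rho> n)), cp r1 r2 (v1 (tau n)) (v2 (tau n)), cp r1 r2 w1 w2)) n
    + err (%n. (cp r1 r2 (v1 (tau n)) (v2 (tau n)), cp r1 r2 (t1 n) (t2 n), cp r1 r2 y1 y2)) n)" for n
  have "E ----> 0 + 0 + (0 + 0) + (0 + 0) + (0 + 0) + (0 + 0)"
   unfolding E_def \<rho>_def
   by (intro tendsto_add err0 sq[OF R1(6)] sq[OF R2(6)] sq[OF R1(7)[OF sub(1)]] sq[OF R2(7)[OF sub(2)]] sq[OF Rv]
     T1(6) T2(6) T1(7)[OF sub(1)] T2(7)[OF sub(2)] Tv)
  then have E0: "E ----> 0" by simp
  have dk: "dir (k1 n) <= dir w1 + dir y1 + dir (t1 n)" "dir (k2 n) <= dir w2 + dir y2 + dir (t2 n)" for n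
   using K1(2)[of n] K2(2)[of n] S1(2) S2(2) X1(2) X2(2) by linarith+
  have pk: "pw p1 s1 + pw p1 (t1 n) <= pw p1 (k1 n)" "pw p2 s2 + pw p2 (t2 n) <= pw p2 (k2 n)"
   "cp r1 r2 s1 s2 + cp r1 r2 (t1 n) (t2 n) <= cp r1 r2 (k1 n) (k2 n)" for n
   unfolding k1_def k2_def by (intro pw_hyp[OF sub(1) S1(1) T1(1)] pw_hyp[OF sub(2) S2(1) T2(1)] cp_hyp[OF rs S1(1) S2(1) T1(1) T2(1)])+
  have fin: "dir (k1 n) + dir (k2 n) <= dir (u1 (\<rho> n)) + dir (u2 (\<rho> n)) + E n &
    pw p1 (u1 (\<rho> n)) + g1 <= pw p1 (k1 n) + E n & pw p2 (u2 (\<rho> n)) + g2 <= pw p2 (k2 n) + E n &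
    cp r1 r2 (u1 (\<rho> n)) (u2 (\<rho> n)) + g3 <= cp r1 r2 (k1 n) (k2 n) + E n" for n
   using dk[of n] pk[of n] B(1,3)[where a = "%n. dir (u1 (\<rho> n))" and b = "%n. dir (v1 (tau n))" and l = "dir w1" and n = n]
    B(1,3)[where a = "%n. dir (v1 (tau n))" and b = "%n. dir (t1 n)" and l = "dir y1" and n = n]
    B(2,3)[where a = "%n. pw p1 (u1 (\<rho> n))" and b = "%n. pw p1 (v1 (tau n))" and l = "pw p1 w1" and n = n]
    B(2,3)[where a = "%n. pw p1 (v1 (tau n))" and b = "%n. pw p1 (t1 n)" and l = "pw p1 y1" and n = n]
    B(1,3)[where a = "%n. dir (u2 (\<rho> n))" and b = "%n. dir (v2 (tau n))" and l = "dir w2" and n = n]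
    B(1,3)[where a = "%n. dir (v2 (tau n))" and b = "%n. dir (t2 n)" and l = "dir y2" and n = n]
    B(2,3)[where a = "%n. pw p2 (u2 (\<rho> n))" and b = "%n. pw p2 (v2 (tau n))" and l = "pw p2 w2" and n = n]
    B(2,3)[where a = "%n. pw p2 (v2 (tau n))" and b = "%n. pw p2 (t2 n)" and l = "pw p2 y2" and n = n]
    B(2,3)[where a = "%n. cp r1 r2 (u1 (\<rho> n)) (u2 (\<rho> n))" and b = "%n. cp r1 r2 (v1 (tau n)) (v2 (tau n))" and l = "cp r1 r2 w1 w2" and n = n]
    B(2,3)[where a = "%n. cp r1 r2 (v1 (tau n)) (v2 (tau n))" and b = "%n. cp r1 r2 (t1 n) (t2 n)" and l = "cp r1 r2 y1 y2" and n = n]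
   unfolding E_def g1_def g2_def g3_def by linarith
  have mk: "(%n. mass (k1 n) - mass (u1 (\<rho> n))) ----> 0" "(%n. mass (k2 n) - mass (u2 (\<rho> n))) ----> 0"
  proof -
   have "(%n. (mass w1 + mass y1) - ((mass (u1 (\<rho> n)) - mass (v1 (tau n))) + (mass (v1 (tau n)) - mass (t1 n)))) ----> (mass w1 + mass y1) - (mass w1 + mass y1)"
    unfolding \<rho>_def by (intro tendsto_diff tendsto_add tendsto_const sq[OF R1(5)] T1(5))
   then show "(%n. mass (k1 n) - mass (u1 (\<rho> n))) ----> 0" by (simp add: K1(3) S1(3) X1(3) algebra_simps)
   have "(%n. (mass w2 + mass y2) - ((mass (u2 (\<rho> n)) - mass (v2 (tau n))) + (mass (v2 (tau n)) - mass (t2 n)))) ----> (mass w2 + mass y2) - (mass w2 + mass y2)"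
    unfolding \<rho>_def by (intro tendsto_diff tendsto_add tendsto_const sq[OF R2(5)] T2(5))
   then show "(%n. mass (k2 n) - mass (u2 (\<rho> n))) ----> 0" by (simp add: K2(3) S2(3) X2(3) algebra_simps)
  qed
  \<comment> \<open>The masses of the combined functions differ from those of the original ones by a
    quantity tending to zero, so the factors restoring the constraint tend to one; the maximum with
    \<open>b\<close> leaves functions of mass below \<open>b\<close> unchanged.\<close>
  have scale: "\<exists>c. c ----> 1 & (\<forall>n. 0 < c n & c n <= 1 & mass (%x. c n * k n x) <= b)"
   if b: "b > 0" and l: "(%n. mass (k n) - mass (f n)) ----> 0" and f: "!!n. mass (f n) <= b" for b k and f :: "nat => real ^ 'n => real"
  proof (intro exI conjI allI)
   let ?c = "%n. sqrt (b / max b (mass (k n)))"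
   have "(%n. max b (mass (k n))) ----> b"
   proof (rule tendsto_sandwich[OF _ _ tendsto_const])
    show "\<forall>\<^sub>F n in sequentially. b <= max b (mass (k n))" by simp
    show "\<forall>\<^sub>F n in sequentially. max b (mass (k n)) <= b + \<bar>mass (k n) - mass (f n)\<bar>"
    proof (intro always_eventually allI)
     fix n show "max b (mass (k n)) <= b + \<bar>mass (k n) - mass (f n)\<bar>" using f[of n] by (auto simp: max_def)
    qed
    show "(%n. b + \<bar>mass (k n) - mass (f n)\<bar>) ----> b"
     using tendsto_add[OF tendsto_const[of b] tendsto_rabs[OF l]] by simp
   qed
   from tendsto_real_sqrt[OF tendsto_divide[OF tendsto_const[of b] this]] b show "?c ----> 1" by simp
   fix n
   show "0 < ?c n" "?c n <= 1" using b by (auto simp: max_def)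
   have "mass (%x. ?c n * k n x) = b / max b (mass (k n)) * mass (k n)" unfolding mass_cmult using b by (simp add: max_def)
   also have "... <= b" using b by (auto simp: max_def divide_le_eq)
   finally show "mass (%x. ?c n * k n x) <= b" .
  qed
  obtain c1 where c1: "c1 ----> 1" "!!n. 0 < c1 n & c1 n <= 1 & mass (%x. c1 n * k1 n x) <= a1"
   using scale[OF a(1) mk(1) M(1)] by blast
  obtain c2 where c2: "c2 ----> 1" "!!n. 0 < c2 n & c2 n <= 1 & mass (%x. c2 n * k2 n x) <= a2"
   using scale[OF a(2) mk(2) M(2)] by blast
  obtain P1 P2 C where B: "!!u v. feasible u v ==> dir u + dir v <= d ==> pw p1 u <= P1 & pw p2 v <= P2 & cp r1 r2 u v <= C"
   using bounded_terms by metis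
  define l1 where "l1 = (%n x. c1 n * k1 n x)"
  define l2 where "l2 = (%n x. c2 n * k2 n x)"
  define e' where "e' n = \<bar>E n\<bar> + (1 - c1 n powr p1) * \<bar>P1 + g1\<bar> + (1 - c2 n powr p2) * \<bar>P2 + g2\<bar> + (1 - c1 n powr r1 * c2 n powr r2) * \<bar>C + g3\<bar>" for n
  have "e' ----> \<bar>0\<bar> + (1 - 1 powr p1) * \<bar>P1 + g1\<bar> + (1 - 1 powr p2) * \<bar>P2 + g2\<bar> + (1 - 1 powr r1 * 1 powr r2) * \<bar>C + g3\<bar>"
   unfolding e'_def[abs_def] by (intro tendsto_add tendsto_mult tendsto_rabs tendsto_diff tendsto_const tendsto_powr c1(1) c2(1) E0) auto
  then have e0: "e' ----> 0" by simp
  have q: "0 <= c1 n powr p1" "c1 n powr p1 <= 1" "0 <= c2 n powr p2" "c2 n powr p2 <= 1"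
   "0 <= c1 n powr r1 * c2 n powr r2" "c1 n powr r1 * c2 n powr r2 <= 1" for n
   using c1(2)[of n] c2(2)[of n] p r0 by (auto intro!: powr_le1 mult_le_one)
  have nn: "0 <= (1 - c1 n powr p1) * \<bar>P1 + g1\<bar>" "0 <= (1 - c2 n powr p2) * \<bar>P2 + g2\<bar>" "0 <= (1 - c1 n powr r1 * c2 n powr r2) * \<bar>C + g3\<bar>" for n
   using q[of n] by auto
  have H: "l1 n \<in> H1" "l2 n \<in> H1" for n unfolding l1_def l2_def using K1(1) K2(1) by (auto intro: H1_cmult)
  have F: "feasible (l1 n) (l2 n)" for n using H c1(2)[of n] c2(2)[of n] by (auto simp: feasible_def l1_def l2_def)
  have dk: "dir (l1 n) <= dir (k1 n)" "dir (l2 n) <= dir (k2 n)" for n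
  proof -
   have "(c1 n)^2 <= 1" "(c2 n)^2 <= 1" using c1(2)[of n] c2(2)[of n] by (auto intro: power_le_one)
   then show "dir (l1 n) <= dir (k1 n)" "dir (l2 n) <= dir (k2 n)"
    unfolding l1_def l2_def using K1(1) K2(1) by (auto simp: dir_cmult intro!: mult_left_le_one_le)
  qed
  \<comment> \<open>Multiplication by a factor \<open>q <= 1\<close> spoils the comparison by at
    most \<open>(1 - q) |P + g|\<close>, where \<open>P\<close> bounds the term
    \<open>x\<close>.\<close>
  have sc: "x + g <= q * k + (\<bar>\<epsilon>\<bar> + (1 - q) * \<bar>P + g\<bar>)" if "x + g <= k + \<epsilon>" "0 <= q" "q <= 1" "x <= P" for x g q k \<epsilon> P :: real
  proof -
   have "q * (x + g) <= q * (k + \<epsilon>)" using that by (intro mult_left_mono) auto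
   moreover have "(1 - q) * (x + g) <= (1 - q) * \<bar>P + g\<bar>" using that by (intro mult_left_mono) auto
   moreover have "q * \<epsilon> <= q * \<bar>\<epsilon>\<bar>" "q * \<bar>\<epsilon>\<bar> <= 1 * \<bar>\<epsilon>\<bar>" using that by (auto intro: mult_left_mono mult_left_le_one_le)
   ultimately show ?thesis by (simp add: algebra_simps)
  qed
  have pl: "pw p1 (l1 n) = c1 n powr p1 * pw p1 (k1 n)" "pw p2 (l2 n) = c2 n powr p2 * pw p2 (k2 n)"
   "cp r1 r2 (l1 n) (l2 n) = c1 n powr r1 * c2 n powr r2 * cp r1 r2 (k1 n) (k2 n)" for n
   unfolding l1_def l2_def using c1(2)[of n] c2(2)[of n] by (simp_all add: pw_cmult cp_cmult_left cp_cmult_right)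
  note Bn = B[OF u(1) u(2)]
  show thesis
  proof (rule D[of \<rho> l1 l2 e' g1 g2 g3])
   fix n
   show "0 <= e' n" unfolding e'_def using nn[of n] by linarith
   have ee: "E n <= e' n" unfolding e'_def using nn[of n] by linarith
   show "dir (l1 n) + dir (l2 n) <= dir (u1 (\<rho> n)) + dir (u2 (\<rho> n)) + e' n"
    using fin[of n] dk[of n] ee by linarith
   have "pw p1 (u1 (\<rho> n)) + g1 <= pw p1 (l1 n) + (\<bar>E n\<bar> + (1 - c1 n powr p1) * \<bar>P1 + g1\<bar>)"
    unfolding pl using fin[of n] q[of n] Bn[of "\<rho> n"] by (intro sc) auto
   then show "pw p1 (u1 (\<rho> n)) + g1 <= pw p1 (l1 n) + e' n" unfolding e'_def using nn[of n] by linarith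
   have "pw p2 (u2 (\<rho> n)) + g2 <= pw p2 (l2 n) + (\<bar>E n\<bar> + (1 - c2 n powr p2) * \<bar>P2 + g2\<bar>)"
    unfolding pl using fin[of n] q[of n] Bn[of "\<rho> n"] by (intro sc) auto
   then show "pw p2 (u2 (\<rho> n)) + g2 <= pw p2 (l2 n) + e' n" unfolding e'_def using nn[of n] by linarith
   have "cp r1 r2 (u1 (\<rho> n)) (u2 (\<rho> n)) + g3 <= cp r1 r2 (l1 n) (l2 n) + (\<bar>E n\<bar> + (1 - c1 n powr r1 * c2 n powr r2) * \<bar>C + g3\<bar>)"
    unfolding pl using fin[of n] q[of n] Bn[of "\<rho> n"] by (intro sc) auto
   then show "cp r1 r2 (u1 (\<rho> n)) (u2 (\<rho> n)) + g3 <= cp r1 r2 (l1 n) (l2 n) + e' n" unfolding e'_def using nn[of n] by linarith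
  qed (use \<rho> F e0 g gs in auto)
 qed
qed

text \<open>Turns the termwise comparison into one for the energy, uniformly for scales in a compact
  range: gains are estimated at \<open>lo\<close>, errors at \<open>hi\<close>.\<close>

lemma J_gain:
 assumes t: "0 < lo" "lo <= t" "t <= hi" and e: "0 <= e" and g: "0 <= g1" "0 <= g2" "0 <= g3"
  and le: "dir k1 + dir k2 <= dir u + dir v + e" "pw p1 u + g1 <= pw p1 k1 + e" "pw p2 v + g2 <= pw p2 k2 + e"
   "cp r1 r2 u v + g3 <= cp r1 r2 k1 k2 + e"
 shows "J \<beta> t k1 k2 + (\<mu>1 / p1 * g1 * lo powr \<alpha>1 + \<mu>2 / p2 * g2 * lo powr \<alpha>2 + \<beta> * g3 * lo powr \<gamma>) <=
  J \<beta> t u v + (hi^2 / 2 + \<mu>1 / p1 * hi powr \<alpha>1 + \<mu>2 / p2 * hi powr \<alpha>2 + \<beta> * hi powr \<gamma>) * e"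
proof -
 have t0: "0 < t" using t by simp
 have k: "0 <= \<mu>1 / p1" "0 <= \<mu>2 / p2" "0 <= \<beta>" using \<mu> p \<beta> by auto
 have est: "m * g * lo powr \<delta> + m * x * t powr \<delta> <= m * y * t powr \<delta> + m * hi powr \<delta> * e"
  if "0 <= m" "0 <= g" "x + g <= y + e" "0 < \<delta>" for m g x y \<delta> :: real
 proof -
  have "m * g * lo powr \<delta> <= m * g * t powr \<delta>" using that t by (intro mult_left_mono powr_mono2) auto
  moreover have "m * (x + g) * t powr \<delta> <= m * (y + e) * t powr \<delta>" using that by (intro mult_right_mono mult_left_mono) auto
  moreover have "m * e * t powr \<delta> <= m * e * hi powr \<delta>" using that t t0 e by (intro mult_left_mono powr_mono2) auto
  ultimately show ?thesis by (simp add: algebra_simps)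
 qed
 have "t^2 / 2 * (dir k1 + dir k2) <= t^2 / 2 * (dir u + dir v + e)" using le(1) by (intro mult_left_mono) auto
 moreover have "t^2 / 2 * e <= hi^2 / 2 * e" using t0 t e by (intro mult_right_mono divide_right_mono power_mono) auto
 moreover note est[OF k(1) g(1) le(2) \<alpha>(1)] est[OF k(2) g(2) le(3) \<alpha>(3)] est[OF k(3) g(3) le(4), of \<gamma>, OF order.strict_trans[OF _ \<gamma>]]
 ultimately show ?thesis unfolding J_def fiber_def distrib_left distrib_right by linarith
qed

end

text \<open>For nonnegative test functions the nonlinear terms have a sign, so dropping them leaves
  the inequality of the maximum principle; if \<open>l\<close> were nonnegative, dropping the linear
  and the coupling term would leave that of the Liouville theorem.\<close>

lemma supersolution:
 fixes w g :: "real ^ 'n => real"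
 assumes p: "subcrit TYPE('n) p" and \<mu>: "\<mu> > 0" and w: "w \<in> H1" "!!x. w x >= 0" "mass w > 0"
  and g: "!!x. g x >= 0" and k: "k >= 0"
  and eq: "!!\<zeta>. \<zeta> \<in> H1 ==> gip w \<zeta> = l * ip w \<zeta> + \<mu> * (LINT x|lebesgue. \<bar>w x\<bar> powr (p - 2) * w x * \<zeta> x)
   + k * (LINT x|lebesgue. g x * \<zeta> x)"
 shows "positive_function w" "CARD('n) <= 4 ==> l < 0"
proof -
 have nn: "0 <= ip w \<zeta>" "0 <= \<mu> * (LINT x|lebesgue. \<bar>w x\<bar> powr (p - 2) * w x * \<zeta> x)" "0 <= k * (LINT x|lebesgue. g x * \<zeta> x)"
  if "!!x. \<zeta> x >= 0" for \<zeta>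
  unfolding ip_def using that w(2) g \<mu> k
  by (auto intro!: mult_nonneg_nonneg integral_nonneg_AE[where M = lebesgue] AE_I2)
 have "ae x. w x > 0"
 proof (rule strong_maximum_principle[OF w])
  fix \<zeta> :: "real ^ 'n => real" assume z: "\<zeta> \<in> H1" "!!x. \<zeta> x >= 0"
  show "l * ip w \<zeta> <= gip w \<zeta>" using eq[OF z(1)] nn[of \<zeta>, OF z(2)] by linarith
 qed
 then show "positive_function w" by (simp add: positive_function_def)
 show "l < 0" if N: "CARD('n) <= 4"
 proof (rule ccontr)
  assume "~ l < 0"
  then have l: "l >= 0" by simp
  show False
  proof (rule Liouville[OF N p \<mu> w])
   fix \<zeta> :: "real ^ 'n => real" assume z: "\<zeta> \<in> H1" "!!x. \<zeta> x >= 0"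
   show "\<mu> * (LINT x|lebesgue. \<bar>w x\<bar> powr (p - 2) * w x * \<zeta> x) <= gip w \<zeta>"
    using eq[OF z(1)] nn[of \<zeta>, OF z(2)] mult_nonneg_nonneg[OF l nn(1)[of \<zeta>, OF z(2)]] by linarith
  qed
 qed
qed

context coupled_masses
begin

text \<open>The hypothesis on paths is phrased to serve both solutions: for the local minimiser the
  scale \<open>T\<close> is constantly one, for the other solution it is the peak of the varied
  pair. The components are varied one at a time, each along its own sphere.\<close>

lemma critical_point:
 assumes u: "u \<in> H1" "!!x. u x >= 0" "mass u = a1" and v: "v \<in> H1" "!!x. v x >= 0" "mass v = a2"
  and path: "!!U V. \<forall>\<^sub>F tau in at (0::real). feasible (U tau) (V tau) ==>
   ((%tau. dir (U tau) + dir (V tau)) \<longlongrightarrow> dir u + dir v) (at 0) ==> ((%tau. pw p1 (U tau)) \<longlongrightarrow> pw p1 u) (at 0) ==>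
   ((%tau. pw p2 (V tau)) \<longlongrightarrow> pw p2 v) (at 0) ==> ((%tau. cp r1 r2 (U tau) (V tau)) \<longlongrightarrow> cp r1 r2 u v) (at 0) ==>
   \<exists>T. (T \<longlongrightarrow> 1) (at 0) & (\<forall>\<^sub>F tau in at 0. J \<beta> (T tau) u v <= J \<beta> (T tau) (U tau) (V tau))"
 shows "\<exists>l1 l2. weak_solution \<mu>1 \<mu>2 p1 p2 r1 r2 \<beta> l1 l2 u v & positive_function u & positive_function v &
  (CARD('n) <= 4 --> l1 < 0 & l2 < 0)"
proof -
 have r0: "r1 > 0" "r2 > 0" using r by auto
 have sub': "subcrit TYPE('n) (r2 + r1)" using sub(3) by (simp add: add.commute)
 have m0: "mass u > 0" "mass v > 0" using u v a by auto
 \<comment> \<open>The terms \<open>X\<close> and \<open>Q\<close> of the component held fixed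
   cancel in the difference of the energies.\<close>
 have ring1: "h * (A + X) - m * B' * P - Q - b * C' * R - (h * (A0 + X) - m * B * P - Q - b * C * R)
   = h * (A - A0) - m * P * (B' - B) - b * R * (C' - C)" for h A X m B' P Q b C' R A0 B C :: real
  by (simp add: algebra_simps)
 have ring2: "h * (X + A) - Q - m * B' * P - b * C' * R - (h * (X + A0) - Q - m * B * P - b * C * R)
   = h * (A - A0) - m * P * (B' - B) - b * R * (C' - C)" for h A X m B' P Q b C' R A0 B C :: real
  by (simp add: algebra_simps)
 define l1 where "l1 = (dir u - \<mu>1 * pw p1 u - \<beta> * r1 * cp r1 r2 u v) / mass u"
 define l2 where "l2 = (dir v - \<mu>2 * pw p2 v - \<beta> * r2 * cp r2 r1 v u) / mass v"
 have E1: "gip u phi = l1 * ip u phi + \<mu>1 * (LINT x|lebesgue. \<bar>u x\<bar> powr (p1 - 2) * u x * phi x)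
   + \<beta> * r1 * (LINT x|lebesgue. \<bar>u x\<bar> powr (r1 - 2) * u x * \<bar>v x\<bar> powr r2 * phi x)" if phi: "phi \<in> H1" for phi
  unfolding l1_def
 proof (rule Euler_Lagrange[where \<alpha> = \<alpha>1 and \<gamma> = \<gamma>, OF sub(1,3) r(1) r0(2) u(1) m0(1) v(1) _ phi])
  fix psi :: "real ^ 'n => real" assume psi: "psi \<in> H1"
   and c: "\<forall>\<^sub>F tau in at 0. mass (curve u psi tau) = mass u" "((%tau. dir (curve u psi tau)) \<longlongrightarrow> dir u) (at 0)"
    "((%tau. pw p1 (curve u psi tau)) \<longlongrightarrow> pw p1 u) (at 0)" "((%tau. cp r1 r2 (curve u psi tau) v) \<longlongrightarrow> cp r1 r2 u v) (at 0)"
  have f: "\<forall>\<^sub>F tau in at 0. feasible (curve u psi tau) v"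
   using c(1) by eventually_elim (use curve_H1[OF u(1) psi] v u in \<open>simp add: feasible_def\<close>)
  obtain T where T: "(T \<longlongrightarrow> 1) (at 0)" "\<forall>\<^sub>F tau in at 0. J \<beta> (T tau) u v <= J \<beta> (T tau) (curve u psi tau) v"
   using path[OF f tendsto_add[OF c(2) tendsto_const] c(3) tendsto_const c(4)] by blast
  from T(2) have "\<forall>\<^sub>F tau in at 0. 0 <= (T tau)^2 / 2 * (dir (curve u psi tau) - dir u) - \<mu>1 / p1 * T tau powr \<alpha>1 * (pw p1 (curve u psi tau) - pw p1 u)
    - \<beta> * T tau powr \<gamma> * (cp r1 r2 (curve u psi tau) v - cp r1 r2 u v)"
  proof eventually_elim
   case (elim tau)
   then show ?case unfolding ring1[symmetric, where X = "dir v" and Q = "\<mu>2 / p2 * pw p2 v * T tau powr \<alpha>2"] J_def fiber_def by simp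
  qed
  with T(1) show "\<exists>T. (T \<longlongrightarrow> 1) (at 0) & (\<forall>\<^sub>F tau in at 0. 0 <= (T tau)^2 / 2 * (dir (curve u psi tau) - dir u)
    - \<mu>1 / p1 * T tau powr \<alpha>1 * (pw p1 (curve u psi tau) - pw p1 u) - \<beta> * T tau powr \<gamma> * (cp r1 r2 (curve u psi tau) v - cp r1 r2 u v))"
   by blast
 qed
 have E2: "gip v phi = l2 * ip v phi + \<mu>2 * (LINT x|lebesgue. \<bar>v x\<bar> powr (p2 - 2) * v x * phi x)
   + \<beta> * r2 * (LINT x|lebesgue. \<bar>v x\<bar> powr (r2 - 2) * v x * \<bar>u x\<bar> powr r1 * phi x)" if phi: "phi \<in> H1" for phi
  unfolding l2_def
 proof (rule Euler_Lagrange[where \<alpha> = \<alpha>2 and \<gamma> = \<gamma>, OF sub(2) sub' r(2) r0(1) v(1) m0(2) u(1) _ phi])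
  fix psi :: "real ^ 'n => real" assume psi: "psi \<in> H1"
   and c: "\<forall>\<^sub>F tau in at 0. mass (curve v psi tau) = mass v" "((%tau. dir (curve v psi tau)) \<longlongrightarrow> dir v) (at 0)"
    "((%tau. pw p2 (curve v psi tau)) \<longlongrightarrow> pw p2 v) (at 0)" "((%tau. cp r2 r1 (curve v psi tau) u) \<longlongrightarrow> cp r2 r1 v u) (at 0)"
  have f: "\<forall>\<^sub>F tau in at 0. feasible u (curve v psi tau)"
   using c(1) by eventually_elim (use curve_H1[OF v(1) psi] v u in \<open>simp add: feasible_def\<close>)
  obtain T where T: "(T \<longlongrightarrow> 1) (at 0)" "\<forall>\<^sub>F tau in at 0. J \<beta> (T tau) u v <= J \<beta> (T tau) u (curve v psi tau)"
   using path[OF f tendsto_add[OF tendsto_const c(2)] tendsto_const c(3) c(4)[unfolded cp_commute[of r2 r1]]] by blast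
  from T(2) have "\<forall>\<^sub>F tau in at 0. 0 <= (T tau)^2 / 2 * (dir (curve v psi tau) - dir v) - \<mu>2 / p2 * T tau powr \<alpha>2 * (pw p2 (curve v psi tau) - pw p2 v)
    - \<beta> * T tau powr \<gamma> * (cp r2 r1 (curve v psi tau) u - cp r2 r1 v u)"
  proof eventually_elim
   case (elim tau)
   then show ?case
    unfolding ring2[symmetric, where X = "dir u" and Q = "\<mu>1 / p1 * pw p1 u * T tau powr \<alpha>1"] J_def fiber_def cp_commute[of r2 r1] by simp
  qed
  with T(1) show "\<exists>T. (T \<longlongrightarrow> 1) (at 0) & (\<forall>\<^sub>F tau in at 0. 0 <= (T tau)^2 / 2 * (dir (curve v psi tau) - dir v)
    - \<mu>2 / p2 * T tau powr \<alpha>2 * (pw p2 (curve v psi tau) - pw p2 v) - \<beta> * T tau powr \<gamma> * (cp r2 r1 (curve v psi tau) u - cp r2 r1 v u))"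
   by blast
 qed
 have W: "weak_solution \<mu>1 \<mu>2 p1 p2 r1 r2 \<beta> l1 l2 u v"
  unfolding weak_solution_def
 proof (intro conjI ballI u(1) v(1))
  fix phi :: "real ^ 'n => real" assume phi: "phi \<in> H1"
  show "(LINT x|lebesgue. grad u x \<bullet> grad phi x) = l1 * (LINT x|lebesgue. u x * phi x) + \<mu>1 * (LINT x|lebesgue. \<bar>u x\<bar> powr (p1 - 2) * u x * phi x)
    + \<beta> * r1 * (LINT x|lebesgue. \<bar>u x\<bar> powr (r1 - 2) * u x * \<bar>v x\<bar> powr r2 * phi x)"
   unfolding gip_eq[OF u(1) phi] using E1[OF phi] by (simp add: ip_def)
  have "(%x. \<bar>u x\<bar> powr r1 * \<bar>v x\<bar> powr (r2 - 2) * v x * phi x) = (%x. \<bar>v x\<bar> powr (r2 - 2) * v x * \<bar>u x\<bar> powr r1 * phi x)"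
   by (simp add: fun_eq_iff)
  then show "(LINT x|lebesgue. grad v x \<bullet> grad phi x) = l2 * (LINT x|lebesgue. v x * phi x) + \<mu>2 * (LINT x|lebesgue. \<bar>v x\<bar> powr (p2 - 2) * v x * phi x)
    + \<beta> * r2 * (LINT x|lebesgue. \<bar>u x\<bar> powr r1 * \<bar>v x\<bar> powr (r2 - 2) * v x * phi x)"
   unfolding gip_eq[OF v(1) phi] using E2[OF phi] by (simp add: ip_def)
 qed
 have k: "0 <= \<beta> * r1" "0 <= \<beta> * r2" using \<beta> r by auto
 note P1 = supersolution[where g = "%x. \<bar>u x\<bar> powr (r1 - 2) * u x * \<bar>v x\<bar> powr r2", OF sub(1) \<mu>(1) u(1,2) m0(1) _ k(1) E1]
 note P2 = supersolution[where g = "%x. \<bar>v x\<bar> powr (r2 - 2) * v x * \<bar>u x\<bar> powr r1", OF sub(2) \<mu>(2) v(1,2) m0(2) _ k(2) E2]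
 show ?thesis
  by (rule exI[of _ l1], rule exI[of _ l2]) (use W P1 P2 u(2) v(2) in auto)
qed

text \<open>Only the sum of the gains is known to be positive, while their coefficients in the
  energy differ; the smallest coefficient gives the bound.\<close>

lemma gain_pos:
 assumes "0 <= g1" "0 <= g2" "0 <= g3" "0 < g1 + g2 + g3" "0 < lo"
 shows "0 < \<mu>1 / p1 * g1 * lo powr \<alpha>1 + \<mu>2 / p2 * g2 * lo powr \<alpha>2 + \<beta> * g3 * lo powr \<gamma>"
proof -
 have k: "0 < \<mu>1 / p1 * lo powr \<alpha>1" "0 < \<mu>2 / p2 * lo powr \<alpha>2" "0 < \<beta> * lo powr \<gamma>" using \<mu> p \<beta> assms by auto
 have "0 < x * g1 + y * g2 + z * g3" if "0 < x" "0 < y" "0 < z" for x y z :: real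
 proof -
  define q where "q = min x (min y z)"
  have q: "0 < q" "q <= x" "q <= y" "q <= z" using that by (auto simp: q_def)
  have "0 < q * (g1 + g2 + g3)" using q(1) assms(4) by simp
  moreover have "q * g1 <= x * g1" "q * g2 <= y * g2" "q * g3 <= z * g3" using q assms by (auto intro: mult_right_mono)
  ultimately show ?thesis by (simp add: distrib_left)
 qed
 from this[OF k] show ?thesis by (simp add: ac_simps)
qed

end

subsection \<open>The local minimiser\<close>

locale coupled_ball = coupled_masses where dim = dim for dim :: "'n :: finite itself" +
 fixes \<rho>' \<rho> :: real
 assumes \<rho>: "0 < \<rho>'" "\<rho>' < \<rho>"
  and geo: "!!u v t. feasible u v ==> 0 < t ==> \<rho>' <= t^2 * (dir u + dir v) ==> t^2 * (dir u + dir v) <= \<rho> ==> 1 <= J \<beta> t u v"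
begin

abbreviation "adm \<equiv> (admissible a1 a2 \<rho> :: ((real ^ 'n => real) \<times> (real ^ 'n => real)) set)"

definition m :: real where "m = inf_energy TYPE('n) \<mu>1 \<mu>2 p1 p2 r1 r2 \<beta> a1 a2 \<rho>"

lemma adm_iff: "(u, v) \<in> adm \<longleftrightarrow> u \<in> H1 & v \<in> H1 & mass u = a1 & mass v = a2 & dir u + dir v < \<rho>"
 using dir_sum_eq[of u v] by (auto simp: admissible_def mass_sphere_def grad_ball_def mass_def)

lemma adm_feasible: "(u, v) \<in> adm ==> feasible u v"
 by (auto simp: adm_iff feasible_def)

lemma m_eq: "m = (INF z\<in>adm. J \<beta> 1 (fst z) (snd z))"
 unfolding m_def inf_energy_def by (intro INF_cong refl) (auto simp: adm_iff energy_J split: prod.split)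

lemma m_le:
 assumes "(u, v) \<in> adm" shows "m <= J \<beta> 1 u v"
proof -
 obtain P1 P2 C where B: "P1 > 0" "P2 > 0" "C > 0" "!!u v. feasible u v ==> dir u + dir v <= \<rho> ==> pw p1 u <= P1 & pw p2 v <= P2 & cp r1 r2 u v <= C"
  using bounded_terms[of \<rho>] by metis
 have "- (\<mu>1 / p1 * P1 + \<mu>2 / p2 * P2 + \<beta> * C) <= J \<beta> 1 u v" if "(u, v) \<in> adm" for u v
 proof -
  have "pw p1 u <= P1 & pw p2 v <= P2 & cp r1 r2 u v <= C" using B(4)[OF adm_feasible[OF that]] that by (simp add: adm_iff)
  then have "\<mu>1 / p1 * pw p1 u <= \<mu>1 / p1 * P1" "\<mu>2 / p2 * pw p2 v <= \<mu>2 / p2 * P2" "\<beta> * cp r1 r2 u v <= \<beta> * C"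
   using \<mu> p \<beta> by (intro mult_left_mono; simp)+
  moreover have "- (a + b + c) <= d - x - y - z" if "x <= a" "y <= b" "z <= c" "0 <= d" for a b c d x y z :: real
   using that by linarith
  moreover have "0 <= 1 / 2 * (dir u + dir v)" by simp
  ultimately show ?thesis unfolding J_def fiber_def powr_one_eq_one mult_1_right power_one by blast
 qed
 then have "bdd_below ((%z. J \<beta> 1 (fst z) (snd z)) ` adm)" by (intro bdd_belowI2) auto
 from cINF_lower[OF this assms] show ?thesis by (simp add: m_eq)
qed

text \<open>The filling is taken with Dirichlet integral below the remaining room, so the merged
  pair has the exact masses and still lies in the ball. The strict version later forces a minimising
  limit to have full mass.\<close>

lemma m_relaxed:
 assumes w: "feasible w1 w2" "dir w1 + dir w2 < \<rho>"
 shows "m <= J \<beta> 1 w1 w2" "mass w1 < a1 \<or> mass w2 < a2 ==> m < J \<beta> 1 w1 w2"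
proof -
 have H: "w1 \<in> H1" "w2 \<in> H1" using w by (auto simp: feasible_def)
 show lt: "m < J \<beta> 1 w1 w2" if "mass w1 < a1 \<or> mass w2 < a2"
 proof -
  have b: "0 <= a1 - mass w1" "0 <= a2 - mass w2" "0 < a1 - mass w1 + (a2 - mass w2)" "0 < \<rho> - (dir w1 + dir w2)" "0 <= \<beta>"
   using w that \<beta> by (auto simp: feasible_def)
  obtain z1 z2 where z: "z1 \<in> H1" "z2 \<in> H1" "mass z1 = a1 - mass w1" "mass z2 = a2 - mass w2"
   "dir z1 + dir z2 < \<rho> - (dir w1 + dir w2)" "!!t. 0 < t ==> t <= 1 ==> J \<beta> t z1 z2 < 0"
   by (rule spread[OF b(1-3) zero_less_one b(4,5)]) blast
  have "(hyp w1 z1, hyp w2 z2) \<in> adm"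
   unfolding adm_iff using hyp_H1[OF H(1) z(1)] hyp_H1[OF H(2) z(2)] z by auto
  from m_le[OF this] J_hyp[OF less_imp_le[OF \<beta>] H z(1,2), of 1] z(6)[of 1] show ?thesis by simp
 qed
 show "m <= J \<beta> 1 w1 w2"
 proof (cases "mass w1 < a1 \<or> mass w2 < a2")
  case True then show ?thesis using lt by simp
 next
  case False
  then show ?thesis using w by (intro m_le) (auto simp: adm_iff feasible_def)
 qed
qed

lemma adm_nonempty_negative:
 obtains z1 z2 where "(z1, z2) \<in> adm" "J \<beta> 1 z1 z2 < 0"
proof -
 obtain z1 z2 where z: "z1 \<in> H1" "z2 \<in> H1" "mass z1 = a1" "mass z2 = a2" "dir z1 + dir z2 < \<rho>" "!!t. 0 < t ==> t <= 1 ==> J \<beta> t z1 z2 < 0"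
  by (rule spread[of a1 a2 1 \<rho> \<beta>]) (use a \<beta> \<rho> in auto)
 show ?thesis by (rule that[of z1 z2]) (use z in \<open>auto simp: adm_iff\<close>)
qed

lemma m_neg: "m < 0"
 using adm_nonempty_negative m_le by (metis le_less_trans)

text \<open>The energy is at least one on the annulus between \<open>\<rho>'\<close> and
  \<open>\<rho>\<close>, so a sequence with energy tending to a negative number eventually stays
  within \<open>\<rho>'\<close>, at a fixed distance from the boundary of the ball. Vanishing is
  excluded by \<open>m < 0\<close>, a second profile by the strict gain.\<close>

lemma minimizing_profile:
 assumes "minimizing_sequence \<mu>1 \<mu>2 p1 p2 r1 r2 \<beta> a1 a2 \<rho> U1 U2"
 obtains sg y w1 w2 where "strict_mono (sg :: nat => nat)" "(w1, w2) \<in> adm" "dir w1 + dir w2 <= \<rho>'" "J \<beta> 1 w1 w2 = m"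
  "(%n. mass (%x. U1 (sg n) (x + y n) - w1 x)) ----> 0" "(%n. mass (%x. U2 (sg n) (x + y n) - w2 x)) ----> 0"
  "(%n. dir (%x. U1 (sg n) (x + y n) - w1 x)) ----> 0" "(%n. dir (%x. U2 (sg n) (x + y n) - w2 x)) ----> 0"
proof -
 have U0: "(U1 n, U2 n) \<in> adm" for n using assms by (simp add: minimizing_sequence_def)
 have "energy \<mu>1 \<mu>2 p1 p2 r1 r2 \<beta> (U1 n) (U2 n) = J \<beta> 1 (U1 n) (U2 n)" for n using U0[of n] by (simp add: adm_iff energy_J)
 then have lim0: "(%n. J \<beta> 1 (U1 n) (U2 n)) ----> m" using assms by (simp add: minimizing_sequence_def m_def)
 have "\<forall>\<^sub>F n in sequentially. J \<beta> 1 (U1 n) (U2 n) < 0" using order_tendstoD(2)[OF lim0 m_neg] .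
 then obtain n0 where n0: "!!n. n >= n0 ==> J \<beta> 1 (U1 n) (U2 n) < 0" by (auto simp: eventually_sequentially)
 have le: "dir (U1 (n + n0)) + dir (U2 (n + n0)) <= \<rho>'" for n
 proof (rule ccontr)
  assume "~ ?thesis"
  then have "1 <= J \<beta> 1 (U1 (n + n0)) (U2 (n + n0))"
   using geo[OF adm_feasible[OF U0[of "n + n0"]], of 1] U0[of "n + n0"] by (simp add: adm_iff)
  with n0[of "n + n0"] show False by simp
 qed
 define u1 u2 where "u1 n = U1 (n + n0)" and "u2 n = U2 (n + n0)" for n
 have U: "(u1 n, u2 n) \<in> adm" "dir (u1 n) + dir (u2 n) <= \<rho>'" for n using U0 le by (auto simp: u1_def u2_def)
 have lim: "(%n. J \<beta> 1 (u1 n) (u2 n)) ----> m"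
  unfolding u1_def u2_def by (rule LIMSEQ_ignore_initial_segment[OF lim0])
 have F: "feasible (u1 n) (u2 n)" for n by (rule adm_feasible[OF U(1)])
 have H: "u1 n \<in> H1" "u2 n \<in> H1" "mass (u1 n) = a1" "mass (u2 n) = a2" for n using U(1)[of n] by (auto simp: adm_iff)
 have nv: "~ (vanishing u1 & vanishing u2)"
 proof
  assume V: "vanishing u1 & vanishing u2"
  have b: "mass (u1 n) <= max a1 a2" "mass (u2 n) <= max a1 a2" "dir (u1 n) <= \<rho>'" "dir (u2 n) <= \<rho>'" for n
   using H[of n] U(2)[of n] dir_nonneg[of "u1 n"] dir_nonneg[of "u2 n"] by (auto simp del: dir_nonneg)
  have "(%n. J \<beta> 1 (u1 n) (u2 n) - 1^2 / 2 * (dir (u1 n) + dir (u2 n))) ----> 0"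
   by (rule vanishing_terms[OF H(1) b(1,3) H(2) b(2,4)]) (use V in auto)
  from LIMSEQ_le[OF this lim] have "0 <= m" by auto
  with m_neg show False by simp
 qed
 show thesis
 proof (cases rule: dichotomy[OF F U(2) nv, case_names S D])
  case (S sg y w1 w2 v1 v2)
  have d\<rho>: "dir w1 + dir w2 < \<rho>" using S(9) \<rho> by simp
  have lim': "(%n. J \<beta> 1 (u1 (sg n)) (u2 (sg n))) ----> m"
   using LIMSEQ_subseq_LIMSEQ[OF lim S(1)] by (simp add: comp_def)
  \<comment> \<open>In the limit the energy of the sequence is that of the profile plus half the
    Dirichlet integral of the remainder. As the profile has energy at least \<open>m\<close>, the
    remainder must tend to zero in Dirichlet integral.\<close>
  have e: "2 * (x - (x - 1^2 / 2 * y)) = y" for x y :: real by simp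
  from tendsto_mult[OF tendsto_const[of 2] tendsto_diff[OF lim' S(11)[of 1]]]
  have dl: "(%n. dir (v1 n) + dir (v2 n)) ----> 2 * (m - J \<beta> 1 w1 w2)" unfolding e .
  have "0 <= 2 * (m - J \<beta> 1 w1 w2)" by (rule LIMSEQ_le_const[OF dl]) (auto intro: add_nonneg_nonneg)
  then have Jm: "J \<beta> 1 w1 w2 = m" using m_relaxed(1)[OF S(2) d\<rho>] by simp
  have "~ (mass w1 < a1 \<or> mass w2 < a2)" using m_relaxed(2)[OF S(2) d\<rho>] Jm by auto
  then have mw: "mass w1 = a1" "mass w2 = a2" using S(2) by (auto simp: feasible_def)
  have wa: "(w1, w2) \<in> adm" using S(2) mw d\<rho> by (simp add: adm_iff feasible_def)
  have d0: "(%n. dir (v1 n) + dir (v2 n)) ----> 0" using dl Jm by simp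
  have dv: "(%n. dir (v1 n)) ----> 0" "(%n. dir (v2 n)) ----> 0"
   by (rule tendsto_sandwich[OF _ _ tendsto_const d0]; simp)+
  have mv: "(%n. mass (v1 n)) ----> 0" "(%n. mass (v2 n)) ----> 0"
   using tendsto_diff[OF tendsto_const[of a1] S(7)] tendsto_diff[OF tendsto_const[of a2] S(8)] by (simp_all add: H mw)
  show thesis
   by (rule that[of "%n. sg n + n0", OF _ wa S(9) Jm mv[unfolded S(3,4) u1_def u2_def] dv[unfolded S(3,4) u1_def u2_def]])
    (use S(1) in \<open>simp add: strict_mono_def\<close>)
 next
  case (D sg k1 k2 e g1 g2 g3)
  \<comment> \<open>Merging would lower the energy by the fixed amount \<open>G\<close>. The merged
    pair stays in the ball because the error in its Dirichlet integral drops below the gap between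
    \<open>\<rho>'\<close> and \<open>\<rho>\<close>.\<close>
  define G where "G = \<mu>1 / p1 * g1 * 1 powr \<alpha>1 + \<mu>2 / p2 * g2 * 1 powr \<alpha>2 + \<beta> * g3 * 1 powr \<gamma>"
  define K where "K = 1^2 / 2 + \<mu>1 / p1 * 1 powr \<alpha>1 + \<mu>2 / p2 * 1 powr \<alpha>2 + \<beta> * 1 powr \<gamma>"
  have G: "0 < G" unfolding G_def by (rule gain_pos[OF D(5-8)]) simp
  have "(%n. J \<beta> 1 (u1 (sg n)) (u2 (sg n)) + K * e n) ----> m + K * 0"
   using LIMSEQ_subseq_LIMSEQ[OF lim D(1)] by (intro tendsto_add tendsto_mult tendsto_const D(3)) (simp add: comp_def)
  moreover have "\<forall>\<^sub>F n in sequentially. m + G <= J \<beta> 1 (u1 (sg n)) (u2 (sg n)) + K * e n"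
  proof -
   have "\<forall>\<^sub>F n in sequentially. e n < \<rho> - \<rho>'" using order_tendstoD(2)[OF D(3)] \<rho> by simp
   then show ?thesis
   proof eventually_elim
    case (elim n)
    have "dir (k1 n) + dir (k2 n) < \<rho>" using D(9)[of n] U(2)[of "sg n"] elim by linarith
    from m_relaxed(1)[OF D(2) this] J_gain[OF zero_less_one order_refl order_refl D(4-7) D(9-12), of n]
    show ?case by (simp add: G_def K_def)
   qed
  qed
  ultimately have "m + G <= m + K * 0" by (intro tendsto_lowerbound) auto
  with G show thesis by simp
 qed
qed

lemma minimizing_sequence_compact:
 assumes m: "minimizing_sequence \<mu>1 \<mu>2 p1 p2 r1 r2 \<beta> a1 a2 \<rho> U1 (U2 :: nat => real ^ 'n => real)"
 shows "compact_up_to_translation U1 U2"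
proof -
 have U: "(U1 n, U2 n) \<in> adm" for n using m by (simp add: minimizing_sequence_def)
 obtain sg y w1 w2 where P: "strict_mono (sg :: nat => nat)" "(w1, w2) \<in> adm"
  "(%n. mass (%x. U1 (sg n) (x + y n) - w1 x)) ----> 0" "(%n. mass (%x. U2 (sg n) (x + y n) - w2 x)) ----> 0"
  "(%n. dir (%x. U1 (sg n) (x + y n) - w1 x)) ----> 0" "(%n. dir (%x. U2 (sg n) (x + y n) - w2 x)) ----> 0"
  by (rule minimizing_profile[OF m]) blast
 have inj: "inj sg" by (rule strict_mono_imp_inj_on[OF P(1)])
 have norm_eq: "H1_norm f = sqrt (mass f + dir f)" if "f \<in> H1" for f :: "real ^ 'n => real"
  using dir_eq[OF that] by (simp add: H1_norm_def mass_def)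
 have lim: "(%n. H1_norm (%x. U (sg n) (x - (- y n)) - w x)) ----> 0"
  if "!!n. U n \<in> H1" "w \<in> H1" "(%n. mass (%x. U (sg n) (x + y n) - w x)) ----> 0" "(%n. dir (%x. U (sg n) (x + y n) - w x)) ----> 0" for U w
  using tendsto_real_sqrt[OF tendsto_add[OF that(3,4)]] norm_eq[OF H1_diff[OF H1_translate(1)[OF that(1)] that(2)]] by simp
 show ?thesis unfolding compact_up_to_translation_def
 \<comment> \<open>The required translations are indexed by the original sequence and evaluated at
   \<open>sg n\<close>, so \<open>y\<close> is transported along the inverse of \<open>sg\<close>;
   the minus sign accounts for \<open>x - y\<close> in place of \<open>x + y\<close>.\<close>
 proof (rule exI[of _ "%k. - y (inv sg k)"], rule exI[of _ sg], intro conjI bexI)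
  show "(%n. H1_norm (%x. U1 (sg n) (x - (- y (inv sg (sg n)))) - w1 x)) ----> 0"
   unfolding inv_f_f[OF inj] using U P by (intro lim) (auto simp: adm_iff)
  show "(%n. H1_norm (%x. U2 (sg n) (x - (- y (inv sg (sg n)))) - w2 x)) ----> 0"
   unfolding inv_f_f[OF inj] using U P by (intro lim) (auto simp: adm_iff)
 qed (use P in \<open>auto simp: adm_iff\<close>)
qed

lemma ground_state:
 obtains v1 v2 where "(v1, v2) \<in> adm" "!!x. v1 x >= 0" "!!x. v2 x >= 0" "J \<beta> 1 v1 v2 = m"
proof -
 have ne: "adm ~= {}" using adm_nonempty_negative by blast
 have "\<exists>z. z \<in> adm & J \<beta> 1 (fst z) (snd z) < m + 1 / real (Suc n)" for n
 proof (rule ccontr)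
  assume "~ ?thesis"
  then have "m + 1 / real (Suc n) <= m" unfolding m_eq by (intro cINF_greatest ne) (auto simp: not_less m_eq[symmetric])
  then show False by simp
 qed
 then obtain Z where Z: "!!n. Z n \<in> adm" "!!n. J \<beta> 1 (fst (Z n)) (snd (Z n)) < m + 1 / real (Suc n)" by metis
 define U1 U2 where "U1 n = fst (Z n)" and "U2 n = snd (Z n)" for n
 have U: "(U1 n, U2 n) \<in> adm" for n using Z(1)[of n] by (simp add: U1_def U2_def)
 have "(%n. J \<beta> 1 (U1 n) (U2 n)) ----> m"
 proof (rule tendsto_sandwich[OF _ _ tendsto_const])
  show "\<forall>\<^sub>F n in sequentially. m <= J \<beta> 1 (U1 n) (U2 n)" using m_le[OF U] by simp
  show "\<forall>\<^sub>F n in sequentially. J \<beta> 1 (U1 n) (U2 n) <= m + 1 / real (Suc n)" using Z(2) by (simp add: U1_def U2_def less_imp_le)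
  show "(%n. m + 1 / real (Suc n)) ----> m" using tendsto_add[OF tendsto_const[of m] LIMSEQ_Suc[OF lim_const_over_n[of 1]]] by simp
 qed
 moreover have "energy \<mu>1 \<mu>2 p1 p2 r1 r2 \<beta> (U1 n) (U2 n) = J \<beta> 1 (U1 n) (U2 n)" for n using U[of n] by (simp add: adm_iff energy_J)
 ultimately have ms: "minimizing_sequence \<mu>1 \<mu>2 p1 p2 r1 r2 \<beta> a1 a2 \<rho> U1 U2" using U by (simp add: minimizing_sequence_def m_def)
 obtain w1 w2 where w: "(w1, w2) \<in> adm" "J \<beta> 1 w1 w2 = m"
  by (rule minimizing_profile[OF ms]) blast
 have H: "w1 \<in> H1" "w2 \<in> H1" using w(1) by (auto simp: adm_iff)
 have A: "((%x. \<bar>w1 x\<bar>), (%x. \<bar>w2 x\<bar>)) \<in> adm"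
  using w(1) H1_abs[OF H(1)] H1_abs[OF H(2)] by (auto simp: adm_iff)
 show ?thesis by (rule that[OF A]) (use m_le[OF A] J_abs[OF H, of \<beta> 1] w(2) in auto)
qed

lemma first_solution:
 "\<exists>l1 l2 (v1 :: real ^ 'n => real) v2. weak_solution \<mu>1 \<mu>2 p1 p2 r1 r2 \<beta> l1 l2 v1 v2 &
  v1 \<in> mass_sphere a1 & v2 \<in> mass_sphere a2 & (v1, v2) \<in> grad_ball \<rho> & positive_function v1 & positive_function v2 &
  energy \<mu>1 \<mu>2 p1 p2 r1 r2 \<beta> v1 v2 < 0 & (CARD('n) <= 4 --> l1 < 0 & l2 < 0)"
proof -
 obtain v1 v2 where v: "(v1, v2) \<in> adm" "!!x. v1 x >= 0" "!!x. v2 x >= 0" "J \<beta> 1 v1 v2 = m"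
  by (rule ground_state) blast
 have "\<exists>l1 l2. weak_solution \<mu>1 \<mu>2 p1 p2 r1 r2 \<beta> l1 l2 v1 v2 & positive_function v1 & positive_function v2 &
  (CARD('n) <= 4 --> l1 < 0 & l2 < 0)"
 proof (rule critical_point)
  fix U V :: "real => real ^ 'n => real"
  assume f: "\<forall>\<^sub>F tau in at 0. feasible (U tau) (V tau)" and d: "((%tau. dir (U tau) + dir (V tau)) \<longlongrightarrow> dir v1 + dir v2) (at 0)"
  have "\<forall>\<^sub>F tau in at 0. dir (U tau) + dir (V tau) < \<rho>" using order_tendstoD(2)[OF d] v(1) by (simp add: adm_iff)
  with f have "\<forall>\<^sub>F tau in at 0. J \<beta> 1 v1 v2 <= J \<beta> 1 (U tau) (V tau)"
   by eventually_elim (simp add: v(4) m_relaxed(1))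
  then show "\<exists>T. (T \<longlongrightarrow> 1) (at 0) & (\<forall>\<^sub>F tau in at 0. J \<beta> (T tau) v1 v2 <= J \<beta> (T tau) (U tau) (V tau))"
   by (intro exI[of _ "%_. 1"]) auto
 qed (use v in \<open>auto simp: adm_iff\<close>)
 moreover have "energy \<mu>1 \<mu>2 p1 p2 r1 r2 \<beta> v1 v2 < 0" using v(1,4) m_neg by (simp add: adm_iff energy_J)
 moreover have "v1 \<in> mass_sphere a1" "v2 \<in> mass_sphere a2" "(v1, v2) \<in> grad_ball \<rho>" using v(1) by (simp_all add: admissible_def)
 ultimately show ?thesis by blast
qed

end

context coupled_ball
begin

subsection \<open>The mountain pass solution\<close>

text \<open>The threshold one is the height guaranteed by the annulus; it makes
  \<open>fib_range\<close> applicable to every peak.\<close>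

definition peak :: "(real ^ 'n => real) => (real ^ 'n => real) => real => bool" where
 "peak u v t \<longleftrightarrow> 0 < t & 1 <= J \<beta> t u v & (\<forall>s>0. J \<beta> s u v <= J \<beta> t u v)"

text \<open>Positive coupling is what bends the fibre down for large \<open>t\<close>; with zero
  coupling a nonzero Dirichlet term would grow without bound.\<close>

definition mountain :: "(real ^ 'n => real) => (real ^ 'n => real) => real => bool" where
 "mountain u v t \<longleftrightarrow> feasible u v & 0 < cp r1 r2 u v & peak u v t"

definition M :: real where "M = Inf {J \<beta> t u v | u v t. mountain u v t}"

lemma cp_pos_dir:
 assumes "feasible u v" "0 < cp r1 r2 u v"
 shows "0 < dir u + dir v"
proof (rule ccontr)
 assume "~ ?thesis"
 then have "dir u = 0" using dir_nonneg[of u] dir_nonneg[of v] by linarith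
 then have "ae x. u x = 0" using dir_0_imp_mass_0[of u] mass_eq_0_iff[of u] assms by (auto simp: feasible_def)
 then have "ae x. \<bar>u x\<bar> powr r1 * \<bar>v x\<bar> powr r2 = 0" by eventually_elim simp
 then have "cp r1 r2 u v = 0" unfolding cp_def by (rule integral_eq_zero_AE)
 with assms show False by simp
qed

lemma peak_exists:
 assumes f: "feasible u v" "0 < cp r1 r2 u v"
 obtains t where "mountain u v t"
proof -
 \<comment> \<open>The scale at which the fibre meets the inner edge of the annulus, where its value
   is at least one.\<close>
 define s where "s = sqrt (\<rho>' / (dir u + dir v))"
 have A: "0 < dir u + dir v" by (rule cp_pos_dir[OF f])
 have s: "0 < s" "s^2 * (dir u + dir v) = \<rho>'" using A \<rho> by (auto simp: s_def)
 have "1 <= J \<beta> s u v" using geo[OF f(1) s(1)] s(2) \<rho> by simp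
 then obtain t where "0 < t" "1 <= J \<beta> t u v" "!!x. 0 < x ==> J \<beta> x u v <= J \<beta> t u v"
  unfolding J_def
  by (rule fib_peak_exists[OF less_imp_le[OF A] coeff_nonneg(1,2) mult_pos_pos[OF \<beta> f(2)] s(1)]) blast
 then show ?thesis using f that by (auto simp: mountain_def peak_def)
qed

lemma M_le: "mountain u v t ==> M <= J \<beta> t u v"
 unfolding M_def by (rule cInf_lower) (auto intro!: bdd_belowI[of _ 1] simp: mountain_def peak_def)

lemma mountain_exists: "\<exists>u v t. mountain u v t"
proof -
 obtain u :: "real ^ 'n => real" where u: "u \<in> H1" "mass u = a1" by (rule H1_nontrivial[OF less_imp_le[OF a(1)]])
 \<comment> \<open>Proportional components overlap completely, so their coupling is a positive
   multiple of \<open>pw (r1 + r2) u\<close>.\<close>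
 define c where "c = sqrt (a2 / a1)"
 have c: "c > 0" using a by (simp add: c_def)
 have "mass (%x. c * u x) = a2" using a u by (simp add: mass_cmult c_def)
 then have f: "feasible u (%x. c * u x)" using u by (simp add: feasible_def H1_cmult)
 have "cp r1 r2 u u = pw (r1 + r2) u" by (simp add: cp_def pw_def powr_add)
 then have "0 < cp r1 r2 u (%x. c * u x)"
  using pw_pos[OF sub(3) u(1)] u a c by (simp add: cp_cmult_right)
 from peak_exists[OF f this] show ?thesis by blast
qed

lemma M_ge_1: "1 <= M"
 unfolding M_def by (rule cInf_greatest) (use mountain_exists in \<open>auto simp: mountain_def peak_def\<close>)

lemma mountain_dil:
 assumes "mountain u v t"
 shows "mountain (dil t u) (dil t v) 1" "J \<beta> 1 (dil t u) (dil t v) = J \<beta> t u v"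
proof -
 have t: "0 < t" and H: "u \<in> H1" "v \<in> H1" using assms by (auto simp: mountain_def peak_def feasible_def)
 show e: "J \<beta> 1 (dil t u) (dil t v) = J \<beta> t u v" using J_dil[OF t zero_less_one H] by simp
 show "mountain (dil t u) (dil t v) 1"
  using assms t feasible_dil[of u v t] unfolding mountain_def peak_def e by (auto simp: J_dil[OF t _ H] cp_dil[OF t H])
qed

lemma mountain_range:
 assumes D: "D > 0" and c0: "c0 > 0"
 obtains lo hi where "0 < lo" "!!u v t. dir u + dir v <= D ==> c0 <= cp r1 r2 u v ==> mountain u v t ==> lo <= t & t <= hi"
proof -
 obtain lo hi where r: "0 < lo" "!!A b1 b2 c t. A <= D ==> 0 <= b1 ==> 0 <= b2 ==> \<beta> * c0 <= c ==> 0 < t ==> 1 <= fib A b1 b2 c t ==> lo <= t & t <= hi"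
  by (rule fib_range[OF D mult_pos_pos[OF \<beta> c0]]) blast
 show ?thesis
 proof (rule that[OF r(1)])
  fix u v t assume *: "dir u + dir v <= D" "c0 <= cp r1 r2 u v" "mountain u v t"
  show "lo <= t & t <= hi"
   by (rule r(2)[OF *(1) coeff_nonneg(1)[of u] coeff_nonneg(2)[of v] mult_left_mono[OF *(2) less_imp_le[OF \<beta>]]])
    (use *(3) in \<open>auto simp: mountain_def peak_def J_def\<close>)
 qed
qed

text \<open>At a peak the derivative of the fibre vanishes, which expresses the coupling through the
  other terms; inserting it leaves \<open>1/2 - 1/\<gamma> > 0\<close> times the Dirichlet integral,
  whence the upper bound. Conversely, a pair with too little coupling would exceed the level
  \<open>L\<close> at another scale, which bounds the coupling from below.\<close>

lemma peak_bounds: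
 obtains D c0 where "D > 0" "c0 > 0" "!!u v. mountain u v 1 ==> J \<beta> 1 u v <= L ==> 2 <= dir u + dir v & dir u + dir v <= D & c0 <= cp r1 r2 u v"
proof -
 obtain X1 X2 where X: "0 <= X1" "0 <= X2" "!!(u :: real ^ 'n => real) (v :: real ^ 'n => real). u \<in> H1 ==> v \<in> H1 ==> mass u <= a1 ==> mass v <= a2 ==>
  \<mu>1 / p1 * pw p1 u <= X1 * (dir u + dir v) powr (\<alpha>1 / 2) & \<mu>2 / p2 * pw p2 v <= X2 * (dir u + dir v) powr (\<alpha>2 / 2)"
  by (rule pw_growth[OF a]) blast
 have k0: "0 < 1 / 2 - 1 / \<gamma>" using \<gamma> by (simp add: field_simps)
 obtain D where D: "D > 0" "!!x. x >= D ==> L + 1 <= (1 / 2 - 1 / \<gamma>) * x - X1 * x powr (\<alpha>1 / 2) - X2 * x powr (\<alpha>2 / 2)"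
  by (rule sublinear_growth[OF k0, of "\<alpha>1 / 2" "\<alpha>2 / 2" "L + 1" X1 X2]) (use \<alpha> in auto)
 have up: "dir u + dir v <= D" if mt: "mountain u v 1" and L: "J \<beta> 1 u v <= L" for u v
 proof (rule ccontr)
  assume nle: "~ dir u + dir v <= D"
  define A b1 b2 c where "A = dir u + dir v" and "b1 = \<mu>1 / p1 * pw p1 u" and "b2 = \<mu>2 / p2 * pw p2 v" and "c = \<beta> * cp r1 r2 u v"
  have "A - b1 * \<alpha>1 * 1 powr (\<alpha>1 - 2) - b2 * \<alpha>2 * 1 powr (\<alpha>2 - 2) - c * \<gamma> * 1 powr (\<gamma> - 2) = 0"
   by (rule fib_peak_derivative[OF zero_less_one]) (use mt in \<open>auto simp: mountain_def peak_def J_def A_def b1_def b2_def c_def\<close>)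
  then have cg: "c * \<gamma> = A - b1 * \<alpha>1 - b2 * \<alpha>2" by simp
  have nn: "0 <= b1 * \<alpha>1" "0 <= b2 * \<alpha>2" unfolding b1_def b2_def
   using mult_nonneg_nonneg[OF coeff_nonneg(1) less_imp_le[OF \<alpha>(1)]] mult_nonneg_nonneg[OF coeff_nonneg(2) less_imp_le[OF \<alpha>(3)]] by blast+
  have "c = (A - b1 * \<alpha>1 - b2 * \<alpha>2) / \<gamma>" using cg \<gamma> by (simp add: field_simps)
  also have "... <= A / \<gamma>" using nn \<gamma> by (intro divide_right_mono) auto
  finally have cA: "c <= A / \<gamma>" .
  have "J \<beta> 1 u v = A / 2 - b1 - b2 - c" by (simp add: J_def fiber_def A_def b1_def b2_def c_def)
  then have "(1 / 2 - 1 / \<gamma>) * A - b1 - b2 <= L" using L cA by (simp add: left_diff_distrib)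
  moreover have "b1 <= X1 * A powr (\<alpha>1 / 2)" "b2 <= X2 * A powr (\<alpha>2 / 2)"
   using X(3)[of u v] mt by (auto simp: mountain_def feasible_def A_def b1_def b2_def)
  moreover have "L + 1 <= (1 / 2 - 1 / \<gamma>) * A - X1 * A powr (\<alpha>1 / 2) - X2 * A powr (\<alpha>2 / 2)"
   using D(2)[of A] nle by (simp add: A_def)
  ultimately show False by linarith
 qed
 have low: "2 <= dir u + dir v" if "mountain u v 1" for u v
  using that J_upper[OF less_imp_le[OF \<beta>], of 1 u v] by (auto simp: mountain_def peak_def)
 define Y1 Y2 where "Y1 = X1 * D powr (\<alpha>1 / 2)" and "Y2 = X2 * D powr (\<alpha>2 / 2)"
 obtain S where S: "S > 0" "!!x. x >= S ==> L + 1 <= 1 * x - Y1 * x powr (\<alpha>1 / 2) - Y2 * x powr (\<alpha>2 / 2)"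
  by (rule sublinear_growth[OF zero_less_one, of "\<alpha>1 / 2" "\<alpha>2 / 2" "L + 1" Y1 Y2]) (use \<alpha> in auto)
 \<comment> \<open>A scale at which the energy apart from the coupling is at least
   \<open>L + 1\<close>. Since the peak at \<open>1\<close> keeps the energy at most
   \<open>L\<close> there, the coupling makes up a full unit.\<close>
 define s where "s = sqrt S"
 have s: "s > 0" "s^2 = S" using S by (auto simp: s_def)
 have sp: "S powr (k / 2) = s powr k" for k
  using s powr_powr[of s 2 "k / 2"] by (simp add: powr_numeral)
 show ?thesis
 proof (rule that[of D "1 / (\<beta> * s powr \<gamma>)"])
  fix u v assume mt: "mountain u v 1" and L: "J \<beta> 1 u v <= L"
  define A where "A = dir u + dir v"
  have A: "2 <= A" "A <= D" using up[OF mt L] low[OF mt] by (auto simp: A_def)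
  have "X1 * A powr (\<alpha>1 / 2) <= Y1" "X2 * A powr (\<alpha>2 / 2) <= Y2"
   unfolding Y1_def Y2_def using A \<alpha> X by (auto intro!: mult_left_mono powr_mono2)
  then have "\<mu>1 / p1 * pw p1 u <= Y1" "\<mu>2 / p2 * pw p2 v <= Y2"
   using X(3)[of u v] mt unfolding A_def[symmetric] by (auto simp: mountain_def feasible_def A_def)
  then have b: "\<mu>1 / p1 * pw p1 u * s powr \<alpha>1 <= Y1 * s powr \<alpha>1" "\<mu>2 / p2 * pw p2 v * s powr \<alpha>2 <= Y2 * s powr \<alpha>2"
   by (auto intro!: mult_right_mono simp del: times_divide_eq_left)
  have "s^2 / 2 * 2 <= s^2 / 2 * A" using A by (intro mult_left_mono) auto
  moreover have "J \<beta> s u v <= L" using mt s(1) L by (auto simp: mountain_def peak_def)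
  moreover have "L + 1 <= s^2 - Y1 * s powr \<alpha>1 - Y2 * s powr \<alpha>2" using S(2)[of S] s by (simp add: sp)
  ultimately have "1 <= \<beta> * cp r1 r2 u v * s powr \<gamma>" using b unfolding J_def fiber_def A_def by linarith
  then have "1 / (\<beta> * s powr \<gamma>) <= cp r1 r2 u v" using \<beta> s by (simp add: pos_divide_le_eq ac_simps)
  with A show "2 <= dir u + dir v & dir u + dir v <= D & 1 / (\<beta> * s powr \<gamma>) <= cp r1 r2 u v" by (simp add: A_def)
 qed (use D \<beta> s in auto)
qed

text \<open>The sequence is dilated so that its peaks sit at scale one. The limit profile has a peak
  at some \<open>t\<close>, and there its energy is at most the limit of the energies of the
  sequence at \<open>t\<close>, which do not exceed those at one. Lower semicontinuity at the single
  scale \<open>t\<close> thus identifies a minimiser.\<close>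

lemma mountain_minimizer:
 obtains w1 w2 t where "mountain w1 w2 t" "J \<beta> t w1 w2 = M"
proof -
 have "\<exists>u v. mountain u v 1 & J \<beta> 1 u v < M + 1 / real (Suc n)" for n
 proof -
  have "\<exists>x\<in>{J \<beta> t u v | u v t. mountain u v t}. x < M + 1 / real (Suc n)"
   unfolding M_def by (rule cInf_lessD) (use mountain_exists in auto)
  then obtain u v t where "mountain u v t" "J \<beta> t u v < M + 1 / real (Suc n)" by blast
  then show ?thesis using mountain_dil[of u v t] by (intro exI[of _ "dil t u"] exI[of _ "dil t v"]) simp
 qed
 then obtain u1 u2 where U: "!!n. mountain (u1 n) (u2 n) 1" "!!n. J \<beta> 1 (u1 n) (u2 n) < M + 1 / real (Suc n)" by metis
 have lim: "(%n. J \<beta> 1 (u1 n) (u2 n)) ----> M"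
 proof (rule tendsto_sandwich[OF _ _ tendsto_const])
  show "\<forall>\<^sub>F n in sequentially. M <= J \<beta> 1 (u1 n) (u2 n)" using M_le[OF U(1)] by simp
  show "\<forall>\<^sub>F n in sequentially. J \<beta> 1 (u1 n) (u2 n) <= M + 1 / real (Suc n)" using U(2) by (simp add: less_imp_le)
  show "(%n. M + 1 / real (Suc n)) ----> M" using tendsto_add[OF tendsto_const[of M] LIMSEQ_Suc[OF lim_const_over_n[of 1]]] by simp
 qed
 have L: "J \<beta> 1 (u1 n) (u2 n) <= M + 1" for n
 proof -
  have "1 / real (Suc n) <= 1" by simp
  then show ?thesis using U(2)[of n] by linarith
 qed
 obtain d c0 where B: "d > 0" "c0 > 0" "!!u v. mountain u v 1 ==> J \<beta> 1 u v <= M + 1 ==> 2 <= dir u + dir v & dir u + dir v <= d & c0 <= cp r1 r2 u v"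
  by (rule peak_bounds[of "M + 1"]) blast
 have b: "2 <= dir (u1 n) + dir (u2 n)" "dir (u1 n) + dir (u2 n) <= d" "c0 <= cp r1 r2 (u1 n) (u2 n)" for n
  using B(3)[OF U(1) L, of n] by auto
 have F: "feasible (u1 n) (u2 n)" and pk: "!!s. 0 < s ==> J \<beta> s (u1 n) (u2 n) <= J \<beta> 1 (u1 n) (u2 n)" for n
  using U(1)[of n] by (auto simp: mountain_def peak_def)
 have nv: "~ (vanishing u1 & vanishing u2)"
 proof
  assume V: "vanishing u1 & vanishing u2"
  \<comment> \<open>If the sequence vanished, its energy at this scale would asymptotically be at
    least \<open>M + 3\<close>, as the Dirichlet integrals are at least two, whereas the energy at
    the peak is at most \<open>M + 1\<close>.\<close>
  define s where "s = sqrt (M + 3)"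
  have s: "s > 0" "s^2 = M + 3" using M_ge_1 by (auto simp: s_def)
  have H: "u1 n \<in> H1" "u2 n \<in> H1" "mass (u1 n) <= max a1 a2" "mass (u2 n) <= max a1 a2" "dir (u1 n) <= d" "dir (u2 n) <= d" for n
   using F[of n] b(2)[of n] dir_nonneg[of "u1 n"] dir_nonneg[of "u2 n"] by (auto simp: feasible_def simp del: dir_nonneg)
  have "(%n. J \<beta> s (u1 n) (u2 n) - s^2 / 2 * (dir (u1 n) + dir (u2 n))) ----> 0"
   by (rule vanishing_terms[OF H(1,3,5) H(2,4,6)]) (use V in auto)
  moreover have "J \<beta> s (u1 n) (u2 n) - s^2 / 2 * (dir (u1 n) + dir (u2 n)) <= - 2" for n
  proof -
   have "s^2 / 2 * 2 <= s^2 / 2 * (dir (u1 n) + dir (u2 n))" using b(1)[of n] by (intro mult_left_mono) auto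
   then show ?thesis using pk[OF s(1), of n] L[of n] s(2) by linarith
  qed
  ultimately have "(0::real) <= - 2" using LIMSEQ_le_const2 by blast
  then show False by simp
 qed
 show thesis
 proof (cases rule: dichotomy[OF F b(2) nv, case_names S D])
  case (S sg y w1 w2 v1 v2)
  have "c0 <= cp r1 r2 w1 w2" using LIMSEQ_le_const[OF S(10)] b(3) by blast
  then obtain t where t: "mountain w1 w2 t" using peak_exists[OF S(2)] B(2) by auto
  then have t0: "0 < t" by (simp add: mountain_def peak_def)
  have "J \<beta> t w1 w2 <= M"
  proof (rule LIMSEQ_le[OF S(11)])
   show "(%n. J \<beta> 1 (u1 (sg n)) (u2 (sg n))) ----> M" using LIMSEQ_subseq_LIMSEQ[OF lim S(1)] by (simp add: comp_def)
   show "\<exists>N. \<forall>n\<ge>N. J \<beta> t (u1 (sg n)) (u2 (sg n)) - t^2 / 2 * (dir (v1 n) + dir (v2 n)) <= J \<beta> 1 (u1 (sg n)) (u2 (sg n))"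
   proof (rule exI[of _ 0], intro allI impI)
    fix n
    have "0 <= t^2 / 2 * (dir (v1 n) + dir (v2 n))" by simp
    then show "J \<beta> t (u1 (sg n)) (u2 (sg n)) - t^2 / 2 * (dir (v1 n) + dir (v2 n)) <= J \<beta> 1 (u1 (sg n)) (u2 (sg n))"
     using pk[OF t0, of "sg n"] by linarith
   qed
  qed
  then have "J \<beta> t w1 w2 = M" using M_le[OF t] by simp
  with t show thesis by (rule that)
 next
  case (D sg k1 k2 e g1 g2 g3)
  have D1: "0 < d + 1" "0 < c0 / 2" using B by auto
  \<comment> \<open>The merged pairs obey the bounds of the sequence up to an error, hence the slack
    in \<open>d + 1\<close> and \<open>c0 / 2\<close>; their peaks then lie in one compact range, on
    which the gain is uniform.\<close>
  obtain lo hi where r: "0 < lo" "!!u v t. dir u + dir v <= d + 1 ==> c0 / 2 <= cp r1 r2 u v ==> mountain u v t ==> lo <= t & t <= hi"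
   by (rule mountain_range[OF D1]) blast
  define G where "G = \<mu>1 / p1 * g1 * lo powr \<alpha>1 + \<mu>2 / p2 * g2 * lo powr \<alpha>2 + \<beta> * g3 * lo powr \<gamma>"
  define Z where "Z = hi^2 / 2 + \<mu>1 / p1 * hi powr \<alpha>1 + \<mu>2 / p2 * hi powr \<alpha>2 + \<beta> * hi powr \<gamma>"
  have G: "0 < G" unfolding G_def by (rule gain_pos[OF D(5-8) r(1)])
  have "(%n. J \<beta> 1 (u1 (sg n)) (u2 (sg n)) + Z * e n) ----> M + Z * 0"
   using LIMSEQ_subseq_LIMSEQ[OF lim D(1)] by (intro tendsto_add tendsto_mult tendsto_const D(3)) (simp add: comp_def)
  moreover have "\<forall>\<^sub>F n in sequentially. M + G <= J \<beta> 1 (u1 (sg n)) (u2 (sg n)) + Z * e n"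
  proof -
   have "\<forall>\<^sub>F n in sequentially. e n < min 1 (c0 / 2)" by (rule order_tendstoD(2)[OF D(3)]) (use B in simp)
   then show ?thesis
   proof eventually_elim
    case (elim n)
    have dk: "dir (k1 n) + dir (k2 n) <= d + 1" using D(9)[of n] b(2)[of "sg n"] elim by linarith
    have c: "c0 / 2 <= cp r1 r2 (k1 n) (k2 n)" using D(12)[of n] b(3)[of "sg n"] D(7) elim by linarith
    then obtain t where t: "mountain (k1 n) (k2 n) t" using peak_exists[OF D(2)] B(2) by (metis D1(2) less_le_trans)
    have I: "lo <= t" "t <= hi" "0 < t" using r(2)[OF dk c t] r(1) by auto
    have "M <= J \<beta> t (k1 n) (k2 n)" by (rule M_le[OF t])
    moreover have "J \<beta> t (k1 n) (k2 n) + G <= J \<beta> t (u1 (sg n)) (u2 (sg n)) + Z * e n"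
     unfolding G_def Z_def by (rule J_gain[OF r(1) I(1,2) D(4-7) D(9-12)])
    ultimately show ?case using pk[OF I(3), of "sg n"] by linarith
   qed
  qed
  ultimately have "M + G <= M + Z * 0" by (intro tendsto_lowerbound) auto
  with G show thesis by simp
 qed
qed

text \<open>The peak of the filled pair depends on the filling, so the range of possible peaks is
  fixed first, from bounds that any filling with Dirichlet integral below one respects; the filling
  is then chosen with negative energy on that whole range.\<close>

lemma mountain_saturated:
 assumes w: "mountain w1 w2 t" "J \<beta> t w1 w2 = M"
 shows "mass w1 = a1" "mass w2 = a2"
proof -
 have f: "feasible w1 w2" and C: "0 < cp r1 r2 w1 w2" and pk: "!!s. 0 < s ==> J \<beta> s w1 w2 <= M"
  using w by (auto simp: mountain_def peak_def)
 have H: "w1 \<in> H1" "w2 \<in> H1" and ml: "mass w1 <= a1" "mass w2 <= a2" using f by (auto simp: feasible_def)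
 have "~ 0 < a1 - mass w1 + (a2 - mass w2)"
 proof
  assume lt: "0 < a1 - mass w1 + (a2 - mass w2)"
  have D: "0 < dir w1 + dir w2 + 1" using dir_nonneg[of w1] dir_nonneg[of w2] by linarith
  obtain lo hi where lh: "0 < lo" "!!u v t. dir u + dir v <= dir w1 + dir w2 + 1 ==> cp r1 r2 w1 w2 <= cp r1 r2 u v ==> mountain u v t ==> lo <= t & t <= hi"
   by (rule mountain_range[OF D C]) blast
  have m: "0 <= a1 - mass w1" "0 <= a2 - mass w2" "0 < max hi 1" "0 <= \<beta>" using ml \<beta> by auto
  obtain z1 z2 where z: "z1 \<in> H1" "z2 \<in> H1" "mass z1 = a1 - mass w1" "mass z2 = a2 - mass w2" "dir z1 + dir z2 < 1"
   "!!t. 0 < t ==> t <= max hi 1 ==> J \<beta> t z1 z2 < 0"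
   by (rule spread[OF m(1,2) lt m(3) zero_less_one m(4)]) blast
  have r0: "r1 > 0" "r2 > 0" using r by auto
  have hf: "feasible (hyp w1 z1) (hyp w2 z2)"
   using hyp_H1[OF H(1) z(1)] hyp_H1[OF H(2) z(2)] z by (simp add: feasible_def)
  have hd: "dir (hyp w1 z1) + dir (hyp w2 z2) <= dir w1 + dir w2 + 1"
   using hyp_H1(2)[OF H(1) z(1)] hyp_H1(2)[OF H(2) z(2)] z(5) by linarith
  have hc: "cp r1 r2 w1 w2 <= cp r1 r2 (hyp w1 z1) (hyp w2 z2)"
   using cp_hyp[OF sub(3) r0 H z(1,2)] cp_nonneg[of r1 r2 z1 z2] by linarith
  obtain s where s: "mountain (hyp w1 z1) (hyp w2 z2) s" by (rule peak_exists[OF hf less_le_trans[OF C hc]])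
  have I: "0 < s" "s <= hi" using lh(2)[OF hd hc s] lh(1) by auto
  have sm: "s <= max hi 1" using I(2) by simp
  have "M <= J \<beta> s (hyp w1 z1) (hyp w2 z2)" by (rule M_le[OF s])
  also have "... <= J \<beta> s w1 w2 + J \<beta> s z1 z2" by (rule J_hyp[OF less_imp_le[OF \<beta>] H z(1,2)])
  also have "J \<beta> s w1 w2 + J \<beta> s z1 z2 < M" using pk[OF I(1)] z(6)[OF I(1) sm] by simp
  finally show False by simp
 qed
 then show "mass w1 = a1" "mass w2 = a2" using ml by linarith+
qed

text \<open>Absolute values keep the coupling and do not raise the energy at any scale, so a peak of
  the new pair is again minimal; a dilation moves it to scale one.\<close>

lemma mountain_state:
 obtains u v where "mountain u v 1" "J \<beta> 1 u v = M" "!!x. u x >= 0" "!!x. v x >= 0" "mass u = a1" "mass v = a2"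
proof -
 obtain w1 w2 t where w: "mountain w1 w2 t" "J \<beta> t w1 w2 = M" by (rule mountain_minimizer)
 define z1 z2 where "z1 x = \<bar>w1 x\<bar>" and "z2 x = \<bar>w2 x\<bar>" for x
 have H: "w1 \<in> H1" "w2 \<in> H1" using w(1) by (auto simp: mountain_def feasible_def)
 have zf: "feasible z1 z2" using w(1) feasible_abs[of w1 w2] by (simp add: mountain_def z1_def[abs_def] z2_def[abs_def])
 have zc: "0 < cp r1 r2 z1 z2" using w(1) by (simp add: mountain_def z1_def z2_def cp_def)
 obtain s where s: "mountain z1 z2 s" by (rule peak_exists[OF zf zc])
 then have s0: "0 < s" by (simp add: mountain_def peak_def)
 have "J \<beta> s z1 z2 <= J \<beta> s w1 w2" unfolding z1_def[abs_def] z2_def[abs_def] by (rule J_abs[OF H])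
 also have "... <= M" using w s0 by (auto simp: mountain_def peak_def)
 finally have "J \<beta> s z1 z2 = M" using M_le[OF s] by simp
 then have d: "mountain (dil s z1) (dil s z2) 1" "J \<beta> 1 (dil s z1) (dil s z2) = M" using mountain_dil[OF s] by auto
 show ?thesis
  by (rule that[OF d _ _ mountain_saturated[OF d]]) (simp_all add: dil_def z1_def z2_def)
qed

text \<open>At its own peak \<open>T tau\<close> a varied pair has energy at least \<open>M\<close>,
  while the original pair has energy at most \<open>M\<close> at that scale. This is the comparison
  at a common scale that \<open>critical_point\<close> asks for.\<close>

lemma second_solution:
 "\<exists>l1 l2 (u :: real ^ 'n => real) v. weak_solution \<mu>1 \<mu>2 p1 p2 r1 r2 \<beta> l1 l2 u v &
  u \<in> mass_sphere a1 & v \<in> mass_sphere a2 & positive_function u & positive_function v &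
  energy \<mu>1 \<mu>2 p1 p2 r1 r2 \<beta> u v > 0 & (CARD('n) <= 4 --> l1 < 0 & l2 < 0)"
proof -
 obtain u v where w: "mountain u v 1" "J \<beta> 1 u v = M" "!!x. u x >= 0" "!!x. v x >= 0" "mass u = a1" "mass v = a2"
  by (rule mountain_state) blast
 have H: "u \<in> H1" "v \<in> H1" using w(1) by (auto simp: mountain_def feasible_def)
 have C: "0 < cp r1 r2 u v" using w(1) by (simp add: mountain_def)
 have "\<exists>l1 l2. weak_solution \<mu>1 \<mu>2 p1 p2 r1 r2 \<beta> l1 l2 u v & positive_function u & positive_function v &
  (CARD('n) <= 4 --> l1 < 0 & l2 < 0)"
 proof (rule critical_point[OF H(1) w(3,5) H(2) w(4,6)])
  fix U V :: "real => real ^ 'n => real"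
  assume f: "\<forall>\<^sub>F tau in at 0. feasible (U tau) (V tau)" and d: "((%tau. dir (U tau) + dir (V tau)) \<longlongrightarrow> dir u + dir v) (at 0)"
   and P: "((%tau. pw p1 (U tau)) \<longlongrightarrow> pw p1 u) (at 0)" "((%tau. pw p2 (V tau)) \<longlongrightarrow> pw p2 v) (at 0)"
   and c: "((%tau. cp r1 r2 (U tau) (V tau)) \<longlongrightarrow> cp r1 r2 u v) (at 0)"
  \<comment> \<open>A peak of the varied pair, chosen arbitrarily wherever one exists; near zero the
    coupling stays positive, so one does. Convergence of the choices to one comes from the
    uniqueness of the peak of the original pair.\<close>
  define T where "T tau = (SOME t. mountain (U tau) (V tau) t)" for tau
  from f order_tendstoD(1)[OF c C] have mt: "\<forall>\<^sub>F tau in at 0. mountain (U tau) (V tau) (T tau)"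
  proof eventually_elim
   case (elim tau)
   obtain t where "mountain (U tau) (V tau) t" by (rule peak_exists[OF elim])
   then show ?case unfolding T_def by (rule someI)
  qed
  from mt have ge: "\<forall>\<^sub>F tau in at 0. 0 < T tau & J \<beta> 1 u v <= J \<beta> (T tau) (U tau) (V tau)"
  proof eventually_elim
   case (elim tau)
   then show ?case using M_le[OF elim] w(2) by (simp add: mountain_def peak_def)
  qed
  have A: "0 <= dir u + dir v" by simp
  have "(T \<longlongrightarrow> 1) (at 0)"
  proof (rule fib_peak_tendsto[OF A coeff_nonneg(1)[of u] coeff_nonneg(2)[of v] mult_pos_pos[OF \<beta> C] coeff_nonneg(1) coeff_nonneg(2) d
     tendsto_mult[OF tendsto_const P(1)] tendsto_mult[OF tendsto_const P(2)] tendsto_mult[OF tendsto_const c] _ _ ge[unfolded J_def]])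
   show "1 <= fib (dir u + dir v) (\<mu>1 / p1 * pw p1 u) (\<mu>2 / p2 * pw p2 v) (\<beta> * cp r1 r2 u v) 1"
    using w(1) by (simp add: mountain_def peak_def J_def)
   fix x :: real assume "0 < x"
   then show "fib (dir u + dir v) (\<mu>1 / p1 * pw p1 u) (\<mu>2 / p2 * pw p2 v) (\<beta> * cp r1 r2 u v) x
    <= fib (dir u + dir v) (\<mu>1 / p1 * pw p1 u) (\<mu>2 / p2 * pw p2 v) (\<beta> * cp r1 r2 u v) 1"
    using w(1) by (simp add: mountain_def peak_def J_def)
  qed
  moreover from ge have "\<forall>\<^sub>F tau in at 0. J \<beta> (T tau) u v <= J \<beta> (T tau) (U tau) (V tau)"
  proof eventually_elim
   case (elim tau)
   then have "J \<beta> (T tau) u v <= J \<beta> 1 u v" using w(1) by (simp add: mountain_def peak_def)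
   with elim show ?case by linarith
  qed
  ultimately show "\<exists>T. (T \<longlongrightarrow> 1) (at 0) & (\<forall>\<^sub>F tau in at 0. J \<beta> (T tau) u v <= J \<beta> (T tau) (U tau) (V tau))" by blast
 qed
 moreover have "energy \<mu>1 \<mu>2 p1 p2 r1 r2 \<beta> u v > 0" using w(2) M_ge_1 by (simp add: energy_J H)
 moreover have "u \<in> mass_sphere a1" "v \<in> mass_sphere a2" using w(5,6) H by (simp_all add: mass_sphere_def mass_def)
 ultimately show ?thesis by blast
qed

end

theorem theorem1p1:
  fixes \<mu>\<^sub>1 \<mu>\<^sub>2 p\<^sub>1 p\<^sub>2 r\<^sub>1 r\<^sub>2 a\<^sub>1 a\<^sub>2 :: real and N :: nat
  assumes N: "N = CARD('n :: finite)"
    and "\<mu>\<^sub>1 > 0" "\<mu>\<^sub>2 > 0"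
    and "2 < p\<^sub>1" "p\<^sub>1 < 2 + 4 / real N"
    and "2 < p\<^sub>2" "p\<^sub>2 < 2 + 4 / real N"
    and "r\<^sub>1 > 1" "r\<^sub>2 > 1"
    and "2 + 4 / real N < r\<^sub>1 + r\<^sub>2" "ereal (r\<^sub>1 + r\<^sub>2) < critical_exponent N"
    and "a\<^sub>1 > 0" "a\<^sub>2 > 0"
  shows "\<exists>\<beta>\<^sub>0>0. \<exists>\<rho>\<^sub>0>0. \<forall>\<beta>. 0 < \<beta> \<and> \<beta> \<le> \<beta>\<^sub>0 \<longrightarrow>
    ((\<forall>(U\<^sub>1 :: nat \<Rightarrow> real ^ 'n \<Rightarrow> real) U\<^sub>2.
       minimizing_sequence \<mu>\<^sub>1 \<mu>\<^sub>2 p\<^sub>1 p\<^sub>2 r\<^sub>1 r\<^sub>2 \<beta> a\<^sub>1 a\<^sub>2 \<rho>\<^sub>0 U\<^sub>1 U\<^sub>2 \<longrightarrow>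
       compact_up_to_translation U\<^sub>1 U\<^sub>2) \<and>
    (\<exists>lam\<^sub>1 lam\<^sub>2 (v\<^sub>1 :: real ^ 'n \<Rightarrow> real) v\<^sub>2.
       weak_solution \<mu>\<^sub>1 \<mu>\<^sub>2 p\<^sub>1 p\<^sub>2 r\<^sub>1 r\<^sub>2 \<beta> lam\<^sub>1 lam\<^sub>2 v\<^sub>1 v\<^sub>2 \<and>
       v\<^sub>1 \<in> mass_sphere a\<^sub>1 \<and> v\<^sub>2 \<in> mass_sphere a\<^sub>2 \<and>
       (v\<^sub>1, v\<^sub>2) \<in> grad_ball \<rho>\<^sub>0 \<and>
       positive_function v\<^sub>1 \<and> positive_function v\<^sub>2 \<and>
       energy \<mu>\<^sub>1 \<mu>\<^sub>2 p\<^sub>1 p\<^sub>2 r\<^sub>1 r\<^sub>2 \<beta> v\<^sub>1 v\<^sub>2 < 0 \<and>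
       (N \<le> 4 \<longrightarrow> lam\<^sub>1 < 0 \<and> lam\<^sub>2 < 0)) \<and>
    (((2 \<le> N \<and> N \<le> 4) \<or>
     (N \<ge> 5 \<and> ((p\<^sub>1 \<le> r\<^sub>1 + r\<^sub>2 - 2 / real N \<and> p\<^sub>2 \<le> r\<^sub>1 + r\<^sub>2 - 2 / real N) \<or>
                \<bar>p\<^sub>1 - p\<^sub>2\<bar> \<le> 2 / real N))) \<longrightarrow>
     (\<exists>lam\<^sub>1 lam\<^sub>2 (u\<^sub>1 :: real ^ 'n \<Rightarrow> real) u\<^sub>2.
        weak_solution \<mu>\<^sub>1 \<mu>\<^sub>2 p\<^sub>1 p\<^sub>2 r\<^sub>1 r\<^sub>2 \<beta> lam\<^sub>1 lam\<^sub>2 u\<^sub>1 u\<^sub>2 \<and>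
        u\<^sub>1 \<in> mass_sphere a\<^sub>1 \<and> u\<^sub>2 \<in> mass_sphere a\<^sub>2 \<and>
        positive_function u\<^sub>1 \<and> positive_function u\<^sub>2 \<and>
        energy \<mu>\<^sub>1 \<mu>\<^sub>2 p\<^sub>1 p\<^sub>2 r\<^sub>1 r\<^sub>2 \<beta> u\<^sub>1 u\<^sub>2 > 0 \<and>
        (N \<le> 4 \<longrightarrow> lam\<^sub>1 < 0 \<and> lam\<^sub>2 < 0))))"
proof -
 interpret coupled "TYPE('n)" \<mu>\<^sub>1 \<mu>\<^sub>2 p\<^sub>1 p\<^sub>2 r\<^sub>1 r\<^sub>2
  by unfold_locales (use assms in simp_all)
 \<comment> \<open>Obtained before any \<open>\<beta>\<close> is fixed, so that the radius and the
   bound on the coupling serve all \<open>\<beta>\<close> at once.\<close>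
 obtain \<rho>' \<rho> \<beta>0 where g: "0 < \<rho>'" "\<rho>' < \<rho>" "0 < \<beta>0"
  "!!\<beta> u v t. 0 < \<beta> ==> \<beta> <= \<beta>0 ==> u \<in> H1 ==> v \<in> H1 ==> mass u <= a\<^sub>1 ==> mass v <= a\<^sub>2 ==> 0 < t ==>
   \<rho>' <= t^2 * (dir u + dir v) ==> t^2 * (dir u + dir v) <= \<rho> ==> 1 <= J \<beta> t u v"
  by (rule geometry[OF \<open>a\<^sub>1 > 0\<close> \<open>a\<^sub>2 > 0\<close>]) blast
 have ball: "coupled_ball TYPE('n) \<mu>\<^sub>1 \<mu>\<^sub>2 p\<^sub>1 p\<^sub>2 r\<^sub>1 r\<^sub>2 a\<^sub>1 a\<^sub>2 \<beta> \<rho>' \<rho>" if b: "0 < \<beta> & \<beta> <= \<beta>0" for \<beta>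
 proof -
  interpret masses: coupled_masses \<mu>\<^sub>1 \<mu>\<^sub>2 p\<^sub>1 p\<^sub>2 r\<^sub>1 r\<^sub>2 "TYPE('n)" a\<^sub>1 a\<^sub>2 \<beta>
   by unfold_locales (use assms b in auto)
  show ?thesis
  proof unfold_locales
   fix u v t assume "masses.feasible u v" "0 < t" "\<rho>' <= t^2 * (dir u + dir v)" "t^2 * (dir u + dir v) <= \<rho>"
   then show "1 <= J \<beta> t u v" unfolding masses.feasible_def using b by (intro g(4)) auto
  qed (use g in auto)
 qed
 show ?thesis
  unfolding N
  by (rule exI[of _ \<beta>0], rule conjI[OF g(3)], rule exI[of _ \<rho>], rule conjI[OF less_trans[OF g(1,2)]], intro allI impI conjI;
   (rule coupled_ball.minimizing_sequence_compact[OF ball] coupled_ball.first_solution[OF ball] coupled_ball.second_solution[OF ball]; assumption)+)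
qed

end
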